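(* There is a polynomial-time algorithm which, given a connected digraph $D$, an integer $p\geq 1$ and a vector function $f=(f_1,\ldots,f_p):V(D)\to\mathbb{N}_0^p$ with $f_1(v) + f_2(v) + \ldots + f_p(v) \geq \max\{d_D^+(v),d_D^-(v)\}$ for all $v \in V(D)$, either verifies that $(D,f)$ is a hard pair or returns an $f$-partition of $D$.
   Context: Digraphs are finite and have no loops and no parallel arcs, but two opposite arcs $uv$ and $vu$ between two vertices are allowed. $d_D^+(v)$ and $d_D^-(v)$ denote the out-degree and in-degree of $v$ in $D$; $|D|$ is the number of vertices. The underlying graph $G(D)$ is the simple undirected graph on $V(D)$ in which $u,v$ are adjacent iff at least one of $uv,vu$ is an arc; $D$ is connected if $G(D)$ is connected. A separating vertex of a connected digraph $D$ is a vertex $v$ such that $D-v$ is non-empty and not connected. "$D$ is a block" means that $D$ is connected and has no separating vertex (a single-vertex digraph is a block). $D$ is Eulerian if $d_D^+(v)=d_D^-(v)$ for every vertex $v$ (connectedness is not part of this definition). A bidirected graph is a digraph obtained from a simple undirected graph by replacing each edge by two opposite arcs; thus a bidirected complete graph comes from $K_n$ and a bidirected cycle of odd length from a cycle of odd length $\geq 3$. Degeneracy and partitions: for $h:V(D)\to\mathbb{N}_0$, a digraph $D$ is weakly $h$-degenerate if every non-empty subdigraph $D'$ of $D$ contains a vertex $v$ with $\min\{d_{D'}^+(v),d_{D'}^-(v)\}<h(v)$. A $p$-partition of $D$ is a sequence $(D_1,\ldots,D_p)$ of pairwise disjoint (possibly empty) induced subdigraphs of $D$ with $V(D)=V(D_1)\cup\ldots\cup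 V(D_p)$. For $f=(f_1,\ldots,f_p):V(D)\to\mathbb{N}_0^p$, an $f$-partition of $D$ is a $p$-partition $(D_1,\ldots,D_p)$ such that $D_i$ is weakly $f_i$-degenerate (with $f_i$ restricted to $V(D_i)$) for all $i\in\{1,\ldots,p\}$. Hard pairs (defined recursively): for a connected digraph $D$ and $f:V(D)\to\mathbb{N}_0^p$, $(D,f)$ is a hard pair if one of the following holds. (H1) [type (M)] $D$ is a block, $D$ is Eulerian, and there is an index $j\in\{1,\ldots,p\}$ such that for every $v\in V(D)$, $f_j(v)=d_D^+(v)=d_D^-(v)$ and $f_i(v)=0$ for all $i\neq j$. (H2) [type (K)] $D$ is a bidirected complete graph and there are integers $n_1,\ldots,n_p\geq 0$, at least two of them non-zero, such that $n_1+\ldots+n_p=|D|-1$ and $f(v)=(n_1,\ldots,n_p)$ for all $v\in V(D)$. (H3) [type (C)] $D$ is a bidirected cycle of odd length and there are two indices $k\neq\ell$ in $\{1,\ldots,p\}$ such that for every $v\in V(D)$, $f_i(v)=1$ if $i\in\{k,\ell\}$ and $f_i(v)=0$ otherwise. (H4) [merging] There are two hard pairs $(D^1,f^1)$ and $(D^2,f^2)$ (with $D^1,D^2$ disjoint and $f^j:V(D^j)\to\mathbb{N}_0^p$) such that $D$ is obtained from $D^1$ and $D^2$ by identifying a vertex $v^1\in V(D^1)$ and a vertex $v^2\in V(D^2)$ to a new vertex $v$, and $f(w)=f^1(w)$ for $w\in V(D^1)\setminus\{v^1\}$, $f(w)=f^2(w)$ for $w\in V(D^2)\setminus\{v^2\}$,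 and $f(v)=f^1(v^1)+f^2(v^2)$. *)

theory Defs
  imports
    "Graph_Theory.Graph_Theory"
    "HOL-Computational_Algebra.Polynomial"
    "HOL-Library.Discrete_Functions"
begin

section \<open>Digraphs, degeneracy and partitions\<close>

text \<open>
  Finite digraphs without loops and parallel arcs are the library's \<open>pair_digraph\<close>. The library's
  \<open>connected\<close> is connectedness of the underlying undirected graph and includes non-emptiness.
  It is written qualified because \<open>connected\<close> also names the topological notion.
\<close>

definition separating_vertex :: "('a, 'b) pre_digraph \<Rightarrow> 'a \<Rightarrow> bool" where
  "separating_vertex G v \<longleftrightarrow> v \<in> verts G \<and>
     verts (pre_digraph.del_vert G v) \<noteq> {} \<and>
     \<not> Digraph_Component.connected (pre_digraph.del_vert G v)"

definition block :: "('a, 'b) pre_digraph \<Rightarrow> bool" where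
  "block G \<longleftrightarrow> Digraph_Component.connected G \<and> \<not> (\<exists>v. separating_vertex G v)"

definition eulerian_digraph :: "('a, 'b) pre_digraph \<Rightarrow> bool" where
  "eulerian_digraph G \<longleftrightarrow> (\<forall>v \<in> verts G. out_degree G v = in_degree G v)"

definition weakly_degenerate :: "('a \<Rightarrow> nat) \<Rightarrow> ('a, 'b) pre_digraph \<Rightarrow> bool" where
  "weakly_degenerate h G \<longleftrightarrow>
     (\<forall>H. subgraph H G \<and> verts H \<noteq> {} \<longrightarrow>
        (\<exists>v \<in> verts H. min (out_degree H v) (in_degree H v) < h v))"

text \<open>
  A sequence of \<open>p\<close> digraphs is a function of which only the values on \<open>{1..p}\<close> matter.
  Likewise \<open>f v i\<close> below stands for \<open>f\<^sub>i(v)\<close>, where only \<open>i \<in> {1..p}\<close> and vertices \<open>v\<close> matter.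
\<close>

definition p_partition ::
  "nat \<Rightarrow> ('a, 'b) pre_digraph \<Rightarrow> (nat \<Rightarrow> ('a, 'b) pre_digraph) \<Rightarrow> bool" where
  "p_partition p G P \<longleftrightarrow>
     (\<forall>i \<in> {1..p}. induced_subgraph (P i) G) \<and>
     (\<forall>i \<in> {1..p}. \<forall>j \<in> {1..p}. i \<noteq> j \<longrightarrow> verts (P i) \<inter> verts (P j) = {}) \<and>
     verts G = (\<Union>i \<in> {1..p}. verts (P i))"

definition f_partition ::
  "nat \<Rightarrow> ('a, 'b) pre_digraph \<Rightarrow> ('a \<Rightarrow> nat \<Rightarrow> nat) \<Rightarrow> (nat \<Rightarrow> ('a, 'b) pre_digraph) \<Rightarrow> bool" where
  "f_partition p G f P \<longleftrightarrow>
     p_partition p G P \<and> (\<forall>i \<in> {1..p}. weakly_degenerate (\<lambda>v. f v i) (P i))"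

section \<open>Hard pairs\<close>

definition bidirected_cycle :: "nat \<Rightarrow> 'a pair_pre_digraph \<Rightarrow> bool" where
  "bidirected_cycle n D \<longleftrightarrow> n \<ge> 3 \<and>
     (\<exists>vs. distinct vs \<and> length vs = n \<and> pverts D = set vs \<and>
        parcs D = (\<Union>i \<in> {..<n}. {(vs ! i, vs ! (Suc i mod n)), (vs ! (Suc i mod n), vs ! i)}))"

definition identify ::
  "'a pair_pre_digraph \<Rightarrow> 'a \<Rightarrow> 'a pair_pre_digraph \<Rightarrow> 'a \<Rightarrow> 'a \<Rightarrow> 'a pair_pre_digraph" where
  "identify D1 v1 D2 v2 v =
     (let r = (\<lambda>x. if x = v1 \<or> x = v2 then v else x) in
      \<lparr> pverts = r ` (pverts D1 \<union> pverts D2), parcs = map_prod r r ` (parcs D1 \<union> parcs D2) \<rparr>)"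

text \<open>
  The vertices are natural numbers, so that there is always room for disjoint copies of the two
  parts in \<open>merge\<close>. The merged vertex \<open>v\<close> may reuse the name of \<open>v1\<close> or \<open>v2\<close>.
\<close>

inductive hard_pair :: "nat \<Rightarrow> nat pair_pre_digraph \<Rightarrow> (nat \<Rightarrow> nat \<Rightarrow> nat) \<Rightarrow> bool" for p :: nat where
  type_M:
    "\<lbrakk> pair_digraph D; Digraph_Component.connected (with_proj D);
       block (with_proj D); eulerian_digraph (with_proj D); j \<in> {1..p};
       \<forall>v \<in> pverts D. f v j = out_degree (with_proj D) v \<and> f v j = in_degree (with_proj D) v \<and>
         (\<forall>i \<in> {1..p}. i \<noteq> j \<longrightarrow> f v i = 0) \<rbrakk>
     \<Longrightarrow> hard_pair p D f"
| type_K: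
    "\<lbrakk> pair_digraph D; Digraph_Component.connected (with_proj D);
       complete_digraph (card (pverts D)) (with_proj D);
       \<exists>k \<in> {1..p}. \<exists>l \<in> {1..p}. k \<noteq> l \<and> m k \<noteq> 0 \<and> m l \<noteq> 0;
       (\<Sum>i = 1..p. m i) = card (pverts D) - 1;
       \<forall>v \<in> pverts D. \<forall>i \<in> {1..p}. f v i = m i \<rbrakk>
     \<Longrightarrow> hard_pair p D f"
| type_C:
    "\<lbrakk> pair_digraph D; Digraph_Component.connected (with_proj D);
       bidirected_cycle n D; odd n; k \<in> {1..p}; l \<in> {1..p}; k \<noteq> l;
       \<forall>v \<in> pverts D. \<forall>i \<in> {1..p}. f v i = (if i \<in> {k, l} then 1 else 0) \<rbrakk>
     \<Longrightarrow> hard_pair p D f"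
| merge:
    "\<lbrakk> hard_pair p D1 f1; hard_pair p D2 f2; pverts D1 \<inter> pverts D2 = {};
       v1 \<in> pverts D1; v2 \<in> pverts D2; v \<notin> (pverts D1 - {v1}) \<union> (pverts D2 - {v2});
       D = identify D1 v1 D2 v2 v;
       \<forall>w \<in> pverts D1 - {v1}. \<forall>i \<in> {1..p}. f w i = f1 w i;
       \<forall>w \<in> pverts D2 - {v2}. \<forall>i \<in> {1..p}. f w i = f2 w i;
       \<forall>i \<in> {1..p}. f v i = f1 v1 i + f2 v2 i \<rbrakk>
     \<Longrightarrow> hard_pair p D f"

section \<open>Algorithms and running time\<close>

text \<open>
  Algorithms are programs of a deterministic random access machine with structured control flow.
  Every variable is an unbounded array of natural numbers, and a scalar is the entry with index 0.
  Guards are true iff non-zero. Every assignment and every evaluation of a guard takes one step;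
  as a program is a fixed finite object, charging for the size of its expressions would
  only change the running time by a constant factor.

  Addition and truncated subtraction are the only arithmetic operations (no multiplication), so
  each step increases the maximal bit length of the stored numbers by at most a constant.
  Hence unit-cost polynomial time in the bit length of the input is Turing machine polynomial time.
\<close>

type_synonym state = "string \<Rightarrow> nat \<Rightarrow> nat"

datatype aexp = N nat | V string aexp | Plus aexp aexp | Minus aexp aexp

primrec aval :: "aexp \<Rightarrow> state \<Rightarrow> nat" where
  "aval (N k) s = k"
| "aval (V x a) s = s x (aval a s)"
| "aval (Plus a b) s = aval a s + aval b s"
| "aval (Minus a b) s = aval a s - aval b s"

datatype com =
    Skip
  | Assign string aexp aexp
  | Seq com com
  | Cond aexp com com
  | While aexp com

text \<open>\<open>exec c s t s'\<close>: started in \<open>s\<close>, program \<open>c\<close> halts after exactly \<open>t\<close> steps in \<open>s'\<close>.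
  \<open>Assign x a b\<close> stores the value of \<open>b\<close> in entry \<open>a\<close> of the array \<open>x\<close>.\<close>

inductive exec :: "com \<Rightarrow> state \<Rightarrow> nat \<Rightarrow> state \<Rightarrow> bool" where
  Skip: "exec Skip s 1 s"
| Assign: "exec (Assign x a b) s 1 (s(x := (s x)(aval a s := aval b s)))"
| Seq: "\<lbrakk> exec c1 s t1 s'; exec c2 s' t2 s'' \<rbrakk> \<Longrightarrow> exec (Seq c1 c2) s (t1 + t2) s''"
| CondTrue: "\<lbrakk> aval b s \<noteq> 0; exec c1 s t s' \<rbrakk> \<Longrightarrow> exec (Cond b c1 c2) s (1 + t) s'"
| CondFalse: "\<lbrakk> aval b s = 0; exec c2 s t s' \<rbrakk> \<Longrightarrow> exec (Cond b c1 c2) s (1 + t) s'"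
| WhileFalse: "aval b s = 0 \<Longrightarrow> exec (While b c) s 1 s"
| WhileTrue: "\<lbrakk> aval b s \<noteq> 0; exec c s t1 s'; exec (While b c) s' t2 s'' \<rbrakk>
    \<Longrightarrow> exec (While b c) s (1 + t1 + t2) s''"

inductive_cases Skip_E: "exec Skip s t s'"
  and Assign_E: "exec (Assign x a b) s t s'"
  and Seq_E: "exec (Seq c1 c2) s t s'"

lemma exec_deterministic:
  "exec c s t s' \<Longrightarrow> exec c s u s'' \<Longrightarrow> t = u \<and> s' = s''"
proof (induction arbitrary: u s'' rule: exec.induct)
  case (Skip s)
  then show ?case by (elim Skip_E) simp
next
  case (Assign x a b s)
  then show ?case by (elim Assign_E) simp
next
  case (Seq c1 s t1 s1 c2 t2 s2)
  from Seq.prems obtain u1 u2 r where u: "u = u1 + u2" "exec c1 s u1 r" "exec c2 r u2 s''"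
    by (rule Seq_E)
  with Seq.IH(1)[OF u(2)] Seq.IH(2) show ?case by simp
next
  case (CondTrue b s c1 t s1 c2)
  from CondTrue.prems obtain u1 where "u = 1 + u1" "exec c1 s u1 s''"
    using CondTrue.hyps by cases auto
  with CondTrue.IH show ?case by simp
next
  case (CondFalse b s c2 t s1 c1)
  from CondFalse.prems obtain u1 where "u = 1 + u1" "exec c2 s u1 s''"
    using CondFalse.hyps by cases auto
  with CondFalse.IH show ?case by simp
next
  case (WhileFalse b s c)
  from WhileFalse.prems show ?case using WhileFalse.hyps by cases auto
next
  case (WhileTrue b s c t1 s1 t2 s2)
  from WhileTrue.prems obtain u1 u2 r
    where u: "u = 1 + u1 + u2" "exec c s u1 r" "exec (While b c) r u2 s''"
    using WhileTrue.hyps by cases auto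
  with WhileTrue.IH(1)[OF u(2)] WhileTrue.IH(2) show ?case by simp
qed

text \<open>
  The input consists of a digraph with vertex set \<open>{..<n}\<close>, given by \<open>n\<close> and its adjacency matrix,
  the number \<open>p\<close>, and the \<open>n \<times> p\<close> table of \<open>f\<close>; both matrices are stored row by row.
\<close>

definition input_state ::
  "nat \<Rightarrow> nat pair_pre_digraph \<Rightarrow> nat \<Rightarrow> (nat \<Rightarrow> nat \<Rightarrow> nat) \<Rightarrow> state" where
  "input_state n D p f = (\<lambda>x k.
     if x = ''n'' \<and> k = 0 then n
     else if x = ''p'' \<and> k = 0 then p
     else if x = ''arc'' \<and> k < n * n then (if (k div n, k mod n) \<in> parcs D then 1 else 0)
     else if x = ''f'' \<and> k < n * p then f (k div p) (k mod p + 1)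
     else 0)"

definition bit_length :: "nat \<Rightarrow> nat" where
  "bit_length k = floor_log k + 1"

definition input_size :: "nat \<Rightarrow> nat \<Rightarrow> (nat \<Rightarrow> nat \<Rightarrow> nat) \<Rightarrow> nat" where
  "input_size n p f =
     bit_length n + bit_length p + n * n + (\<Sum>v < n. \<Sum>i = 1..p. bit_length (f v i))"

text \<open>
  The answer is \<open>hard pair\<close> iff the variable \<open>hard\<close> is non-zero. Otherwise the array \<open>part\<close>
  holds the index of the part of every vertex.
\<close>

definition says_hard :: "state \<Rightarrow> bool" where
  "says_hard s \<longleftrightarrow> s ''hard'' 0 \<noteq> 0"

definition output_partition ::
  "nat pair_pre_digraph \<Rightarrow> state \<Rightarrow> nat \<Rightarrow> (nat, nat \<times> nat) pre_digraph" where
  "output_partition D s i = with_proj D \<restriction> {v \<in> pverts D. s ''part'' v = i}"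

end

theory Submission
  imports Defs "HOL-Combinatorics.Transposition"
begin

text \<open>
  Colour all vertices but one greedily. The uncoloured vertex is a hole in a sliding puzzle: either
  some colour is available for it and an \<open>f\<close>-partition has been found, or the demand on \<open>f\<close> forces
  every colour \<open>i\<close> to occur exactly \<open>f v i\<close> times among the out-neighbours and among the
  in-neighbours of the hole \<open>v\<close> (\<open>no_avail\<close>). In this case the hole is stuck, but any neighbour can
  give its colour to the hole and become the hole itself (\<open>holed_move\<close>). So the hole can be sent
  along arbitrary walks, and unless this completes the colouring at some moment, every configuration
  on the way is stuck.

  That all reachable configurations are stuck makes the pair hard. A closed walk from the hole \<open>z\<close>
  through its neighbours \<open>x1\<close> and \<open>xm\<close> and otherwise outside of its neighbourhood changes only the
  colours of \<open>x1\<close> and \<open>xm\<close> next to \<open>z\<close>; as the counts at \<open>z\<close> are the same before and after, certain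
  tokens have equal colours (\<open>probe_calm\<close>). Let \<open>E r x y\<close> mean that the tokens on \<open>x\<close> and \<open>y\<close> have
  equal colours whenever the hole is at \<open>r\<close>. This is an equivalence relation for each \<open>r\<close>, and it is
  transported by slides. In a graph without separating vertex, either any two neighbours of the hole
  are equivalent or no two distinct ones are (\<open>middle\<close>, \<open>flat_all\<close>). In the first case all tokens
  have the same colour, which is type (M). In the second case the consequences of the closed walks
  show that all arcs occur in both directions (\<open>same_type\<close>) and that a vertex which is not adjacent
  to all others has degree two (\<open>degree_two\<close>). So the graph is complete, which is type (K), or a
  cycle around which the tokens alternate, which is type (C) (\<open>odd_cycle\<close>). At a separating vertex
  the puzzle projects to the two sides (\<open>part\<close>), and induction leads to a merged pair
  (\<open>frozen_hard\<close>).

  For a polynomial algorithm it is essential that not all configurations are needed. The argument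
  only uses which triples \<open>(r, x, y)\<close> fail to satisfy \<open>E\<close>. It suffices to explore these triples, at
  most \<open>n * n * n\<close> of them, to keep one configuration as a witness for each, and to send the hole
  around the closed walks from the witnesses only (\<open>explored_hard\<close>). The program runs through a
  queue of such triples; each of its loops has at most \<open>n * n * n + n + p\<close> iterations, so its
  running time is bounded by a polynomial (\<open>cost_poly\<close>).
\<close>

section \<open>Sliding puzzles on two-connected graphs\<close>

abbreviation linked :: "'a rel \<Rightarrow> 'a set \<Rightarrow> 'a \<Rightarrow> 'a \<Rightarrow> bool" where
  "linked G S u v \<equiv> (u, v) \<in> (Restr G S)\<^sup>*"

definition conn :: "'a rel \<Rightarrow> 'a set \<Rightarrow> bool" where
  "conn G S \<longleftrightarrow> S \<noteq> {} \<and> (\<forall>u \<in> S. \<forall>v \<in> S. linked G S u v)"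

lemma linked_mono: "linked G S u v \<Longrightarrow> S \<subseteq> T \<Longrightarrow> linked G T u v"
  by (rule rtrancl_mono[THEN subsetD]) auto

lemma linked_sym: "sym G \<Longrightarrow> linked G S u v \<Longrightarrow> linked G S v u"
  by (metis rtrancl_converseI sym_Int sym_conv_converse_eq Int_Un_distrib sym_def mem_Sigma_iff Int_iff converse_iff rtrancl_converseD
      sym_rtrancl[THEN symD])

lemma linked_in: "linked G S u v \<Longrightarrow> u \<in> S \<Longrightarrow> v \<in> S"
  by (induction rule: rtrancl_induct) auto

lemma linked_step: "linked G S u v \<Longrightarrow> (v, w) \<in> G \<Longrightarrow> v \<in> S \<Longrightarrow> w \<in> S \<Longrightarrow> linked G S u w"
  by (rule rtrancl_into_rtrancl) auto

lemma linked_edge: "(v, w) \<in> G \<Longrightarrow> v \<in> S \<Longrightarrow> w \<in> S \<Longrightarrow> linked G S v w"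
  by auto

lemma linked_trans: "linked G S u v \<Longrightarrow> linked G S v w \<Longrightarrow> linked G S u w"
  by (rule rtrancl_trans)

lemma linked_avoid:
  assumes "linked G S u v" "\<not> linked G S u a"
  shows "linked G (S - {a}) u v"
  using assms(1)
proof (induction rule: rtrancl_induct)
  case (step y z)
  have "linked G S u z" using step.hyps by (meson rtrancl.rtrancl_into_rtrancl)
  then have "y \<noteq> a" "z \<noteq> a" using assms(2) step.hyps by auto
  then show ?case using step by (intro linked_step[OF step.IH]) auto
qed simp

lemma first_hit:
  assumes "linked G S v t" "v \<notin> T" "t \<in> T"
  obtains k y where "linked G (S - T) v k" "(k, y) \<in> G" "k \<in> S - T" "y \<in> S" "y \<in> T"
proof -
  have "(t \<notin> T \<and> linked G (S - T) v t) \<or>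
    (\<exists>k y. linked G (S - T) v k \<and> (k, y) \<in> G \<and> k \<in> S - T \<and> y \<in> S \<and> y \<in> T)"
    using assms(1)
  proof (induction rule: rtrancl_induct)
    case base then show ?case using assms by auto
  next
    case (step y z)
    then show ?case
      by (cases "z \<in> T") (auto intro: linked_step)
  qed
  then show ?thesis using assms(3) that by blast
qed

text \<open>
  \<open>E r x y\<close> stands for: whenever the hole is at \<open>r\<close>, the tokens on \<open>x\<close> and \<open>y\<close> have the same colour.
  In this reading \<open>E_move\<close> holds since sliding the hole from \<open>r\<close> to \<open>s\<close> carries the token of \<open>s\<close> to
  \<open>r\<close> and leaves all others in place, and since slides can be undone.
\<close>
locale puzzle =
  fixes U :: "'a set" and G :: "'a rel" and E :: "'a \<Rightarrow> 'a \<Rightarrow> 'a \<Rightarrow> bool"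
  assumes fin: "finite U"
    and symG: "sym G" and irr: "(x, x) \<notin> G"
    and conn_U: "conn G U"
    and conn_del: "v \<in> U \<Longrightarrow> conn G (U - {v})"
    and card3: "card U \<ge> 3"
    and E_sym: "E r x y \<Longrightarrow> E r y x"
    and E_trans: "E r x y \<Longrightarrow> E r y z \<Longrightarrow> E r x z"
    and E_refl: "E r x x"
    and E_move: "r \<in> U \<Longrightarrow> s \<in> U \<Longrightarrow> (r, s) \<in> G \<Longrightarrow>
      E r x y \<longleftrightarrow> E s (transpose r s x) (transpose r s y)"
begin

lemma edge_sym: "(x, y) \<in> G \<Longrightarrow> (y, x) \<in> G"
  using symG by (meson symD)

lemma edge_neq: "(x, y) \<in> G \<Longrightarrow> x \<noteq> y"
  using irr by auto

lemma lsym: "linked G S u v \<Longrightarrow> linked G S v u"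
  using linked_sym[OF symG] .

lemma linked_del: "v \<in> U \<Longrightarrow> x \<in> U - {v} \<Longrightarrow> y \<in> U - {v} \<Longrightarrow> linked G (U - {v}) x y"
  using conn_del unfolding conn_def by blast

text \<open>
  The hole can walk around \<open>x\<close> and \<open>y\<close> without touching the two tokens.
\<close>
lemma avoid:
  assumes "linked G (U - {x, y}) r s"
  shows "E r x y \<longleftrightarrow> E s x y"
  using assms
proof (induction rule: rtrancl_induct)
  case (step s t)
  then have "E s x y \<longleftrightarrow> E t (transpose s t x) (transpose s t y)" by (intro E_move) auto
  moreover have "transpose s t x = x" "transpose s t y = y"
    using step.hyps by (auto simp: transpose_def)
  ultimately show ?case using step.IH by simp
qed simp

lemma slide:
  assumes "(r, x) \<in> G" "r \<in> U" "x \<in> U" "y \<noteq> x" "y \<noteq> r"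
  shows "E r x y \<longleftrightarrow> E x r y"
  using E_move[of r x x y] assms by (auto simp: transpose_def)

text \<open>
  Since \<open>c\<close> does not separate the graph, \<open>v\<close> reaches \<open>b\<close> in \<open>U - {c}\<close>; the vertex from which \<open>b\<close> is
  first entered is as required. This is what two-connectedness is used for throughout: a hole that
  has to keep away from one vertex while it approaches another can do so.
\<close>
lemma nb_same_part:
  assumes "b \<in> U" "c \<in> U" "v \<in> U - {b, c}" "b \<noteq> c"
  obtains a where "linked G (U - {b, c}) v a" "(a, b) \<in> G" "a \<in> U" "a \<noteq> b" "a \<noteq> c"
proof -
  have "linked G (U - {c}) v b" using assms by (intro linked_del) auto
  then obtain k y where k: "linked G (U - {c} - {b}) v k" "(k, y) \<in> G" "k \<in> U - {c} - {b}" "y \<in> {b}"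
    by (rule first_hit[where T = "{b}"]) (use assms in auto)
  moreover have "U - {c} - {b} = U - {b, c}" by auto
  ultimately show ?thesis using that by auto
qed

lemma third: assumes "b \<noteq> c" "b \<in> U" "c \<in> U" obtains v where "v \<in> U - {b, c}"
proof -
  have "\<not> U \<subseteq> {b, c}"
  proof
    assume "U \<subseteq> {b, c}"
    then have "card U \<le> card {b, c}" by (intro card_mono) auto
    then show False using card3 assms by simp
  qed
  then show ?thesis using that by auto
qed

text \<open>
  Both sides are questions about the tokens on \<open>a\<close> and \<open>b\<close>: after the hole has left \<open>b\<close> through \<open>c\<close>
  or through \<open>a'\<close>, respectively. As \<open>a\<close> is cut off from \<open>a'\<close> by \<open>{b, c}\<close>, a path from \<open>a'\<close> to \<open>c\<close>
  around \<open>b\<close> does not meet \<open>a\<close>, and along it the hole can go from one situation to the other.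
\<close>
lemma middle_aux:
  assumes "(b, a) \<in> G" "(b, a') \<in> G" "(b, c) \<in> G" "a \<noteq> c" "a' \<noteq> c" "a \<noteq> a'"
    and U: "a \<in> U" "a' \<in> U" "b \<in> U" "c \<in> U"
    and nl: "\<not> linked G (U - {b, c}) a a'"
  shows "E b a c \<longleftrightarrow> E b a a'"
proof -
  note ne = edge_neq[OF assms(1)] edge_neq[OF assms(2)] edge_neq[OF assms(3)]
  obtain k where k: "linked G (U - {c, b}) a' k" "(k, c) \<in> G" "k \<in> U" "k \<noteq> c" "k \<noteq> b"
    using nb_same_part[of c b a'] U ne assms by auto
  have k': "linked G (U - {b, c}) a' k" using k(1) by (simp add: insert_commute)
  have nl': "\<not> linked G (U - {b, c}) a' a" using nl lsym by blast
  have "linked G (U - {b, c} - {a}) a' k" using linked_avoid[OF k' nl'] .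
  then have l: "linked G (U - {a, b}) a' k" by (rule linked_mono) auto
  have "k \<noteq> a" using k' nl' by auto
  then have "linked G (U - {a, b}) a' c"
    by (intro linked_step[OF l]) (use k U ne assms in auto)
  then have "E a' a b \<longleftrightarrow> E c a b" using avoid by blast
  moreover have "E b a c \<longleftrightarrow> E c a b" using slide[of b c a] assms ne E_sym by auto
  moreover have "E b a a' \<longleftrightarrow> E a' a b" using slide[of b a' a] assms ne E_sym by auto
  ultimately show ?thesis by simp
qed

text \<open>
  If \<open>{b, c}\<close> does not separate \<open>a\<close> from \<open>a'\<close>, the hole walks from one to the other; otherwise
  \<open>middle_aux\<close> compares both sides with the pair \<open>a, a'\<close>.
\<close>
lemma middle:
  assumes "(b, a) \<in> G" "(b, a') \<in> G" "(b, c) \<in> G" "a \<noteq> c" "a' \<noteq> c"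
    and U: "a \<in> U" "a' \<in> U" "b \<in> U" "c \<in> U"
  shows "E b a c \<longleftrightarrow> E b a' c"
proof (cases "a = a'")
  case False
  show ?thesis
  proof (cases "linked G (U - {b, c}) a a'")
    case True
    then have "E a b c \<longleftrightarrow> E a' b c" using avoid by blast
    then show ?thesis using slide[of b a c] slide[of b a' c] assms edge_neq by auto
  next
    case l: False
    then have l': "\<not> linked G (U - {b, c}) a' a" using lsym by blast
    show ?thesis
      using middle_aux[of b a a' c] middle_aux[of b a' a c] assms l l' False E_sym by auto
  qed
qed simp

lemma middle_all:
  assumes "E b a c" "(b, a) \<in> G" "(b, c) \<in> G" "a \<noteq> c" "a \<in> U" "c \<in> U" "b \<in> U"
    and "(b, a') \<in> G" "(b, c') \<in> G" "a' \<in> U" "c' \<in> U"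
  shows "E b a' c'"
proof -
  have *: "E b x c" if "(b, x) \<in> G" "x \<in> U" for x
    using middle[of b a x c] that assms E_refl by (cases "x = c") auto
  show ?thesis using *[of a'] *[of c'] assms E_sym E_trans by blast
qed

text \<open>
  The hole leaves \<open>b\<close> through \<open>a\<close>, walks around \<open>b\<close> and \<open>c\<close> to another neighbour of \<open>c\<close> and enters
  \<open>c\<close> from there; so the two tokens next to the hole at \<open>b\<close> become tokens next to the hole at \<open>c\<close>.
\<close>
lemma middle_step:
  assumes "E b a c" "(b, a) \<in> G" "(b, c) \<in> G" "a \<noteq> c" "a \<in> U" "c \<in> U" "b \<in> U"
  shows "\<exists>a'. a' \<in> U \<and> a' \<noteq> b \<and> (c, a') \<in> G \<and> E c a' b"
proof -
  have 1: "E a b c" using slide[of b a c] assms edge_neq by auto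
  obtain a' where a': "linked G (U - {c, b}) a a'" "(a', c) \<in> G" "a' \<in> U" "a' \<noteq> c" "a' \<noteq> b"
    using nb_same_part[of c b a] assms edge_neq[OF assms(2)] edge_neq[OF assms(3)] by blast
  then have "E a' b c" using avoid[of a a' b c] 1 by (simp add: insert_commute)
  then have "E c a' b" using slide[of a' c b] a' assms edge_neq E_sym by auto
  then show ?thesis using a' edge_sym by blast
qed

text \<open>
  By \<open>middle_all\<close> a vertex is flat as soon as two distinct neighbours of it are equivalent, and by
  \<open>middle_step\<close> flatness spreads to adjacent vertices. So either all vertices are flat, and then all
  tokens have the same colour, or none is.
\<close>
definition flat :: "'a \<Rightarrow> bool" where
  "flat b \<longleftrightarrow> (\<forall>a \<in> U. \<forall>c \<in> U. (b, a) \<in> G \<longrightarrow> (b, c) \<in> G \<longrightarrow> E b a c)"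

lemma flat_step:
  assumes "flat b" "(b, c) \<in> G" "b \<in> U" "c \<in> U"
  shows "flat c"
proof -
  have ne: "b \<noteq> c" using assms edge_neq by auto
  obtain v where v: "v \<in> U - {b, c}" using third[OF ne] assms by auto
  then obtain a where a: "(a, b) \<in> G" "a \<in> U" "a \<noteq> b" "a \<noteq> c"
    using nb_same_part[of b c v] assms(3,4) ne by blast
  then have "E b a c" using assms edge_sym unfolding flat_def by auto
  then obtain a' where "a' \<in> U" "a' \<noteq> b" "(c, a') \<in> G" "E c a' b"
    using middle_step[of b a c] a assms edge_sym by blast
  then show ?thesis unfolding flat_def
    using middle_all[of c a' b] assms edge_sym by blast
qed

lemma flat_all: assumes "flat b" "b \<in> U" "c \<in> U" shows "flat c"
proof -
  have "linked G U b c" using conn_U assms unfolding conn_def by blast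
  then show ?thesis
    using assms(1) by (induction rule: rtrancl_induct) (auto intro: flat_step)
qed

lemma flat_adjacent:
  assumes "flat b" "b \<in> U" "r \<in> U" "x \<in> U" "y \<in> U" "(x, y) \<in> G" "r \<noteq> x" "r \<noteq> y"
  shows "E r x y"
proof -
  have ne: "x \<noteq> y" using assms edge_neq by auto
  obtain a where a: "linked G (U - {x, y}) r a" "(a, x) \<in> G" "a \<in> U" "a \<noteq> x" "a \<noteq> y"
    using nb_same_part[of x y r] assms ne by auto
  have "E x a y" using flat_all[of b x] assms a edge_sym unfolding flat_def by blast
  then have "E a x y" using slide[of x a y] a assms ne edge_sym by auto
  then show ?thesis using avoid[OF a(1)] by simp
qed

lemma flat_mono:
  assumes "flat b" "b \<in> U" "r \<in> U" "x \<in> U - {r}" "y \<in> U - {r}"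
  shows "E r x y"
proof -
  have "linked G (U - {r}) x y" using linked_del assms by blast
  then show ?thesis
  proof (induction rule: rtrancl_induct)
    case base then show ?case by (rule E_refl)
  next
    case (step y z)
    then show ?case using flat_adjacent[of b r y z] assms E_trans by blast
  qed
qed

end

locale sharp_puzzle = puzzle +
  assumes not_flat: "b \<in> U \<Longrightarrow> \<not> flat b"
begin

lemma nbrs_differ:
  assumes "b \<in> U" "a \<in> U" "c \<in> U" "(b, a) \<in> G" "(b, c) \<in> G" "a \<noteq> c"
  shows "\<not> E b a c"
proof
  assume "E b a c"
  then have "flat b" unfolding flat_def using middle_all[of b a c] assms by blast
  then show False using not_flat assms by blast
qed

text \<open>
  The hole can walk to a neighbour of \<open>x\<close> around both tokens and then swap with \<open>x\<close>; after that the
  two tokens are next to the hole.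
\<close>
lemma adjacent_differ:
  assumes "r \<in> U" "x \<in> U" "y \<in> U" "(x, y) \<in> G" "r \<noteq> x" "r \<noteq> y"
  shows "\<not> E r x y"
proof
  assume E: "E r x y"
  have ne: "x \<noteq> y" using assms edge_neq by auto
  obtain a where a: "linked G (U - {x, y}) r a" "(a, x) \<in> G" "a \<in> U" "a \<noteq> x" "a \<noteq> y"
    using nb_same_part[of x y r] assms ne by auto
  have "E a x y" using avoid[OF a(1)] E by simp
  then have "E x a y" using slide[of x a y] a assms ne edge_sym by auto
  then show False using nbrs_differ[of x a y] a assms edge_sym by blast
qed

text \<open>
  The hole gets from \<open>t\<close> to \<open>w\<close> in two ways: directly, or along the path to \<open>z\<close> and from there. Both
  times the equivalence of \<open>x\<close> and \<open>w\<close> is carried along, which makes \<open>x\<close> equivalent to \<open>t\<close> and to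
  \<open>z\<close> for the hole at \<open>w\<close>; but \<open>t\<close> and \<open>z\<close> are two neighbours of \<open>w\<close>.
\<close>
lemma no_return:
  assumes "E t x w" "(t, w) \<in> G" "(w, z) \<in> G" "linked G (U - {x, w}) t z" "t \<noteq> z"
    "t \<in> U" "x \<in> U" "w \<in> U" "z \<in> U" "x \<noteq> t" "x \<noteq> z" "x \<noteq> w"
  shows False
proof -
  have "E w x t" using slide[of t w x] assms E_sym by blast
  moreover have "E z x w" using avoid[OF assms(4)] assms(1) by blast
  then have "E w x z" using slide[of z w x] assms E_sym edge_sym by blast
  ultimately have "E w t z" using E_sym E_trans by blast
  then show False using nbrs_differ[of w t z] assms edge_sym by blast
qed

end

text \<open>
  The rules come from sending the hole around a closed walk \<open>r, x1, x2, ..., xm, r\<close> which after \<open>x1\<close>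
  does not meet a neighbour of \<open>r\<close> before \<open>xm\<close>. In the application \<open>ty r x\<close> tells which of the two
  possible arcs between \<open>r\<close> and \<open>x\<close> are present.
\<close>
locale ruled_puzzle = sharp_puzzle +
  fixes ty :: "'a \<Rightarrow> 'a \<Rightarrow> 'b"
  assumes rule_A: "\<lbrakk> r \<in> U; x1 \<in> U; xm \<in> U; x2 \<in> U; (r, x1) \<in> G; (r, xm) \<in> G; x1 \<noteq> xm; (x1, x2) \<in> G;
      linked G (insert xm {y \<in> U. y \<noteq> r \<and> (r, y) \<notin> G}) x2 xm \<rbrakk> \<Longrightarrow> E r x2 xm"
    and rule_B: "\<lbrakk> r \<in> U; x1 \<in> U; xm \<in> U; x2 \<in> U; (r, x1) \<in> G; (r, xm) \<in> G; x1 \<noteq> xm; (x1, x2) \<in> G;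
      linked G (insert xm {y \<in> U. y \<noteq> r \<and> (r, y) \<notin> G}) x2 xm; ty r x1 \<noteq> ty r xm \<rbrakk> \<Longrightarrow> E r x1 xm"
begin

abbreviation M where "M r \<equiv> {y \<in> U. y \<noteq> r \<and> (r, y) \<notin> G}"

lemma same_type_aux:
  assumes r: "r \<in> U" "x1 \<in> U" "xm \<in> U" "x2 \<in> U" "(r, x1) \<in> G" "(r, xm) \<in> G" "(x1, x2) \<in> G"
    "linked G (insert xm (M r)) x2 xm"
  shows "ty r x1 = ty r xm"
  using rule_B[of r x1 xm x2] nbrs_differ[of r x1 xm] assms by blast

text \<open>
  A path in \<open>U - {r}\<close> from \<open>a\<close> to \<open>c\<close> is cut into pieces by its visits to neighbours of \<open>r\<close>. Two
  neighbours that are consecutive on it are the ends of a closed walk as in \<open>rule_B\<close>, so if their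
  types differed, they would be equivalent. The induction therefore remembers the last neighbour of
  \<open>r\<close> on the path.
\<close>
lemma same_type:
  assumes r: "r \<in> U" "a \<in> U" "c \<in> U" "(r, a) \<in> G" "(r, c) \<in> G"
  shows "ty r a = ty r c"
proof -
  have "linked G (U - {r}) a c" using assms edge_neq by (intro linked_del) auto
  then have "if (r, c) \<in> G then ty r c = ty r a else \<exists>x1 x2. x1 \<in> U \<and> x2 \<in> U \<and> (r, x1) \<in> G \<and>
     ty r x1 = ty r a \<and> (x1, x2) \<in> G \<and> linked G (M r) x2 c \<and> c \<in> M r"
  proof (induction rule: rtrancl_induct)
    case base then show ?case using assms by simp
  next
    case (step v w)
    then have vw: "(v, w) \<in> G" "v \<in> U" "w \<in> U" "v \<noteq> r" "w \<noteq> r" by auto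
    show ?case
    proof (cases "(r, v) \<in> G")
      case True
      then have ty: "ty r v = ty r a" using step.IH by simp
      show ?thesis
      proof (cases "(r, w) \<in> G")
        case w: True
        have "ty r v = ty r w" using same_type_aux[of r v w w] w True vw assms by auto
        then show ?thesis using w ty by simp
      next
        case w: False
        then show ?thesis using ty True vw by auto
      qed
    next
      case False
      then obtain x1 x2 where x: "x1 \<in> U" "x2 \<in> U" "(r, x1) \<in> G" "ty r x1 = ty r a" "(x1, x2) \<in> G"
        "linked G (M r) x2 v" "v \<in> M r" using step.IH by auto
      show ?thesis
      proof (cases "(r, w) \<in> G")
        case w: True
        have "linked G (insert w (M r)) x2 v" using x(6) by (rule linked_mono) auto
        then have "linked G (insert w (M r)) x2 w" by (rule linked_step) (use w x(7) vw in auto)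
        then have "ty r x1 = ty r w" using same_type_aux[of r x1 w x2] w x vw assms by auto
        then show ?thesis using w x by simp
      next
        case w: False
        then have "linked G (M r) x2 w" by (intro linked_step[OF x(6)]) (use w x vw in auto)
        then show ?thesis using w x vw by auto
      qed
    qed
  qed
  then show ?thesis using assms by simp
qed

text \<open>
  Let \<open>x1\<close> and \<open>xm\<close> be neighbours of \<open>r\<close> that are adjacent to the same component of the
  non-neighbours of \<open>r\<close>, at \<open>x2\<close> and \<open>y2\<close>, respectively. Then \<open>x2\<close> is equivalent to \<open>xm\<close> and \<open>y2\<close> to
  \<open>x1\<close> by \<open>rule_A\<close>. By \<open>no_return\<close> a hole at \<open>xm\<close> cannot come back to another neighbour of \<open>r\<close>
  around \<open>x2\<close> and \<open>r\<close>, and likewise for \<open>x1\<close> and \<open>y2\<close>. A third neighbour \<open>z\<close> of \<open>r\<close> leads to a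
  contradiction: its connection to \<open>x2\<close> in \<open>U - {r}\<close> has to pass \<open>x1\<close> or \<open>xm\<close> (any other neighbour
  of \<open>r\<close> on it would be equivalent to \<open>xm\<close>), and whichever of the two comes first closes one of
  these forbidden detours.
\<close>
lemma degree_two:
  assumes r: "r \<in> U" and w: "w \<in> M r"
  obtains x1 xm where "x1 \<noteq> xm" "{x \<in> U. (r, x) \<in> G} = {x1, xm}" "(x1, xm) \<notin> G"
proof -
  let ?N = "{x \<in> U. (r, x) \<in> G}"
  have hit: "\<exists>k y. linked G (M r) v k \<and> (k, y) \<in> G \<and> k \<in> M r \<and> y \<in> ?N \<and> y \<in> S"
    if v: "v \<in> M r" and l: "linked G S v r" and S: "S \<subseteq> U" for v S
  proof -
    obtain k y where k: "linked G (S - insert r ?N) v k" "(k, y) \<in> G" "k \<in> S - insert r ?N" "y \<in> S" "y \<in> insert r ?N"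
      using first_hit[OF l, of "insert r ?N"] v by auto
    have "linked G (M r) v k" using k(1) by (rule linked_mono) (use S in auto)
    moreover have "k \<in> M r" using k(3) S by auto
    moreover have "y \<noteq> r" using k edge_sym S by auto
    ultimately show ?thesis using k by blast
  qed
  have "linked G U w r" using conn_U r w unfolding conn_def by blast
  then obtain x2 x1 where x: "(x2, x1) \<in> G" "x2 \<in> M r" "x1 \<in> ?N" using hit[OF w] by blast
  have "linked G (U - {x1}) x2 r" using x r edge_neq by (intro linked_del) auto
  then obtain y2 xm where y: "linked G (M r) x2 y2" "(y2, xm) \<in> G" "y2 \<in> M r" "xm \<in> ?N" "xm \<noteq> x1"
    using hit[OF x(2)] by blast
  have M1: "M r \<subseteq> insert z (M r)" for z by auto
  have mem: "x1 \<in> U" "xm \<in> U" "x2 \<in> U" "y2 \<in> U" "(r, x1) \<in> G" "(r, xm) \<in> G" "x1 \<noteq> xm"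
    "(x1, x2) \<in> G" "(xm, y2) \<in> G"
    using x y edge_sym by auto
  have "linked G (insert xm (M r)) x2 y2" using y(1) M1 by (rule linked_mono)
  then have "linked G (insert xm (M r)) x2 xm" by (rule linked_step) (use y in auto)
  then have E1: "E r x2 xm" using rule_A r mem by blast
  have "linked G (M r) y2 x2" using y(1) by (rule lsym)
  then have "linked G (insert x1 (M r)) y2 x2" using M1 by (rule linked_mono)
  then have "linked G (insert x1 (M r)) y2 x1" by (rule linked_step) (use x in auto)
  then have E2: "E r y2 x1" using rule_A r mem by blast
  have n1: "(x2, xm) \<notin> G" using adjacent_differ[of r x2 xm] E1 x y r edge_neq by auto
  have n2: "(y2, x1) \<notin> G" using adjacent_differ[of r y2 x1] E2 x y r edge_neq by auto
  have nex: "x2 \<noteq> y2" using n1 y by auto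
  have E3: "E xm x2 r" using slide[of r xm x2] E1 x y r E_sym by auto
  have E4: "E x1 y2 r" using slide[of r x1 y2] E2 x y r E_sym by auto
  have X1: "\<not> linked G (U - {x2, r}) z xm" if "z \<in> ?N" "z \<noteq> xm" for z
  proof
    assume "linked G (U - {x2, r}) z xm"
    then have "linked G (U - {x2, r}) xm z" by (rule lsym)
    from no_return[OF E3 _ _ this] show False using that x y r edge_sym by auto
  qed
  have X2: "\<not> linked G (U - {y2, r}) z x1" if "z \<in> ?N" "z \<noteq> x1" for z
  proof
    assume "linked G (U - {y2, r}) z x1"
    then have "linked G (U - {y2, r}) x1 z" by (rule lsym)
    from no_return[OF E4 _ _ this] show False using that x y r edge_sym by auto
  qed
  have Mr: "M r - {x2} \<subseteq> U - {x2, r}" by auto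
  have sub: "?N \<subseteq> {x1, xm}"
  proof (rule ccontr)
    assume "\<not> ?N \<subseteq> {x1, xm}"
    then obtain z where z: "z \<in> ?N" "z \<noteq> x1" "z \<noteq> xm" by blast
    have zr: "z \<noteq> r" "z \<noteq> x2" using z x irr by auto
    have bd: "k2 \<in> {x1, xm}" if k2: "k2 \<in> ?N" "linked G (insert k2 (M r)) x2 k2" for k2
    proof (rule ccontr)
      assume "k2 \<notin> {x1, xm}"
      then have "E r x2 k2" using k2 x r edge_sym by (intro rule_A[of r x1]) auto
      then have "E r k2 xm" using E1 E_sym E_trans by blast
      then show False using nbrs_differ[of r k2 xm] k2 r y \<open>k2 \<notin> {x1, xm}\<close> by auto
    qed
    obtain k where k: "linked G (U - {x2, r}) z k" "(k, x2) \<in> G" "k \<in> U" "k \<noteq> x2" "k \<noteq> r"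
      using nb_same_part[of x2 r z] x r z zr by auto
    have "\<exists>k2 \<in> {x1, xm}. linked G (U - {x2, r}) z k2"
    proof (cases "k \<in> ?N")
      case True
      then have "k \<in> {x1, xm}" using bd[of k] k x edge_sym by auto
      then show ?thesis using k by auto
    next
      case False
      have "linked G (U - {x2, r}) k z" using k(1) by (rule lsym)
      then obtain k1 k2 where kk: "linked G (U - {x2, r} - ?N) k k1" "(k1, k2) \<in> G" "k1 \<in> U - {x2, r} - ?N"
        "k2 \<in> U - {x2, r}" "k2 \<in> ?N"
        by (rule first_hit[where T = ?N]) (use z False in auto)
      have 1: "linked G (insert k2 (M r)) k k1" using kk(1) by (rule linked_mono) auto
      have 2: "linked G (insert k2 (M r)) x2 k" by (rule linked_edge) (use x k False edge_sym in auto)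
      have 3: "linked G (insert k2 (M r)) k1 k2" by (rule linked_edge) (use kk in auto)
      have "k2 \<in> {x1, xm}" using bd[of k2] kk linked_trans[OF linked_trans[OF 2 1] 3] by blast
      moreover have "linked G (U - {x2, r}) k k1" using kk(1) by (rule linked_mono) auto
      with k(1) have "linked G (U - {x2, r}) z k1" by (rule linked_trans)
      then have "linked G (U - {x2, r}) z k2" by (rule linked_step) (use kk in auto)
      ultimately show ?thesis by blast
    qed
    then have l: "linked G (U - {x2, r}) z x1" using X1 z by blast
    have "\<not> linked G (U - {x2, r}) z y2"
    proof
      assume "linked G (U - {x2, r}) z y2"
      then have "linked G (U - {x2, r}) z xm" by (rule linked_step) (use y nex x irr in auto)
      then show False using X1 z by blast
    qed
    with l have "linked G (U - {x2, r} - {y2}) z x1" by (rule linked_avoid)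
    then have "linked G (U - {y2, r}) z x1" by (rule linked_mono) auto
    then show False using X2 z by blast
  qed
  have "E x1 x2 xm"
  proof -
    have "linked G (U - {x2, xm}) r x1"
      by (rule linked_edge) (use mem x y r edge_neq in auto)
    then show ?thesis using avoid E1 by blast
  qed
  then have "(x1, xm) \<notin> G" using nbrs_differ[of x1 x2 xm] x y edge_sym by (metis (no_types, lifting) mem_Collect_eq)
  moreover have "?N = {x1, xm}" using sub x y by auto
  ultimately show ?thesis using that y(5) by metis
qed

end

section \<open>Cycles\<close>

lemma pair_set_eq: "S = {a, b} \<Longrightarrow> a \<noteq> b \<Longrightarrow> c \<in> S \<Longrightarrow> d \<in> S \<Longrightarrow> c \<noteq> d \<Longrightarrow> S = {c, d}"
  by auto

text \<open>
  A longest path is closed up: both neighbours of its last vertex lie on it, and one of them has to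
  be its first vertex because an inner vertex has its two neighbours on the path already.
\<close>
lemma two_regular_cycle:
  assumes fin: "finite U" and con: "conn G U" and symG: "sym G" and irr: "\<And>x. (x, x) \<notin> G"
    and two: "\<And>u. u \<in> U \<Longrightarrow> \<exists>a b. a \<noteq> b \<and> {x \<in> U. (u, x) \<in> G} = {a, b}"
  obtains vs where "distinct vs" "set vs = U" "length vs \<ge> 3"
    "\<And>i. i < length vs \<Longrightarrow> {x \<in> U. (vs ! i, x) \<in> G} =
      {vs ! (Suc i mod length vs), vs ! ((i + length vs - 1) mod length vs)}"
proof -
  define path where "path P \<longleftrightarrow> P \<noteq> [] \<and> distinct P \<and> set P \<subseteq> U \<and>
    (\<forall>i. Suc i < length P \<longrightarrow> (P ! i, P ! Suc i) \<in> G)" for P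
  have sG: "(x, y) \<in> G \<Longrightarrow> (y, x) \<in> G" for x y using symG by (meson symD)
  obtain u where u: "u \<in> U" using con unfolding conn_def by auto
  have "path [u]" using u by (auto simp: path_def)
  moreover have "length P \<le> card U" if "path P" for P
    using that card_mono[OF fin, of "set P"] by (auto simp: path_def distinct_card)
  ultimately obtain P where P: "path P" and mx: "\<And>Q. path Q \<Longrightarrow> length Q \<le> length P"
    using ex_has_greatest_nat[of path "[u]" length "card U + 1"] by (metis less_Suc_eq_le add.commute plus_1_eq_Suc)
  define k where "k = length P"
  have k0: "k > 0" using P by (simp add: path_def k_def)
  have Pd: "distinct P" "set P \<subseteq> U" "\<And>i. Suc i < k \<Longrightarrow> (P ! i, P ! Suc i) \<in> G"
    using P by (auto simp: path_def k_def)
  have PU: "P ! i \<in> U" if "i < k" for i using that Pd(2) k_def by auto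
  have inj: "P ! i = P ! j \<longleftrightarrow> i = j" if "i < k" "j < k" for i j
    using that Pd(1) k_def nth_eq_iff_index_eq by blast
  let ?x = "P ! (k - 1)"
  have inP: "y \<in> set P" if y: "y \<in> U" "(?x, y) \<in> G" for y
  proof (rule ccontr)
    assume "y \<notin> set P"
    have "(P @ [y]) ! i = (if i < k then P ! i else y)" if "i < Suc k" for i
      using that k_def by (auto simp: nth_append less_Suc_eq)
    moreover have "((P @ [y]) ! i, (P @ [y]) ! Suc i) \<in> G" if "Suc i < Suc k" for i
    proof (cases "Suc i < k")
      case True then show ?thesis using Pd(3)[of i] k_def by (simp add: nth_append)
    next
      case False then have "i = k - 1" using that by simp
      then show ?thesis using y k0 k_def by (simp add: nth_append)
    qed
    ultimately have "path (P @ [y])" using P y \<open>y \<notin> set P\<close> by (auto simp: path_def k_def)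
    from mx[OF this] show False by simp
  qed
  obtain a b where ab: "a \<noteq> b" "{z \<in> U. (?x, z) \<in> G} = {a, b}" using two PU k0 by (metis diff_less zero_less_one)
  have pos: "j = 0 \<or> Suc j = k - 1" if j: "j < k" "(?x, P ! j) \<in> G" for j
  proof (rule ccontr)
    assume n: "\<not> (j = 0 \<or> Suc j = k - 1)"
    have "j \<noteq> k - 1" using j irr by auto
    then have jk: "Suc j < k - 1" using n j by linarith
    have m: "P ! (j - 1) \<in> {z \<in> U. (P ! j, z) \<in> G}" "P ! Suc j \<in> {z \<in> U. (P ! j, z) \<in> G}"
      "?x \<in> {z \<in> U. (P ! j, z) \<in> G}"
      using PU Pd(3)[of "j - 1"] Pd(3)[of j] j jk n sG by auto
    have d: "P ! (j - 1) \<noteq> P ! Suc j" "P ! (j - 1) \<noteq> ?x" "P ! Suc j \<noteq> ?x"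
      using inj[of "j - 1" "Suc j"] inj[of "j - 1" "k - 1"] inj[of "Suc j" "k - 1"] jk n by auto
    obtain a b where "a \<noteq> b" "{z \<in> U. (P ! j, z) \<in> G} = {a, b}" using two PU j by meson
    then show False using m d by auto
  qed
  have "a \<in> set P" "b \<in> set P" using inP ab by auto
  then obtain ja jb where jj: "ja < k" "jb < k" "a = P ! ja" "b = P ! jb" by (auto simp: in_set_conv_nth k_def)
  have "(?x, P ! ja) \<in> G" "(?x, P ! jb) \<in> G" using ab jj by auto
  then have jc: "ja = 0 \<or> Suc ja = k - 1" "jb = 0 \<or> Suc jb = k - 1" using pos jj by auto
  have jn: "ja \<noteq> jb" using jj ab by auto
  have k3: "k \<ge> 3" and closing: "(?x, P ! 0) \<in> G"
    using jc jn \<open>(?x, P ! ja) \<in> G\<close> \<open>(?x, P ! jb) \<in> G\<close> by auto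
  have nx: "(P ! i, P ! (Suc i mod k)) \<in> G" if "i < k" for i
  proof (cases "Suc i < k")
    case True then show ?thesis using Pd(3) by simp
  next
    case False then have "i = k - 1" using that by simp
    then show ?thesis using closing k0 by simp
  qed
  have nb: "{x \<in> U. (P ! i, x) \<in> G} = {P ! (Suc i mod k), P ! ((i + k - 1) mod k)}" if i: "i < k" for i
  proof -
    let ?j = "(i + k - 1) mod k"
    have j: "?j < k" "Suc ?j mod k = i"
      using i k0 by (auto simp: mod_Suc_eq)
    have "(P ! ?j, P ! i) \<in> G" using nx[OF j(1)] j(2) by simp
    then have m: "P ! ?j \<in> {x \<in> U. (P ! i, x) \<in> G}" using sG PU j by auto
    have m2: "P ! (Suc i mod k) \<in> {x \<in> U. (P ! i, x) \<in> G}" using nx[OF i] PU k0 by auto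
    have "Suc i mod k \<noteq> ?j"
    proof (cases "i = 0")
      case True then show ?thesis using k3 by (simp)
    next
      case False
      then have e: "i + k - 1 = (i - 1) + k" using i by simp
      have "(i - 1 + k) mod k = i - 1" using i by simp
      then have "?j = i - 1" unfolding e .
      then show ?thesis using k3 False i by (cases "Suc i = k") auto
    qed
    then have "P ! (Suc i mod k) \<noteq> P ! ?j" using inj k0 by simp
    moreover obtain a b where "a \<noteq> b" "{x \<in> U. (P ! i, x) \<in> G} = {a, b}" using two PU i by meson
    ultimately show ?thesis using pair_set_eq m m2 by metis
  qed
  have "U \<subseteq> set P"
  proof
    fix y assume "y \<in> U"
    then have "linked G U (P ! 0) y" using con PU[OF k0] unfolding conn_def by blast
    then show "y \<in> set P"
    proof (induction rule: rtrancl_induct)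
      case base then show ?case using k0 k_def by simp
    next
      case (step y z)
      then obtain i where i: "i < k" "y = P ! i" by (auto simp: in_set_conv_nth k_def)
      then have "z \<in> {P ! (Suc i mod k), P ! ((i + k - 1) mod k)}" using nb[of i] step.hyps by blast
      then show ?case using k0 k_def by auto
    qed
  qed
  then show ?thesis using that[of P] Pd k3 nb k_def by auto
qed

context ruled_puzzle
begin

text \<open>
  By \<open>rule_A\<close> the token two steps ahead of the hole is equivalent to the one just behind it. Sliding
  the hole away turns this into the statement that tokens at distance two are equivalent, so that
  they alternate around the hole. On an even cycle the two alternating classes would coincide,
  against \<open>adjacent_differ\<close>.

  The cycle is given by a periodic enumeration \<open>v\<close>, which keeps the positions free of reductions
  modulo \<open>n\<close>; in particular \<open>b + n - 1\<close> is the position behind \<open>b\<close>.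
\<close>
lemma odd_cycle_aux:
  fixes v :: "nat \<Rightarrow> 'a"
  assumes n: "n \<ge> 4" and per: "\<And>k. v (k + n) = v k" and inj: "inj_on v {..<n}" and img: "v ` {..<n} = U"
    and nb: "\<And>k. {x \<in> U. (v k, x) \<in> G} = {v (k + 1), v (k + n - 1)}"
  shows "odd n \<and> (\<forall>b. \<forall>x \<in> U - {v b}. E (v b) x (v (b + 1)) \<or> E (v b) x (v (b + n - 1)))"
proof -
  have vmod: "v k = v (k mod n)" for k
  proof (induction k rule: less_induct)
    case (less k)
    show ?case
    proof (cases "k < n")
      case False
      then have "v k = v (k - n)" using per[of "k - n"] by simp
      also have "\<dots> = v ((k - n) mod n)" using less[of "k - n"] False n by simp
      also have "(k - n) mod n = k mod n" using False by (simp add: mod_if)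
      finally show ?thesis .
    qed simp
  qed
  have vU: "v k \<in> U" for k using vmod[of k] img n by auto
  have apart: "v a \<noteq> v b" if "a < b" "b < a + n" for a b
  proof
    assume "v a = v b"
    then have "v (a mod n) = v (b mod n)" using vmod by metis
    then have "a mod n = b mod n" using inj n by (auto dest: inj_onD)
    then have "n dvd b - a" using that by (metis mod_eq_dvd_iff_nat less_imp_le)
    then show False using that by (auto dest: dvd_imp_le)
  qed
  have ed: "(v k, v (k + 1)) \<in> G" for k using nb[of k] by auto
  have adj: "(v k, v m) \<in> G \<longleftrightarrow> v m = v (k + 1) \<or> v m = v (k + n - 1)" for k m
    using nb[of k] vU[of m] by blast
  have C1: "E (v j) (v (j + 2)) (v (j + n - 1))" for j
  proof -
    let ?S = "insert (v (j + n - 1)) (M (v j))"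
    have inS: "v m \<in> ?S" if "j + 2 \<le> m" "m \<le> j + n - 1" for m
    proof (cases "m = j + n - 1")
      case False
      then have "v j \<noteq> v m" "v (j + 1) \<noteq> v m" "v m \<noteq> v (j + n - 1)"
        using that n apart[of j m] apart[of "j + 1" m] apart[of m "j + n - 1"] by simp_all
      then show ?thesis using vU adj[of j m] by auto
    qed simp
    have "linked G ?S (v (j + 2)) (v (j + 2 + i))" if "j + 2 + i \<le> j + n - 1" for i
      using that
    proof (induction i)
      case (Suc i)
      have *: "(v (j + 2 + i), v (j + 2 + Suc i)) \<in> G" using ed[of "j + 2 + i"] by simp
      show ?case by (rule linked_step[OF Suc.IH *]) (use Suc.prems inS in auto)
    qed simp
    from this[of "n - 3"] have l: "linked G ?S (v (j + 2)) (v (j + n - 1))" 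
    proof -
      have e: "j + 2 + (n - 3) = j + n - 1" using n by simp
      show ?thesis using \<open>j + 2 + (n - 3) \<le> j + n - 1 \<Longrightarrow> linked G ?S (v (j + 2)) (v (j + 2 + (n - 3)))\<close>
        unfolding e by blast
    qed
    have "v (j + 1) \<noteq> v (j + n - 1)" using n apart[of "j + 1" "j + n - 1"] by simp
    then show ?thesis
      using rule_A[of "v j" "v (j + 1)" "v (j + n - 1)" "v (j + 2)"] vU ed[of j] ed[of "j + 1"] adj[of j "j + n - 1"] l
      by simp
  qed
  have C2: "E (v j) (v (j + 1)) (v (j + 3))" for j
  proof -
    have "E (v (j + 1)) (v (j + 3)) (v j)" using C1[of "j + 1"] per[of j] by (simp add: numeral_3_eq_3)
    moreover have "v j \<noteq> v (j + 3)" "v (j + 1) \<noteq> v (j + 3)"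
      using n apart[of j "j + 3"] apart[of "j + 1" "j + 3"] by simp_all
    ultimately show ?thesis using slide[of "v (j + 1)" "v j" "v (j + 3)"] vU ed[of j] edge_sym E_sym by metis
  qed
  have C3: "E (v t) (v (j + 1)) (v (j + 3))" if t: "j + 4 \<le> t" "t \<le> j + n" for j t
  proof -
    let ?S = "U - {v (j + 1), v (j + 3)}"
    have inS: "v m \<in> ?S" if "j + 4 \<le> m" "m \<le> j + n" for m
      using apart[of "j + 1" m] apart[of "j + 3" m] that vU by auto
    have "linked G ?S (v t) (v (t + i))" if "t + i \<le> j + n" for i
      using that
    proof (induction i)
      case (Suc i)
      have *: "(v (t + i), v (t + Suc i)) \<in> G" using ed[of "t + i"] by simp
      show ?case by (rule linked_step[OF Suc.IH *]) (use Suc.prems inS t in auto)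
    qed simp
    from this[of "j + n - t"] have "linked G ?S (v t) (v (j + n))" using t by simp
    then show ?thesis using avoid C2[of j] per by metis
  qed
  have C4: "E (v b) (v (b + k)) (v (b + k + 2))" if "1 \<le> k" "k + 2 \<le> n - 1" for b k
  proof -
    have "E (v (b + n)) (v (b + k - 1 + 1)) (v (b + k - 1 + 3))" by (rule C3) (use that in auto)
    moreover have "b + k - 1 + 1 = b + k" "b + k - 1 + 3 = b + k + 2" using that by auto
    ultimately show ?thesis using per by metis
  qed
  have C5: "E (v b) (v (b + k)) (v (b + k + 2 * i))" if "1 \<le> k" "k + 2 * i \<le> n - 1" for b k i
    using that
  proof (induction i)
    case 0 then show ?case by (simp add: E_refl)
  next
    case (Suc i)
    have "E (v b) (v (b + (k + 2 * i))) (v (b + (k + 2 * i) + 2))" by (rule C4) (use Suc.prems in auto)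
    moreover have "E (v b) (v (b + k)) (v (b + k + 2 * i))" using Suc by simp
    moreover have "b + (k + 2 * i) + 2 = b + k + 2 * Suc i" "b + (k + 2 * i) = b + k + 2 * i" by simp_all
    ultimately show ?case using E_trans by metis
  qed
  have odd: "odd n"
  proof
    assume "even n"
    then obtain l where "n = 2 * l" by (auto elim: evenE)
    then obtain i where i: "n - 1 = 1 + 2 * i" using n by (intro that[of "l - 1"]) simp
    have "E (v 0) (v 1) (v (n - 1))" using C5[of 1 i 0] i by simp
    moreover have "E (v 0) (v 2) (v (n - 1))" using C1[of 0] by (simp add: numeral_2_eq_2)
    ultimately have "E (v 0) (v 1) (v 2)" using E_sym E_trans by blast
    moreover have "(v 1, v 2) \<in> G" using ed[of 1] by (simp add: numeral_2_eq_2)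
    moreover have "v 0 \<noteq> v 1" "v 0 \<noteq> v 2" using n apart[of 0 1] apart[of 0 2] by simp_all
    ultimately show False using adjacent_differ[of "v 0" "v 1" "v 2"] vU by blast
  qed
  have "E (v b) x (v (b + 1)) \<or> E (v b) x (v (b + n - 1))" if x: "x \<in> U - {v b}" for b x
  proof -
    obtain k where k: "k < n" "x = v (b + k)"
    proof -
      obtain i where i: "i < n" "x = v i" using x img by auto
      let ?k = "(i + n - b mod n) mod n"
      have "b mod n < n" using n by simp
      then have "(b + ?k) mod n = (b mod n + (i + n - b mod n)) mod n" by (simp only: mod_add_left_eq mod_add_right_eq)
      also have "b mod n + (i + n - b mod n) = i + n" using \<open>b mod n < n\<close> by simp
      also have "(i + n) mod n = i" using i by simp
      finally have "v (b + ?k) = v i" using vmod[of "b + ?k"] by simp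
      then show ?thesis using that[of ?k] i n by simp
    qed
    have "k \<noteq> 0" by (rule notI) (use k x in simp)
    show ?thesis
    proof (cases "odd k")
      case True
      then obtain i where "k = 1 + 2 * i" by (auto elim: oddE)
      then show ?thesis using C5[of 1 i b] k E_sym by auto
    next
      case False
      then obtain i where i: "k = 2 * i" by (auto elim: evenE)
      obtain l where l: "n - 1 = 2 * l" using odd by (auto elim: oddE)
      have "E (v b) (v (b + k)) (v (b + k + 2 * (l - i)))"
        by (rule C5) (use i l k \<open>k \<noteq> 0\<close> in auto)
      moreover have "b + k + 2 * (l - i) = b + n - 1" using i l k n by auto
      ultimately show ?thesis using k by simp
    qed
  qed
  then show ?thesis using odd by blast
qed

lemma odd_cycle:
  assumes r: "r \<in> U" "w \<in> M r"
  obtains vs where "distinct vs" "set vs = U" "length vs \<ge> 3" "odd (length vs)"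
    "\<And>i. i < length vs \<Longrightarrow> {x \<in> U. (vs ! i, x) \<in> G} =
      {vs ! (Suc i mod length vs), vs ! ((i + length vs - 1) mod length vs)}"
    "\<And>i x. i < length vs \<Longrightarrow> x \<in> U - {vs ! i} \<Longrightarrow>
      E (vs ! i) x (vs ! (Suc i mod length vs)) \<or> E (vs ! i) x (vs ! ((i + length vs - 1) mod length vs))"
proof -
  obtain y z where yz: "y \<noteq> z" "{x \<in> U. (r, x) \<in> G} = {y, z}" "(y, z) \<notin> G" using degree_two[OF r] .
  have yzU: "y \<in> U" "z \<in> U" "(r, y) \<in> G" "(r, z) \<in> G" using yz by auto
  have two: "\<exists>a b. a \<noteq> b \<and> {x \<in> U. (u, x) \<in> G} = {a, b}" if u: "u \<in> U" for u
  proof -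
    \<comment> \<open>Having a non-neighbour spreads from \<open>r\<close> to all vertices: a neighbour of \<open>r\<close> is \<open>y\<close> or \<open>z\<close>, and these two are not adjacent.\<close>
    have "M u \<noteq> {}"
    proof (cases "u = r")
      case True then show ?thesis using r by auto
    next
      case False
      show ?thesis
      proof (cases "(u, r) \<in> G")
        case True
        then have "u \<in> {y, z}" using yz u edge_sym by blast
        then show ?thesis using yz yzU edge_sym by blast
      next
        case False then show ?thesis using r \<open>u \<noteq> r\<close> by blast
      qed
    qed
    then obtain w' where "w' \<in> M u" by blast
    from degree_two[OF u this] show ?thesis by blast
  qed
  obtain vs where vs: "distinct vs" "set vs = U" "length vs \<ge> 3"
    "\<And>i. i < length vs \<Longrightarrow> {x \<in> U. (vs ! i, x) \<in> G} =
      {vs ! (Suc i mod length vs), vs ! ((i + length vs - 1) mod length vs)}"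
    using two_regular_cycle[OF fin conn_U symG irr two] by blast
  define n where "n = length vs"
  define v where "v i = vs ! (i mod n)" for i
  have n3: "n \<ge> 3" using vs n_def by simp
  have "r \<noteq> y" "r \<noteq> z" "w \<noteq> r" "w \<noteq> y" "w \<noteq> z" using r yzU irr by auto
  then have c4: "card {r, y, z, w} = 4" using yz(1) by simp
  have "{r, y, z, w} \<subseteq> U" using r yzU by auto
  then have "card U \<ge> 4" using card_mono[OF fin, of "{r, y, z, w}"] c4 by simp
  then have n: "n \<ge> 4" using vs n_def distinct_card by metis
  have "odd n \<and> (\<forall>b. \<forall>x \<in> U - {v b}. E (v b) x (v (b + 1)) \<or> E (v b) x (v (b + n - 1)))"
  proof (rule odd_cycle_aux)
    show "n \<ge> 4" by (rule n)
    show "v (k + n) = v k" for k by (simp add: v_def)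
    show "inj_on v {..<n}" using vs(1) by (auto simp: inj_on_def v_def n_def nth_eq_iff_index_eq)
    show "v ` {..<n} = U" 
    proof -
      have "v ` {..<n} = (!) vs ` {..<n}" by (intro image_cong) (auto simp: v_def)
      also have "\<dots> = set vs" by (auto simp: n_def in_set_conv_nth)
      finally show ?thesis using vs(2) by simp
    qed
    show "{x \<in> U. (v k, x) \<in> G} = {v (k + 1), v (k + n - 1)}" for k
    proof -
      have "(k + n - 1) mod n = (k mod n + n - 1) mod n"
      proof -
        have "(k + (n - 1)) mod n = (k mod n + (n - 1)) mod n" by (simp only: mod_add_left_eq)
        then show ?thesis using n by (simp only: Nat.add_diff_assoc)
      qed
      moreover have "k mod length vs < length vs" by (rule mod_less_divisor) (use n3 n_def in linarith)
      ultimately show ?thesis using vs(4)[of "k mod length vs"] by (simp add: v_def n_def mod_Suc_eq)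
    qed
  qed
  then have "odd n" and a: "\<And>b x. x \<in> U - {v b} \<Longrightarrow> E (v b) x (v (b + 1)) \<or> E (v b) x (v (b + n - 1))" by auto
  show ?thesis
  proof (rule that[of vs])
    show "distinct vs" "set vs = U" "length vs \<ge> 3" "odd (length vs)" using vs \<open>odd n\<close> n_def by auto
    show "{x \<in> U. (vs ! i, x) \<in> G} =
      {vs ! (Suc i mod length vs), vs ! ((i + length vs - 1) mod length vs)}" if "i < length vs" for i
      using vs(4) that .
    show "E (vs ! i) x (vs ! (Suc i mod length vs)) \<or> E (vs ! i) x (vs ! ((i + length vs - 1) mod length vs))"
      if "i < length vs" "x \<in> U - {vs ! i}" for i x
      using a[of x i] that n_def by (simp add: v_def)
  qed
qed

end

section \<open>Digraphs as relations\<close>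

definition ugraph :: "'a rel \<Rightarrow> 'a rel" where "ugraph A = A \<union> A\<inverse>"

lemma ugraph_sym: "sym (ugraph A)" by (auto simp: ugraph_def sym_def)

lemma ugraph_iff: "(x, y) \<in> ugraph A \<longleftrightarrow> (x, y) \<in> A \<or> (y, x) \<in> A" by (auto simp: ugraph_def)

definition induced :: "'a rel \<Rightarrow> 'a set \<Rightarrow> 'a pair_pre_digraph" where
  "induced A U = \<lparr> pverts = U, parcs = A \<inter> U \<times> U \<rparr>"

lemma induced_simps[simp]: "pverts (induced A U) = U" "parcs (induced A U) = A \<inter> U \<times> U"
  by (auto simp: induced_def)

lemma conn_cong: "Restr G S = Restr G' S \<Longrightarrow> conn G S \<longleftrightarrow> conn G' S"
  by (simp add: conn_def)

lemma rtrancl_on_iff: "u \<in> F \<Longrightarrow> (u, v) \<in> rtrancl_on F r \<longleftrightarrow> linked r F u v"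
proof
  assume "u \<in> F" "(u, v) \<in> rtrancl_on F r"
  from this(2) show "linked r F u v"
    by (induction rule: rtrancl_on_induct) (auto intro: rtrancl_into_rtrancl)
next
  assume u: "u \<in> F" and "linked r F u v"
  from this(2) show "(u, v) \<in> rtrancl_on F r"
    by (induction rule: rtrancl_induct) (use u in \<open>auto intro: rtrancl_on_into_rtrancl_on\<close>)
qed

lemma connected_iff_conn:
  assumes "tail H = fst" "head H = snd"
  shows "Digraph_Component.connected H \<longleftrightarrow> conn (ugraph (arcs H)) (verts H)"
proof -
  have "parcs (mk_symmetric H) = ugraph (arcs H)"
    using assms by (auto simp: parcs_mk_symmetric ugraph_def)
  then show ?thesis
    unfolding connected_def strongly_connected_def conn_def
    by (auto simp: reachable_def rtrancl_on_iff)
qed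

lemma block_iff:
  "block (with_proj D) \<longleftrightarrow> conn (ugraph (parcs D)) (pverts D) \<and>
    (\<forall>v \<in> pverts D. pverts D - {v} \<noteq> {} \<longrightarrow> conn (ugraph (parcs D)) (pverts D - {v}))"
proof -
  have *: "Digraph_Component.connected (pre_digraph.del_vert (with_proj D) v) \<longleftrightarrow>
     conn (ugraph (parcs D)) (pverts D - {v})" for v
  proof -
    have "Digraph_Component.connected (pre_digraph.del_vert (with_proj D) v) \<longleftrightarrow>
      conn (ugraph {a \<in> parcs D. fst a \<noteq> v \<and> snd a \<noteq> v}) (pverts D - {v})"
      by (subst connected_iff_conn) (simp_all add: pre_digraph.del_vert_def)
    also have "\<dots> \<longleftrightarrow> conn (ugraph (parcs D)) (pverts D - {v})"
      by (rule conn_cong) (auto simp: ugraph_def)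
    finally show ?thesis .
  qed
  have c: "Digraph_Component.connected (with_proj D) \<longleftrightarrow> conn (ugraph (parcs D)) (pverts D)"
    by (subst connected_iff_conn) simp_all
  have "verts (pre_digraph.del_vert (with_proj D) v) = pverts D - {v}" for v
    by (simp add: pre_digraph.del_vert_def)
  then show ?thesis unfolding block_def separating_vertex_def c * by auto
qed

lemma degree_card:
  shows "out_degree (with_proj D) v = card {y. (v, y) \<in> parcs D}"
    and "in_degree (with_proj D) v = card {y. (y, v) \<in> parcs D}"
proof -
  have "out_arcs (with_proj D) v = Pair v ` {y. (v, y) \<in> parcs D}"
    by (auto simp: out_arcs_def)
  then show "out_degree (with_proj D) v = card {y. (v, y) \<in> parcs D}"
    unfolding out_degree_def by (simp add: card_image inj_on_def)
  have "in_arcs (with_proj D) v = (\<lambda>y. (y, v)) ` {y. (y, v) \<in> parcs D}"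
    by (auto simp: in_arcs_def)
  then show "in_degree (with_proj D) v = card {y. (y, v) \<in> parcs D}"
    unfolding in_degree_def by (simp add: card_image inj_on_def)
qed

lemma pair_digraph_iff:
  "pair_digraph D \<longleftrightarrow> finite (pverts D) \<and> parcs D \<subseteq> pverts D \<times> pverts D \<and> (\<forall>x. (x, x) \<notin> parcs D)"
proof
  assume "pair_digraph D"
  then interpret pair_digraph D .
  show "finite (pverts D) \<and> parcs D \<subseteq> pverts D \<times> pverts D \<and> (\<forall>x. (x, x) \<notin> parcs D)"
    using pair_finite_verts arc_fst_in_verts arc_snd_in_verts pair_no_loops by force
next
  assume a: "finite (pverts D) \<and> parcs D \<subseteq> pverts D \<times> pverts D \<and> (\<forall>x. (x, x) \<notin> parcs D)"
  then have "finite (parcs D)" by (meson finite_SigmaI finite_subset)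
  then show "pair_digraph D" using a by unfold_locales auto
qed

section \<open>Renaming hard pairs\<close>

definition renamed :: "('a \<Rightarrow> 'b) \<Rightarrow> 'a pair_pre_digraph \<Rightarrow> 'b pair_pre_digraph" where
  "renamed h D = \<lparr> pverts = h ` pverts D, parcs = map_prod h h ` parcs D \<rparr>"

lemma renamed_simps[simp]: "pverts (renamed h D) = h ` pverts D" "parcs (renamed h D) = map_prod h h ` parcs D"
  by (auto simp: renamed_def)

lemma renamed_conn:
  assumes "conn (ugraph A) S"
  shows "conn (ugraph (map_prod h h ` A)) (h ` S)"
proof -
  have "linked (ugraph (map_prod h h ` A)) (h ` S) (h u) (h v)" if "linked (ugraph A) S u v" for u v
    using that
  proof (induction rule: rtrancl_induct)
    case (step y z)
    show ?case by (rule linked_step[OF step.IH]) (use step.hyps in \<open>auto simp: ugraph_def\<close>)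
  qed simp
  then show ?thesis using assms unfolding conn_def by blast
qed

lemma renamed_pair_digraph:
  assumes "inj_on h (pverts D)" "pair_digraph D"
  shows "pair_digraph (renamed h D)"
  using assms unfolding pair_digraph_iff by (auto dest: inj_onD)

lemma renamed_degree:
  assumes inj: "inj_on h (pverts D)" and D: "pair_digraph D" and v: "v \<in> pverts D"
  shows "out_degree (with_proj (renamed h D)) (h v) = out_degree (with_proj D) v"
    and "in_degree (with_proj (renamed h D)) (h v) = in_degree (with_proj D) v"
proof -
  have A: "parcs D \<subseteq> pverts D \<times> pverts D" using D by (simp add: pair_digraph_iff)
  have "{y. (h v, y) \<in> parcs (renamed h D)} = h ` {y. (v, y) \<in> parcs D}"
    using A v inj by (auto dest: inj_onD intro: rev_image_eqI)
  moreover have "{y. (v, y) \<in> parcs D} \<subseteq> pverts D" using A by auto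
  ultimately show "out_degree (with_proj (renamed h D)) (h v) = out_degree (with_proj D) v"
    unfolding degree_card by (metis card_image inj inj_on_subset)
  have "{y. (y, h v) \<in> parcs (renamed h D)} = h ` {y. (y, v) \<in> parcs D}"
    using A v inj by (auto dest: inj_onD intro: rev_image_eqI)
  moreover have "{y. (y, v) \<in> parcs D} \<subseteq> pverts D" using A by auto
  ultimately show "in_degree (with_proj (renamed h D)) (h v) = in_degree (with_proj D) v"
    unfolding degree_card by (metis card_image inj inj_on_subset)
qed

lemma connected_renamed:
  "Digraph_Component.connected (with_proj D) \<Longrightarrow> Digraph_Component.connected (with_proj (renamed h D))"
  using renamed_conn[of "parcs D" "pverts D" h] by (simp add: connected_iff_conn)

lemma block_renamed:
  assumes inj: "inj_on h (pverts D)" and b: "block (with_proj D)"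
  shows "block (with_proj (renamed h D))"
proof -
  have 1: "h ` pverts D - {h v} = h ` (pverts D - {v})" if "v \<in> pverts D" for v
    using inj that by (auto dest: inj_onD)
  show ?thesis using b renamed_conn unfolding block_iff by (auto simp: 1)
qed

lemma identify_verts:
  assumes "v1 \<in> V1" "v2 \<in> V2" "V1 \<inter> V2 = {}"
  shows "(\<lambda>x. if x = v1 \<or> x = v2 then v else x) ` (V1 \<union> V2) = insert v ((V1 - {v1}) \<union> (V2 - {v2}))"
  using assms by auto

lemma hard_pair_wf:
  assumes "hard_pair p D f"
  shows "finite (pverts D) \<and> parcs D \<subseteq> pverts D \<times> pverts D"
  using assms
proof induction
  case (merge D1 f1 D2 f2 v1 v2 v D f)
  have im: "map_prod r r ` A \<subseteq> r ` S \<times> r ` S" if "A \<subseteq> S \<times> S" for r :: "nat \<Rightarrow> nat" and A S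
    using that by auto
  have "parcs D1 \<union> parcs D2 \<subseteq> (pverts D1 \<union> pverts D2) \<times> (pverts D1 \<union> pverts D2)"
    using merge.IH by blast
  note 1 = im[OF this, of "\<lambda>x. if x = v1 \<or> x = v2 then v else x"]
  have "finite (pverts D)" using merge.IH by (simp add: merge.hyps(7) identify_def Let_def)
  moreover have "parcs D \<subseteq> pverts D \<times> pverts D"
    unfolding merge.hyps(7) identify_def Let_def pair_pre_digraph.simps by (rule 1)
  ultimately show ?case by blast
qed (auto simp: pair_digraph_iff)

text \<open>
  When two pairs are merged, the common vertex may reuse the name of one of the two identified
  vertices, and these names say nothing about the renamed digraph. So the parts are not simply
  renamed by \<open>h\<close>: the vertex \<open>v1\<close> gets the name \<open>h v\<close> and \<open>v2\<close> a fresh name \<open>N\<close>.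
\<close>
lemma hard_pair_renamed:
  assumes "hard_pair p D f" "inj_on h (pverts D)" "\<forall>v \<in> pverts D. \<forall>i \<in> {1..p}. f' (h v) i = f v i"
  shows "hard_pair p (renamed h D) f'"
  using assms
proof (induction arbitrary: h f' rule: hard_pair.induct)
  case (type_M D j f)
  note D = type_M.hyps(1) and inj = type_M.prems(1)
  show ?case
  proof (rule hard_pair.type_M[where j = j])
    show "pair_digraph (renamed h D)" using renamed_pair_digraph[OF inj D] .
    show "Digraph_Component.connected (with_proj (renamed h D))" using connected_renamed[OF type_M.hyps(2)] .
    show "block (with_proj (renamed h D))" using block_renamed[OF inj type_M.hyps(3)] .
    show "eulerian_digraph (with_proj (renamed h D))"
      using type_M.hyps(4) renamed_degree[OF inj D] unfolding eulerian_digraph_def by simp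
    show "j \<in> {1..p}" by (rule type_M.hyps(5))
    show "\<forall>w \<in> pverts (renamed h D). f' w j = out_degree (with_proj (renamed h D)) w \<and>
        f' w j = in_degree (with_proj (renamed h D)) w \<and> (\<forall>i \<in> {1..p}. i \<noteq> j \<longrightarrow> f' w i = 0)"
    proof
      fix w assume "w \<in> pverts (renamed h D)"
      then obtain x where x: "x \<in> pverts D" "w = h x" by auto
      then show "f' w j = out_degree (with_proj (renamed h D)) w \<and>
        f' w j = in_degree (with_proj (renamed h D)) w \<and> (\<forall>i \<in> {1..p}. i \<noteq> j \<longrightarrow> f' w i = 0)"
        using type_M.hyps(5) bspec[OF type_M.hyps(6) x(1)] bspec[OF type_M.prems(2) x(1)] renamed_degree[OF inj D x(1)]
        by simp
    qed
  qed
next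
  case (type_K D m f)
  have "card (h ` pverts D) = card (pverts D)" using type_K by (simp add: card_image)
  moreover have "complete_digraph (card (pverts D)) (with_proj (renamed h D))"
    using type_K unfolding complete_digraph_pair_def by (auto simp: card_image dest: inj_onD)
  ultimately show ?case
    using type_K.hyps(4,5,6) type_K.prems(2) renamed_pair_digraph[OF type_K.prems(1) type_K.hyps(1)]
      connected_renamed[OF type_K.hyps(2)]
    by (intro hard_pair.type_K[where m = m]) simp_all
next
  case (type_C D n k l f)
  obtain vs where vs: "n \<ge> 3" "distinct vs" "length vs = n" "pverts D = set vs"
    "parcs D = (\<Union>i \<in> {..<n}. {(vs ! i, vs ! (Suc i mod n)), (vs ! (Suc i mod n), vs ! i)})"
    using type_C.hyps(3) unfolding bidirected_cycle_def by blast
  have "bidirected_cycle n (renamed h D)"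
    unfolding bidirected_cycle_def
  proof (intro conjI exI[of _ "map h vs"])
    have "map h vs ! i = h (vs ! i)" if "i < n" for i using that vs by simp
    moreover have "Suc i mod n < n" for i using vs by simp
    ultimately show "parcs (renamed h D) = (\<Union>i \<in> {..<n}. {(map h vs ! i, map h vs ! (Suc i mod n)),
        (map h vs ! (Suc i mod n), map h vs ! i)})"
      using vs(5) by (simp add: image_UN)
  qed (use vs type_C.prems(1) in \<open>auto simp: distinct_map\<close>)
  then show ?case
    using type_C.hyps(4-8) type_C.prems(2) renamed_pair_digraph[OF type_C.prems(1) type_C.hyps(1)]
      connected_renamed[OF type_C.hyps(2)]
    by (intro hard_pair.type_C[where n = n and k = k and l = l]) simp_all
next
  case (merge D1 f1 D2 f2 v1 v2 v D f)
  define r where "r = (\<lambda>x. if x = v1 \<or> x = v2 then v else x)"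
  have wf1: "finite (pverts D1)" "parcs D1 \<subseteq> pverts D1 \<times> pverts D1" using merge.hyps(1) hard_pair_wf by auto
  have wf2: "finite (pverts D2)" "parcs D2 \<subseteq> pverts D2 \<times> pverts D2" using merge.hyps(2) hard_pair_wf by auto
  have VD: "pverts D = insert v ((pverts D1 - {v1}) \<union> (pverts D2 - {v2}))"
    using identify_verts[OF merge.hyps(4,5,3)] merge.hyps(7) by (simp add: identify_def Let_def)
  have "finite (h ` pverts D)" using VD wf1 wf2 by simp
  then obtain N where N: "N \<notin> h ` pverts D" using ex_new_if_finite infinite_UNIV_nat by blast
  define h1 where "h1 x = (if x = v1 then h v else h x)" for x
  define h2 where "h2 x = (if x = v2 then N else h x)" for x
  have hi: "h x = h y \<longleftrightarrow> x = y" if "x \<in> pverts D" "y \<in> pverts D" for x y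
    using merge.prems(1) that by (auto dest: inj_onD)
  have hN: "h x \<noteq> N" if "x \<in> pverts D" for x using N that by auto
  have i1: "inj_on h1 (pverts D1)" using hi VD merge.hyps(6) by (auto simp: inj_on_def h1_def)
  have i2: "inj_on h2 (pverts D2)" using hi hN VD by (auto simp: inj_on_def h2_def)
  define g1 where "g1 y = f1 (inv_into (pverts D1) h1 y)" for y
  define g2 where "g2 y = f2 (inv_into (pverts D2) h2 y)" for y
  have g1: "g1 (h1 x) = f1 x" if "x \<in> pverts D1" for x using i1 that by (simp add: g1_def)
  have g2: "g2 (h2 x) = f2 x" if "x \<in> pverts D2" for x using i2 that by (simp add: g2_def)
  have H1: "hard_pair p (renamed h1 D1) g1" using merge.IH(1)[OF i1] g1 by simp
  have H2: "hard_pair p (renamed h2 D2) g2" using merge.IH(2)[OF i2] g2 by simp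
  define r' where "r' = (\<lambda>x. if x = h v \<or> x = N then h v else x)"
  have c1: "r' (h1 x) = h (r x)" if "x \<in> pverts D1" for x
    using that hN[of x] VD merge.hyps(3,5) by (auto simp: h1_def r_def r'_def)
  have c2: "r' (h2 x) = h (r x)" if "x \<in> pverts D2" for x
    using that hN[of x] VD merge.hyps(3,4) by (auto simp: h2_def r_def r'_def)
  have cc1: "(\<lambda>x. r' (h1 x)) ` pverts D1 = (\<lambda>x. h (r x)) ` pverts D1" by (rule image_cong[OF refl c1])
  have cc2: "(\<lambda>x. r' (h2 x)) ` pverts D2 = (\<lambda>x. h (r x)) ` pverts D2" by (rule image_cong[OF refl c2])
  have aa1: "(\<lambda>x. map_prod r' r' (map_prod h1 h1 x)) ` parcs D1 = (\<lambda>x. map_prod h h (map_prod r r x)) ` parcs D1"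
    by (rule image_cong[OF refl]) (use wf1 c1 in auto)
  have aa2: "(\<lambda>x. map_prod r' r' (map_prod h2 h2 x)) ` parcs D2 = (\<lambda>x. map_prod h h (map_prod r r x)) ` parcs D2"
    by (rule image_cong[OF refl]) (use wf2 c2 in auto)
  have eq: "renamed h D = identify (renamed h1 D1) (h v) (renamed h2 D2) N (h v)"
    unfolding merge.hyps(7) renamed_def identify_def Let_def r_def[symmetric] r'_def[symmetric]
    using cc1 cc2 aa1 aa2 by (simp add: image_Un image_image)
  have hv1: "h x \<noteq> h v" if "x \<in> pverts D1" "x \<noteq> v1" for x
    using hi[of x v] VD merge.hyps(6) that by blast
  have hv2: "h x \<noteq> h v" if "x \<in> pverts D2" "x \<noteq> v2" for x
    using hi[of x v] VD merge.hyps(6) that by blast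
  have hN2: "h x \<noteq> N" if "x \<in> pverts D2" "x \<noteq> v2" for x
    using hN[of x] VD that by blast
  have hN1: "h x \<noteq> N" if "x \<in> pverts D1" "x \<noteq> v1" for x
    using hN[of x] VD that by blast
  have hNv: "h v \<noteq> N" using hN[of v] VD by blast
  have h12: "h x \<noteq> h y" if "x \<in> pverts D1" "x \<noteq> v1" "y \<in> pverts D2" "y \<noteq> v2" for x y
    using hi[of x y] VD merge.hyps(3) that by blast
  have V1: "h1 ` pverts D1 - {h v} = h ` (pverts D1 - {v1})"
    using hv1 by (auto simp: h1_def)
  have V2: "h2 ` pverts D2 - {N} = h ` (pverts D2 - {v2})"
    using hN2 by (auto simp: h2_def)
  have V1': "h1 ` pverts D1 = insert (h v) (h ` (pverts D1 - {v1}))"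
    using merge.hyps(4) by (auto simp: h1_def)
  have V2': "h2 ` pverts D2 = insert N (h ` (pverts D2 - {v2}))"
    using merge.hyps(5) by (auto simp: h2_def)
  show ?case
  proof (rule hard_pair.merge[OF H1 H2])
    show "pverts (renamed h1 D1) \<inter> pverts (renamed h2 D2) = {}"
      unfolding renamed_simps V1' V2'
    proof (rule equals0I)
      fix x assume "x \<in> insert (h v) (h ` (pverts D1 - {v1})) \<inter> insert N (h ` (pverts D2 - {v2}))"
      then have 1: "x = h v \<or> (\<exists>y. y \<in> pverts D1 \<and> y \<noteq> v1 \<and> x = h y)"
        and 2: "x = N \<or> (\<exists>z. z \<in> pverts D2 \<and> z \<noteq> v2 \<and> x = h z)" by auto
      show False using 1
      proof (elim disjE exE conjE)
        assume "x = h v"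
        then show False using 2 hNv hv2 by metis
      next
        fix y assume "y \<in> pverts D1" "y \<noteq> v1" "x = h y"
        then show False using 2 hN1 h12 by metis
      qed
    qed
    show "h v \<in> pverts (renamed h1 D1)" using V1' by simp
    show "N \<in> pverts (renamed h2 D2)" using V2' by simp
    show "h v \<notin> (pverts (renamed h1 D1) - {h v}) \<union> (pverts (renamed h2 D2) - {N})"
      unfolding renamed_simps V2
    proof
      assume "h v \<in> h1 ` pverts D1 - {h v} \<union> h ` (pverts D2 - {v2})"
      then obtain x where "x \<in> pverts D2" "x \<noteq> v2" "h v = h x" by blast
      then show False using hv2[of x] by simp
    qed
    show "renamed h D = identify (renamed h1 D1) (h v) (renamed h2 D2) N (h v)" by (rule eq)
    show "\<forall>w \<in> pverts (renamed h1 D1) - {h v}. \<forall>i \<in> {1..p}. f' w i = g1 w i"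
    proof (intro ballI)
      fix w i assume w: "w \<in> pverts (renamed h1 D1) - {h v}" and i: "i \<in> {1..p}"
      then obtain x where x: "x \<in> pverts D1" "x \<noteq> v1" "w = h x" using V1 by auto
      then have "g1 w = f1 x" using g1[of x] by (simp add: h1_def)
      then show "f' w i = g1 w i" using merge.prems(2) merge.hyps(8) x VD i by auto
    qed
    show "\<forall>w \<in> pverts (renamed h2 D2) - {N}. \<forall>i \<in> {1..p}. f' w i = g2 w i"
    proof (intro ballI)
      fix w i assume w: "w \<in> pverts (renamed h2 D2) - {N}" and i: "i \<in> {1..p}"
      then obtain x where x: "x \<in> pverts D2" "x \<noteq> v2" "w = h x" using V2 by auto
      then have "g2 w = f2 x" using g2[of x] by (simp add: h2_def)
      then show "f' w i = g2 w i" using merge.prems(2) merge.hyps(9) x VD i by auto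
    qed
    show "\<forall>i \<in> {1..p}. f' (h v) i = g1 (h v) i + g2 N i"
      using g1[OF merge.hyps(4)] g2[OF merge.hyps(5)] merge.prems(2) merge.hyps(10) VD
      by (auto simp: h1_def h2_def)
  qed
qed

section \<open>Sliding the hole\<close>

text \<open>
  Slides are considered here regardless of the degeneracy of the colour classes, which will turn out
  to be preserved in the situations of interest.
\<close>
inductive reach :: "'a rel \<Rightarrow> 'a set \<Rightarrow> ('a \<Rightarrow> nat) \<Rightarrow> 'a \<Rightarrow> ('a \<Rightarrow> nat) \<Rightarrow> 'a \<Rightarrow> bool"
  for G U \<psi>0 t0 where
  reach_refl: "reach G U \<psi>0 t0 \<psi>0 t0"
| reach_step: "reach G U \<psi>0 t0 \<psi> t \<Longrightarrow> (t, s) \<in> G \<Longrightarrow> s \<in> U \<Longrightarrow> reach G U \<psi>0 t0 (\<psi> \<circ> transpose t s) s"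

lemma reach_trans: "reach G U \<psi>1 t1 \<psi> t \<Longrightarrow> reach G U \<psi>0 t0 \<psi>1 t1 \<Longrightarrow> reach G U \<psi>0 t0 \<psi> t"
  by (induction rule: reach.induct) (auto intro: reach.intros)

lemma reach_mono: "reach G S \<psi>0 t0 \<psi> t \<Longrightarrow> S \<subseteq> U \<Longrightarrow> reach G U \<psi>0 t0 \<psi> t"
  by (induction rule: reach.induct) (auto intro: reach.intros)

lemma reach_in: "reach G U \<psi>0 t0 \<psi> t \<Longrightarrow> t0 \<in> U \<Longrightarrow> t \<in> U"
  by (induction rule: reach.induct) auto

lemma reach_back:
  assumes "reach G U \<psi>0 t0 \<psi> t" "sym G" "t0 \<in> U"
  shows "reach G U \<psi> t \<psi>0 t0"
  using assms
proof (induction rule: reach.induct)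
  case (reach_step \<psi> t s)
  have "reach G U (\<psi> \<circ> transpose t s) s (\<psi> \<circ> transpose t s \<circ> transpose s t) t"
    using reach_step.hyps reach_step.prems reach_in[OF reach_step.hyps(1)]
    by (intro reach.intros) (auto dest: symD)
  moreover have "\<psi> \<circ> transpose t s \<circ> transpose s t = \<psi>"
    by (simp add: fun_eq_iff transpose_commute[of s t])
  ultimately show ?case using reach_trans reach_step by metis
qed (rule reach_refl)

lemma reach_hole: "reach G U \<psi>0 t0 \<psi> t \<Longrightarrow> \<psi>0 t0 = 0 \<Longrightarrow> \<psi> t = 0"
  by (induction rule: reach.induct) auto

lemma reach_count:
  assumes "reach G U \<psi>0 t0 \<psi> t" "t0 \<in> U"
  shows "card {y \<in> U - {t}. \<psi> y = i} = card {y \<in> U - {t0}. \<psi>0 y = i}"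
  using assms
proof (induction rule: reach.induct)
  case (reach_step \<psi> t s)
  have t: "t \<in> U" using reach_in reach_step by metis
  have "{y \<in> U - {s}. (\<psi> \<circ> transpose t s) y = i} = transpose t s ` {y \<in> U - {t}. \<psi> y = i}"
  proof (intro set_eqI iffI)
    fix y assume "y \<in> {y \<in> U - {s}. (\<psi> \<circ> transpose t s) y = i}"
    then have "transpose t s y \<in> {y \<in> U - {t}. \<psi> y = i}"
      using t reach_step.hyps by (auto simp: transpose_def)
    then show "y \<in> transpose t s ` {y \<in> U - {t}. \<psi> y = i}"
      by (metis imageI transpose_involutory)
  next
    fix y assume "y \<in> transpose t s ` {y \<in> U - {t}. \<psi> y = i}"
    then show "y \<in> {y \<in> U - {s}. (\<psi> \<circ> transpose t s) y = i}"
      using t reach_step.hyps by (auto simp: transpose_def)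
  qed
  moreover have "inj_on (transpose t s) S" for S by (rule inj_onI) (rule transpose_eq_imp_eq)
  ultimately show ?case using reach_step by (simp add: card_image)
qed simp

lemma reach_image:
  assumes "reach G U \<psi>0 t0 \<psi> t" "t0 \<in> U" "finite U"
  shows "\<psi> ` (U - {t}) = \<psi>0 ` (U - {t0})"
proof -
  have *: "i \<in> \<psi> ` (U - {t}) \<longleftrightarrow> card {y \<in> U - {t}. \<psi> y = i} \<noteq> 0" for i \<psi> t
    using assms(3) by (auto simp: card_eq_0_iff)
  show ?thesis
  proof (rule set_eqI)
    show "i \<in> \<psi> ` (U - {t}) \<longleftrightarrow> i \<in> \<psi>0 ` (U - {t0})" for i
      using *[of i \<psi> t] *[of i \<psi>0 t0] reach_count[OF assms(1,2), of i] by simp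
  qed
qed

text \<open>
  The set \<open>S\<close> is attached to the rest of the graph only by \<open>z\<close>. While the hole is outside of \<open>W\<close>,
  the projected hole waits at \<open>z\<close>: the tokens on \<open>S\<close> do not move meanwhile, and the hole can enter
  \<open>S\<close> only through \<open>z\<close>.
\<close>
lemma reach_proj:
  assumes "reach G U \<chi> z \<psi> t"
    and symG: "sym G" and irr: "\<And>x. (x, x) \<notin> G"
    and W: "W = insert z S" "z \<notin> S" "S \<subseteq> U" "z \<in> U"
    and closed: "\<And>x y. x \<in> S \<Longrightarrow> y \<in> U \<Longrightarrow> (x, y) \<in> G \<Longrightarrow> y \<in> W"
  shows "\<exists>\<psi>'. reach G W \<chi> z \<psi>' (if t \<in> W then t else z) \<and>
    (\<forall>x \<in> W - {if t \<in> W then t else z}. \<psi>' x = \<psi> x)"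
  using assms(1)
proof (induction rule: reach.induct)
  case reach_refl then show ?case using W by (auto intro: reach.intros)
next
  case (reach_step \<psi> t s)
  have t: "t \<in> U" using reach_in[OF reach_step.hyps(1)] W by auto
  have ts: "t \<noteq> s" using reach_step.hyps irr by auto
  obtain \<psi>' where *: "reach G W \<chi> z \<psi>' (if t \<in> W then t else z)"
    "\<forall>x \<in> W - {if t \<in> W then t else z}. \<psi>' x = \<psi> x" using reach_step.IH by blast
  consider "t \<in> W" "s \<in> W" | "t \<in> W" "s \<notin> W" | "t \<notin> W" "s \<in> W" | "t \<notin> W" "s \<notin> W" by blast
  then show ?case
  proof cases
    case 1
    then have "reach G W \<chi> z (\<psi>' \<circ> transpose t s) s"
      using * reach_step.hyps by (auto intro: reach.intros)
    moreover have "(\<psi>' \<circ> transpose t s) x = (\<psi> \<circ> transpose t s) x" if "x \<in> W - {s}" for x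
      using * 1 that ts by (auto simp: transpose_def)
    ultimately show ?thesis using 1 by (intro exI[of _ "\<psi>' \<circ> transpose t s"]) (simp add: o_def)
  next
    case 2
    then have "t = z" using closed[of t s] W reach_step.hyps by auto
    moreover have "\<psi>' x = (\<psi> \<circ> transpose t s) x" if "x \<in> W - {z}" for x
      using * 2 that calculation by (auto simp: transpose_def)
    ultimately show ?thesis using * 2 by auto
  next
    case 3
    have "(s, t) \<in> G" using reach_step.hyps symG by (meson symD)
    then have "s = z" using closed[of s t] W reach_step.hyps 3 t by auto
    moreover have "\<psi>' x = (\<psi> \<circ> transpose t s) x" if "x \<in> W - {z}" for x
      using * 3 that calculation by (auto simp: transpose_def)
    ultimately show ?thesis using * 3 by auto
  next
    case 4
    have "z \<in> W" using W by simp
    moreover have "\<psi>' x = (\<psi> \<circ> transpose t s) x" if "x \<in> W - {z}" for x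
      using * 4 that by (auto simp: transpose_def)
    ultimately show ?thesis using * 4 by auto
  qed
qed

section \<open>Frozen configurations\<close>

definition arc_type :: "'a rel \<Rightarrow> 'a \<Rightarrow> 'a \<Rightarrow> bool \<times> bool" where
  "arc_type A r x = ((r, x) \<in> A, (x, r) \<in> A)"

text \<open>
  The two conclusions of \<open>ruled_puzzle\<close> for a single colouring. For all colourings with hole \<open>r\<close>
  together they become the rules for \<open>E\<close>.
\<close>
definition calm :: "'a rel \<Rightarrow> 'a set \<Rightarrow> ('a \<Rightarrow> nat) \<Rightarrow> 'a \<Rightarrow> bool" where
  "calm A U \<psi> r \<longleftrightarrow> (\<forall>x1 \<in> U. \<forall>x2 \<in> U. \<forall>xm \<in> U.
     (r, x1) \<in> ugraph A \<longrightarrow> (r, xm) \<in> ugraph A \<longrightarrow> (x1, x2) \<in> ugraph A \<longrightarrow> x1 \<noteq> xm \<longrightarrow>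
     linked (ugraph A) (insert xm {y \<in> U. y \<noteq> r \<and> (r, y) \<notin> ugraph A}) x2 xm \<longrightarrow>
     \<psi> x2 = \<psi> xm \<and> (arc_type A r x1 \<noteq> arc_type A r xm \<longrightarrow> \<psi> x1 = \<psi> xm))"

lemma calm_subset:
  assumes "calm A U \<psi> r" "S \<subseteq> U"
  shows "calm A S \<psi> r"
  unfolding calm_def
proof (intro ballI impI)
  fix x1 x2 xm assume x: "x1 \<in> S" "x2 \<in> S" "xm \<in> S" "(r, x1) \<in> ugraph A" "(r, xm) \<in> ugraph A" "(x1, x2) \<in> ugraph A"
    "x1 \<noteq> xm" and l: "linked (ugraph A) (insert xm {y \<in> S. y \<noteq> r \<and> (r, y) \<notin> ugraph A}) x2 xm"
  from l have "linked (ugraph A) (insert xm {y \<in> U. y \<noteq> r \<and> (r, y) \<notin> ugraph A}) x2 xm"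
    by (rule linked_mono) (use assms(2) in auto)
  then show "\<psi> x2 = \<psi> xm \<and> (arc_type A r x1 \<noteq> arc_type A r xm \<longrightarrow> \<psi> x1 = \<psi> xm)"
    using assms x unfolding calm_def by (meson subsetD)
qed

definition out_count :: "'a rel \<Rightarrow> 'a set \<Rightarrow> ('a \<Rightarrow> nat) \<Rightarrow> 'a \<Rightarrow> nat \<Rightarrow> nat" where
  "out_count A U \<psi> v i = card {y \<in> U. (v, y) \<in> A \<and> \<psi> y = i}"

definition in_count :: "'a rel \<Rightarrow> 'a set \<Rightarrow> ('a \<Rightarrow> nat) \<Rightarrow> 'a \<Rightarrow> nat \<Rightarrow> nat" where
  "in_count A U \<psi> v i = card {y \<in> U. (y, v) \<in> A \<and> \<psi> y = i}"

text \<open>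
  The outcome of an unsuccessful search, phrased such that it passes to the parts of the graph at a
  separating vertex. The prescribed numbers \<open>fo\<close> of out-neighbours and \<open>fi\<close> of in-neighbours of each
  colour are kept apart: at the separating vertex the share of a part in them is read off from a
  colouring, and that the two shares are equal only follows from the classification of the part.
\<close>
locale frozen =
  fixes A :: "nat rel" and p :: nat and U :: "nat set" and \<psi>0 :: "nat \<Rightarrow> nat" and t0 :: nat
    and fo fi :: "nat \<Rightarrow> nat \<Rightarrow> nat"
  assumes fin: "finite U" and con: "conn (ugraph A) U" and irr: "(x, x) \<notin> A"
    and t0: "t0 \<in> U" and hole: "\<psi>0 t0 = 0" and col: "x \<in> U - {t0} \<Longrightarrow> \<psi>0 x \<in> {1..p}"
    and p: "p \<ge> 1"
    and bal: "v \<in> U \<Longrightarrow> card {y \<in> U. (v, y) \<in> A} = card {y \<in> U. (y, v) \<in> A}"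
    and calm: "reach (ugraph A) U \<psi>0 t0 \<psi> r \<Longrightarrow> calm A U \<psi> r"
    and cnt: "v \<in> U \<Longrightarrow> \<exists>\<psi>. reach (ugraph A) U \<psi>0 t0 \<psi> v \<and>
      (\<forall>i \<in> {1..p}. out_count A U \<psi> v i = fo v i \<and> in_count A U \<psi> v i = fi v i)"
begin

abbreviation "R \<equiv> reach (ugraph A) U \<psi>0 t0"

lemma irr_ugraph: "(x, x) \<notin> ugraph A" using irr by (simp add: ugraph_iff)

lemma R_col: assumes "R \<psi> t" "x \<in> U - {t}" shows "\<psi> x \<in> {1..p}"
  using reach_image[OF assms(1) t0 fin] assms(2) col by (metis (no_types, lifting) imageE imageI)

lemma pd: "pair_digraph (induced A U)"
  unfolding pair_digraph_iff using fin irr by auto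

lemma ugraph_induced: "conn (ugraph (parcs (induced A U))) S \<longleftrightarrow> conn (ugraph A) S" if "S \<subseteq> U"
  by (rule conn_cong) (use that in \<open>auto simp: ugraph_def\<close>)

lemma cn: "Digraph_Component.connected (with_proj (induced A U))"
  using con ugraph_induced[of U] by (simp add: connected_iff_conn)

lemma degrees:
  assumes "v \<in> U"
  shows "out_degree (with_proj (induced A U)) v = card {y \<in> U. (v, y) \<in> A}"
    "in_degree (with_proj (induced A U)) v = card {y \<in> U. (y, v) \<in> A}"
  unfolding degree_card using assms by (auto intro: arg_cong[where f = card])

definition E :: "nat \<Rightarrow> nat \<Rightarrow> nat \<Rightarrow> bool" where
  "E r x y \<longleftrightarrow> (\<forall>\<psi>. R \<psi> r \<longrightarrow> \<psi> x = \<psi> y)"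

lemma E_move:
  assumes "r \<in> U" "s \<in> U" "(r, s) \<in> ugraph A"
  shows "E r x y \<longleftrightarrow> E s (transpose r s x) (transpose r s y)"
proof
  assume E: "E r x y"
  show "E s (transpose r s x) (transpose r s y)"
    unfolding E_def
  proof (intro allI impI)
    fix \<chi> assume "R \<chi> s"
    then have "R (\<chi> \<circ> transpose s r) r" using assms by (auto intro: reach_step simp: ugraph_iff)
    then show "\<chi> (transpose r s x) = \<chi> (transpose r s y)"
      using E unfolding E_def by (metis comp_apply transpose_commute)
  qed
next
  assume E: "E s (transpose r s x) (transpose r s y)"
  show "E r x y"
    unfolding E_def
  proof (intro allI impI)
    fix \<psi> assume "R \<psi> r"
    then have "R (\<psi> \<circ> transpose r s) s" using assms by (auto intro: reach_step)
    then show "\<psi> x = \<psi> y"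
      using E unfolding E_def by (metis comp_apply transpose_involutory)
  qed
qed

text \<open>
  All tokens have the same colour, so around a hole at \<open>v\<close> this colour is seen as often as the
  degree of \<open>v\<close> says.
\<close>
lemma mono_case:
  assumes bl: "block (with_proj (induced A U))"
    and mono: "\<And>r x y. r \<in> U \<Longrightarrow> x \<in> U - {r} \<Longrightarrow> y \<in> U - {r} \<Longrightarrow> E r x y"
  shows "(\<forall>v \<in> U. \<forall>i \<in> {1..p}. fo v i = fi v i) \<and> hard_pair p (induced A U) fo"
proof -
  obtain j where j: "j \<in> {1..p}" "\<And>x. x \<in> U - {t0} \<Longrightarrow> \<psi>0 x = j"
  proof (cases "U - {t0} = {}")
    case True then show ?thesis using that[of 1] p by auto
  next
    case False
    then obtain x where x: "x \<in> U - {t0}" by blast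
    have "\<psi>0 y = \<psi>0 x" if "y \<in> U - {t0}" for y
      using mono[OF t0 that x] reach_refl unfolding E_def by metis
    then show ?thesis using that[of "\<psi>0 x"] col[OF x] by blast
  qed
  have all: "\<psi> x = j" if "R \<psi> t" "x \<in> U - {t}" for \<psi> t x
  proof -
    have "\<psi> x \<in> \<psi>0 ` (U - {t0})" using reach_image[OF that(1) t0 fin] that(2) by blast
    then show ?thesis using j by auto
  qed
  have f: "fo v i = (if i = j then card {y \<in> U. (v, y) \<in> A} else 0)"
    "fi v i = (if i = j then card {y \<in> U. (y, v) \<in> A} else 0)" if v: "v \<in> U" and i: "i \<in> {1..p}" for v i
  proof -
    obtain \<psi> where R: "R \<psi> v" and c: "out_count A U \<psi> v i = fo v i" "in_count A U \<psi> v i = fi v i"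
      using cnt[OF v] i by blast
    have 1: "\<psi> y = j" if "y \<in> U" "(v, y) \<in> A \<or> (y, v) \<in> A" for y
      using all[OF R, of y] that irr by blast
    have "{y \<in> U. (v, y) \<in> A \<and> \<psi> y = i} = (if i = j then {y \<in> U. (v, y) \<in> A} else {})"
      "{y \<in> U. (y, v) \<in> A \<and> \<psi> y = i} = (if i = j then {y \<in> U. (y, v) \<in> A} else {})"
      using 1 by auto
    then show "fo v i = (if i = j then card {y \<in> U. (v, y) \<in> A} else 0)"
      "fi v i = (if i = j then card {y \<in> U. (y, v) \<in> A} else 0)"
      unfolding c[symmetric] out_count_def in_count_def by simp_all
  qed
  have "hard_pair p (induced A U) fo"
  proof (rule hard_pair.type_M[OF pd cn bl _ j(1)])
    show "eulerian_digraph (with_proj (induced A U))"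
      unfolding eulerian_digraph_def using degrees bal by simp
    show "\<forall>v \<in> pverts (induced A U). fo v j = out_degree (with_proj (induced A U)) v \<and>
      fo v j = in_degree (with_proj (induced A U)) v \<and> (\<forall>i \<in> {1..p}. i \<noteq> j \<longrightarrow> fo v i = 0)"
      using f j(1) degrees bal by simp
  qed
  then show ?thesis using f bal by simp
qed

text \<open>
  If \<open>E\<close> is not trivial, two different colours occur around the hole, no vertex is flat and
  \<open>ruled_puzzle\<close> applies. With \<open>same_type\<close> and the balance of degrees the digraph is bidirected. If
  it is complete, the colours around any hole are those of all tokens, whose numbers never change;
  if not, it is an odd cycle with alternating tokens.
\<close>
lemma block_case:
  assumes del: "\<And>v. v \<in> U \<Longrightarrow> U - {v} \<noteq> {} \<Longrightarrow> conn (ugraph A) (U - {v})"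
  shows "(\<forall>v \<in> U. \<forall>i \<in> {1..p}. fo v i = fi v i) \<and> hard_pair p (induced A U) fo"
proof (cases "\<forall>r \<in> U. \<forall>x \<in> U - {r}. \<forall>y \<in> U - {r}. E r x y")
  case True
  have "block (with_proj (induced A U))"
    unfolding block_iff using del con ugraph_induced by (metis Diff_subset induced_simps(1) order_refl)
  then show ?thesis using mono_case True by blast
next
  case False
  then obtain r x y where rxy: "r \<in> U" "x \<in> U - {r}" "y \<in> U - {r}" "\<not> E r x y" by blast
  then obtain \<chi> where \<chi>: "R \<chi> r" "\<chi> x \<noteq> \<chi> y" unfolding E_def by blast
  have c3: "card U \<ge> 3"
  proof -
    have "x \<noteq> y" using \<chi> by auto
    then have "card {r, x, y} = 3" using rxy by auto
    then show ?thesis using card_mono[OF fin, of "{r, x, y}"] rxy by auto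
  qed
  have ne: "U - {v} \<noteq> {}" for v
  proof
    assume "U - {v} = {}"
    then have "card U \<le> card {v}" by (intro card_mono) auto
    then show False using c3 by simp
  qed
  interpret puzzle U "ugraph A" E
  proof unfold_locales
    show "finite U" by (rule fin)
    show "sym (ugraph A)" by (rule ugraph_sym)
    show "(x, x) \<notin> ugraph A" for x by (rule irr_ugraph)
    show "conn (ugraph A) U" by (rule con)
    show "conn (ugraph A) (U - {v})" if "v \<in> U" for v using del that ne by blast
    show "card U \<ge> 3" by (rule c3)
    show "E r x y \<longleftrightarrow> E s (transpose r s x) (transpose r s y)" if "r \<in> U" "s \<in> U" "(r, s) \<in> ugraph A" for r s x y
      using E_move that .
  qed (auto simp: E_def)
  interpret sharp_puzzle U "ugraph A" E
  proof
    fix b assume "b \<in> U"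
    show "\<not> flat b" using flat_mono[of b] rxy \<open>b \<in> U\<close> by blast
  qed
  interpret ruled_puzzle U "ugraph A" E "arc_type A"
  proof unfold_locales
    fix r x1 xm x2
    assume *: "r \<in> U" "x1 \<in> U" "xm \<in> U" "x2 \<in> U" "(r, x1) \<in> ugraph A" "(r, xm) \<in> ugraph A" "x1 \<noteq> xm" "(x1, x2) \<in> ugraph A"
      "linked (ugraph A) (insert xm {y \<in> U. y \<noteq> r \<and> (r, y) \<notin> ugraph A}) x2 xm"
    have "\<psi> x2 = \<psi> xm \<and> (arc_type A r x1 \<noteq> arc_type A r xm \<longrightarrow> \<psi> x1 = \<psi> xm)" if "R \<psi> r" for \<psi>
      using calm[OF that] * unfolding calm_def by meson
    then show "E r x2 xm" "arc_type A r x1 \<noteq> arc_type A r xm \<Longrightarrow> E r x1 xm" unfolding E_def by auto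
  qed
  have bidir: "(v, u) \<in> A" if v: "v \<in> U" and u: "u \<in> U" and vu: "(v, u) \<in> ugraph A" for v u
  proof (rule ccontr)
    assume n: "(v, u) \<notin> A"
    then have "(u, v) \<in> A" using vu by (simp add: ugraph_iff)
    \<comment> \<open>All neighbours of \<open>v\<close> are of the type of \<open>u\<close>, so \<open>v\<close> would have in-neighbours but no out-neighbours.\<close>
    have "(v, w) \<notin> A" if w: "w \<in> U" for w
    proof
      assume "(v, w) \<in> A"
      then have "arc_type A v w = arc_type A v u" using same_type[OF v w u _ vu] by (simp add: ugraph_iff)
      then show False using n \<open>(v, w) \<in> A\<close> by (simp add: arc_type_def)
    qed
    then have "card {y \<in> U. (v, y) \<in> A} = 0" by (auto simp: card_eq_0_iff)
    moreover have "card {y \<in> U. (y, v) \<in> A} \<noteq> 0"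
      using \<open>(u, v) \<in> A\<close> u fin by (auto simp: card_eq_0_iff)
    ultimately show False using bal[OF v] by simp
  qed
  have A_ugraph: "(v, u) \<in> A \<longleftrightarrow> (v, u) \<in> ugraph A" "(u, v) \<in> A \<longleftrightarrow> (v, u) \<in> ugraph A" if "v \<in> U" "u \<in> U" for v u
  proof -
    have "(v, u) \<in> ugraph A \<longleftrightarrow> (u, v) \<in> ugraph A" unfolding ugraph_iff by blast
    then show "(v, u) \<in> A \<longleftrightarrow> (v, u) \<in> ugraph A" "(u, v) \<in> A \<longleftrightarrow> (v, u) \<in> ugraph A"
      using bidir[OF that] bidir[OF that(2,1)] unfolding ugraph_iff by blast+
  qed
  have oi: "out_count A U \<psi> v i = card {y \<in> U. (v, y) \<in> ugraph A \<and> \<psi> y = i}"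
    "in_count A U \<psi> v i = card {y \<in> U. (v, y) \<in> ugraph A \<and> \<psi> y = i}" if "v \<in> U" for \<psi> v i
  proof -
    have "{y \<in> U. (v, y) \<in> A \<and> \<psi> y = i} = {y \<in> U. (v, y) \<in> ugraph A \<and> \<psi> y = i}"
      "{y \<in> U. (y, v) \<in> A \<and> \<psi> y = i} = {y \<in> U. (v, y) \<in> ugraph A \<and> \<psi> y = i}"
      using A_ugraph that by blast+
    then show "out_count A U \<psi> v i = card {y \<in> U. (v, y) \<in> ugraph A \<and> \<psi> y = i}"
      "in_count A U \<psi> v i = card {y \<in> U. (v, y) \<in> ugraph A \<and> \<psi> y = i}"
      unfolding out_count_def in_count_def by simp_all
  qed
  have eq: "\<forall>v \<in> U. \<forall>i \<in> {1..p}. fo v i = fi v i"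
  proof (intro ballI)
    fix v i assume v: "v \<in> U" and i: "i \<in> {1..p}"
    obtain \<psi> where "out_count A U \<psi> v i = fo v i" "in_count A U \<psi> v i = fi v i" using cnt[OF v] i by blast
    then show "fo v i = fi v i" using oi[OF v, of \<psi> i] by simp
  qed
  have img: "\<psi> ` (U - {t}) = \<chi> ` (U - {r})" if "R \<psi> t" for \<psi> t
    using reach_image[OF that t0 fin] reach_image[OF \<chi>(1) t0 fin] by simp
  have xyc: "\<chi> x \<in> {1..p}" "\<chi> y \<in> {1..p}" using R_col[OF \<chi>(1)] rxy by auto
  have "hard_pair p (induced A U) fo"
  proof (cases "\<exists>r \<in> U. M r \<noteq> {}")
    case True
    then obtain r' w where r': "r' \<in> U" "w \<in> M r'" by blast
    have "\<exists>vs. distinct vs \<and> set vs = U \<and> length vs \<ge> 3 \<and> odd (length vs) \<and>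
      (\<forall>i < length vs. {x \<in> U. (vs ! i, x) \<in> ugraph A} =
        {vs ! (Suc i mod length vs), vs ! ((i + length vs - 1) mod length vs)}) \<and>
      (\<forall>i < length vs. \<forall>x \<in> U - {vs ! i}.
        E (vs ! i) x (vs ! (Suc i mod length vs)) \<or> E (vs ! i) x (vs ! ((i + length vs - 1) mod length vs)))"
      by (rule odd_cycle[OF r']) blast
    then obtain vs where vs: "distinct vs" "set vs = U" "length vs \<ge> 3" "odd (length vs)"
      and N: "\<forall>i < length vs. {x \<in> U. (vs ! i, x) \<in> ugraph A} =
        {vs ! (Suc i mod length vs), vs ! ((i + length vs - 1) mod length vs)}"
      and alt: "\<forall>i < length vs. \<forall>x \<in> U - {vs ! i}.
        E (vs ! i) x (vs ! (Suc i mod length vs)) \<or> E (vs ! i) x (vs ! ((i + length vs - 1) mod length vs))"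
      by blast
    let ?n = "length vs"
    have cyc: "bidirected_cycle ?n (induced A U)"
      unfolding bidirected_cycle_def
    proof (intro conjI exI[of _ vs])
      have "A \<inter> U \<times> U = (\<Union>i \<in> {..<?n}. {(vs ! i, vs ! (Suc i mod ?n)), (vs ! (Suc i mod ?n), vs ! i)})" (is "?L = ?R")
      proof
        show "?R \<subseteq> ?L"
        proof
          fix e assume "e \<in> ?R"
          then obtain i where i: "i < ?n"
            and e: "e = (vs ! i, vs ! (Suc i mod ?n)) \<or> e = (vs ! (Suc i mod ?n), vs ! i)" by auto
          have "vs ! (Suc i mod ?n) \<in> {x \<in> U. (vs ! i, x) \<in> ugraph A}" using N i by blast
          moreover have "vs ! i \<in> U" using i vs(2) by auto
          ultimately show "e \<in> ?L" using e A_ugraph[of "vs ! i" "vs ! (Suc i mod ?n)"] by auto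
        qed
        show "?L \<subseteq> ?R"
        proof
          fix e assume "e \<in> ?L"
          then obtain a b where ab: "e = (a, b)" "a \<in> U" "b \<in> U" "(a, b) \<in> A" by auto
          obtain i where i: "i < ?n" "a = vs ! i" using ab vs(2) by (auto simp: in_set_conv_nth)
          have "b \<in> {x \<in> U. (vs ! i, x) \<in> ugraph A}" using ab i by (auto simp: ugraph_iff)
          then consider "b = vs ! (Suc i mod ?n)" | "b = vs ! ((i + ?n - 1) mod ?n)" using N i(1) by blast
          then show "e \<in> ?R"
          proof cases
            case 1 then show ?thesis using ab i by blast
          next
            case 2
            let ?j = "(i + ?n - 1) mod ?n"
            have "0 < ?n" using i by linarith
            then have j: "?j < ?n" by (rule mod_less_divisor)
            have "Suc ?j mod ?n = Suc (i + ?n - 1) mod ?n" by (rule mod_Suc_eq)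
            also have "Suc (i + ?n - 1) = i + ?n" using \<open>0 < ?n\<close> by simp
            also have "(i + ?n) mod ?n = i" using i by simp
            finally have "e = (vs ! (Suc ?j mod ?n), vs ! ?j)" using ab i 2 by simp
            then show ?thesis using j by blast
          qed
        qed
      qed
      then show "parcs (induced A U) = ?R" by simp
    qed (use vs in auto)
    have xyn: "\<chi> x \<noteq> \<chi> y" by (rule \<chi>(2))
    show ?thesis
    proof (rule hard_pair.type_C[OF pd cn cyc vs(4) xyc xyn], intro ballI)
      fix v i assume "v \<in> pverts (induced A U)" and i: "i \<in> {1..p}"
      then have v: "v \<in> U" by simp
      then obtain m where m: "m < ?n" "v = vs ! m" using vs(2) by (auto simp: in_set_conv_nth)
      let ?a = "vs ! (Suc m mod ?n)" and ?b = "vs ! ((m + ?n - 1) mod ?n)"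
      have N: "{x \<in> U. (v, x) \<in> ugraph A} = {?a, ?b}" using N m by simp
      obtain \<psi> where R: "R \<psi> v" and c: "out_count A U \<psi> v i = fo v i" using cnt[OF v] i by blast
      have abU: "?a \<in> U - {v}" "?b \<in> U - {v}" using N irr_ugraph by auto
      have two: "\<psi> z = \<psi> ?a \<or> \<psi> z = \<psi> ?b" if "z \<in> U - {v}" for z
        using alt m that R unfolding E_def by blast
      have im: "\<psi> ` (U - {v}) = \<chi> ` (U - {r})" by (rule img[OF R])
      have "\<psi> ` (U - {v}) = {\<psi> ?a, \<psi> ?b}" using two abU by auto
      moreover have "\<chi> x \<in> \<chi> ` (U - {r})" "\<chi> y \<in> \<chi> ` (U - {r})" using rxy by auto
      ultimately have s: "{\<psi> ?a, \<psi> ?b} = {\<chi> x, \<chi> y}" using im xyn by auto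
      then have nab: "\<psi> ?a \<noteq> \<psi> ?b" using xyn by auto
      have "{y \<in> U. (v, y) \<in> ugraph A \<and> \<psi> y = i} = {z \<in> {?a, ?b}. \<psi> z = i}" using N by blast
      then have "fo v i = card {z \<in> {?a, ?b}. \<psi> z = i}" using c oi[OF v] by simp
      also have "{z \<in> {?a, ?b}. \<psi> z = i} = (if i = \<psi> ?a then {?a} else if i = \<psi> ?b then {?b} else {})"
        using nab by auto
      also have "card \<dots> = (if i \<in> {\<psi> ?a, \<psi> ?b} then 1 else 0)" by simp
      finally show "fo v i = (if i \<in> {\<chi> x, \<chi> y} then 1 else 0)" unfolding s .
    qed
  next
    case False
    have adj: "(v, u) \<in> ugraph A" if "v \<in> U" "u \<in> U" "v \<noteq> u" for v u
    proof (rule ccontr)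
      assume "(v, u) \<notin> ugraph A"
      then have "u \<in> M v" using that by simp
      then show False using False that(1) by (metis empty_iff)
    qed
    define m where "m i = card {z \<in> U - {r}. \<chi> z = i}" for i
    have "complete_digraph (card (pverts (induced A U))) (with_proj (induced A U))"
      unfolding complete_digraph_pair_def
    proof (intro conjI)
      show "parcs (induced A U) = {(u, v). (u, v) \<in> pverts (induced A U) \<times> pverts (induced A U) \<and> u \<noteq> v}"
        using irr adj A_ugraph(1) by fastforce
    qed (simp_all add: fin)
    moreover have "\<exists>k \<in> {1..p}. \<exists>l \<in> {1..p}. k \<noteq> l \<and> m k \<noteq> 0 \<and> m l \<noteq> 0"
    proof (intro bexI conjI)
      show "\<chi> x \<noteq> \<chi> y" by (rule \<chi>(2))
      show "m (\<chi> x) \<noteq> 0" "m (\<chi> y) \<noteq> 0" unfolding m_def using rxy fin by (simp_all add: card_eq_0_iff) blast+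
    qed (rule xyc)+
    moreover have "(\<Sum>i = 1..p. m i) = card (pverts (induced A U)) - 1"
    proof -
      have "(\<Sum>i = 1..p. m i) = card (\<Union>i \<in> {1..p}. {z \<in> U - {r}. \<chi> z = i})"
        unfolding m_def by (rule card_UN_disjoint[symmetric]) (use fin in auto)
      also have "(\<Union>i \<in> {1..p}. {z \<in> U - {r}. \<chi> z = i}) = U - {r}"
        using R_col[OF \<chi>(1)] by blast
      finally show ?thesis using rxy fin by simp
    qed
    moreover have "\<forall>v \<in> pverts (induced A U). \<forall>i \<in> {1..p}. fo v i = m i"
    proof (intro ballI)
      fix v i assume "v \<in> pverts (induced A U)" and i: "i \<in> {1..p}"
      then have v: "v \<in> U" by simp
      obtain \<psi> where R: "R \<psi> v" and c: "out_count A U \<psi> v i = fo v i" using cnt[OF v] i by blast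
      have "{y \<in> U. (v, y) \<in> ugraph A \<and> \<psi> y = i} = {z \<in> U - {v}. \<psi> z = i}"
        using adj v irr_ugraph by auto
      then have "fo v i = card {z \<in> U - {v}. \<psi> z = i}" using c oi[OF v] by simp
      then show "fo v i = m i"
        unfolding m_def using reach_count[OF R t0] reach_count[OF \<chi>(1) t0] by simp
    qed
    ultimately show ?thesis by (rule hard_pair.type_K[OF pd cn])
  qed
  then show ?thesis using eq by blast
qed

end

section \<open>Splitting at a separating vertex\<close>

lemma image_fixed: "(\<And>e. e \<in> S \<Longrightarrow> g e = e) \<Longrightarrow> g ` S = S"
  by force

lemma sum_out_in:
  assumes "finite W"
  shows "(\<Sum>v \<in> W. card {y \<in> W. (v, y) \<in> A}) = (\<Sum>v \<in> W. card {y \<in> W. (y, v) \<in> A})"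
proof -
  have c: "card {y \<in> W. Q y} = (\<Sum>y \<in> W. if Q y then 1 else 0)" for Q
    by (simp only: card_eq_sum sum.inter_filter[OF assms])
  show ?thesis unfolding c by (rule sum.swap)
qed

context frozen
begin

lemma part_conn:
  assumes z: "z \<in> U" and S: "z \<notin> S" "S \<subseteq> U"
    and closed: "\<And>x y. x \<in> S \<Longrightarrow> y \<in> U \<Longrightarrow> (x, y) \<in> ugraph A \<Longrightarrow> y \<in> insert z S"
  shows "conn (ugraph A) (insert z S)"
proof -
  have stay: "k \<in> S \<and> linked (ugraph A) S u k" if "linked (ugraph A) (U - {z}) u k" "u \<in> S" for u k
    using that(1)
  proof (induction rule: rtrancl_induct)
    case base then show ?case using that by simp
  next
    case (step k y)
    then have "y \<in> S" using closed[of k y] by auto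
    moreover have "linked (ugraph A) S u y" by (rule linked_step[of u k]) (use step calculation in auto)
    ultimately show ?case by blast
  qed
  have to_z: "linked (ugraph A) (insert z S) u z" if u: "u \<in> S" for u
  proof -
    have "linked (ugraph A) U u z" using con u S z unfolding conn_def by blast
    then obtain k y where k: "linked (ugraph A) (U - {z}) u k" "(k, y) \<in> ugraph A" "y \<in> {z}"
      by (rule first_hit[where T = "{z}"]) (use u S in auto)
    then have "k \<in> S" and l: "linked (ugraph A) S u k" using stay u by auto
    from l have "linked (ugraph A) (insert z S) u k" by (rule linked_mono) auto
    then show ?thesis by (rule linked_step) (use k \<open>k \<in> S\<close> in auto)
  qed
  have z1: "linked (ugraph A) (insert z S) u z" if "u \<in> insert z S" for u using that to_z by auto
  have z2: "linked (ugraph A) (insert z S) z u" if "u \<in> insert z S" for u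
    using linked_sym[OF ugraph_sym z1[OF that]] .
  show ?thesis unfolding conn_def
  proof (intro conjI ballI)
    show "linked (ugraph A) (insert z S) u v" if "u \<in> insert z S" "v \<in> insert z S" for u v
      using linked_trans[OF z1[OF that(1)] z2[OF that(2)]] .
  qed simp
qed

text \<open>
  The balance of \<open>z\<close> inside the part follows from that of all other vertices by counting arcs, and
  the configurations of the part are projections of those of the whole graph.
\<close>
lemma part:
  assumes z: "z \<in> U" and S: "z \<notin> S" "S \<subseteq> U"
    and closed: "\<And>x y. x \<in> S \<Longrightarrow> y \<in> U \<Longrightarrow> (x, y) \<in> ugraph A \<Longrightarrow> y \<in> insert z S"
    and \<chi>: "R \<chi> z"
  shows "frozen A p (insert z S) \<chi> z
    (\<lambda>v i. if v = z then out_count A (insert z S) \<chi> z i else fo v i)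
    (\<lambda>v i. if v = z then in_count A (insert z S) \<chi> z i else fi v i)"
proof -
  let ?W = "insert z S"
  have WU: "?W \<subseteq> U" using z S by auto
  have finW: "finite ?W" by (rule finite_subset[OF WU fin])
  have nb: "{y \<in> ?W. (v, y) \<in> A \<and> Q y} = {y \<in> U. (v, y) \<in> A \<and> Q y}"
    "{y \<in> ?W. (y, v) \<in> A \<and> Q y} = {y \<in> U. (y, v) \<in> A \<and> Q y}" if "v \<in> S" for v Q
    using closed[OF that] WU by (auto simp: ugraph_iff)
  have balS: "card {y \<in> ?W. (v, y) \<in> A} = card {y \<in> ?W. (y, v) \<in> A}" if "v \<in> S" for v
    using nb[OF that, of "\<lambda>_. True"] bal[of v] that S by auto
  show ?thesis
  proof
    show "finite ?W" by (rule finW)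
    show "conn (ugraph A) ?W" by (rule part_conn[OF z S closed])
    show "(x, x) \<notin> A" for x by (rule irr)
    show "z \<in> ?W" by simp
    show "\<chi> z = 0" using reach_hole[OF \<chi> hole] .
    show "\<chi> x \<in> {1..p}" if "x \<in> ?W - {z}" for x using R_col[OF \<chi>, of x] that WU by auto
    show "1 \<le> p" by (rule p)
    show "card {y \<in> ?W. (v, y) \<in> A} = card {y \<in> ?W. (y, v) \<in> A}" if v: "v \<in> ?W" for v
    proof (cases "v = z")
      case True
      have "(\<Sum>v \<in> ?W. card {y \<in> ?W. (v, y) \<in> A}) = card {y \<in> ?W. (z, y) \<in> A} + (\<Sum>v \<in> S. card {y \<in> ?W. (v, y) \<in> A})"
        "(\<Sum>v \<in> ?W. card {y \<in> ?W. (y, v) \<in> A}) = card {y \<in> ?W. (y, z) \<in> A} + (\<Sum>v \<in> S. card {y \<in> ?W. (y, v) \<in> A})"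
        using finW S(1) by simp_all
      moreover have "(\<Sum>v \<in> S. card {y \<in> ?W. (v, y) \<in> A}) = (\<Sum>v \<in> S. card {y \<in> ?W. (y, v) \<in> A})"
        by (rule sum.cong[OF refl balS])
      ultimately show ?thesis unfolding True using sum_out_in[OF finW, of A] by linarith
    next
      case False then show ?thesis using balS v by blast
    qed
    show "calm A ?W \<psi> r" if "reach (ugraph A) ?W \<chi> z \<psi> r" for \<psi> r
      using calm_subset[OF calm WU] reach_trans[OF reach_mono[OF that WU] \<chi>] by blast
    show "\<exists>\<psi>. reach (ugraph A) ?W \<chi> z \<psi> v \<and>
      (\<forall>i \<in> {1..p}. out_count A ?W \<psi> v i = (if v = z then out_count A ?W \<chi> z i else fo v i) \<and>
        in_count A ?W \<psi> v i = (if v = z then in_count A ?W \<chi> z i else fi v i))" if v: "v \<in> ?W" for v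
    proof (cases "v = z")
      case True then show ?thesis using reach_refl[of "ugraph A" ?W \<chi> z] by auto
    next
      case False
      then have vS: "v \<in> S" using v by simp
      then obtain \<psi> where R: "R \<psi> v" and c: "\<forall>i \<in> {1..p}. out_count A U \<psi> v i = fo v i \<and> in_count A U \<psi> v i = fi v i"
        using cnt[of v] S by blast
      have "reach (ugraph A) U \<chi> z \<psi>0 t0" using reach_back[OF \<chi> ugraph_sym t0] .
      then have "reach (ugraph A) U \<chi> z \<psi> v" using reach_trans[OF R] by blast
      then have "\<exists>\<psi>'. reach (ugraph A) ?W \<chi> z \<psi>' (if v \<in> ?W then v else z) \<and>
        (\<forall>x \<in> ?W - {if v \<in> ?W then v else z}. \<psi>' x = \<psi> x)"
        by (rule reach_proj[OF _ ugraph_sym irr_ugraph refl S(1,2) z]) (rule closed)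
      then obtain \<psi>' where \<psi>': "reach (ugraph A) ?W \<chi> z \<psi>' v" "\<forall>x \<in> ?W - {v}. \<psi>' x = \<psi> x"
        unfolding if_P[OF v] by blast
      have "out_count A ?W \<psi>' v i = out_count A U \<psi> v i" "in_count A ?W \<psi>' v i = in_count A U \<psi> v i" for i
      proof -
        have e: "\<psi>' y = \<psi> y" if "y \<in> ?W" "(v, y) \<in> A \<or> (y, v) \<in> A" for y
        proof -
          have "y \<noteq> v" using that irr by auto
          then show ?thesis using \<psi>'(2) that by blast
        qed
        have "{y \<in> ?W. (v, y) \<in> A \<and> \<psi>' y = i} = {y \<in> ?W. (v, y) \<in> A \<and> \<psi> y = i}"
          "{y \<in> ?W. (y, v) \<in> A \<and> \<psi>' y = i} = {y \<in> ?W. (y, v) \<in> A \<and> \<psi> y = i}"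
          using e by auto
        then show "out_count A ?W \<psi>' v i = out_count A U \<psi> v i" "in_count A ?W \<psi>' v i = in_count A U \<psi> v i"
          unfolding out_count_def in_count_def using nb[OF vS, of "\<lambda>y. \<psi> y = i"] by simp_all
      qed
      then show ?thesis using \<psi>'(1) c False by auto
    qed
  qed
qed

end

text \<open>
  At a separating vertex \<open>z\<close> the graph is cut into a component of \<open>U - {z}\<close> and the rest. The
  colours seen from a hole at \<open>z\<close> are distributed over the two parts, so the prescriptions at \<open>z\<close>
  add up as required for merging, with a copy \<open>w\<close> of \<open>z\<close> for the second part.
\<close>
theorem frozen_hard:
  assumes "frozen A p U \<psi>0 t0 fo fi"
  shows "(\<forall>v \<in> U. \<forall>i \<in> {1..p}. fo v i = fi v i) \<and> hard_pair p (induced A U) fo"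
  using assms
proof (induction "card U" arbitrary: U \<psi>0 t0 fo fi rule: less_induct)
  case less
  interpret frozen A p U \<psi>0 t0 fo fi by (rule less.prems)
  show ?case
  proof (cases "\<exists>z \<in> U. U - {z} \<noteq> {} \<and> \<not> conn (ugraph A) (U - {z})")
    case False
    then show ?thesis using block_case by blast
  next
    case True
    then obtain z a b where z: "z \<in> U" and ab: "a \<in> U - {z}" "b \<in> U - {z}" "\<not> linked (ugraph A) (U - {z}) a b"
      unfolding conn_def by blast
    define S1 where "S1 = {y. linked (ugraph A) (U - {z}) a y}"
    define S2 where "S2 = U - {z} - S1"
    have S1U: "S1 \<subseteq> U - {z}" unfolding S1_def using linked_in[OF _ ab(1)] by blast
    have aS: "a \<in> S1" "b \<in> S2" using ab by (auto simp: S1_def S2_def)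
    have S1: "z \<notin> S1" "S1 \<subseteq> U" and S2: "z \<notin> S2" "S2 \<subseteq> U" using S1U by (auto simp: S2_def)
    have cl1: "y \<in> insert z S1" if "x \<in> S1" "y \<in> U" "(x, y) \<in> ugraph A" for x y
    proof (cases "y = z")
      case False
      have "x \<in> U - {z}" using that S1U by blast
      moreover have "linked (ugraph A) (U - {z}) a x" using that by (simp add: S1_def)
      ultimately have "linked (ugraph A) (U - {z}) a y" using linked_step[of a x "ugraph A" "U - {z}" y] that False by blast
      then show ?thesis by (simp add: S1_def)
    qed simp
    have cl2: "y \<in> insert z S2" if "x \<in> S2" "y \<in> U" "(x, y) \<in> ugraph A" for x y
    proof (rule ccontr)
      assume "y \<notin> insert z S2"
      then have "y \<in> S1" using that by (auto simp: S2_def)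
      moreover have "(y, x) \<in> ugraph A" using that by (auto simp: ugraph_iff)
      ultimately have "x \<in> insert z S1" using cl1[of y x] that S2 by blast
      then show False using that by (auto simp: S2_def)
    qed
    obtain \<chi> where \<chi>: "R \<chi> z" and c: "\<forall>i \<in> {1..p}. out_count A U \<chi> z i = fo z i \<and> in_count A U \<chi> z i = fi z i"
      using cnt[OF z] by blast
    let ?W1 = "insert z S1" and ?W2 = "insert z S2"
    define fo1 where "fo1 = (\<lambda>v i. if v = z then out_count A ?W1 \<chi> z i else fo v i)"
    define fi1 where "fi1 = (\<lambda>v i. if v = z then in_count A ?W1 \<chi> z i else fi v i)"
    define fo2 where "fo2 = (\<lambda>v i. if v = z then out_count A ?W2 \<chi> z i else fo v i)"
    define fi2 where "fi2 = (\<lambda>v i. if v = z then in_count A ?W2 \<chi> z i else fi v i)"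
    have F1: "frozen A p ?W1 \<chi> z fo1 fi1" unfolding fo1_def fi1_def by (rule part[OF z S1 cl1 \<chi>])
    have F2: "frozen A p ?W2 \<chi> z fo2 fi2" unfolding fo2_def fi2_def by (rule part[OF z S2 cl2 \<chi>])
    have U12: "U = ?W1 \<union> ?W2" "S1 \<inter> S2 = {}" using z S1 by (auto simp: S2_def)
    have "?W1 \<subset> U" "?W2 \<subset> U" proof -
      have "b \<notin> ?W1" "a \<notin> ?W2" using aS U12 ab by auto
      then show "?W1 \<subset> U" "?W2 \<subset> U" using U12(1) ab by auto
    qed
    then have "card ?W1 < card U" "card ?W2 < card U" by (simp_all only: psubset_card_mono[OF fin])
    then have H1: "(\<forall>v \<in> ?W1. \<forall>i \<in> {1..p}. fo1 v i = fi1 v i) \<and> hard_pair p (induced A ?W1) fo1"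
      and H2: "(\<forall>v \<in> ?W2. \<forall>i \<in> {1..p}. fo2 v i = fi2 v i) \<and> hard_pair p (induced A ?W2) fo2"
      using less.hyps[OF _ F1] less.hyps[OF _ F2] by simp_all
    have finS: "finite S1" "finite S2" using finite_subset[OF S1(2) fin] finite_subset[OF S2(2) fin] by simp_all
    have split: "fo z i = fo1 z i + fo2 z i" "fi z i = fi1 z i + fi2 z i" if "i \<in> {1..p}" for i
    proof -
      have "{y \<in> U. (z, y) \<in> A \<and> \<chi> y = i} = {y \<in> ?W1. (z, y) \<in> A \<and> \<chi> y = i} \<union> {y \<in> ?W2. (z, y) \<in> A \<and> \<chi> y = i}"
        "{y \<in> U. (y, z) \<in> A \<and> \<chi> y = i} = {y \<in> ?W1. (y, z) \<in> A \<and> \<chi> y = i} \<union> {y \<in> ?W2. (y, z) \<in> A \<and> \<chi> y = i}"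
        using U12 by auto
      moreover have "{y \<in> ?W1. (z, y) \<in> A \<and> \<chi> y = i} \<inter> {y \<in> ?W2. (z, y) \<in> A \<and> \<chi> y = i} = {}"
        "{y \<in> ?W1. (y, z) \<in> A \<and> \<chi> y = i} \<inter> {y \<in> ?W2. (y, z) \<in> A \<and> \<chi> y = i} = {}"
        using U12 irr by auto
      ultimately have "out_count A U \<chi> z i = out_count A ?W1 \<chi> z i + out_count A ?W2 \<chi> z i"
        "in_count A U \<chi> z i = in_count A ?W1 \<chi> z i + in_count A ?W2 \<chi> z i"
        unfolding out_count_def in_count_def using finS by (simp_all add: card_Un_disjoint)
      then show "fo z i = fo1 z i + fo2 z i" "fi z i = fi1 z i + fi2 z i"
        using c that by (simp_all add: fo1_def fo2_def fi1_def fi2_def)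
    qed
    have eq: "fo v i = fi v i" if v: "v \<in> U" and i: "i \<in> {1..p}" for v i
    proof (cases "v = z")
      case True then show ?thesis using split[OF i] H1 H2 i by simp
    next
      case False
      then consider "v \<in> S1" | "v \<in> S2" using v U12 by blast
      then show ?thesis
      proof cases
        case 1
        then have "fo1 v i = fi1 v i" using H1 i by blast
        then show ?thesis using False by (simp add: fo1_def fi1_def)
      next
        case 2
        then have "fo2 v i = fi2 v i" using H2 i by blast
        then show ?thesis using False by (simp add: fo2_def fi2_def)
      qed
    qed
    obtain w where w: "w \<notin> U" using ex_new_if_finite[OF infinite_UNIV_nat fin] by blast
    define h where "h x = (if x = z then w else x)" for x
    define g2 where "g2 y = fo2 (if y = w then z else y)" for y
    have hinj: "inj_on h ?W2" using w S2 by (auto simp: inj_on_def h_def)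
    have g2h: "g2 (h v) = fo2 v" if "v \<in> ?W2" for v using that w S2 z by (auto simp: g2_def h_def)
    have hp2: "hard_pair p (renamed h (induced A ?W2)) g2"
      by (rule hard_pair_renamed[of p "induced A ?W2" fo2]) (use H2 hinj g2h in auto)
    have hW2: "h ` ?W2 = insert w S2" using S2 by (auto simp: h_def)
    define r where "r = (\<lambda>x. if x = z \<or> x = w then z else x)"
    have rW1: "r x = x" if "x \<in> ?W1" for x using that w S1 by (auto simp: r_def)
    have rW2: "r (h x) = x" if "x \<in> ?W2" for x using that w S2 by (auto simp: r_def h_def)
    have id: "induced A U = identify (induced A ?W1) z (renamed h (induced A ?W2)) w z"
    proof -
      have "r ` (?W1 \<union> h ` ?W2) = U"
      proof -
        have "r ` ?W1 = ?W1" by (rule image_fixed[OF rW1])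
        moreover have "r ` h ` ?W2 = ?W2" unfolding image_image by (rule image_fixed[OF rW2])
        ultimately show ?thesis unfolding image_Un using U12 by simp
      qed
      moreover have "map_prod r r ` (A \<inter> ?W1 \<times> ?W1 \<union> map_prod h h ` (A \<inter> ?W2 \<times> ?W2)) = A \<inter> U \<times> U"
      proof -
        have "map_prod r r ` (A \<inter> ?W1 \<times> ?W1) = A \<inter> ?W1 \<times> ?W1"
        proof (rule image_fixed)
          fix e assume "e \<in> A \<inter> ?W1 \<times> ?W1"
          then obtain x y where "e = (x, y)" "x \<in> ?W1" "y \<in> ?W1" by blast
          then show "map_prod r r e = e" using rW1[of x] rW1[of y] by simp
        qed
        moreover have "map_prod r r ` map_prod h h ` (A \<inter> ?W2 \<times> ?W2) = A \<inter> ?W2 \<times> ?W2"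
          unfolding image_image
        proof (rule image_fixed)
          fix e assume "e \<in> A \<inter> ?W2 \<times> ?W2"
          then obtain x y where "e = (x, y)" "x \<in> ?W2" "y \<in> ?W2" by blast
          then show "map_prod r r (map_prod h h e) = e" using rW2[of x] rW2[of y] by simp
        qed
        moreover have "A \<inter> U \<times> U = A \<inter> ?W1 \<times> ?W1 \<union> A \<inter> ?W2 \<times> ?W2"
        proof
          show "A \<inter> U \<times> U \<subseteq> A \<inter> ?W1 \<times> ?W1 \<union> A \<inter> ?W2 \<times> ?W2"
          proof
            fix e assume "e \<in> A \<inter> U \<times> U"
            then obtain x y where xy: "e = (x, y)" "(x, y) \<in> A" "x \<in> U" "y \<in> U" by blast
            then have s: "(x, y) \<in> ugraph A" by (simp add: ugraph_iff)
            consider "x \<in> S1" | "x \<in> S2" | "x = z" using xy(3) U12(1) by blast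
            then show "e \<in> A \<inter> ?W1 \<times> ?W1 \<union> A \<inter> ?W2 \<times> ?W2"
            proof cases
              case 1 then show ?thesis using cl1[OF 1 xy(4) s] xy(1,2) by simp
            next
              case 2 then show ?thesis using cl2[OF 2 xy(4) s] xy(1,2) by simp
            next
              case 3
              have "y \<in> ?W1 \<or> y \<in> ?W2" using xy(4) U12(1) by blast
              then show ?thesis using 3 xy(1,2) by auto
            qed
          qed
          show "A \<inter> ?W1 \<times> ?W1 \<union> A \<inter> ?W2 \<times> ?W2 \<subseteq> A \<inter> U \<times> U" using U12 by blast
        qed
        ultimately show ?thesis unfolding image_Un by simp
      qed
      ultimately show ?thesis
        unfolding identify_def Let_def r_def[symmetric] by (simp add: induced_def renamed_def)
    qed
    have "hard_pair p (induced A U) fo"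
    proof (rule hard_pair.merge[OF conjunct2[OF H1] hp2 _ _ _ _ id])
      show "pverts (induced A ?W1) \<inter> pverts (renamed h (induced A ?W2)) = {}"
        unfolding renamed_simps induced_simps hW2 using w z U12 S2(1) by auto
      show "z \<in> pverts (induced A ?W1)" by simp
      show "w \<in> pverts (renamed h (induced A ?W2))" using hW2 by simp
      show "z \<notin> (pverts (induced A ?W1) - {z}) \<union> (pverts (renamed h (induced A ?W2)) - {w})" using hW2 S2 by simp
      show "\<forall>x \<in> pverts (induced A ?W1) - {z}. \<forall>i \<in> {1..p}. fo x i = fo1 x i" by (simp add: fo1_def)
      show "\<forall>x \<in> pverts (renamed h (induced A ?W2)) - {w}. \<forall>i \<in> {1..p}. fo x i = g2 x i"
      proof (intro ballI)
        fix x i assume "x \<in> pverts (renamed h (induced A ?W2)) - {w}"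
        then have "x \<in> S2" "x \<noteq> w" using hW2 by auto
        then show "fo x i = g2 x i" using S2 by (auto simp: g2_def fo2_def)
      qed
      show "\<forall>i \<in> {1..p}. fo z i = fo1 z i + g2 w i" using split by (simp add: g2_def)
    qed
    then show ?thesis using eq by blast
  qed
qed

section \<open>Degenerate classes\<close>

text \<open>
  Among the subdigraphs with a given vertex set the induced one has the largest degrees; so weak
  degeneracy only has to be tested there (\<open>degenerate_weakly_degenerate\<close>).
\<close>
definition degenerate :: "('a \<Rightarrow> nat) \<Rightarrow> 'a rel \<Rightarrow> 'a set \<Rightarrow> bool" where
  "degenerate h A S \<longleftrightarrow> (\<forall>T \<subseteq> S. T \<noteq> {} \<longrightarrow>
     (\<exists>v \<in> T. card {y \<in> T. (v, y) \<in> A} < h v \<or> card {y \<in> T. (y, v) \<in> A} < h v))"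

lemma degenerate_subset: "degenerate h A S \<Longrightarrow> S' \<subseteq> S \<Longrightarrow> degenerate h A S'"
  unfolding degenerate_def by (meson order_trans)

lemma degenerate_empty: "degenerate h A {}" by (simp add: degenerate_def)

text \<open>
  The new vertex is itself the required vertex of every subset that contains it.
\<close>
lemma degenerate_insert:
  assumes "degenerate h A S" "finite S" "(r, r) \<notin> A"
    and "card {y \<in> S. (r, y) \<in> A} < h r \<or> card {y \<in> S. (y, r) \<in> A} < h r"
  shows "degenerate h A (insert r S)"
  unfolding degenerate_def
proof (intro allI impI)
  fix T assume T: "T \<subseteq> insert r S" "T \<noteq> {}"
  show "\<exists>v \<in> T. card {y \<in> T. (v, y) \<in> A} < h v \<or> card {y \<in> T. (y, v) \<in> A} < h v"
  proof (cases "r \<in> T")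
    case True
    have "{y \<in> T. (r, y) \<in> A} \<subseteq> {y \<in> S. (r, y) \<in> A}" "{y \<in> T. (y, r) \<in> A} \<subseteq> {y \<in> S. (y, r) \<in> A}"
      using T assms(3) by auto
    then have "card {y \<in> T. (r, y) \<in> A} \<le> card {y \<in> S. (r, y) \<in> A}"
      "card {y \<in> T. (y, r) \<in> A} \<le> card {y \<in> S. (y, r) \<in> A}"
      by (simp_all add: card_mono assms(2))
    then show ?thesis using True assms(4) by (meson le_less_trans)
  next
    case False
    then have "T \<subseteq> S" using T by auto
    then show ?thesis using assms(1) T unfolding degenerate_def by blast
  qed
qed

lemma degenerate_weakly_degenerate:
  assumes "degenerate h (parcs D) S" "finite S"
  shows "weakly_degenerate h (with_proj D \<restriction> S)"
  unfolding weakly_degenerate_def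
proof (intro allI impI)
  fix H assume H: "subgraph H (with_proj D \<restriction> S) \<and> verts H \<noteq> {}"
  then have sub: "verts H \<subseteq> S" "arcs H \<subseteq> parcs D" "tail H = fst" "head H = snd" and wf: "wf_digraph H"
    by (auto simp: subgraph_def compatible_def)
  have inH: "fst e \<in> verts H" "snd e \<in> verts H" if "e \<in> arcs H" for e
    using wf_digraph.tail_in_verts[OF wf that] wf_digraph.head_in_verts[OF wf that] sub by simp_all
  obtain v where v: "v \<in> verts H"
    "card {y \<in> verts H. (v, y) \<in> parcs D} < h v \<or> card {y \<in> verts H. (y, v) \<in> parcs D} < h v"
    using assms(1) sub(1) H unfolding degenerate_def by blast
  have fin: "finite (verts H)" using sub(1) assms(2) finite_subset by blast
  have "out_arcs H v \<subseteq> Pair v ` {y \<in> verts H. (v, y) \<in> parcs D}"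
    using sub inH by (fastforce simp: out_arcs_def)
  then have 1: "out_degree H v \<le> card {y \<in> verts H. (v, y) \<in> parcs D}"
    unfolding out_degree_def using fin by (intro surj_card_le) auto
  have "in_arcs H v \<subseteq> (\<lambda>y. (y, v)) ` {y \<in> verts H. (y, v) \<in> parcs D}"
    using sub inH by (fastforce simp: in_arcs_def)
  then have 2: "in_degree H v \<le> card {y \<in> verts H. (y, v) \<in> parcs D}"
    unfolding in_degree_def using fin by (intro surj_card_le) auto
  show "\<exists>v \<in> verts H. min (out_degree H v) (in_degree H v) < h v"
    using v 1 2 by (intro bexI[OF _ v(1)]) linarith
qed

text \<open>
  Two slots, which are counted if \<open>P\<close> and \<open>Q\<close> hold, respectively, change their colours from \<open>a\<close> and
  \<open>c\<close> to \<open>b\<close> and \<open>a\<close>, and no colour is counted more or less often than before.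
\<close>
lemma two_slots:
  fixes a b c :: nat
  assumes "of_bool (P \<and> a = a) + of_bool (Q \<and> c = a) = (of_bool (P \<and> b = a) + of_bool (Q \<and> a = a) :: nat)"
    and "of_bool (P \<and> a = b) + of_bool (Q \<and> c = b) = (of_bool (P \<and> b = b) + of_bool (Q \<and> a = b) :: nat)"
    and "of_bool (P \<and> a = c) + of_bool (Q \<and> c = c) = (of_bool (P \<and> b = c) + of_bool (Q \<and> a = c) :: nat)"
  shows "(P \<and> Q \<longrightarrow> b = c) \<and> (P \<and> \<not> Q \<longrightarrow> a = b) \<and> (\<not> P \<and> Q \<longrightarrow> a = c)"
proof (intro conjI impI)
  assume "P \<and> Q" then show "b = c" using assms(2) by (cases "c = b"; cases "a = b") simp_all
next
  assume "P \<and> \<not> Q" then show "a = b" using assms(1) by (cases "b = a") simp_all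
next
  assume "\<not> P \<and> Q" then show "a = c" using assms(3) by (cases "a = c") simp_all
qed

section \<open>Instances\<close>

locale inst =
  fixes n p :: nat and A :: "nat rel" and f :: "nat \<Rightarrow> nat \<Rightarrow> nat"
  assumes AU: "A \<subseteq> {..<n} \<times> {..<n}" and irrA: "(x, x) \<notin> A" and conA: "conn (ugraph A) {..<n}" and p1: "p \<ge> 1"
    and demand: "v < n \<Longrightarrow> card {y \<in> {..<n}. (v, y) \<in> A} \<le> (\<Sum>i = 1..p. f v i) \<and>
      card {y \<in> {..<n}. (y, v) \<in> A} \<le> (\<Sum>i = 1..p. f v i)"
begin

abbreviation "U \<equiv> {..<n}"

lemma n1: "n \<ge> 1" using conA unfolding conn_def by (cases n) auto

lemma ugraph_in: "(x, y) \<in> ugraph A \<Longrightarrow> x < n \<and> y < n" using AU by (auto simp: ugraph_iff)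

lemma ugraph_commute: "(x, y) \<in> ugraph A \<longleftrightarrow> (y, x) \<in> ugraph A" by (auto simp: ugraph_iff)

lemma ugraph_ne: "(x, y) \<in> ugraph A \<Longrightarrow> x \<noteq> y" using irrA by (auto simp: ugraph_iff)

text \<open>
  The colour 0 means that a vertex is not coloured. A colour is available at \<open>v\<close> if \<open>v\<close> can join its
  class without spoiling the degeneracy.
\<close>
definition avail where "avail \<psi> v i \<longleftrightarrow> i \<in> {1..p} \<and> (out_count A U \<psi> v i < f v i \<or> in_count A U \<psi> v i < f v i)"

definition stuck where "stuck \<psi> v \<longleftrightarrow> (\<forall>i \<in> {1..p}. out_count A U \<psi> v i = f v i \<and> in_count A U \<psi> v i = f v i)"

definition valid where "valid \<psi> \<longleftrightarrow> (\<forall>i \<in> {1..p}. degenerate (\<lambda>v. f v i) A {v \<in> U. \<psi> v = i})"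

definition solved where "solved \<psi> \<longleftrightarrow> valid \<psi> \<and> (\<forall>v \<in> U. \<psi> v \<in> {1..p})"

definition holed where "holed \<psi> r \<longleftrightarrow> valid \<psi> \<and> r < n \<and> \<psi> r = 0 \<and> (\<forall>v \<in> U - {r}. \<psi> v \<in> {1..p})"

lemma valid_sub:
  assumes "valid \<psi>" "\<And>v i. i \<in> {1..p} \<Longrightarrow> v < n \<Longrightarrow> \<psi>' v = i \<Longrightarrow> \<psi> v = i"
  shows "valid \<psi>'"
  unfolding valid_def
proof
  fix i assume i: "i \<in> {1..p}"
  have "{v \<in> U. \<psi>' v = i} \<subseteq> {v \<in> U. \<psi> v = i}" using assms(2)[OF i] by auto
  then show "degenerate (\<lambda>v. f v i) A {v \<in> U. \<psi>' v = i}" using assms(1) i degenerate_subset unfolding valid_def by blast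
qed

lemma valid_fill:
  assumes "valid \<psi>" "r < n" "avail \<psi> r i"
  shows "valid (\<psi>(r := i))"
  unfolding valid_def
proof
  fix j assume j: "j \<in> {1..p}"
  have ok: "degenerate (\<lambda>v. f v j) A {v \<in> U. \<psi> v = j}" using assms(1) j unfolding valid_def by blast
  show "degenerate (\<lambda>v. f v j) A {v \<in> U. (\<psi>(r := i)) v = j}"
  proof (cases "j = i")
    case False
    then have "{v \<in> U. (\<psi>(r := i)) v = j} \<subseteq> {v \<in> U. \<psi> v = j}" by auto
    then show ?thesis using ok degenerate_subset by blast
  next
    case True
    have e: "{v \<in> U. (\<psi>(r := i)) v = j} = insert r {v \<in> U. \<psi> v = j}" using True assms(2) by auto
    have "{y \<in> {v \<in> U. \<psi> v = j}. (r, y) \<in> A} = {y \<in> U. (r, y) \<in> A \<and> \<psi> y = j}"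
      "{y \<in> {v \<in> U. \<psi> v = j}. (y, r) \<in> A} = {y \<in> U. (y, r) \<in> A \<and> \<psi> y = j}" by auto
    then have "card {y \<in> {v \<in> U. \<psi> v = j}. (r, y) \<in> A} < f r j \<or> card {y \<in> {v \<in> U. \<psi> v = j}. (y, r) \<in> A} < f r j"
      using assms(3) True unfolding avail_def out_count_def in_count_def by simp
    then show ?thesis unfolding e by (intro degenerate_insert[OF ok]) (auto simp: irrA)
  qed
qed

lemma out_count_upd: "out_count A U (\<psi>(r := i)) r j = out_count A U \<psi> r j" "in_count A U (\<psi>(r := i)) r j = in_count A U \<psi> r j"
proof -
  have "{y \<in> U. (r, y) \<in> A \<and> (\<psi>(r := i)) y = j} = {y \<in> U. (r, y) \<in> A \<and> \<psi> y = j}"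
    "{y \<in> U. (y, r) \<in> A \<and> (\<psi>(r := i)) y = j} = {y \<in> U. (y, r) \<in> A \<and> \<psi> y = j}"
    using irrA by auto
  then show "out_count A U (\<psi>(r := i)) r j = out_count A U \<psi> r j" "in_count A U (\<psi>(r := i)) r j = in_count A U \<psi> r j"
    unfolding out_count_def in_count_def by simp_all
qed

lemma sum_counts:
  "(\<Sum>i = 1..p. out_count A U \<psi> v i) = card {y \<in> U. (v, y) \<in> A \<and> \<psi> y \<in> {1..p}}"
  "(\<Sum>i = 1..p. in_count A U \<psi> v i) = card {y \<in> U. (y, v) \<in> A \<and> \<psi> y \<in> {1..p}}"
proof -
  have "(\<Sum>i = 1..p. card {y \<in> U. Q y \<and> \<psi> y = i}) = card {y \<in> U. Q y \<and> \<psi> y \<in> {1..p}}" for Q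
  proof -
    have "(\<Sum>i = 1..p. card {y \<in> U. Q y \<and> \<psi> y = i}) = card (\<Union>i \<in> {1..p}. {y \<in> U. Q y \<and> \<psi> y = i})"
      by (rule card_UN_disjoint[symmetric]) auto
    also have "(\<Union>i \<in> {1..p}. {y \<in> U. Q y \<and> \<psi> y = i}) = {y \<in> U. Q y \<and> \<psi> y \<in> {1..p}}" by auto
    finally show ?thesis .
  qed
  then show "(\<Sum>i = 1..p. out_count A U \<psi> v i) = card {y \<in> U. (v, y) \<in> A \<and> \<psi> y \<in> {1..p}}"
    "(\<Sum>i = 1..p. in_count A U \<psi> v i) = card {y \<in> U. (y, v) \<in> A \<and> \<psi> y \<in> {1..p}}"
    unfolding out_count_def in_count_def by simp_all
qed

text \<open>
  If no colour is available, the numbers of coloured out-neighbours and of coloured in-neighbours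
  are at least the sum of \<open>f v i\<close> over all colours, hence at least the degrees. So there is equality
  everywhere, and all neighbours are coloured.
\<close>
lemma no_avail:
  assumes "v < n" "\<And>i. \<not> avail \<psi> v i"
  shows "stuck \<psi> v" "\<And>y. (v, y) \<in> ugraph A \<Longrightarrow> \<psi> y \<in> {1..p}"
proof -
  have le: "f v i \<le> out_count A U \<psi> v i" "f v i \<le> in_count A U \<psi> v i" if "i \<in> {1..p}" for i
    using assms(2)[of i] that unfolding avail_def by auto
  have s: "(\<Sum>i = 1..p. f v i) \<le> (\<Sum>i = 1..p. out_count A U \<psi> v i)" "(\<Sum>i = 1..p. f v i) \<le> (\<Sum>i = 1..p. in_count A U \<psi> v i)"
    using le by (auto intro: sum_mono)
  have c: "card {y \<in> U. (v, y) \<in> A \<and> \<psi> y \<in> {1..p}} \<le> card {y \<in> U. (v, y) \<in> A}"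
    "card {y \<in> U. (y, v) \<in> A \<and> \<psi> y \<in> {1..p}} \<le> card {y \<in> U. (y, v) \<in> A}"
    by (auto intro: card_mono)
  have e: "(\<Sum>i = 1..p. f v i) = (\<Sum>i = 1..p. out_count A U \<psi> v i)" "(\<Sum>i = 1..p. f v i) = (\<Sum>i = 1..p. in_count A U \<psi> v i)"
    and f: "card {y \<in> U. (v, y) \<in> A \<and> \<psi> y \<in> {1..p}} = card {y \<in> U. (v, y) \<in> A}"
    "card {y \<in> U. (y, v) \<in> A \<and> \<psi> y \<in> {1..p}} = card {y \<in> U. (y, v) \<in> A}"
    using s c demand[OF assms(1)] unfolding sum_counts by linarith+
  show "stuck \<psi> v"
    unfolding stuck_def using sum_mono_inv[OF e(1) le(1)] sum_mono_inv[OF e(2) le(2)] by simp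
  have g: "{y \<in> U. (v, y) \<in> A \<and> \<psi> y \<in> {1..p}} = {y \<in> U. (v, y) \<in> A}"
    "{y \<in> U. (y, v) \<in> A \<and> \<psi> y \<in> {1..p}} = {y \<in> U. (y, v) \<in> A}"
    by (rule card_subset_eq[OF _ _ f(1)]; auto) (rule card_subset_eq[OF _ _ f(2)]; auto)
  show "\<psi> y \<in> {1..p}" if "(v, y) \<in> ugraph A" for y
  proof -
    have "y \<in> {y \<in> U. (v, y) \<in> A} \<or> y \<in> {y \<in> U. (y, v) \<in> A}"
      using that ugraph_in[OF that] by (simp add: ugraph_iff)
    then show ?thesis using g by blast
  qed
qed

lemma solved_fill:
  assumes "holed \<psi> r" "avail \<psi> r i"
  shows "solved (\<psi>(r := i))"
  using assms valid_fill[of \<psi> r i] unfolding holed_def solved_def avail_def by auto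

text \<open>
  The colour of \<open>s\<close> was used around \<open>r\<close> exactly as often as \<open>f\<close> permits. Once \<open>s\<close> has lost its
  colour, it is used less often in at least one direction and has become available at \<open>r\<close>.
\<close>
lemma holed_move:
  assumes c: "holed \<psi> r" and st: "stuck \<psi> r" and rs: "(r, s) \<in> ugraph A"
  shows "holed (\<psi> \<circ> transpose r s) s"
proof -
  have s: "s < n" "s \<noteq> r" using ugraph_in[OF rs] ugraph_ne[OF rs] by auto
  have sc: "\<psi> s \<in> {1..p}" and r: "r < n" "\<psi> r = 0" using c s unfolding holed_def by auto
  have eq: "\<psi> \<circ> transpose r s = (\<psi>(s := 0))(r := \<psi> s)"
    using s r by (auto simp: fun_eq_iff transpose_def)
  have "valid (\<psi>(s := 0))" using c unfolding holed_def by (elim conjE, elim valid_sub) (auto split: if_splits)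
  moreover have "avail (\<psi>(s := 0)) r (\<psi> s)"
  proof -
    have fi: "finite {y \<in> U. (r, y) \<in> A \<and> \<psi> y = \<psi> s}" "finite {y \<in> U. (y, r) \<in> A \<and> \<psi> y = \<psi> s}" by auto
    have "out_count A U (\<psi>(s := 0)) r (\<psi> s) < out_count A U \<psi> r (\<psi> s) \<or> in_count A U (\<psi>(s := 0)) r (\<psi> s) < in_count A U \<psi> r (\<psi> s)"
    proof (cases "(r, s) \<in> A")
      case True
      have "{y \<in> U. (r, y) \<in> A \<and> (\<psi>(s := 0)) y = \<psi> s} \<subset> {y \<in> U. (r, y) \<in> A \<and> \<psi> y = \<psi> s}"
        using True s sc by auto
      then show ?thesis unfolding out_count_def using psubset_card_mono[OF fi(1)] by blast
    next
      case False
      then have "(s, r) \<in> A" using rs by (simp add: ugraph_iff)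
      then have "{y \<in> U. (y, r) \<in> A \<and> (\<psi>(s := 0)) y = \<psi> s} \<subset> {y \<in> U. (y, r) \<in> A \<and> \<psi> y = \<psi> s}"
        using s sc by auto
      then show ?thesis unfolding in_count_def using psubset_card_mono[OF fi(2)] by blast
    qed
    then show ?thesis using st sc unfolding stuck_def avail_def by auto
  qed
  ultimately have "valid (\<psi> \<circ> transpose r s)" unfolding eq using valid_fill r by blast
  moreover have "(\<psi> \<circ> transpose r s) v \<in> {1..p}" if "v \<in> U - {s}" for v
    using that c s sc unfolding holed_def by (auto simp: transpose_def)
  ultimately show ?thesis unfolding holed_def using s r by simp
qed

text \<open>
  Here \<open>\<psi>'\<close> results from \<open>\<psi>\<close> by a closed walk of the hole from \<open>r\<close> via \<open>x1\<close> and \<open>x2\<close> to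
  \<open>xm\<close> and back, in the course of which all other neighbours of \<open>r\<close> keep their tokens. Since \<open>r\<close> is
  stuck before and after the walk, the changes at \<open>x1\<close> and \<open>xm\<close> leave the number of out-neighbours
  and of in-neighbours of each colour invariant.
\<close>
lemma probe_calm:
  assumes c: "holed \<psi> r" and st: "stuck \<psi> r" and st': "stuck \<psi>' r"
    and x: "(r, x1) \<in> ugraph A" "(r, xm) \<in> ugraph A" "x1 \<noteq> xm" "x2 < n" "x2 \<noteq> r"
    and new: "\<psi>' x1 = \<psi> x2" "\<psi>' xm = \<psi> x1" "\<And>y. (r, y) \<in> ugraph A \<Longrightarrow> y \<noteq> x1 \<Longrightarrow> y \<noteq> xm \<Longrightarrow> \<psi>' y = \<psi> y"
  shows "\<psi> x2 = \<psi> xm \<and> (arc_type A r x1 \<noteq> arc_type A r xm \<longrightarrow> \<psi> x1 = \<psi> xm)"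
proof -
  have xs: "x1 < n" "xm < n" "x1 \<noteq> r" "xm \<noteq> r" using x ugraph_in ugraph_ne by blast+
  have col: "\<psi> x1 \<in> {1..p}" "\<psi> x2 \<in> {1..p}" "\<psi> xm \<in> {1..p}" using c xs x unfolding holed_def by auto
  have split: "card {y \<in> U. Q y \<and> \<chi> y = i} =
      card {y \<in> U. y \<noteq> x1 \<and> y \<noteq> xm \<and> Q y \<and> \<chi> y = i} + of_bool (Q x1 \<and> \<chi> x1 = i) + of_bool (Q xm \<and> \<chi> xm = i)"
    for Q and \<chi> :: "nat \<Rightarrow> nat" and i
  proof -
    have "{y \<in> U. Q y \<and> \<chi> y = i} = {y \<in> U. y \<noteq> x1 \<and> y \<noteq> xm \<and> Q y \<and> \<chi> y = i} \<union>
      (if Q x1 \<and> \<chi> x1 = i then {x1} else {}) \<union> (if Q xm \<and> \<chi> xm = i then {xm} else {})"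
      using xs by auto
    also have "card \<dots> = card {y \<in> U. y \<noteq> x1 \<and> y \<noteq> xm \<and> Q y \<and> \<chi> y = i} +
      card (if Q x1 \<and> \<chi> x1 = i then {x1} else {}) + card (if Q xm \<and> \<chi> xm = i then {xm} else {})"
      using x(3) by (subst card_Un_disjoint; (subst card_Un_disjoint)?) auto
    finally show ?thesis by simp
  qed
  have o: "of_bool ((r, x1) \<in> A \<and> \<psi> x1 = i) + of_bool ((r, xm) \<in> A \<and> \<psi> xm = i) =
      (of_bool ((r, x1) \<in> A \<and> \<psi> x2 = i) + of_bool ((r, xm) \<in> A \<and> \<psi> x1 = i) :: nat)" if i: "i \<in> {1..p}" for i
  proof -
    have "{y \<in> U. y \<noteq> x1 \<and> y \<noteq> xm \<and> (r, y) \<in> A \<and> \<psi>' y = i} = {y \<in> U. y \<noteq> x1 \<and> y \<noteq> xm \<and> (r, y) \<in> A \<and> \<psi> y = i}"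
      using new(3) by (auto simp: ugraph_iff)
    moreover have "out_count A U \<psi> r i = out_count A U \<psi>' r i" using st st' i unfolding stuck_def by simp
    ultimately show ?thesis
      using split[of "\<lambda>y. (r, y) \<in> A" \<psi> i] split[of "\<lambda>y. (r, y) \<in> A" \<psi>' i] new(1,2) unfolding out_count_def by simp
  qed
  have n: "of_bool ((x1, r) \<in> A \<and> \<psi> x1 = i) + of_bool ((xm, r) \<in> A \<and> \<psi> xm = i) =
      (of_bool ((x1, r) \<in> A \<and> \<psi> x2 = i) + of_bool ((xm, r) \<in> A \<and> \<psi> x1 = i) :: nat)" if i: "i \<in> {1..p}" for i
  proof -
    have "{y \<in> U. y \<noteq> x1 \<and> y \<noteq> xm \<and> (y, r) \<in> A \<and> \<psi>' y = i} = {y \<in> U. y \<noteq> x1 \<and> y \<noteq> xm \<and> (y, r) \<in> A \<and> \<psi> y = i}"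
      using new(3) by (auto simp: ugraph_iff)
    moreover have "in_count A U \<psi> r i = in_count A U \<psi>' r i" using st st' i unfolding stuck_def by simp
    ultimately show ?thesis
      using split[of "\<lambda>y. (y, r) \<in> A" \<psi> i] split[of "\<lambda>y. (y, r) \<in> A" \<psi>' i] new(1,2) unfolding in_count_def by simp
  qed
  have O: "(r, x1) \<in> A \<and> (r, xm) \<in> A \<longrightarrow> \<psi> x2 = \<psi> xm" "(r, x1) \<in> A \<and> (r, xm) \<notin> A \<longrightarrow> \<psi> x1 = \<psi> x2"
    "(r, x1) \<notin> A \<and> (r, xm) \<in> A \<longrightarrow> \<psi> x1 = \<psi> xm"
    using two_slots[OF o[OF col(1)] o[OF col(2)] o[OF col(3)]] by blast+
  have I: "(x1, r) \<in> A \<and> (xm, r) \<in> A \<longrightarrow> \<psi> x2 = \<psi> xm" "(x1, r) \<in> A \<and> (xm, r) \<notin> A \<longrightarrow> \<psi> x1 = \<psi> x2"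
    "(x1, r) \<notin> A \<and> (xm, r) \<in> A \<longrightarrow> \<psi> x1 = \<psi> xm"
    using two_slots[OF n[OF col(1)] n[OF col(2)] n[OF col(3)]] by blast+
  show ?thesis
    using O I x(1,2) unfolding ugraph_iff arc_type_def prod.inject by metis
qed

lemma reach_exists:
  assumes "linked (ugraph A) U t s"
  shows "\<exists>\<psi>. reach (ugraph A) U \<psi>0 t \<psi> s"
  using assms
proof (induction rule: rtrancl_induct)
  case base show ?case by (intro exI) (rule reach_refl)
next
  case (step s s')
  then obtain \<psi> where "reach (ugraph A) U \<psi>0 t \<psi> s" by blast
  from reach_step[OF this, of s'] show ?case using step.hyps by blast
qed

text \<open>
  There may be exponentially many reachable configurations, but only the triples \<open>(r, x, y)\<close> matter
  such that two tokens \<open>x\<close> and \<open>y\<close> differ in colour for some configuration with hole \<open>r\<close>. The set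
  \<open>F\<close> of explored triples contains all of them, as it contains those of the first configuration and
  is closed under slides. If some reachable configuration violated \<open>calm\<close>, it would do so by the
  difference of two colours; the configuration stored for the corresponding triple has the same
  defect.
\<close>
theorem explored_hard:
  assumes c0: "holed \<phi> 0" and st0: "stuck \<phi> 0"
    and seeds: "\<And>u v. u < n \<Longrightarrow> v < n \<Longrightarrow> \<phi> u \<noteq> \<phi> v \<Longrightarrow> (0, u, v) \<in> F"
    and step: "\<And>r x y s. (r, x, y) \<in> F \<Longrightarrow> (r, s) \<in> ugraph A \<Longrightarrow> (s, transpose r s x, transpose r s y) \<in> F"
    and stored: "\<And>r x y. (r, x, y) \<in> F \<Longrightarrow> \<exists>\<psi>. reach (ugraph A) U \<phi> 0 \<psi> r \<and> \<psi> x \<noteq> \<psi> y \<and> stuck \<psi> r \<and> calm A U \<psi> r"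
  shows "hard_pair p (induced A U) f"
proof -
  have 0: "0 < n" using n1 by simp
  have hole: "\<phi> 0 = 0" and col: "\<And>v. v \<in> U - {0} \<Longrightarrow> \<phi> v \<in> {1..p}" using c0 unfolding holed_def by auto
  have F: "(r, x, y) \<in> F" if "reach (ugraph A) U \<phi> 0 \<psi> r" "x < n" "y < n" "\<psi> x \<noteq> \<psi> y" for \<psi> r x y
    using that
  proof (induction arbitrary: x y rule: reach.induct)
    case reach_refl then show ?case using seeds by blast
  next
    case (reach_step \<psi> t s)
    have "t < n" "s < n" using ugraph_in reach_step.hyps by blast+
    then have "transpose t s x < n" "transpose t s y < n" using reach_step.prems by (auto simp: transpose_def)
    then have "(t, transpose t s x, transpose t s y) \<in> F"
      using reach_step.IH reach_step.prems by simp
    from step[OF this reach_step.hyps(2)] show ?case by simp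
  qed
  have cnt: "\<exists>\<psi>. reach (ugraph A) U \<phi> 0 \<psi> v \<and> stuck \<psi> v" if v: "v < n" for v
  proof (cases "n = 1")
    case True then show ?thesis using v st0 reach_refl by fastforce
  next
    case False
    define y where "y = (if v = 0 then 1 else 0 :: nat)"
    have y: "y < n" "y \<noteq> v" using False 0 by (auto simp: y_def)
    have "linked (ugraph A) U 0 v" using conA 0 v unfolding conn_def by blast
    then obtain \<psi> where R: "reach (ugraph A) U \<phi> 0 \<psi> v" using reach_exists by blast
    have v0: "\<psi> v = 0" using reach_hole[OF R hole] .
    have "\<psi> y \<in> \<phi> ` (U - {0})" using reach_image[OF R] 0 y by auto
    then obtain u where "u \<in> U - {0}" "\<psi> y = \<phi> u" by blast
    then have "\<psi> y \<noteq> 0" using col[of u] by simp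
    then have "(v, v, y) \<in> F" using F[OF R v y(1)] v0 by simp
    then show ?thesis using stored by blast
  qed
  have bal: "card {y \<in> U. (v, y) \<in> A} = card {y \<in> U. (y, v) \<in> A}" if v: "v < n" for v
  proof -
    obtain \<psi> where R: "reach (ugraph A) U \<phi> 0 \<psi> v" and st: "stuck \<psi> v" using cnt[OF v] by blast
    have "\<psi> y \<in> {1..p}" if "y \<in> U - {v}" for y
    proof -
      have "\<psi> y \<in> \<phi> ` (U - {0})" using reach_image[OF R] 0 that by auto
      then obtain u where "u \<in> U - {0}" "\<psi> y = \<phi> u" by blast
      then show ?thesis using col[of u] by simp
    qed
    then have "{y \<in> U. (v, y) \<in> A \<and> \<psi> y \<in> {1..p}} = {y \<in> U. (v, y) \<in> A}"
      "{y \<in> U. (y, v) \<in> A \<and> \<psi> y \<in> {1..p}} = {y \<in> U. (y, v) \<in> A}" using irrA by auto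
    moreover have "(\<Sum>i = 1..p. out_count A U \<psi> v i) = (\<Sum>i = 1..p. in_count A U \<psi> v i)"
      using st unfolding stuck_def by (intro sum.cong) auto
    ultimately show ?thesis unfolding sum_counts by simp
  qed
  have "frozen A p U \<phi> 0 f f"
  proof
    show "finite U" by simp
    show "conn (ugraph A) U" by (rule conA)
    show "(x, x) \<notin> A" for x by (rule irrA)
    show "0 \<in> U" using 0 by simp
    show "\<phi> 0 = 0" by (rule hole)
    show "\<phi> x \<in> {1..p}" if "x \<in> U - {0}" for x using col that .
    show "1 \<le> p" by (rule p1)
    show "card {y \<in> U. (v, y) \<in> A} = card {y \<in> U. (y, v) \<in> A}" if "v \<in> U" for v using bal that by simp
    show "\<exists>\<psi>. reach (ugraph A) U \<phi> 0 \<psi> v \<and> (\<forall>i \<in> {1..p}. out_count A U \<psi> v i = f v i \<and> in_count A U \<psi> v i = f v i)"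
      if "v \<in> U" for v
      using cnt[of v] that unfolding stuck_def by simp
    show "calm A U \<psi> r" if R: "reach (ugraph A) U \<phi> 0 \<psi> r" for \<psi> r
      unfolding calm_def
    proof (intro ballI impI)
      fix x1 x2 xm assume x: "x1 \<in> U" "x2 \<in> U" "xm \<in> U" "(r, x1) \<in> ugraph A" "(r, xm) \<in> ugraph A" "(x1, x2) \<in> ugraph A"
        "x1 \<noteq> xm" and l: "linked (ugraph A) (insert xm {y \<in> U. y \<noteq> r \<and> (r, y) \<notin> ugraph A}) x2 xm"
      have *: "\<psi>' x2 = \<psi>' xm \<and> (arc_type A r x1 \<noteq> arc_type A r xm \<longrightarrow> \<psi>' x1 = \<psi>' xm)" if "calm A U \<psi>' r" for \<psi>'
        using that x l unfolding calm_def by meson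
      have 1: "\<psi> x2 = \<psi> xm"
      proof (rule ccontr)
        assume "\<psi> x2 \<noteq> \<psi> xm"
        then have "(r, x2, xm) \<in> F" using F[OF R] x by simp
        then show False using stored * by blast
      qed
      have 2: "\<psi> x1 = \<psi> xm" if "arc_type A r x1 \<noteq> arc_type A r xm"
      proof (rule ccontr)
        assume "\<psi> x1 \<noteq> \<psi> xm"
        then have "(r, x1, xm) \<in> F" using F[OF R] x by simp
        then show False using stored * that by blast
      qed
      show "\<psi> x2 = \<psi> xm \<and> (arc_type A r x1 \<noteq> arc_type A r xm \<longrightarrow> \<psi> x1 = \<psi> xm)" using 1 2 by blast
    qed
  qed
  then show ?thesis using frozen_hard by blast
qed

end

section \<open>Reasoning about programs\<close>

text \<open>
  A bound for the running time if no loop is iterated more than \<open>L\<close> times. As it does not depend on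
  the state, it is a polynomial in \<open>L\<close> for every program.
\<close>
primrec cost :: "nat \<Rightarrow> com \<Rightarrow> nat" where
  "cost L Skip = 1"
| "cost L (Assign x a b) = 1"
| "cost L (Seq c1 c2) = cost L c1 + cost L c2"
| "cost L (Cond b c1 c2) = 1 + cost L c1 + cost L c2"
| "cost L (While b c) = 1 + L * (1 + cost L c)"

lemma cost_poly: "\<exists>q :: nat poly. \<forall>L. cost L c = poly q L"
proof (induction c)
  case (Seq c1 c2)
  then obtain q1 q2 where "\<forall>L. cost L c1 = poly q1 L" "\<forall>L. cost L c2 = poly q2 L" by blast
  then show ?case by (intro exI[of _ "q1 + q2"]) simp
next
  case (Cond b c1 c2)
  then obtain q1 q2 where "\<forall>L. cost L c1 = poly q1 L" "\<forall>L. cost L c2 = poly q2 L" by blast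
  then show ?case by (intro exI[of _ "1 + q1 + q2"]) simp
next
  case (While b c)
  then obtain q where "\<forall>L. cost L c = poly q L" by blast
  then show ?case by (intro exI[of _ "1 + [:0, 1:] * (1 + q)"]) simp
qed (auto intro: exI[of _ "1"])

primrec mods :: "com \<Rightarrow> string set" where
  "mods Skip = {}"
| "mods (Assign x a b) = {x}"
| "mods (Seq c1 c2) = mods c1 \<union> mods c2"
| "mods (Cond b c1 c2) = mods c1 \<union> mods c2"
| "mods (While b c) = mods c"

definition same :: "string set \<Rightarrow> state \<Rightarrow> state \<Rightarrow> bool" where
  "same X s s' \<longleftrightarrow> (\<forall>x. x \<notin> X \<longrightarrow> s' x = s x)"

lemma same_refl: "same X s s" by (simp add: same_def)

lemma same_trans: "same X s s' \<Longrightarrow> same X s' s'' \<Longrightarrow> same X s s''" by (simp add: same_def)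

lemma same_mono: "same X s s' \<Longrightarrow> X \<subseteq> Y \<Longrightarrow> same Y s s'" by (auto simp: same_def)

lemma exec_same: "exec c s t s' \<Longrightarrow> same (mods c) s s'"
  by (induction rule: exec.induct) (auto simp: same_def)

text \<open>
  Total correctness including the time bound; every rule also supplies the frame \<open>same (mods c)\<close>.
\<close>
definition wp :: "nat \<Rightarrow> com \<Rightarrow> (state \<Rightarrow> bool) \<Rightarrow> state \<Rightarrow> bool" where
  "wp L c Q s \<longleftrightarrow> (\<exists>t s'. exec c s t s' \<and> t \<le> cost L c \<and> Q s')"

lemma wp_weaken:
  assumes "wp L c R s" "\<And>s'. R s' \<Longrightarrow> same (mods c) s s' \<Longrightarrow> Q s'"
  shows "wp L c Q s"
  using assms exec_same unfolding wp_def by blast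

lemma wp_Skip: "Q s \<Longrightarrow> wp L Skip Q s"
  unfolding wp_def by (intro exI conjI, rule exec.Skip) auto

lemma wp_Assign: "Q (s(x := (s x)(aval a s := aval b s))) \<Longrightarrow> wp L (Assign x a b) Q s"
  unfolding wp_def by (intro exI conjI, rule exec.Assign) auto

lemma wp_Seq:
  assumes "wp L c1 R s" "\<And>s'. R s' \<Longrightarrow> same (mods c1) s s' \<Longrightarrow> wp L c2 Q s'"
  shows "wp L (Seq c1 c2) Q s"
proof -
  obtain t s' where 1: "exec c1 s t s'" "t \<le> cost L c1" "R s'" using assms(1) unfolding wp_def by blast
  then obtain t' s'' where 2: "exec c2 s' t' s''" "t' \<le> cost L c2" "Q s''"
    using assms(2)[of s'] exec_same unfolding wp_def by blast
  have "exec (Seq c1 c2) s (t + t') s''" using 1 2 by (blast intro: exec.Seq)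
  moreover have "t + t' \<le> cost L (Seq c1 c2)" using 1 2 by simp
  ultimately show ?thesis using 2 unfolding wp_def by blast
qed

lemma wp_SeqA: "wp L c Q (s(x := (s x)(aval a s := aval b s))) \<Longrightarrow> wp L (Seq (Assign x a b) c) Q s"
  by (rule wp_Seq[where R = "\<lambda>s'. s' = s(x := (s x)(aval a s := aval b s))"]) (auto intro: wp_Assign)

lemma wp_Cond:
  assumes "aval b s \<noteq> 0 \<Longrightarrow> wp L c1 Q s" "aval b s = 0 \<Longrightarrow> wp L c2 Q s"
  shows "wp L (Cond b c1 c2) Q s"
proof (cases "aval b s = 0")
  case True
  then obtain t s' where 1: "exec c2 s t s'" "t \<le> cost L c2" "Q s'" using assms unfolding wp_def by blast
  have "exec (Cond b c1 c2) s (1 + t) s'" using 1 True by (blast intro: exec.CondFalse)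
  moreover have "1 + t \<le> cost L (Cond b c1 c2)" using 1 by simp
  ultimately show ?thesis using 1 unfolding wp_def by blast
next
  case False
  then obtain t s' where 1: "exec c1 s t s'" "t \<le> cost L c1" "Q s'" using assms unfolding wp_def by blast
  have "exec (Cond b c1 c2) s (1 + t) s'" using 1 False by (blast intro: exec.CondTrue)
  moreover have "1 + t \<le> cost L (Cond b c1 c2)" using 1 by simp
  ultimately show ?thesis using 1 unfolding wp_def by blast
qed

lemma wp_While:
  fixes \<mu> :: "state \<Rightarrow> nat"
  assumes I: "I s" and \<mu>: "\<mu> s \<le> L"
    and step: "\<And>s. I s \<Longrightarrow> aval b s \<noteq> 0 \<Longrightarrow> wp L c (\<lambda>s'. I s' \<and> \<mu> s' < \<mu> s) s"
    and exit: "\<And>s. I s \<Longrightarrow> aval b s = 0 \<Longrightarrow> Q s"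
  shows "wp L (While b c) Q s"
proof -
  have "\<exists>t s'. exec (While b c) s t s' \<and> t \<le> 1 + \<mu> s * (1 + cost L c) \<and> Q s'" if "I s" for s
    using that
  proof (induction "\<mu> s" arbitrary: s rule: less_induct)
    case less
    show ?case
    proof (cases "aval b s = 0")
      case True
      then have "exec (While b c) s 1 s" by (rule exec.WhileFalse)
      then show ?thesis using exit less.prems True by (intro exI[of _ 1] exI[of _ s]) simp
    next
      case False
      then obtain t1 s1 where 1: "exec c s t1 s1" "t1 \<le> cost L c" "I s1" "\<mu> s1 < \<mu> s"
        using step less.prems unfolding wp_def by blast
      then obtain t2 s2 where 2: "exec (While b c) s1 t2 s2" "t2 \<le> 1 + \<mu> s1 * (1 + cost L c)" "Q s2"
        using less.hyps by blast
      have e: "exec (While b c) s (1 + t1 + t2) s2" using False 1 2 by (blast intro: exec.WhileTrue)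
      have "1 + t1 + t2 \<le> 1 + (1 + \<mu> s1) * (1 + cost L c)" using 1 2 by (simp add: algebra_simps)
      also have "(1 + \<mu> s1) * (1 + cost L c) \<le> \<mu> s * (1 + cost L c)" by (rule mult_right_mono) (use 1 in auto)
      finally have "1 + t1 + t2 \<le> 1 + \<mu> s * (1 + cost L c)" by simp
      then show ?thesis using e 2 by blast
    qed
  qed
  from this[OF I] obtain t s' where 1: "exec (While b c) s t s'" "t \<le> 1 + \<mu> s * (1 + cost L c)" "Q s'" by blast
  have "\<mu> s * (1 + cost L c) \<le> L * (1 + cost L c)" using \<mu> by (rule mult_right_mono) simp
  then have "t \<le> cost L (While b c)" using 1 by simp
  then show ?thesis using 1 unfolding wp_def by blast
qed

abbreviation vr :: "string \<Rightarrow> aexp" where "vr x \<equiv> V x (N 0)"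
abbreviation asg :: "string \<Rightarrow> aexp \<Rightarrow> com" where "asg x e \<equiv> Assign x (N 0) e"

definition For :: "string \<Rightarrow> aexp \<Rightarrow> com \<Rightarrow> com" where
  "For x e c = Seq (asg x (N 0)) (While (Minus e (vr x)) (Seq c (asg x (Plus (vr x) (N 1)))))"

lemma mods_For[simp]: "mods (For x e c) = insert x (mods c)"
  by (auto simp: For_def)

text \<open>
  The invariant takes the counter as its argument and must not look at the variable which holds it.
  The bound \<open>e\<close> is evaluated anew in every iteration, which is why it has to be constant on all
  states that the loop can produce.
\<close>
lemma wp_For:
  assumes m: "m \<le> L" and x: "x \<notin> mods c"
    and init: "I 0 s"
    and indep: "\<And>k s1 g. I k s1 \<Longrightarrow> I k (s1(x := g))"
    and bound: "\<And>s1. same (insert x (mods c)) s s1 \<Longrightarrow> aval e s1 = m"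
    and step: "\<And>k s1. k < m \<Longrightarrow> s1 x 0 = k \<Longrightarrow> I k s1 \<Longrightarrow> same (insert x (mods c)) s s1 \<Longrightarrow>
      wp L c (I (Suc k)) s1"
    and exit: "\<And>s1. I m s1 \<Longrightarrow> same (insert x (mods c)) s s1 \<Longrightarrow> Q s1"
  shows "wp L (For x e c) Q s"
  unfolding For_def
proof (rule wp_SeqA)
  let ?s0 = "s(x := (s x)(aval (N 0) s := aval (N 0) s))"
  let ?I = "\<lambda>s1. s1 x 0 \<le> m \<and> I (s1 x 0) s1 \<and> same (insert x (mods c)) s s1"
  show "wp L (While (Minus e (vr x)) (Seq c (asg x (Plus (vr x) (N 1))))) Q ?s0"
  proof (rule wp_While[where I = ?I and \<mu> = "\<lambda>s1. m - s1 x 0"])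
    show "?I ?s0" using indep[OF init] by (simp add: same_def)
    show "m - ?s0 x 0 \<le> L" using m by simp
    fix s1 assume I: "?I s1"
    then have b: "aval e s1 = m" using bound by blast
    { assume "aval (Minus e (vr x)) s1 \<noteq> 0"
      then have k: "s1 x 0 < m" using b by simp
      show "wp L (Seq c (asg x (Plus (vr x) (N 1)))) (\<lambda>s'. ?I s' \<and> m - s' x 0 < m - s1 x 0) s1"
      proof (rule wp_Seq)
        show "wp L c (I (Suc (s1 x 0))) s1" using step[of "s1 x 0" s1] k I by blast
        fix s2 assume 2: "I (Suc (s1 x 0)) s2" "same (mods c) s1 s2"
        then have "s2 x 0 = s1 x 0" using x by (simp add: same_def)
        moreover have "same (insert x (mods c)) s s2" using I 2 by (auto simp: same_def)
        ultimately show "wp L (asg x (Plus (vr x) (N 1))) (\<lambda>s'. ?I s' \<and> m - s' x 0 < m - s1 x 0) s2"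
          using k indep[OF 2(1)] by (intro wp_Assign) (auto simp: same_def)
      qed }
    { assume "aval (Minus e (vr x)) s1 = 0"
      then have "s1 x 0 = m" using b I by simp
      then show "Q s1" using exit I by blast }
  qed
qed

abbreviation When :: "aexp \<Rightarrow> com \<Rightarrow> com" where "When b c \<equiv> Cond b c Skip"
abbreviation Unless :: "aexp \<Rightarrow> com \<Rightarrow> com" where "Unless b c \<equiv> Cond b Skip c"
abbreviation neq :: "aexp \<Rightarrow> aexp \<Rightarrow> aexp" where "neq a b \<equiv> Plus (Minus a b) (Minus b a)"

lemma neq_val: "aval (neq a b) s = 0 \<longleftrightarrow> aval a s = aval b s" by auto

lemma wp_When: "(aval b s \<noteq> 0 \<Longrightarrow> wp L c Q s) \<Longrightarrow> (aval b s = 0 \<Longrightarrow> Q s) \<Longrightarrow> wp L (When b c) Q s"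
  by (rule wp_Cond) (auto intro: wp_Skip)

lemma wp_Unless: "(aval b s = 0 \<Longrightarrow> wp L c Q s) \<Longrightarrow> (aval b s \<noteq> 0 \<Longrightarrow> Q s) \<Longrightarrow> wp L (Unless b c) Q s"
  by (rule wp_Cond) (auto intro: wp_Skip)

section \<open>The program\<close>

text \<open>
  The program uses the following variables. The array \<open>col\<close> is the current colouring, with hole \<open>r\<close>;
  a non-zero value of \<open>col\<close> at \<open>r\<close> signals that the colouring is complete, and then \<open>col\<close> and \<open>r\<close>
  are left alone for the rest of the search. The tables \<open>mn\<close> and \<open>mp\<close> hold the multiples of \<open>n\<close> and
  \<open>p\<close> and replace multiplication in the access to matrices. The arrays \<open>mark\<close>, \<open>ord\<close>, \<open>par\<close> and \<open>al\<close>
  belong to the breadth-first search. The \<open>h\<close>-th entry of the queue is the triple in \<open>qr\<close>, \<open>qx\<close>,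
  \<open>qy\<close> together with row \<open>h\<close> of \<open>conf\<close>, and \<open>T\<close> is the length of the queue. During the processing of
  an entry, \<open>z\<close> is its hole, and \<open>z\<close>, \<open>b\<close>, \<open>d\<close>, ..., \<open>a\<close>, \<open>z\<close> is the closed walk to be probed.
\<close>
definition arcE where "arcE a b = V ''arc'' (Plus (V ''mn'' a) b)"
definition adjE where "adjE a b = Plus (arcE a b) (arcE b a)"

text \<open>
  The counters \<open>o\<close> and \<open>e\<close> are the numbers of out-neighbours and in-neighbours of colour \<open>i + 1\<close>.
  They do not depend on the colour of \<open>r\<close>, so it is harmless that the loop continues after \<open>r\<close> has
  been coloured: another available colour just replaces the first one.
\<close>
definition Try :: com where
  "Try = For ''i'' (vr ''p'') (
     Seq (asg ''o'' (N 0)) (Seq (asg ''e'' (N 0)) (Seq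
       (For ''w'' (vr ''n'') (Unless (neq (V ''col'' (vr ''w'')) (Plus (vr ''i'') (N 1)))
          (Seq (asg ''o'' (Plus (vr ''o'') (arcE (vr ''r'') (vr ''w''))))
               (asg ''e'' (Plus (vr ''e'') (arcE (vr ''w'') (vr ''r'')))))))
       (When (Plus (Minus (V ''f'' (Plus (V ''mp'' (vr ''r'')) (vr ''i''))) (vr ''o''))
                   (Minus (V ''f'' (Plus (V ''mp'' (vr ''r'')) (vr ''i''))) (vr ''e'')))
          (Assign ''col'' (vr ''r'') (Plus (vr ''i'') (N 1)))))))"

definition Step :: com where
  "Step = Unless (V ''col'' (vr ''r'')) (Seq Try (Unless (V ''col'' (vr ''r'')) (
     Seq (Assign ''col'' (vr ''r'') (V ''col'' (vr ''s''))) (Seq (Assign ''col'' (vr ''s'') (N 0))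
     (asg ''r'' (vr ''s''))))))"

lemma mods_Try: "mods Try = {''i'', ''w'', ''o'', ''e'', ''col''}"
  by (auto simp: Try_def)

lemma mods_Step: "mods Step = {''i'', ''w'', ''o'', ''e'', ''col'', ''r''}"
  by (auto simp: Step_def mods_Try)

locale prog = inst +
  fixes L :: nat
  assumes L: "n * n * n + n + p \<le> L"
begin

text \<open>
  The part of the state that never changes once the tables have been filled. Rows of \<open>conf\<close> are
  indexed by the queue, whence the range of \<open>mn\<close>.
\<close>
definition tables_ok :: "state \<Rightarrow> bool" where
  "tables_ok s \<longleftrightarrow> s ''n'' 0 = n \<and> s ''p'' 0 = p \<and>
     (\<forall>u < n. \<forall>v < n. s ''arc'' (u * n + v) = of_bool ((u, v) \<in> A)) \<and>
     (\<forall>v < n. \<forall>i < p. s ''f'' (v * p + i) = f v (Suc i)) \<and>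
     (\<forall>k \<le> n * n * n. s ''mn'' k = k * n) \<and> (\<forall>k \<le> n. s ''mp'' k = k * p)"

lemma tables_ok_same:
  assumes "tables_ok s" "same X s s'" "X \<inter> {''n'', ''p'', ''arc'', ''f'', ''mn'', ''mp''} = {}"
  shows "tables_ok s'"
proof -
  have "s' x = s x" if "x \<in> {''n'', ''p'', ''arc'', ''f'', ''mn'', ''mp''}" for x
    using assms(2,3) that unfolding same_def by blast
  then show ?thesis using assms(1) unfolding tables_ok_def by simp
qed

lemma tables_ok_upd:
  assumes "x \<notin> {''n'', ''p'', ''arc'', ''f'', ''mn'', ''mp''}"
  shows "tables_ok (s(x := g)) = tables_ok s"
proof -
  have 1: "{x} \<inter> {''n'', ''p'', ''arc'', ''f'', ''mn'', ''mp''} = {}" using assms by blast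
  have "same {x} s (s(x := g))" "same {x} (s(x := g)) s" by (simp_all add: same_def)
  then show ?thesis using tables_ok_same[OF _ _ 1] by blast
qed

lemma L_bounds: "n \<le> L" "p \<le> L" "n * n * n \<le> L" using L by auto

lemma n_cube: "n \<le> n * n * n" 
proof -
  have "n * 1 * 1 \<le> n * n * n" by (intro mult_le_mono) (use n1 in auto)
  then show ?thesis by simp
qed

lemma tables_okD:
  assumes "tables_ok s"
  shows "s ''n'' 0 = n" "s ''p'' 0 = p"
    and "u < n \<Longrightarrow> v < n \<Longrightarrow> s ''arc'' (u * n + v) = of_bool ((u, v) \<in> A)"
    and "v < n \<Longrightarrow> i < p \<Longrightarrow> s ''f'' (v * p + i) = f v (Suc i)"
    and "k \<le> n * n * n \<Longrightarrow> s ''mn'' k = k * n" "k \<le> n \<Longrightarrow> s ''mp'' k = k * p"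
  using assms unfolding tables_ok_def by blast+

lemma mn_val: "tables_ok s \<Longrightarrow> u \<le> n \<Longrightarrow> s ''mn'' u = u * n"
  using n_cube tables_okD(5) by (meson le_trans)

lemma arc_val:
  assumes "tables_ok s" "aval a s < n" "aval b s < n"
  shows "aval (arcE a b) s = of_bool ((aval a s, aval b s) \<in> A)"
  using assms mn_val[of s "aval a s"] tables_okD(3)[OF assms] unfolding arcE_def by simp

lemma adj_val:
  assumes "tables_ok s" "aval a s < n" "aval b s < n"
  shows "aval (adjE a b) s = 0 \<longleftrightarrow> (aval a s, aval b s) \<notin> ugraph A"
  using arc_val[of s a b] arc_val[of s b a] assms unfolding adjE_def by (auto simp: ugraph_iff)

lemma f_val:
  assumes "tables_ok s" "v < n" "i < p"
  shows "s ''f'' (s ''mp'' v + i) = f v (Suc i)"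
  using tables_okD(4)[OF assms] tables_okD(6)[OF assms(1), of v] assms(2) by simp

lemma card_Suc: "card {y \<in> {..<Suc k}. P y} = card {y \<in> {..<k}. P y} + of_bool (P k)"
proof -
  have "{y \<in> {..<Suc k}. P y} = (if P k then insert k {y \<in> {..<k}. P y} else {y \<in> {..<k}. P y})"
    by (auto simp: less_Suc_eq)
  then show ?thesis by simp
qed

lemma Try_wp:
  assumes env: "tables_ok s" and r: "s ''r'' 0 < n"
  defines "\<phi> \<equiv> s ''col''" and "\<rho> \<equiv> s ''r'' 0"
  shows "wp L Try (\<lambda>s'. (s' ''col'' = \<phi> \<and> (\<forall>i. \<not> avail \<phi> \<rho> i)) \<or>
    (\<exists>i. avail \<phi> \<rho> i \<and> s' ''col'' = \<phi>(\<rho> := i))) s"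
  unfolding Try_def
proof (rule wp_For[where m = p and I = "\<lambda>k s1. (s1 ''col'' = \<phi> \<and> (\<forall>i \<le> k. \<not> avail \<phi> \<rho> i)) \<or>
    (\<exists>i. avail \<phi> \<rho> i \<and> s1 ''col'' = \<phi>(\<rho> := i))"], goal_cases)
  case 1 show ?case by (rule L_bounds)
next
  case 2 show ?case by simp
next
  case 3 show ?case by (simp add: \<phi>_def avail_def)
next
  case (4 k s1 g) then show ?case by simp
next
  case (5 s1) then show ?case using tables_okD(2)[OF env] by (simp add: same_def)
next
  case (6 k s1)
  have env1: "tables_ok s1" using env 6(4) by (rule tables_ok_same) simp
  have r1: "s1 ''r'' 0 = \<rho>" using 6(4) by (simp add: same_def \<rho>_def)
  have \<rho>n: "\<rho> < n" using r \<rho>_def by simp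
  let ?c = "s1 ''col''"
  have cc: "out_count A U ?c \<rho> j = out_count A U \<phi> \<rho> j" "in_count A U ?c \<rho> j = in_count A U \<phi> \<rho> j" for j
    using 6(3) out_count_upd by auto
  show ?case
  proof (intro wp_SeqA)
    let ?s2 = "s1(''o'' := (s1 ''o'')(aval (N 0) s1 := aval (N 0) s1))"
    let ?s3 = "?s2(''e'' := (?s2 ''e'')(aval (N 0) ?s2 := aval (N 0) ?s2))"
    show "wp L (Seq (For ''w'' (vr ''n'') (Unless (neq (V ''col'' (vr ''w'')) (Plus (vr ''i'') (N 1)))
          (Seq (asg ''o'' (Plus (vr ''o'') (arcE (vr ''r'') (vr ''w''))))
               (asg ''e'' (Plus (vr ''e'') (arcE (vr ''w'') (vr ''r'')))))))
       (When (Plus (Minus (V ''f'' (Plus (V ''mp'' (vr ''r'')) (vr ''i''))) (vr ''o''))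
                   (Minus (V ''f'' (Plus (V ''mp'' (vr ''r'')) (vr ''i''))) (vr ''e'')))
          (Assign ''col'' (vr ''r'') (Plus (vr ''i'') (N 1)))))
      (\<lambda>s1. (s1 ''col'' = \<phi> \<and> (\<forall>i \<le> Suc k. \<not> avail \<phi> \<rho> i)) \<or>
        (\<exists>i. avail \<phi> \<rho> i \<and> s1 ''col'' = \<phi>(\<rho> := i))) ?s3"
    proof (rule wp_Seq[where R = "\<lambda>s4. s4 ''o'' 0 = out_count A U ?c \<rho> (Suc k) \<and> s4 ''e'' 0 = in_count A U ?c \<rho> (Suc k)"])
      show "wp L (For ''w'' (vr ''n'') (Unless (neq (V ''col'' (vr ''w'')) (Plus (vr ''i'') (N 1)))
          (Seq (asg ''o'' (Plus (vr ''o'') (arcE (vr ''r'') (vr ''w''))))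
               (asg ''e'' (Plus (vr ''e'') (arcE (vr ''w'') (vr ''r'')))))))
        (\<lambda>s4. s4 ''o'' 0 = out_count A U ?c \<rho> (Suc k) \<and> s4 ''e'' 0 = in_count A U ?c \<rho> (Suc k)) ?s3"
      proof (rule wp_For[where m = n and I = "\<lambda>q s4.
          s4 ''o'' 0 = card {y \<in> {..<q}. (\<rho>, y) \<in> A \<and> ?c y = Suc k} \<and>
          s4 ''e'' 0 = card {y \<in> {..<q}. (y, \<rho>) \<in> A \<and> ?c y = Suc k}"], goal_cases)
        case 1 show ?case by (rule L_bounds)
      next
        case 2 show ?case by simp
      next
        case 3 show ?case by simp
      next
        case (4 k s1 g) then show ?case by simp
      next
        case (5 s4) then show ?case using tables_okD(1)[OF env1] by (simp add: same_def)
      next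
        case (6 q s4)
        have env4: "tables_ok s4" by (rule tables_ok_same[OF _ 6(4)]) (simp_all add: env1 tables_ok_upd)
        have v4: "s4 ''r'' 0 = \<rho>" "s4 ''col'' = ?c" "s4 ''i'' 0 = k"
          using 6(4) r1 \<open>s1 ''i'' 0 = k\<close> by (simp_all add: same_def)
        show ?case
        proof (rule wp_Unless)
          assume "aval (neq (V ''col'' (vr ''w'')) (Plus (vr ''i'') (N 1))) s4 = 0"
          then have cq: "?c q = Suc k" unfolding neq_val using v4 6(2) by simp
          have a: "aval (arcE (vr ''r'') (vr ''w'')) s4 = of_bool ((\<rho>, q) \<in> A)"
            using arc_val[OF env4, of "vr ''r''" "vr ''w''"] v4 6(1,2) \<rho>n by simp
          let ?s5 = "s4(''o'' := (s4 ''o'')(aval (N 0) s4 := aval (Plus (vr ''o'') (arcE (vr ''r'') (vr ''w''))) s4))"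
          have env5: "tables_ok ?s5" by (simp add: env4 tables_ok_upd)
          have b: "aval (arcE (vr ''w'') (vr ''r'')) ?s5 = of_bool ((q, \<rho>) \<in> A)"
            using arc_val[OF env5, of "vr ''w''" "vr ''r''"] v4 6(1,2) \<rho>n by simp
          show "wp L (Seq (asg ''o'' (Plus (vr ''o'') (arcE (vr ''r'') (vr ''w''))))
               (asg ''e'' (Plus (vr ''e'') (arcE (vr ''w'') (vr ''r'')))))
            (\<lambda>s4. s4 ''o'' 0 = card {y \<in> {..<Suc q}. (\<rho>, y) \<in> A \<and> ?c y = Suc k} \<and>
              s4 ''e'' 0 = card {y \<in> {..<Suc q}. (y, \<rho>) \<in> A \<and> ?c y = Suc k}) s4"
            unfolding card_Suc using a b 6(3) cq by (intro wp_SeqA wp_Assign) simp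
        next
          assume "aval (neq (V ''col'' (vr ''w'')) (Plus (vr ''i'') (N 1))) s4 \<noteq> 0"
          then have "aval (V ''col'' (vr ''w'')) s4 \<noteq> aval (Plus (vr ''i'') (N 1)) s4" unfolding neq_val .
          then have cq: "?c q \<noteq> Suc k" using v4 6(2) by simp
          then show "s4 ''o'' 0 = card {y \<in> {..<Suc q}. (\<rho>, y) \<in> A \<and> ?c y = Suc k} \<and>
              s4 ''e'' 0 = card {y \<in> {..<Suc q}. (y, \<rho>) \<in> A \<and> ?c y = Suc k}"
            unfolding card_Suc using 6(3) by simp
        qed
      next
        case (7 s4) then show ?case by (simp add: out_count_def in_count_def)
      qed
      fix s4 assume 4: "s4 ''o'' 0 = out_count A U ?c \<rho> (Suc k) \<and> s4 ''e'' 0 = in_count A U ?c \<rho> (Suc k)"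
        and sm: "same (mods (For ''w'' (vr ''n'') (Unless (neq (V ''col'' (vr ''w'')) (Plus (vr ''i'') (N 1)))
          (Seq (asg ''o'' (Plus (vr ''o'') (arcE (vr ''r'') (vr ''w''))))
               (asg ''e'' (Plus (vr ''e'') (arcE (vr ''w'') (vr ''r''))))))))
          ?s3 s4"
      have env4: "tables_ok s4" by (rule tables_ok_same[OF _ sm]) (simp_all add: env1 tables_ok_upd)
      have v4: "s4 ''r'' 0 = \<rho>" "s4 ''col'' = ?c" "s4 ''i'' 0 = k"
        using sm r1 6(2) by (simp_all add: same_def)
      have fv: "s4 ''f'' (s4 ''mp'' \<rho> + k) = f \<rho> (Suc k)" using f_val[OF env4 \<rho>n 6(1)] .
      have av: "avail \<phi> \<rho> (Suc k) \<longleftrightarrow> out_count A U ?c \<rho> (Suc k) < f \<rho> (Suc k) \<or> in_count A U ?c \<rho> (Suc k) < f \<rho> (Suc k)"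
        unfolding avail_def cc using 6(1) by auto
      show "wp L (When (Plus (Minus (V ''f'' (Plus (V ''mp'' (vr ''r'')) (vr ''i''))) (vr ''o''))
                   (Minus (V ''f'' (Plus (V ''mp'' (vr ''r'')) (vr ''i''))) (vr ''e'')))
          (Assign ''col'' (vr ''r'') (Plus (vr ''i'') (N 1))))
        (\<lambda>s1. (s1 ''col'' = \<phi> \<and> (\<forall>i \<le> Suc k. \<not> avail \<phi> \<rho> i)) \<or>
          (\<exists>i. avail \<phi> \<rho> i \<and> s1 ''col'' = \<phi>(\<rho> := i))) s4"
      proof (rule wp_When)
        assume "aval (Plus (Minus (V ''f'' (Plus (V ''mp'' (vr ''r'')) (vr ''i''))) (vr ''o''))
                   (Minus (V ''f'' (Plus (V ''mp'' (vr ''r'')) (vr ''i''))) (vr ''e''))) s4 \<noteq> 0"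
        then have "avail \<phi> \<rho> (Suc k)" unfolding av using 4 v4 fv by auto
        moreover have "?c(\<rho> := Suc k) = \<phi>(\<rho> := Suc k)" using 6(3) by auto
        ultimately show "wp L (Assign ''col'' (vr ''r'') (Plus (vr ''i'') (N 1)))
          (\<lambda>s1. (s1 ''col'' = \<phi> \<and> (\<forall>i \<le> Suc k. \<not> avail \<phi> \<rho> i)) \<or>
            (\<exists>i. avail \<phi> \<rho> i \<and> s1 ''col'' = \<phi>(\<rho> := i))) s4"
          using v4 by (intro wp_Assign) auto
      next
        assume "aval (Plus (Minus (V ''f'' (Plus (V ''mp'' (vr ''r'')) (vr ''i''))) (vr ''o''))
                   (Minus (V ''f'' (Plus (V ''mp'' (vr ''r'')) (vr ''i''))) (vr ''e''))) s4 = 0"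
        then have "\<not> avail \<phi> \<rho> (Suc k)" unfolding av using 4 v4 fv by auto
        then show "(s4 ''col'' = \<phi> \<and> (\<forall>i \<le> Suc k. \<not> avail \<phi> \<rho> i)) \<or>
            (\<exists>i. avail \<phi> \<rho> i \<and> s4 ''col'' = \<phi>(\<rho> := i))"
          using 6(3) v4 by (auto simp: le_Suc_eq)
      qed
    qed
  qed
next
  case (7 s1)
  have "avail \<phi> \<rho> i \<Longrightarrow> i \<le> p" for i unfolding avail_def by simp
  then show ?case using 7(1) by blast
qed

end

context prog
begin

text \<open>
  The invariant of the search for \<open>col\<close> and \<open>r\<close>. Colours outside of the vertex set are fixed to be
  zero so that colourings can be compared as functions.
\<close>
definition sound :: "(nat \<Rightarrow> nat) \<Rightarrow> nat \<Rightarrow> bool" where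
  "sound \<psi> r \<longleftrightarrow> r < n \<and> (\<forall>v \<ge> n. \<psi> v = 0) \<and> (solved \<psi> \<or> holed \<psi> r)"

lemma solved_nonzero: assumes "solved \<psi>" "r < n" shows "\<psi> r \<noteq> 0"
proof -
  have "\<psi> r \<in> {1..p}" using assms unfolding solved_def by blast
  then show ?thesis by simp
qed

lemma holed_zero: "holed \<psi> r \<Longrightarrow> \<psi> r = 0" by (simp add: holed_def)

lemma sound_solved: "sound \<psi> r \<Longrightarrow> \<psi> r \<noteq> 0 \<longleftrightarrow> solved \<psi>"
  unfolding sound_def using solved_nonzero holed_zero by metis

lemma sound_holed: "sound \<psi> r \<Longrightarrow> \<psi> r = 0 \<longleftrightarrow> holed \<psi> r"
  unfolding sound_def using solved_nonzero holed_zero by metis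

lemma Try_sound:
  assumes env: "tables_ok s" and h: "holed (s ''col'') (s ''r'' 0)" "\<forall>v \<ge> n. s ''col'' v = 0"
  shows "wp L Try (\<lambda>s'. (s' ''col'' = s ''col'' \<and> stuck (s ''col'') (s ''r'' 0)) \<or>
    (sound (s' ''col'') (s ''r'' 0) \<and> solved (s' ''col''))) s"
proof (rule wp_weaken[OF Try_wp[OF env]])
  show r: "s ''r'' 0 < n" using h unfolding holed_def by blast
  fix s' assume "(s' ''col'' = s ''col'' \<and> (\<forall>i. \<not> avail (s ''col'') (s ''r'' 0) i)) \<or>
     (\<exists>i. avail (s ''col'') (s ''r'' 0) i \<and> s' ''col'' = (s ''col'')(s ''r'' 0 := i))"
  then show "(s' ''col'' = s ''col'' \<and> stuck (s ''col'') (s ''r'' 0)) \<or>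
    (sound (s' ''col'') (s ''r'' 0) \<and> solved (s' ''col''))"
  proof
    assume "s' ''col'' = s ''col'' \<and> (\<forall>i. \<not> avail (s ''col'') (s ''r'' 0) i)"
    then show ?thesis using no_avail(1)[OF r] by blast
  next
    assume "\<exists>i. avail (s ''col'') (s ''r'' 0) i \<and> s' ''col'' = (s ''col'')(s ''r'' 0 := i)"
    then obtain i where i: "avail (s ''col'') (s ''r'' 0) i" "s' ''col'' = (s ''col'')(s ''r'' 0 := i)" by blast
    then have "solved (s' ''col'')" using solved_fill h by simp
    then show ?thesis unfolding sound_def using i r h(2) by simp
  qed
qed

text \<open>
  Either the hole can be filled, or it is stuck, which is just what permits the slide.
\<close>
lemma Step_wp:
  assumes env: "tables_ok s" and h: "sound (s ''col'') (s ''r'' 0)"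
    and e: "s ''col'' (s ''r'' 0) = 0 \<Longrightarrow> (s ''r'' 0, s ''s'' 0) \<in> ugraph A"
  shows "wp L Step (\<lambda>s'. sound (s' ''col'') (s' ''r'' 0) \<and> (solved (s' ''col'') \<or>
    (holed (s ''col'') (s ''r'' 0) \<and> stuck (s ''col'') (s ''r'' 0) \<and> s' ''r'' 0 = s ''s'' 0 \<and>
     s' ''col'' = s ''col'' \<circ> transpose (s ''r'' 0) (s ''s'' 0) \<and> holed (s' ''col'') (s' ''r'' 0)))) s"
    (is "wp L Step ?Q s")
  unfolding Step_def
proof (rule wp_Unless)
  assume "aval (V ''col'' (vr ''r'')) s \<noteq> 0"
  then show "?Q s" using h sound_solved by simp
next
  assume "aval (V ''col'' (vr ''r'')) s = 0"
  then have c0: "s ''col'' (s ''r'' 0) = 0" by simp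
  then have c: "holed (s ''col'') (s ''r'' 0)" using h sound_holed by simp
  have sup: "\<forall>v \<ge> n. s ''col'' v = 0" using h unfolding sound_def by blast
  note e' = e[OF c0]
  show "wp L (Seq Try (Unless (V ''col'' (vr ''r'')) (
     Seq (Assign ''col'' (vr ''r'') (V ''col'' (vr ''s''))) (Seq (Assign ''col'' (vr ''s'') (N 0))
     (asg ''r'' (vr ''s'')))))) ?Q s"
  proof (rule wp_Seq[OF Try_sound[OF env c sup]])
    fix s1 assume 1: "(s1 ''col'' = s ''col'' \<and> stuck (s ''col'') (s ''r'' 0)) \<or>
      (sound (s1 ''col'') (s ''r'' 0) \<and> solved (s1 ''col''))" and sm: "same (mods Try) s s1"
    have v: "s1 ''r'' 0 = s ''r'' 0" "s1 ''s'' 0 = s ''s'' 0" using sm by (simp_all add: same_def mods_Try)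
    show "wp L (Unless (V ''col'' (vr ''r'')) (
     Seq (Assign ''col'' (vr ''r'') (V ''col'' (vr ''s''))) (Seq (Assign ''col'' (vr ''s'') (N 0))
     (asg ''r'' (vr ''s''))))) ?Q s1"
    proof (rule wp_Unless)
      assume "aval (V ''col'' (vr ''r'')) s1 \<noteq> 0"
      then have "s1 ''col'' \<noteq> s ''col''" using v c0 by auto
      then show "?Q s1" using 1 v by auto
    next
      assume "aval (V ''col'' (vr ''r'')) s1 = 0"
      then have "s1 ''col'' (s ''r'' 0) = 0" using v by simp
      then have "\<not> (sound (s1 ''col'') (s ''r'' 0) \<and> solved (s1 ''col''))"
        using sound_solved[of "s1 ''col''" "s ''r'' 0"] by blast
      then have 2: "s1 ''col'' = s ''col''" "stuck (s ''col'') (s ''r'' 0)" using 1 by blast+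
      let ?r = "s ''r'' 0" and ?q = "s ''s'' 0" and ?\<psi> = "s ''col''"
      have eq: "(?\<psi>(?r := ?\<psi> ?q))(?q := 0) = ?\<psi> \<circ> transpose ?r ?q"
        using c0 ugraph_ne[OF e'] by (auto simp: fun_eq_iff transpose_def)
      have cm: "holed (?\<psi> \<circ> transpose ?r ?q) ?q" using holed_move[OF c 2(2) e'] .
      have "(?\<psi> \<circ> transpose ?r ?q) v = 0" if "v \<ge> n" for v
        using sup that ugraph_in[OF e'] by (auto simp: transpose_def)
      then have hd: "sound (?\<psi> \<circ> transpose ?r ?q) ?q" using cm ugraph_in[OF e'] unfolding sound_def by blast
      let ?s2 = "s1(''col'' := (s1 ''col'')(s1 ''r'' 0 := s1 ''col'' (s1 ''s'' 0)))"
      let ?s3 = "?s2(''col'' := (?s2 ''col'')(?s2 ''s'' 0 := 0))"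
      have "?Q (?s3(''r'' := (?s3 ''r'')(0 := ?s3 ''s'' 0)))"
        using 2 v eq hd c cm by simp
      then show "wp L (Seq (Assign ''col'' (vr ''r'') (V ''col'' (vr ''s''))) (Seq (Assign ''col'' (vr ''s'') (N 0))
         (asg ''r'' (vr ''s'')))) ?Q s1"
        by (intro wp_SeqA wp_Assign) simp
    qed
  qed
qed

end

section \<open>Breadth-first numbering\<close>

text \<open>
  Breadth-first search from \<open>x\<close> in the vertices marked by \<open>al\<close>; the root itself need not be one of
  them.
\<close>
definition RankBody :: com where
  "RankBody = Unless (V ''mark'' (vr ''w'')) (When (V ''al'' (vr ''w'')) (When (adjE (V ''ord'' (vr ''g'')) (vr ''w''))
     (Seq (Assign ''ord'' (vr ''c'') (vr ''w'')) (Seq (asg ''c'' (Plus (vr ''c'') (N 1)))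
     (Seq (Assign ''mark'' (vr ''w'') (vr ''c'')) (Assign ''par'' (vr ''w'') (V ''ord'' (vr ''g''))))))))"

definition RankLoop :: com where
  "RankLoop = While (Minus (vr ''c'') (vr ''g''))
     (Seq (For ''w'' (vr ''n'') RankBody) (asg ''g'' (Plus (vr ''g'') (N 1))))"

definition Rank :: com where
  "Rank = Seq (For ''w'' (vr ''n'') (Assign ''mark'' (vr ''w'') (N 0)))
     (Seq (Assign ''mark'' (vr ''x'') (N 1)) (Seq (Assign ''ord'' (N 0) (vr ''x''))
     (Seq (asg ''c'' (N 1)) (Seq (asg ''g'' (N 0)) RankLoop))))"

lemma mods_RankBody: "mods RankBody = {''ord'', ''c'', ''mark'', ''par''}"
  by (auto simp: RankBody_def)
lemma mods_RankLoop: "mods RankLoop = {''w'', ''ord'', ''c'', ''mark'', ''par'', ''g''}"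
  by (auto simp: RankLoop_def mods_RankBody)
lemma mods_Rank: "mods Rank = {''w'', ''ord'', ''c'', ''mark'', ''par'', ''g''}"
  by (auto simp: Rank_def mods_RankLoop)

context prog
begin

text \<open>
  \<open>mark v\<close> is the position of \<open>v\<close> in the search order plus one, so that zero means that \<open>v\<close> has not
  been reached. The search order is at the same time the queue of the search.
\<close>
definition ranked :: "(nat \<Rightarrow> nat) \<Rightarrow> (nat \<Rightarrow> nat) \<Rightarrow> (nat \<Rightarrow> nat) \<Rightarrow> nat \<Rightarrow> (nat \<Rightarrow> nat) \<Rightarrow> nat \<Rightarrow> bool" where
  "ranked mark par ord c al x0 \<longleftrightarrow> 1 \<le> c \<and> ord 0 = x0 \<and> (\<forall>k < c. ord k < n \<and> mark (ord k) = Suc k) \<and>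
     (\<forall>v < n. mark v \<noteq> 0 \<longrightarrow> mark v \<le> c \<and> ord (mark v - 1) = v) \<and>
     (\<forall>v < n. mark v \<noteq> 0 \<longrightarrow> v \<noteq> x0 \<longrightarrow> al v \<noteq> 0 \<and> mark (par v) \<noteq> 0 \<and> mark (par v) < mark v \<and>
        (par v, v) \<in> ugraph A)"

lemma ranked_le: assumes "ranked mark par ord c al x0" shows "c \<le> n"
proof -
  have "inj_on ord {..<c}" using assms unfolding ranked_def by (intro inj_onI) (metis Suc_inject lessThan_iff)
  moreover have "ord ` {..<c} \<subseteq> {..<n}" using assms unfolding ranked_def by auto
  ultimately have "card {..<c} \<le> card {..<n}" by (intro card_inj_on_le) auto
  then show ?thesis by simp
qed

lemma ranked_push:
  assumes R: "ranked mark par ord c al x0" and w: "w < n" "mark w = 0" "al w \<noteq> 0"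
    and u: "u < n" "mark u \<noteq> 0" "(u, w) \<in> ugraph A"
  shows "ranked (mark(w := Suc c)) (par(w := u)) (ord(c := w)) (Suc c) al x0"
proof -
  have R1: "1 \<le> c" "ord 0 = x0" and R2: "\<And>k. k < c \<Longrightarrow> ord k < n \<and> mark (ord k) = Suc k"
    and R3: "\<And>v. v < n \<Longrightarrow> mark v \<noteq> 0 \<Longrightarrow> mark v \<le> c \<and> ord (mark v - 1) = v"
    and R4: "\<And>v. v < n \<Longrightarrow> mark v \<noteq> 0 \<Longrightarrow> v \<noteq> x0 \<Longrightarrow> al v \<noteq> 0 \<and> mark (par v) \<noteq> 0 \<and>
      mark (par v) < mark v \<and> (par v, v) \<in> ugraph A"
    using R unfolding ranked_def by blast+
  have ow: "ord k \<noteq> w" if "k < c" for k using R2[OF that] w by auto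
  show ?thesis
    unfolding ranked_def
  proof (intro conjI allI impI)
    show "1 \<le> Suc c" by simp
    show "(ord(c := w)) 0 = x0" using R1 by simp
    fix k assume k: "k < Suc c"
    show "(ord(c := w)) k < n" using R2[of k] w k by auto
    show "(mark(w := Suc c)) ((ord(c := w)) k) = Suc k" using R2[of k] ow[of k] k by auto
  next
    fix v assume v: "v < n" "(mark(w := Suc c)) v \<noteq> 0"
    show "(mark(w := Suc c)) v \<le> Suc c" using R3[of v] v by (cases "v = w") auto
    show "(ord(c := w)) ((mark(w := Suc c)) v - 1) = v"
    proof (cases "v = w")
      case False
      then have "mark v \<noteq> 0" "mark v \<le> c" "ord (mark v - 1) = v" using R3[of v] v by auto
      then show ?thesis using False by auto
    qed simp
  next
    fix v assume v: "v < n" "(mark(w := Suc c)) v \<noteq> 0" "v \<noteq> x0"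
    have uw: "u \<noteq> w" using u w by auto
    have uc: "mark u < Suc c" using R3[OF u(1,2)] by simp
    show "al v \<noteq> 0" using R4[of v] v w by (cases "v = w") auto
    have par: "par v \<noteq> w" if "v \<noteq> w" using R4[of v] v w that by auto
    show "(mark(w := Suc c)) ((par(w := u)) v) \<noteq> 0" using R4[of v] v par u uw by (cases "v = w") auto
    show "(mark(w := Suc c)) ((par(w := u)) v) < (mark(w := Suc c)) v"
      using R4[of v] v par uc uw by (cases "v = w") auto
    show "((par(w := u)) v, v) \<in> ugraph A" using R4[of v] v u by (cases "v = w") auto
  qed
qed

abbreviation rk :: "state \<Rightarrow> (nat \<Rightarrow> nat) \<Rightarrow> nat \<Rightarrow> bool" where
  "rk s al x0 \<equiv> ranked (s ''mark'') (s ''par'') (s ''ord'') (s ''c'' 0) al x0"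

definition closed_to :: "state \<Rightarrow> (nat \<Rightarrow> nat) \<Rightarrow> nat \<Rightarrow> bool" where
  "closed_to s al k \<longleftrightarrow> (\<forall>j < k. \<forall>w < n. (s ''ord'' j, w) \<in> ugraph A \<longrightarrow> al w \<noteq> 0 \<longrightarrow> s ''mark'' w \<noteq> 0)"

lemma RankBody_wp:
  assumes env: "tables_ok s" and R: "rk s (s ''al'') x0" and g: "s ''g'' 0 < s ''c'' 0" and w: "s ''w'' 0 = q" "q < n"
    and cl: "closed_to s (s ''al'') (s ''g'' 0)"
    and part: "\<forall>w < q. (s ''ord'' (s ''g'' 0), w) \<in> ugraph A \<longrightarrow> s ''al'' w \<noteq> 0 \<longrightarrow> s ''mark'' w \<noteq> 0"
  shows "wp L RankBody (\<lambda>s'. rk s' (s ''al'') x0 \<and> s ''g'' 0 < s' ''c'' 0 \<and> closed_to s' (s ''al'') (s ''g'' 0) \<and>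
    (\<forall>w < Suc q. (s' ''ord'' (s ''g'' 0), w) \<in> ugraph A \<longrightarrow> s ''al'' w \<noteq> 0 \<longrightarrow> s' ''mark'' w \<noteq> 0)) s" (is "wp L _ ?Q s")
proof -
  let ?g = "s ''g'' 0" and ?c = "s ''c'' 0" and ?u = "s ''ord'' (s ''g'' 0)"
  have u: "?u < n" "s ''mark'' ?u \<noteq> 0" using R g unfolding ranked_def by auto
  have skip: "?Q s" if "(?u, q) \<in> ugraph A \<Longrightarrow> s ''al'' q \<noteq> 0 \<Longrightarrow> s ''mark'' q \<noteq> 0"
    using R g cl part that by (auto simp: less_Suc_eq)
  have adj: "aval (adjE (V ''ord'' (vr ''g'')) (vr ''w'')) s = 0 \<longleftrightarrow> (?u, q) \<notin> ugraph A"
    using adj_val[OF env, of "V ''ord'' (vr ''g'')" "vr ''w''"] u w by simp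
  show ?thesis
    unfolding RankBody_def
  proof (intro wp_Unless wp_When)
    assume a: "aval (V ''mark'' (vr ''w'')) s = 0" "aval (V ''al'' (vr ''w'')) s \<noteq> 0"
      "aval (adjE (V ''ord'' (vr ''g'')) (vr ''w'')) s \<noteq> 0"
    then have b: "s ''mark'' q = 0" "s ''al'' q \<noteq> 0" "(?u, q) \<in> ugraph A" using w adj by simp_all
    have R': "ranked ((s ''mark'')(q := Suc ?c)) ((s ''par'')(q := ?u)) ((s ''ord'')(?c := q)) (Suc ?c) (s ''al'') x0"
      by (rule ranked_push[OF R w(2) b(1,2) u b(3)])
    have cl': "\<forall>j < ?g. \<forall>v < n. (((s ''ord'')(?c := q)) j, v) \<in> ugraph A \<longrightarrow> s ''al'' v \<noteq> 0 \<longrightarrow> ((s ''mark'')(q := Suc ?c)) v \<noteq> 0"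
      using cl g unfolding closed_to_def by auto
    have part': "\<forall>v < Suc q. (((s ''ord'')(?c := q)) ?g, v) \<in> ugraph A \<longrightarrow> s ''al'' v \<noteq> 0 \<longrightarrow> ((s ''mark'')(q := Suc ?c)) v \<noteq> 0"
      using part g by (auto simp: less_Suc_eq)
    have gc: "?g \<noteq> ?c" using g by simp
    show "wp L (Seq (Assign ''ord'' (vr ''c'') (vr ''w'')) (Seq (asg ''c'' (Plus (vr ''c'') (N 1)))
     (Seq (Assign ''mark'' (vr ''w'') (vr ''c'')) (Assign ''par'' (vr ''w'') (V ''ord'' (vr ''g'')))))) ?Q s"
      by (intro wp_SeqA wp_Assign) (use R' cl' part' w g gc in \<open>simp add: closed_to_def\<close>)
  next
    assume "aval (V ''mark'' (vr ''w'')) s = 0" "aval (V ''al'' (vr ''w'')) s \<noteq> 0"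
      "aval (adjE (V ''ord'' (vr ''g'')) (vr ''w'')) s = 0"
    then show "?Q s" using skip adj by blast
  next
    assume "aval (V ''mark'' (vr ''w'')) s = 0" "aval (V ''al'' (vr ''w'')) s = 0"
    then have "s ''al'' q = 0" using w by simp
    then show "?Q s" using skip by blast
  next
    assume "aval (V ''mark'' (vr ''w'')) s \<noteq> 0"
    then have "s ''mark'' q \<noteq> 0" using w by simp
    then show "?Q s" using skip by blast
  qed
qed

definition full_rank :: "state \<Rightarrow> (nat \<Rightarrow> nat) \<Rightarrow> nat \<Rightarrow> bool" where
  "full_rank s al x0 \<longleftrightarrow> rk s al x0 \<and>
     (\<forall>v < n. \<forall>w < n. s ''mark'' v \<noteq> 0 \<longrightarrow> (v, w) \<in> ugraph A \<longrightarrow> al w \<noteq> 0 \<longrightarrow> s ''mark'' w \<noteq> 0)"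

lemma RankLoop_wp:
  assumes env: "tables_ok s" and R: "rk s (s ''al'') x0" and g: "s ''g'' 0 = 0"
  shows "wp L RankLoop (\<lambda>s'. full_rank s' (s ''al'') x0) s"
  unfolding RankLoop_def
proof (rule wp_While[where \<mu> = "\<lambda>s'. n - s' ''g'' 0" and I = "\<lambda>s'. same (mods RankLoop) s s' \<and>
    rk s' (s ''al'') x0 \<and> s' ''g'' 0 \<le> s' ''c'' 0 \<and> closed_to s' (s ''al'') (s' ''g'' 0)"], goal_cases)
  case 1 show ?case using R g by (simp add: same_refl closed_to_def)
next
  case 2 show ?case using L_bounds by simp
next
  case (3 s1)
  have env1: "tables_ok s1" by (rule tables_ok_same[OF env]) (use 3 in \<open>auto simp: mods_RankLoop\<close>)
  have al: "s1 ''al'' = s ''al''" using 3 by (simp add: same_def mods_RankLoop)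
  note outer = 3
  have gc: "s1 ''g'' 0 < s1 ''c'' 0" using 3(2) by simp
  have cn: "s1 ''c'' 0 \<le> n" using 3 ranked_le by blast
  let ?I = "\<lambda>q s2. rk s2 (s ''al'') x0 \<and> s1 ''g'' 0 < s2 ''c'' 0 \<and> closed_to s2 (s ''al'') (s1 ''g'' 0) \<and>
    (\<forall>w < q. (s2 ''ord'' (s1 ''g'' 0), w) \<in> ugraph A \<longrightarrow> s ''al'' w \<noteq> 0 \<longrightarrow> s2 ''mark'' w \<noteq> 0)"
  have For: "wp L (For ''w'' (vr ''n'') RankBody) (?I n) s1"
  proof (rule wp_For[where m = n and I = ?I], goal_cases)
    case 1 show ?case by (rule L_bounds)
  next
    case 2 show ?case by (simp add: mods_RankBody)
  next
    case 3 show ?case using outer gc by simp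
  next
    case (4 k s2 z) then show ?case by (simp add: closed_to_def)
  next
    case (5 s2) then show ?case using tables_okD(1)[OF env1] by (simp add: same_def mods_RankBody)
  next
    case (6 q s2)
    have env2: "tables_ok s2" by (rule tables_ok_same[OF env1 6(4)]) (simp add: mods_RankBody)
    have v: "s2 ''g'' 0 = s1 ''g'' 0" "s2 ''al'' = s ''al''" using 6(4) al by (simp_all add: same_def mods_RankBody)
    show ?case
      by (rule wp_weaken[OF RankBody_wp[OF env2, of x0 q]]) (use 6 v in simp_all)
  next
    case (7 s2) then show ?case by blast
  qed
  show ?case
  proof (rule wp_Seq[OF For])
    fix s2 assume 2: "?I n s2" and sm: "same (mods (For ''w'' (vr ''n'') RankBody)) s1 s2"
    have g2: "s2 ''g'' 0 = s1 ''g'' 0" using sm by (simp add: same_def mods_RankBody)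
    have "same (mods RankLoop) s1 s2" using sm by (rule same_mono) (auto simp: mods_RankBody mods_RankLoop)
    then have "same (mods RankLoop) s s2" using outer same_trans by blast
    then have "same (mods RankLoop) s (s2(''g'' := z))" for z by (auto simp: same_def mods_RankLoop)
    moreover have "closed_to s2 (s ''al'') (Suc (s1 ''g'' 0))" using 2 unfolding closed_to_def by (auto simp: less_Suc_eq)
    ultimately show "wp L (asg ''g'' (Plus (vr ''g'') (N 1))) (\<lambda>s'. (same (mods RankLoop) s s' \<and>
      rk s' (s ''al'') x0 \<and> s' ''g'' 0 \<le> s' ''c'' 0 \<and> closed_to s' (s ''al'') (s' ''g'' 0)) \<and>
      n - s' ''g'' 0 < n - s1 ''g'' 0) s2"
      using 2 g2 gc cn by (intro wp_Assign) (simp add: closed_to_def)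
  qed
next
  case (4 s1)
  then have R1: "rk s1 (s ''al'') x0" and cl: "closed_to s1 (s ''al'') (s1 ''c'' 0)" by auto
  have "s1 ''mark'' w \<noteq> 0" if "v < n" "w < n" "s1 ''mark'' v \<noteq> 0" "(v, w) \<in> ugraph A" "s ''al'' w \<noteq> 0" for v w
  proof -
    have m: "s1 ''mark'' v \<le> s1 ''c'' 0" "s1 ''ord'' (s1 ''mark'' v - 1) = v" using R1 that unfolding ranked_def by blast+
    then have "s1 ''mark'' v - 1 < s1 ''c'' 0" using that by linarith
    then show ?thesis using cl that m(2) unfolding closed_to_def by metis
  qed
  then show ?case using R1 unfolding full_rank_def by blast
qed

lemma Rank_wp:
  assumes env: "tables_ok s" and x: "s ''x'' 0 < n"
  shows "wp L Rank (\<lambda>s'. full_rank s' (s ''al'') (s ''x'' 0)) s"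
  unfolding Rank_def
proof (rule wp_Seq[where R = "\<lambda>s1. \<forall>v < n. s1 ''mark'' v = 0"])
  show "wp L (For ''w'' (vr ''n'') (Assign ''mark'' (vr ''w'') (N 0))) (\<lambda>s1. \<forall>v < n. s1 ''mark'' v = 0) s"
  proof (rule wp_For[where m = n and I = "\<lambda>q s1. \<forall>v < q. s1 ''mark'' v = 0"], goal_cases)
    case 1 show ?case by (rule L_bounds)
  next
    case (5 s2) then show ?case using tables_okD(1)[OF env] by (simp add: same_def)
  next
    case (6 q s2) then show ?case by (intro wp_Assign) (simp add: less_Suc_eq)
  qed simp_all
  fix s1 assume 1: "\<forall>v < n. s1 ''mark'' v = 0"
    and sm: "same (mods (For ''w'' (vr ''n'') (Assign ''mark'' (vr ''w'') (N 0)))) s s1"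
  have env1: "tables_ok s1" by (rule tables_ok_same[OF env sm]) simp
  have v: "s1 ''x'' 0 = s ''x'' 0" "s1 ''al'' = s ''al''" using sm by (simp_all add: same_def)
  define s2 where "s2 = s1(''mark'' := (s1 ''mark'')(s1 ''x'' 0 := 1))"
  define s3 where "s3 = s2(''ord'' := (s2 ''ord'')(0 := s2 ''x'' 0))"
  define s4 where "s4 = s3(''c'' := (s3 ''c'')(0 := 1))"
  define s5 where "s5 = s4(''g'' := (s4 ''g'')(0 := 0))"
  note sd = s5_def s4_def s3_def s2_def
  have env5: "tables_ok s5" unfolding sd by (simp add: tables_ok_upd env1)
  have v5: "s5 ''mark'' = (s1 ''mark'')(s ''x'' 0 := 1)" "s5 ''ord'' 0 = s ''x'' 0" "s5 ''c'' 0 = 1" "s5 ''g'' 0 = 0"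
    "s5 ''al'' = s ''al''"
    using v unfolding sd by simp_all
  have m5: "s5 ''mark'' u \<noteq> 0 \<longleftrightarrow> u = s ''x'' 0" if "u < n" for u using v5 1 that by auto
  have "rk s5 (s5 ''al'') (s ''x'' 0)"
    unfolding ranked_def
  proof (intro conjI allI impI)
    show "1 \<le> s5 ''c'' 0" "s5 ''ord'' 0 = s ''x'' 0" using v5 by simp_all
    fix k assume "k < s5 ''c'' 0"
    then have "k = 0" using v5 by simp
    then show "s5 ''ord'' k < n" "s5 ''mark'' (s5 ''ord'' k) = Suc k" using v5 x by simp_all
  next
    fix u assume "u < n" "s5 ''mark'' u \<noteq> 0"
    then have "u = s ''x'' 0" using m5 by blast
    then show "s5 ''mark'' u \<le> s5 ''c'' 0" "s5 ''ord'' (s5 ''mark'' u - 1) = u" using v5 by simp_all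
  qed (use m5 in blast)+
  then have "wp L RankLoop (\<lambda>s'. full_rank s' (s ''al'') (s ''x'' 0)) s5"
    using RankLoop_wp[OF env5 _ v5(4)] v5(5) by simp
  then show "wp L (Seq (Assign ''mark'' (vr ''x'') (N 1)) (Seq (Assign ''ord'' (N 0) (vr ''x''))
     (Seq (asg ''c'' (N 1)) (Seq (asg ''g'' (N 0)) RankLoop)))) (\<lambda>s'. full_rank s' (s ''al'') (s ''x'' 0)) s1"
    by (intro wp_SeqA) (simp add: sd)
qed

end

section \<open>The queue of stored colourings\<close>

definition Load :: com where
  "Load = Seq (For ''w'' (vr ''n'') (Assign ''col'' (vr ''w'') (V ''conf'' (Plus (V ''mn'' (vr ''h'')) (vr ''w'')))))
     (asg ''r'' (V ''qr'' (vr ''h'')))"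

definition Find :: com where
  "Find = For ''j'' (vr ''T'') (Unless (Plus (neq (V ''qr'' (vr ''j'')) (vr ''r''))
       (Plus (neq (V ''qx'' (vr ''j'')) (vr ''x'')) (neq (V ''qy'' (vr ''j'')) (vr ''y''))))
     (asg ''fd'' (N 1)))"

definition Save :: com where
  "Save = For ''w'' (vr ''n'') (Assign ''conf'' (Plus (V ''mn'' (vr ''T'')) (vr ''w'')) (V ''col'' (vr ''w'')))"

definition Push :: com where
  "Push = Seq (asg ''fd'' (N 0)) (Seq Find (Unless (vr ''fd'')
     (Seq (Assign ''qr'' (vr ''T'') (vr ''r'')) (Seq (Assign ''qx'' (vr ''T'') (vr ''x''))
     (Seq (Assign ''qy'' (vr ''T'') (vr ''y'')) (Seq Save (asg ''T'' (Plus (vr ''T'') (N 1)))))))))"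

lemma mods_Load: "mods Load = {''w'', ''col'', ''r''}"
  by (auto simp: Load_def)
lemma mods_Find: "mods Find = {''j'', ''fd''}"
  by (auto simp: Find_def)
lemma mods_Save: "mods Save = {''w'', ''conf''}"
  by (auto simp: Save_def)
lemma mods_Push: "mods Push = {''j'', ''fd'', ''w'', ''conf'', ''qr'', ''qx'', ''qy'', ''T''}"
  by (auto simp: Push_def mods_Find mods_Save)

context prog
begin

definition triple :: "state \<Rightarrow> nat \<Rightarrow> nat \<times> nat \<times> nat" where
  "triple s k = (s ''qr'' k, s ''qx'' k, s ''qy'' k)"

text \<open>
  Behind the last vertex the stored colouring is zero, as for \<open>sound\<close>.
\<close>
definition stored :: "state \<Rightarrow> nat \<Rightarrow> nat \<Rightarrow> nat" where
  "stored s k = (\<lambda>v. if v < n then s ''conf'' (k * n + v) else 0)"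

lemma Load_wp:
  assumes env: "tables_ok s" and h: "s ''h'' 0 \<le> n * n * n" and sup: "\<forall>v \<ge> n. s ''col'' v = 0"
  shows "wp L Load (\<lambda>s'. s' ''col'' = stored s (s ''h'' 0) \<and> s' ''r'' 0 = s ''qr'' (s ''h'' 0)) s"
  unfolding Load_def
proof (rule wp_Seq[where R = "\<lambda>s1. s1 ''col'' = stored s (s ''h'' 0)"])
  let ?h = "s ''h'' 0"
  show "wp L (For ''w'' (vr ''n'') (Assign ''col'' (vr ''w'') (V ''conf'' (Plus (V ''mn'' (vr ''h'')) (vr ''w'')))))
    (\<lambda>s1. s1 ''col'' = stored s ?h) s"
  proof (rule wp_For[where m = n and I = "\<lambda>q s1. (\<forall>v < q. s1 ''col'' v = s ''conf'' (?h * n + v)) \<and> (\<forall>v \<ge> n. s1 ''col'' v = 0)"], goal_cases)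
    case 1 show ?case by (rule L_bounds)
  next
    case 3 show ?case using sup by simp
  next
    case (5 s2) then show ?case using tables_okD(1)[OF env] by (simp add: same_def)
  next
    case (6 q s2)
    have e: "s2 ''mn'' = s ''mn''" "s2 ''h'' = s ''h''" "s2 ''conf'' = s ''conf''" using 6(4) by (simp_all add: same_def)
    have "s ''mn'' ?h = ?h * n" using tables_okD(5)[OF env h] .
    then show ?case using 6(1,2,3) e by (intro wp_Assign) (simp add: less_Suc_eq)
  next
    case (7 s2) then show ?case by (auto simp: stored_def fun_eq_iff)
  qed simp_all
  fix s1 assume 1: "s1 ''col'' = stored s ?h"
    and sm: "same (mods (For ''w'' (vr ''n'') (Assign ''col'' (vr ''w'') (V ''conf'' (Plus (V ''mn'' (vr ''h'')) (vr ''w'')))))) s s1"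
  have "s1 ''h'' = s ''h''" "s1 ''qr'' = s ''qr''" using sm by (simp_all add: same_def)
  then show "wp L (asg ''r'' (V ''qr'' (vr ''h''))) (\<lambda>s'. s' ''col'' = stored s ?h \<and> s' ''r'' 0 = s ''qr'' ?h) s1"
    using 1 by (intro wp_Assign) simp
qed

definition current :: "state \<Rightarrow> nat \<times> nat \<times> nat" where
  "current s = (s ''r'' 0, s ''x'' 0, s ''y'' 0)"

lemma Find_wp:
  assumes env: "tables_ok s" and T: "s ''T'' 0 \<le> n * n * n" and fd: "s ''fd'' 0 = 0"
  shows "wp L Find (\<lambda>s'. s' ''fd'' 0 = 0 \<longleftrightarrow> (\<forall>k < s ''T'' 0. triple s k \<noteq> current s)) s"
  unfolding Find_def
proof (rule wp_For[where m = "s ''T'' 0" and I = "\<lambda>q s1. s1 ''fd'' 0 = 0 \<longleftrightarrow> (\<forall>k < q. triple s k \<noteq> current s)"], goal_cases)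
  case 1 show ?case using T L_bounds by simp
next
  case 3 show ?case using fd by simp
next
  case (5 s2) then show ?case by (simp add: same_def)
next
  case (6 q s2)
  have e: "s2 ''qr'' = s ''qr''" "s2 ''qx'' = s ''qx''" "s2 ''qy'' = s ''qy''"
    "s2 ''r'' = s ''r''" "s2 ''x'' = s ''x''" "s2 ''y'' = s ''y''" using 6(4) by (simp_all add: same_def)
  let ?b = "Plus (neq (V ''qr'' (vr ''j'')) (vr ''r''))
       (Plus (neq (V ''qx'' (vr ''j'')) (vr ''x'')) (neq (V ''qy'' (vr ''j'')) (vr ''y'')))"
  have b: "aval ?b s2 = 0 \<longleftrightarrow> triple s q = current s"
  proof -
    have "aval ?b s2 = 0 \<longleftrightarrow> aval (neq (V ''qr'' (vr ''j'')) (vr ''r'')) s2 = 0 \<and>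
      aval (neq (V ''qx'' (vr ''j'')) (vr ''x'')) s2 = 0 \<and> aval (neq (V ''qy'' (vr ''j'')) (vr ''y'')) s2 = 0"
      by simp
    then show ?thesis unfolding neq_val using e 6(2) by (simp add: triple_def current_def)
  qed
  show ?case
  proof (rule wp_Unless)
    assume "aval ?b s2 = 0"
    then have "triple s q = current s" unfolding b .
    then show "wp L (asg ''fd'' (N 1)) (\<lambda>s1. s1 ''fd'' 0 = 0 \<longleftrightarrow> (\<forall>k < Suc q. triple s k \<noteq> current s)) s2"
      by (intro wp_Assign) auto
  next
    assume "aval ?b s2 \<noteq> 0"
    then have "triple s q \<noteq> current s" unfolding b .
    then show "s2 ''fd'' 0 = 0 \<longleftrightarrow> (\<forall>k < Suc q. triple s k \<noteq> current s)" using 6(3) by (auto simp: less_Suc_eq)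
  qed
qed simp_all

lemma Save_wp:
  assumes env: "tables_ok s" and T: "s ''T'' 0 \<le> n * n * n"
  shows "wp L Save (\<lambda>s'. (\<forall>v < n. s' ''conf'' (s ''T'' 0 * n + v) = s ''col'' v) \<and>
    (\<forall>m < s ''T'' 0 * n. s' ''conf'' m = s ''conf'' m)) s"
  unfolding Save_def
proof (rule wp_For[where m = n and I = "\<lambda>q s1. (\<forall>v < q. s1 ''conf'' (s ''T'' 0 * n + v) = s ''col'' v) \<and>
    (\<forall>m < s ''T'' 0 * n. s1 ''conf'' m = s ''conf'' m)"], goal_cases)
  case 1 show ?case by (rule L_bounds)
next
  case (5 s2) then show ?case using tables_okD(1)[OF env] by (simp add: same_def)
next
  case (6 q s2)
  have e: "s2 ''mn'' = s ''mn''" "s2 ''T'' = s ''T''" "s2 ''col'' = s ''col''" using 6(4) by (simp_all add: same_def)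
  have "s ''mn'' (s ''T'' 0) = s ''T'' 0 * n" using tables_okD(5)[OF env T] .
  then show ?case using 6(1,2,3) e by (intro wp_Assign) (simp add: less_Suc_eq)
qed simp_all

text \<open>
  A triple that is already present is not stored again, even though the colouring may differ: one
  witness for each triple suffices.
\<close>
lemma Push_wp:
  assumes env: "tables_ok s" and T: "s ''T'' 0 \<le> n * n * n" and sup: "\<forall>v \<ge> n. s ''col'' v = 0"
  shows "wp L Push (\<lambda>s'. (if \<exists>k < s ''T'' 0. triple s k = current s then s' ''T'' 0 = s ''T'' 0
      else s' ''T'' 0 = Suc (s ''T'' 0) \<and> triple s' (s ''T'' 0) = current s \<and> stored s' (s ''T'' 0) = s ''col'') \<and>
      (\<forall>k < s ''T'' 0. triple s' k = triple s k \<and> stored s' k = stored s k)) s" (is "wp L Push ?Q s")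
  unfolding Push_def
proof (rule wp_SeqA)
  define s0 where "s0 = s(''fd'' := (s ''fd'')(aval (N 0) s := aval (N 0) s))"
  have v0: "s0 ''fd'' 0 = 0" "s0 ''T'' = s ''T''" "s0 ''col'' = s ''col''" "triple s0 = triple s" "stored s0 = stored s" "current s0 = current s"
    by (auto simp: s0_def triple_def stored_def current_def fun_eq_iff)
  have env0: "tables_ok s0" unfolding s0_def using env by (simp add: tables_ok_upd)
  let ?T = "s ''T'' 0"
  have F: "wp L Find (\<lambda>s'. s' ''fd'' 0 = 0 \<longleftrightarrow> (\<forall>k < ?T. triple s k \<noteq> current s)) s0"
    using Find_wp[OF env0] T v0 by simp
  let ?c = "Seq (Assign ''qr'' (vr ''T'') (vr ''r'')) (Seq (Assign ''qx'' (vr ''T'') (vr ''x''))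
     (Seq (Assign ''qy'' (vr ''T'') (vr ''y'')) (Seq Save (asg ''T'' (Plus (vr ''T'') (N 1))))))"
  have "wp L (Seq Find (Unless (vr ''fd'') ?c)) ?Q s0"
  proof (rule wp_Seq[OF F])
    fix s1 assume 1: "s1 ''fd'' 0 = 0 \<longleftrightarrow> (\<forall>k < ?T. triple s k \<noteq> current s)" and sm: "same (mods Find) s0 s1"
    have e: "s1 ''qr'' = s0 ''qr''" "s1 ''qx'' = s0 ''qx''" "s1 ''qy'' = s0 ''qy''" "s1 ''conf'' = s0 ''conf''"
      "s1 ''r'' = s0 ''r''" "s1 ''x'' = s0 ''x''" "s1 ''y'' = s0 ''y''" "s1 ''T'' = s0 ''T''" "s1 ''col'' = s0 ''col''"
      using sm by (simp_all add: same_def mods_Find)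
    have e0: "s0 ''qr'' = s ''qr''" "s0 ''qx'' = s ''qx''" "s0 ''qy'' = s ''qy''" "s0 ''conf'' = s ''conf''"
      "s0 ''r'' = s ''r''" "s0 ''x'' = s ''x''" "s0 ''y'' = s ''y''" "s0 ''T'' = s ''T''" "s0 ''col'' = s ''col''"
      by (simp_all add: s0_def)
    have v1: "triple s1 = triple s" "stored s1 = stored s" "current s1 = current s" "s1 ''T'' 0 = ?T" "s1 ''col'' = s ''col''"
      by (simp_all add: e e0 triple_def[abs_def] stored_def[abs_def] current_def cong: if_cong)
    have env1: "tables_ok s1" by (rule tables_ok_same[OF env0 sm]) (simp add: mods_Find)
    show "wp L (Unless (vr ''fd'') ?c) ?Q s1"
    proof (rule wp_Unless)
      assume "aval (vr ''fd'') s1 \<noteq> 0"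
      then show "?Q s1" using 1 v1 by auto
    next
      assume "aval (vr ''fd'') s1 = 0"
      then have new: "\<not> (\<exists>k < ?T. triple s k = current s)" using 1 by auto
      define s2 where "s2 = s1(''qr'' := (s1 ''qr'')(?T := s1 ''r'' 0))"
      define s3 where "s3 = s2(''qx'' := (s2 ''qx'')(?T := s1 ''x'' 0))"
      define s4 where "s4 = s3(''qy'' := (s3 ''qy'')(?T := s1 ''y'' 0))"
      note sd = s4_def s3_def s2_def
      have env4: "tables_ok s4" unfolding sd using env1 by (simp add: tables_ok_upd)
      have v4: "s4 ''T'' 0 = ?T" "s4 ''col'' = s ''col''" "s4 ''conf'' = s1 ''conf''" "triple s4 ?T = current s"
        "\<And>k. k < ?T \<Longrightarrow> triple s4 k = triple s k"
        unfolding sd by (simp_all add: triple_def current_def e e0)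
      have S: "wp L Save (\<lambda>s'. (\<forall>v < n. s' ''conf'' (?T * n + v) = s ''col'' v) \<and>
        (\<forall>m < ?T * n. s' ''conf'' m = s1 ''conf'' m)) s4"
        using Save_wp[OF env4] T v4 by simp
      have "wp L (Seq Save (asg ''T'' (Plus (vr ''T'') (N 1)))) ?Q s4"
      proof (rule wp_Seq[OF S])
        fix s5 assume 5: "(\<forall>v < n. s5 ''conf'' (?T * n + v) = s ''col'' v) \<and>
          (\<forall>m < ?T * n. s5 ''conf'' m = s1 ''conf'' m)" and sm5: "same (mods Save) s4 s5"
        have v5: "s5 ''T'' 0 = ?T" "triple s5 = triple s4" using sm5 v4 by (auto simp: same_def mods_Save triple_def fun_eq_iff)
        have a: "stored s5 ?T = s ''col''" using 5 sup by (auto simp: stored_def fun_eq_iff)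
        have b: "stored s5 k = stored s k" if "k < ?T" for k
        proof -
          have "s5 ''conf'' (k * n + v) = s1 ''conf'' (k * n + v)" if v: "v < n" for v
          proof -
            have "k * n + v < Suc k * n" using v by simp
            also have "\<dots> \<le> ?T * n" using \<open>k < ?T\<close> by (intro mult_right_mono) auto
            finally show ?thesis using 5 by blast
          qed
          then have "stored s5 k = stored s1 k" by (auto simp: stored_def fun_eq_iff)
          then show ?thesis using v1 by simp
        qed
        have induced: "triple (s5(''T'' := z)) = triple s5" "stored (s5(''T'' := z)) = stored s5" for z
          by (auto simp: triple_def stored_def fun_eq_iff)
        show "wp L (asg ''T'' (Plus (vr ''T'') (N 1))) ?Q s5"
          using new v5 v4(4,5) a b by (intro wp_Assign) (simp add: induced)
      qed
      then show "wp L ?c ?Q s1"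
        by (intro wp_SeqA) (use v1 in \<open>simp add: sd\<close>)
    qed
  qed
  then show "wp L (Seq Find (Unless (vr ''fd'') ?c)) ?Q (s(''fd'' := (s ''fd'')(aval (N 0) s := aval (N 0) s)))"
    unfolding s0_def .
qed

end

section \<open>Probing a closed walk\<close>

text \<open>
  The hole follows the parents in the search tree with root \<open>a\<close>. It idles at \<open>a\<close> once it has
  arrived, so that a fixed number of iterations can be used.
\<close>
definition Walk :: com where
  "Walk = For ''k'' (vr ''n'') (When (neq (vr ''r'') (vr ''a''))
     (Seq (asg ''s'' (V ''par'' (vr ''r''))) Step))"

definition Probe :: com where
  "Probe = Unless (V ''col'' (vr ''r'')) (Seq Load (Seq (asg ''s'' (vr ''b'')) (Seq Step
     (Seq (asg ''s'' (vr ''d'')) (Seq Step (Seq Walk (Seq (asg ''s'' (vr ''z'')) (Seq Step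
     (Unless (V ''col'' (vr ''r'')) Try)))))))))"

lemma mods_Walk: "mods Walk = {''k'', ''s'', ''i'', ''w'', ''o'', ''e'', ''col'', ''r''}"
  by (auto simp: Walk_def mods_Step)
lemma mods_Probe: "mods Probe = {''k'', ''s'', ''i'', ''w'', ''o'', ''e'', ''col'', ''r''}"
  by (auto simp: Probe_def mods_Step mods_Walk mods_Try mods_Load)

context prog
begin

text \<open>
  The case \<open>b = a\<close> is not excluded by the loops of the program and has to be void.
\<close>
definition probe_ok :: "(nat \<Rightarrow> nat) \<Rightarrow> nat \<Rightarrow> nat \<Rightarrow> nat \<Rightarrow> nat \<Rightarrow> bool" where
  "probe_ok \<psi> z a b d \<longleftrightarrow> (b \<noteq> a \<longrightarrow> \<psi> d = \<psi> a \<and> (arc_type A z b \<noteq> arc_type A z a \<longrightarrow> \<psi> b = \<psi> a))"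

text \<open>
  The colouring while the hole is on its way from \<open>d\<close> to \<open>a\<close>: the first two slides have moved the
  token of \<open>b\<close> to \<open>z\<close> and that of \<open>d\<close> to \<open>b\<close>, and of the neighbours of \<open>z\<close> only \<open>a\<close> can be affected
  later.
\<close>
definition away :: "(nat \<Rightarrow> nat) \<Rightarrow> nat \<Rightarrow> nat \<Rightarrow> nat \<Rightarrow> nat \<Rightarrow> (nat \<Rightarrow> nat) \<Rightarrow> bool" where
  "away \<psi> z a b d \<chi> \<longleftrightarrow> (b \<noteq> a \<longrightarrow> \<chi> b = \<psi> d \<and> \<chi> z = \<psi> b \<and>
     (\<forall>y. (z, y) \<in> ugraph A \<longrightarrow> y \<noteq> a \<longrightarrow> y \<noteq> b \<longrightarrow> \<chi> y = \<psi> y))"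

lemma away_move:
  assumes "away \<psi> z a b d \<chi>" and zb: "(z, b) \<in> ugraph A"
    and t: "t \<noteq> z" "(z, t) \<in> ugraph A \<Longrightarrow> t = a" and u: "u \<noteq> z" "(z, u) \<in> ugraph A \<Longrightarrow> u = a"
  shows "away \<psi> z a b d (\<chi> \<circ> transpose t u)"
  unfolding away_def
proof (intro impI conjI allI)
  assume ba: "b \<noteq> a"
  have c: "\<chi> b = \<psi> d" "\<chi> z = \<psi> b" "\<And>y. (z, y) \<in> ugraph A \<Longrightarrow> y \<noteq> a \<Longrightarrow> y \<noteq> b \<Longrightarrow> \<chi> y = \<psi> y"
    using assms(1) ba unfolding away_def by blast+
  have "b \<noteq> t" "b \<noteq> u" using ba t u zb by auto
  then show "(\<chi> \<circ> transpose t u) b = \<psi> d" using c by simp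
  show "(\<chi> \<circ> transpose t u) z = \<psi> b" using c t u by simp
  fix y assume y: "(z, y) \<in> ugraph A" "y \<noteq> a" "y \<noteq> b"
  then have "y \<noteq> t" "y \<noteq> u" using t u by auto
  then show "(\<chi> \<circ> transpose t u) y = \<psi> y" using c y by simp
qed

lemma marked_in:
  assumes R: "full_rank s al a" and al: "\<And>v. v < n \<Longrightarrow> al v \<noteq> 0 \<longleftrightarrow> v \<noteq> z \<and> (z, v) \<notin> ugraph A"
    and t: "t < n" "s ''mark'' t \<noteq> 0" and za: "(z, a) \<in> ugraph A"
  shows "t \<noteq> z" "(z, t) \<in> ugraph A \<Longrightarrow> t = a"
proof -
  have "t = a \<or> al t \<noteq> 0" using R t unfolding full_rank_def ranked_def by blast
  then have "t = a \<or> (t \<noteq> z \<and> (z, t) \<notin> ugraph A)" using al t by blast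
  then show "t \<noteq> z" "(z, t) \<in> ugraph A \<Longrightarrow> t = a" using ugraph_ne[OF za] by auto
qed

text \<open>
  Marks are at most \<open>n\<close> and decrease along parents, so \<open>n\<close> iterations lead to \<open>a\<close>.
\<close>
lemma Walk_wp:
  assumes env: "tables_ok s" and R: "full_rank s al a" and al: "\<And>v. v < n \<Longrightarrow> al v \<noteq> 0 \<longleftrightarrow> v \<noteq> z \<and> (z, v) \<notin> ugraph A"
    and a: "s ''a'' 0 = a" and adj: "(z, a) \<in> ugraph A" "(z, b) \<in> ugraph A"
    and hd: "sound (s ''col'') (s ''r'' 0)"
    and st: "solved (s ''col'') \<or> s ''mark'' (s ''r'' 0) \<noteq> 0 \<and> away \<psi> z a b d (s ''col'')"
  shows "wp L Walk (\<lambda>s'. sound (s' ''col'') (s' ''r'' 0) \<and> (solved (s' ''col'') \<or>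
    \<not> solved (s ''col'') \<and> s' ''r'' 0 = a \<and> away \<psi> z a b d (s' ''col''))) s"
  unfolding Walk_def
proof (rule wp_For[where m = n and I = "\<lambda>q s1. sound (s1 ''col'') (s1 ''r'' 0) \<and> (solved (s1 ''col'') \<or>
    \<not> solved (s ''col'') \<and> s ''mark'' (s1 ''r'' 0) \<noteq> 0 \<and> (s1 ''r'' 0 = a \<or> s ''mark'' (s1 ''r'' 0) + q \<le> n) \<and>
    away \<psi> z a b d (s1 ''col''))"], goal_cases)
  case 1 show ?case by (rule L_bounds)
next
  case 2 show ?case by (simp add: mods_Step)
next
  case 3
  have "s ''mark'' (s ''r'' 0) \<le> n" if "s ''mark'' (s ''r'' 0) \<noteq> 0"
  proof -
    have rk: "rk s al a" using R unfolding full_rank_def by blast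
    have "s ''r'' 0 < n" using hd unfolding sound_def by blast
    then have "s ''mark'' (s ''r'' 0) \<le> s ''c'' 0" using rk that unfolding ranked_def by blast
    then show ?thesis using ranked_le[OF rk] by simp
  qed
  then show ?case using hd st by auto
next
  case (4 k s1 g) then show ?case by simp
next
  case (5 s1) then show ?case using tables_okD(1)[OF env] by (simp add: same_def mods_Step)
next
  case (6 q s1)
  have env1: "tables_ok s1" by (rule tables_ok_same[OF env 6(4)]) (simp add: mods_Step)
  have v: "s1 ''a'' 0 = a" "s1 ''par'' = s ''par''" using 6(4) a by (simp_all add: same_def mods_Step)
  let ?r = "s1 ''r'' 0" and ?u = "s ''par'' (s1 ''r'' 0)"
  have r: "?r < n" using 6(3) unfolding sound_def by blast
  show ?case
  proof (rule wp_When)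
    assume "aval (neq (vr ''r'') (vr ''a'')) s1 = 0"
    then have ra: "?r = a" unfolding neq_val using v by simp
    then show "sound (s1 ''col'') ?r \<and> (solved (s1 ''col'') \<or> \<not> solved (s ''col'') \<and> s ''mark'' ?r \<noteq> 0 \<and>
      (?r = a \<or> s ''mark'' ?r + Suc q \<le> n) \<and> away \<psi> z a b d (s1 ''col''))" using 6(3) by simp
  next
    assume "aval (neq (vr ''r'') (vr ''a'')) s1 \<noteq> 0"
    then have "aval (vr ''r'') s1 \<noteq> aval (vr ''a'') s1" unfolding neq_val .
    then have ra: "?r \<noteq> a" using v by simp
    define s2 where "s2 = s1(''s'' := (s1 ''s'')(0 := ?u))"
    have v2: "s2 ''col'' = s1 ''col''" "s2 ''r'' 0 = ?r" "s2 ''s'' 0 = ?u" by (simp_all add: s2_def)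
    have env2: "tables_ok s2" unfolding s2_def using env1 by (simp add: tables_ok_upd)
    have nw: "\<not> solved (s ''col'') \<and> s ''mark'' ?r \<noteq> 0 \<and> s ''mark'' ?r + q \<le> n \<and> away \<psi> z a b d (s1 ''col'')" if "\<not> solved (s1 ''col'')"
      using 6(3) that ra by blast
    have up: "s ''mark'' ?u \<noteq> 0 \<and> s ''mark'' ?u < s ''mark'' ?r \<and> (?u, ?r) \<in> ugraph A" if "s ''mark'' ?r \<noteq> 0"
      using R r ra that unfolding full_rank_def ranked_def by blast
    have S: "wp L Step (\<lambda>s'. sound (s' ''col'') (s' ''r'' 0) \<and> (solved (s' ''col'') \<or>
      (holed (s1 ''col'') ?r \<and> stuck (s1 ''col'') ?r \<and> s' ''r'' 0 = ?u \<and>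
       s' ''col'' = s1 ''col'' \<circ> transpose ?r ?u \<and> holed (s' ''col'') (s' ''r'' 0)))) s2"
    proof (rule Step_wp[OF env2, unfolded v2])
      show "sound (s1 ''col'') ?r" using 6(3) by blast
      assume "s1 ''col'' ?r = 0"
      then have "\<not> solved (s1 ''col'')" using solved_nonzero r by blast
      then show "(?r, ?u) \<in> ugraph A" using nw up ugraph_commute by blast
    qed
    have "wp L Step (\<lambda>s1. sound (s1 ''col'') (s1 ''r'' 0) \<and> (solved (s1 ''col'') \<or>
      \<not> solved (s ''col'') \<and> s ''mark'' (s1 ''r'' 0) \<noteq> 0 \<and> (s1 ''r'' 0 = a \<or> s ''mark'' (s1 ''r'' 0) + Suc q \<le> n) \<and>
      away \<psi> z a b d (s1 ''col''))) s2"
    proof (rule wp_weaken[OF S])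
      fix s3 assume 3: "sound (s3 ''col'') (s3 ''r'' 0) \<and> (solved (s3 ''col'') \<or>
      (holed (s1 ''col'') ?r \<and> stuck (s1 ''col'') ?r \<and> s3 ''r'' 0 = ?u \<and>
       s3 ''col'' = s1 ''col'' \<circ> transpose ?r ?u \<and> holed (s3 ''col'') (s3 ''r'' 0)))"
      show "sound (s3 ''col'') (s3 ''r'' 0) \<and> (solved (s3 ''col'') \<or>
        \<not> solved (s ''col'') \<and> s ''mark'' (s3 ''r'' 0) \<noteq> 0 \<and> (s3 ''r'' 0 = a \<or> s ''mark'' (s3 ''r'' 0) + Suc q \<le> n) \<and>
        away \<psi> z a b d (s3 ''col''))"
      proof (cases "solved (s3 ''col'')")
        case False
        then have 4: "holed (s1 ''col'') ?r" "s3 ''r'' 0 = ?u" "s3 ''col'' = s1 ''col'' \<circ> transpose ?r ?u" using 3 by blast+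
        have "\<not> solved (s1 ''col'')" using solved_nonzero[of "s1 ''col''" ?r] holed_zero[OF 4(1)] r by blast
        note w = nw[OF this]
        note u = up[OF conjunct1[OF conjunct2[OF w]]]
        have un: "?u < n" using ugraph_in u by blast
        have "away \<psi> z a b d (s1 ''col'' \<circ> transpose ?r ?u)"
          using away_move[of \<psi> z a b d "s1 ''col''" ?r ?u] marked_in[OF R al _ _ adj(1)] w u un r adj(2) by blast
        moreover have "s ''mark'' ?u + Suc q \<le> n" using w u by linarith
        ultimately show ?thesis using 3 4 u w by simp
      qed (use 3 in blast)
    qed
    then show "wp L (Seq (asg ''s'' (V ''par'' (vr ''r''))) Step) (\<lambda>s1. sound (s1 ''col'') (s1 ''r'' 0) \<and> (solved (s1 ''col'') \<or>
      \<not> solved (s ''col'') \<and> s ''mark'' (s1 ''r'' 0) \<noteq> 0 \<and> (s1 ''r'' 0 = a \<or> s ''mark'' (s1 ''r'' 0) + Suc q \<le> n) \<and>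
      away \<psi> z a b d (s1 ''col''))) s1"
      by (intro wp_SeqA) (simp add: s2_def v)
  qed
next
  case (7 s1) then show ?case by auto
qed

text \<open>
  The program text does not branch after each step, although any step may complete the colouring.
  The rule hides this: \<open>P\<close> has to be shown only if the slide is really made, and the alternative
  that the search has succeeded is passed on.
\<close>
lemma step_to:
  assumes env: "tables_ok s" and h: "sound (s ''col'') (s ''r'' 0)" and q: "aval ex s = q"
    and e: "\<not> solved (s ''col'') \<Longrightarrow> (s ''r'' 0, q) \<in> ugraph A"
    and P: "\<And>\<chi>. \<not> solved (s ''col'') \<Longrightarrow> stuck (s ''col'') (s ''r'' 0) \<Longrightarrow> \<chi> = s ''col'' \<circ> transpose (s ''r'' 0) q \<Longrightarrow> holed \<chi> q \<Longrightarrow> P \<chi>"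
    and c: "\<And>s'. tables_ok s' \<Longrightarrow> same {''s'', ''i'', ''w'', ''o'', ''e'', ''col'', ''r''} s s' \<Longrightarrow> sound (s' ''col'') (s' ''r'' 0) \<Longrightarrow>
      solved (s' ''col'') \<or> s' ''r'' 0 = q \<and> P (s' ''col'') \<Longrightarrow> wp L c Q s'"
  shows "wp L (Seq (asg ''s'' ex) (Seq Step c)) Q s"
proof (rule wp_SeqA)
  define s2 where "s2 = s(''s'' := (s ''s'')(0 := q))"
  have v2: "s2 ''col'' = s ''col''" "s2 ''r'' 0 = s ''r'' 0" "s2 ''s'' 0 = q" by (simp_all add: s2_def)
  have env2: "tables_ok s2" unfolding s2_def using env by (simp add: tables_ok_upd)
  have r: "s ''r'' 0 < n" using h unfolding sound_def by blast
  have S: "wp L Step (\<lambda>s'. sound (s' ''col'') (s' ''r'' 0) \<and> (solved (s' ''col'') \<or>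
      (holed (s ''col'') (s ''r'' 0) \<and> stuck (s ''col'') (s ''r'' 0) \<and> s' ''r'' 0 = q \<and>
       s' ''col'' = s ''col'' \<circ> transpose (s ''r'' 0) q \<and> holed (s' ''col'') (s' ''r'' 0)))) s2"
  proof (rule Step_wp[OF env2, unfolded v2])
    show "sound (s ''col'') (s ''r'' 0)" by (rule h)
    assume "s ''col'' (s ''r'' 0) = 0"
    then have "\<not> solved (s ''col'')" using solved_nonzero r by blast
    then show "(s ''r'' 0, q) \<in> ugraph A" by (rule e)
  qed
  have "wp L (Seq Step c) Q s2"
  proof (rule wp_Seq[OF S])
    fix s3 assume 3: "sound (s3 ''col'') (s3 ''r'' 0) \<and> (solved (s3 ''col'') \<or>
      (holed (s ''col'') (s ''r'' 0) \<and> stuck (s ''col'') (s ''r'' 0) \<and> s3 ''r'' 0 = q \<and>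
       s3 ''col'' = s ''col'' \<circ> transpose (s ''r'' 0) q \<and> holed (s3 ''col'') (s3 ''r'' 0)))"
      and sm: "same (mods Step) s2 s3"
    show "wp L c Q s3"
    proof (rule c)
      show "tables_ok s3" by (rule tables_ok_same[OF env2 sm]) (simp add: mods_Step)
      show "same {''s'', ''i'', ''w'', ''o'', ''e'', ''col'', ''r''} s s3"
        using sm unfolding s2_def by (auto simp: same_def mods_Step)
      show "sound (s3 ''col'') (s3 ''r'' 0)" using 3 by blast
      show "solved (s3 ''col'') \<or> s3 ''r'' 0 = q \<and> P (s3 ''col'')"
      proof (cases "solved (s3 ''col'')")
        case False
        then have 4: "holed (s ''col'') (s ''r'' 0)" "stuck (s ''col'') (s ''r'' 0)" "s3 ''r'' 0 = q"
          "s3 ''col'' = s ''col'' \<circ> transpose (s ''r'' 0) q" "holed (s3 ''col'') (s3 ''r'' 0)" using 3 by blast+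
        have "\<not> solved (s ''col'')" using solved_nonzero[of "s ''col''"] holed_zero[OF 4(1)] r by blast
        then show ?thesis using P 4 by metis
      qed simp
    qed
  qed
  then show "wp L (Seq Step c) Q (s(''s'' := (s ''s'')(aval (N 0) s := aval ex s)))"
    unfolding s2_def q[symmetric] by simp
qed

text \<open>
  If no step completes the colouring, the hole is stuck at \<open>z\<close> at both ends of the walk and
  \<open>probe_calm\<close> applies.
\<close>
lemma Probe_wp:
  assumes env: "tables_ok s" and h: "s ''h'' 0 \<le> n * n * n" and hd: "sound (s ''col'') (s ''r'' 0)"
    and \<psi>: "holed \<psi> z" "stored s (s ''h'' 0) = \<psi>" "s ''qr'' (s ''h'' 0) = z" and z: "s ''z'' 0 = z"
    and R: "full_rank s al a" and al: "\<And>v. v < n \<Longrightarrow> al v \<noteq> 0 \<longleftrightarrow> v \<noteq> z \<and> (z, v) \<notin> ugraph A"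
    and v: "s ''a'' 0 = a" "s ''b'' 0 = b" "s ''d'' 0 = d"
    and adj: "(z, a) \<in> ugraph A" "(z, b) \<in> ugraph A" "(b, d) \<in> ugraph A" and d: "s ''mark'' d \<noteq> 0"
  shows "wp L Probe (\<lambda>s'. sound (s' ''col'') (s' ''r'' 0) \<and> (solved (s' ''col'') \<or> probe_ok \<psi> z a b d)) s"
    (is "wp L _ ?Q s")
  unfolding Probe_def
proof (rule wp_Unless)
  assume "aval (V ''col'' (vr ''r'')) s \<noteq> 0"
  then show "?Q s" using hd sound_solved by simp
next
  assume "aval (V ''col'' (vr ''r'')) s = 0"
  have sup: "\<forall>v \<ge> n. s ''col'' v = 0" using hd unfolding sound_def by blast
  have dn: "d < n" "b < n" "a < n" using adj ugraph_in by blast+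
  have sz: "\<forall>v \<ge> n. \<psi> v = 0" using \<psi>(2) by (auto simp: stored_def)
  have zn: "z < n" using adj ugraph_in by blast
  have dz: "d \<noteq> z" "(z, d) \<in> ugraph A \<Longrightarrow> d = a" using marked_in[OF R al dn(1) d adj(1)] by auto
  show "wp L (Seq Load (Seq (asg ''s'' (vr ''b'')) (Seq Step
     (Seq (asg ''s'' (vr ''d'')) (Seq Step (Seq Walk (Seq (asg ''s'' (vr ''z'')) (Seq Step
     (Unless (V ''col'' (vr ''r'')) Try))))))))) ?Q s"
  proof (rule wp_Seq[OF Load_wp[OF env h sup]])
    fix s1 assume "s1 ''col'' = stored s (s ''h'' 0) \<and> s1 ''r'' 0 = s ''qr'' (s ''h'' 0)"
      and sm1: "same (mods Load) s s1"
    then have 1: "s1 ''col'' = \<psi>" "s1 ''r'' 0 = z" using \<psi> by auto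
    have env1: "tables_ok s1" by (rule tables_ok_same[OF env sm1]) (simp add: mods_Load)
    have hd1: "sound (s1 ''col'') (s1 ''r'' 0)" unfolding sound_def 1 using \<psi>(1) sz zn by blast
    have nw: "\<not> solved \<psi>" using solved_nonzero[of \<psi> z] zn holed_zero[OF \<psi>(1)] by blast
    have b1: "s1 ''b'' 0 = b" using sm1 v by (simp add: same_def mods_Load)
    show "wp L (Seq (asg ''s'' (vr ''b'')) (Seq Step
     (Seq (asg ''s'' (vr ''d'')) (Seq Step (Seq Walk (Seq (asg ''s'' (vr ''z'')) (Seq Step
     (Unless (V ''col'' (vr ''r'')) Try)))))))) ?Q s1"
    proof (rule step_to[OF env1 hd1, where q = b and P = "\<lambda>\<chi>. \<chi> = \<psi> \<circ> transpose z b \<and> stuck \<psi> z \<and> holed \<chi> b"])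
      show "aval (vr ''b'') s1 = b" using b1 by simp
      show "(s1 ''r'' 0, b) \<in> ugraph A" using 1 adj by simp
      show "\<chi> = \<psi> \<circ> transpose z b \<and> stuck \<psi> z \<and> holed \<chi> b"
        if "stuck (s1 ''col'') (s1 ''r'' 0)" "\<chi> = s1 ''col'' \<circ> transpose (s1 ''r'' 0) b" "holed \<chi> b" for \<chi>
        using that 1 by simp
      fix s2 assume env2: "tables_ok s2" and sm2: "same {''s'', ''i'', ''w'', ''o'', ''e'', ''col'', ''r''} s1 s2"
        and hd2: "sound (s2 ''col'') (s2 ''r'' 0)"
        and c2: "solved (s2 ''col'') \<or> s2 ''r'' 0 = b \<and> s2 ''col'' = \<psi> \<circ> transpose z b \<and> stuck \<psi> z \<and> holed (s2 ''col'') b"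
      have d2: "s2 ''d'' 0 = d" using sm1 sm2 v by (simp add: same_def mods_Load)
      show "wp L (Seq (asg ''s'' (vr ''d'')) (Seq Step (Seq Walk (Seq (asg ''s'' (vr ''z'')) (Seq Step
        (Unless (V ''col'' (vr ''r'')) Try)))))) ?Q s2"
      proof (rule step_to[OF env2 hd2, where q = d and P = "\<lambda>\<chi>. away \<psi> z a b d \<chi> \<and> stuck \<psi> z"])
        show "aval (vr ''d'') s2 = d" using d2 by simp
        show "(s2 ''r'' 0, d) \<in> ugraph A" if "\<not> solved (s2 ''col'')" using c2 that adj by simp
        show "away \<psi> z a b d \<chi> \<and> stuck \<psi> z"
          if "\<not> solved (s2 ''col'')" "\<chi> = s2 ''col'' \<circ> transpose (s2 ''r'' 0) d" for \<chi>
        proof -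
          have e: "\<chi> = \<psi> \<circ> transpose z b \<circ> transpose b d" "stuck \<psi> z" using c2 that by auto
          have bd: "b \<noteq> d" "z \<noteq> b" using ugraph_ne adj by blast+
          have "away \<psi> z a b d \<chi>"
            unfolding away_def
          proof (intro impI conjI allI)
            show "\<chi> b = \<psi> d" unfolding e using bd dz by simp
            show "\<chi> z = \<psi> b" unfolding e using bd dz by simp
            fix y assume y: "(z, y) \<in> ugraph A" "y \<noteq> a" "y \<noteq> b"
            then have "y \<noteq> d" "y \<noteq> z" using dz ugraph_ne by blast+
            then show "\<chi> y = \<psi> y" unfolding e using y by simp
          qed
          then show ?thesis using e by blast
        qed
        fix s3 assume env3: "tables_ok s3" and sm3: "same {''s'', ''i'', ''w'', ''o'', ''e'', ''col'', ''r''} s2 s3"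
          and hd3: "sound (s3 ''col'') (s3 ''r'' 0)"
          and c3: "solved (s3 ''col'') \<or> s3 ''r'' 0 = d \<and> away \<psi> z a b d (s3 ''col'') \<and> stuck \<psi> z"
        have e3: "s3 ''mark'' = s ''mark''" "s3 ''par'' = s ''par''" "s3 ''ord'' = s ''ord''" "s3 ''c'' = s ''c''"
          "s3 ''a'' 0 = a" "s3 ''z'' 0 = z"
          using sm1 sm2 sm3 v z by (simp_all add: same_def mods_Load)
        have R3: "full_rank s3 al a" using R unfolding full_rank_def e3 .
        have W: "wp L Walk (\<lambda>s'. sound (s' ''col'') (s' ''r'' 0) \<and> (solved (s' ''col'') \<or>
            \<not> solved (s3 ''col'') \<and> s' ''r'' 0 = a \<and> away \<psi> z a b d (s' ''col''))) s3"
          by (rule Walk_wp[OF env3 R3 al e3(5) adj(1,2) hd3]) (use c3 d e3 in auto)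
        have stz: "stuck \<psi> z" if "\<not> solved (s3 ''col'')" using c3 that by blast
        show "wp L (Seq Walk (Seq (asg ''s'' (vr ''z'')) (Seq Step (Unless (V ''col'' (vr ''r'')) Try)))) ?Q s3"
        proof (rule wp_Seq[OF W])
          fix s4 assume 4: "sound (s4 ''col'') (s4 ''r'' 0) \<and> (solved (s4 ''col'') \<or>
            \<not> solved (s3 ''col'') \<and> s4 ''r'' 0 = a \<and> away \<psi> z a b d (s4 ''col''))" and sm4: "same (mods Walk) s3 s4"
          have env4: "tables_ok s4" by (rule tables_ok_same[OF env3 sm4]) (simp add: mods_Walk)
          have hd4: "sound (s4 ''col'') (s4 ''r'' 0)" using 4 by blast
          have z4: "s4 ''z'' 0 = z" using sm4 e3 by (simp add: same_def mods_Walk)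
          let ?P = "\<lambda>\<chi>. stuck \<psi> z \<and> holed \<chi> z \<and> (b \<noteq> a \<longrightarrow> \<chi> b = \<psi> d \<and> \<chi> a = \<psi> b \<and>
            (\<forall>y. (z, y) \<in> ugraph A \<longrightarrow> y \<noteq> b \<longrightarrow> y \<noteq> a \<longrightarrow> \<chi> y = \<psi> y))"
          show "wp L (Seq (asg ''s'' (vr ''z'')) (Seq Step (Unless (V ''col'' (vr ''r'')) Try))) ?Q s4"
          proof (rule step_to[OF env4 hd4, where q = z and P = ?P])
            show "aval (vr ''z'') s4 = z" using z4 by simp
            show "(s4 ''r'' 0, z) \<in> ugraph A" if "\<not> solved (s4 ''col'')" using 4 that adj(1) ugraph_commute by blast
            show "?P \<chi>" if "\<not> solved (s4 ''col'')" "\<chi> = s4 ''col'' \<circ> transpose (s4 ''r'' 0) z" "holed \<chi> z" for \<chi>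
            proof -
              have e: "\<chi> = s4 ''col'' \<circ> transpose a z" and aw: "away \<psi> z a b d (s4 ''col'')" using 4 that by auto
              have az: "a \<noteq> z" "b \<noteq> z" using ugraph_ne adj by blast+
              show ?thesis
              proof (intro conjI impI allI)
                show "holed \<chi> z" by (rule that)
                show "stuck \<psi> z" using 4 that stz by blast
                assume ba: "b \<noteq> a"
                show "\<chi> b = \<psi> d" using aw ba az unfolding e away_def by simp
                show "\<chi> a = \<psi> b" using aw ba unfolding e away_def by simp
                fix y assume y: "(z, y) \<in> ugraph A" "y \<noteq> b" "y \<noteq> a"
                then have "y \<noteq> z" using ugraph_ne by blast
                then show "\<chi> y = \<psi> y" using aw ba y unfolding e away_def by simp
              qed
            qed
            fix s5 assume env5: "tables_ok s5" and hd5: "sound (s5 ''col'') (s5 ''r'' 0)"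
              and c5: "solved (s5 ''col'') \<or> s5 ''r'' 0 = z \<and> ?P (s5 ''col'')"
            show "wp L (Unless (V ''col'' (vr ''r'')) Try) ?Q s5"
            proof (rule wp_Unless)
              assume "aval (V ''col'' (vr ''r'')) s5 \<noteq> 0"
              then show "?Q s5" using hd5 sound_solved by simp
            next
              assume "aval (V ''col'' (vr ''r'')) s5 = 0"
              then have c: "holed (s5 ''col'') (s5 ''r'' 0)" using sound_holed[OF hd5] by simp
              have r5: "s5 ''r'' 0 < n" using hd5 unfolding sound_def by blast
              have "\<not> solved (s5 ''col'')" using solved_nonzero[of "s5 ''col''" "s5 ''r'' 0"] r5 holed_zero[OF c] by blast
              then have p5: "s5 ''r'' 0 = z" "?P (s5 ''col'')" using c5 by blast+
              have sup5: "\<forall>v \<ge> n. s5 ''col'' v = 0" using hd5 unfolding sound_def by blast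
              show "wp L Try ?Q s5"
              proof (rule wp_weaken[OF Try_sound[OF env5 c sup5]])
                fix s6 assume 6: "(s6 ''col'' = s5 ''col'' \<and> stuck (s5 ''col'') (s5 ''r'' 0)) \<or>
                  (sound (s6 ''col'') (s5 ''r'' 0) \<and> solved (s6 ''col''))" and sm6: "same (mods Try) s5 s6"
                have r6: "s6 ''r'' 0 = s5 ''r'' 0" using sm6 by (simp add: same_def mods_Try)
                show "?Q s6"
                proof (cases "solved (s6 ''col'')")
                  case True
                  then have "s6 ''col'' \<noteq> s5 ''col''" using \<open>\<not> solved (s5 ''col'')\<close> by auto
                  then show ?thesis using 6 r6 by simp
                next
                  case nw6: False
                  then have e6: "s6 ''col'' = s5 ''col''" "stuck (s5 ''col'') z" using 6 p5 by auto
                  have "probe_ok \<psi> z a b d"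
                    unfolding probe_ok_def
                  proof
                    assume ba: "b \<noteq> a"
                    show "\<psi> d = \<psi> a \<and> (arc_type A z b \<noteq> arc_type A z a \<longrightarrow> \<psi> b = \<psi> a)"
                      by (rule probe_calm[OF \<psi>(1) conjunct1[OF p5(2)] e6(2) adj(2,1) ba dn(1) dz(1)]) (use p5 ba in auto)
                  qed
                  then show ?thesis using e6 hd5 r6 by simp
                qed
              qed
            qed
          qed
        qed
      qed
    qed
  qed
qed

end

section \<open>Processing a stored colouring\<close>

text \<open>
  The transposition of \<open>z\<close> and \<open>a\<close> applied to a component of the processed triple.
\<close>
definition Image :: "string \<Rightarrow> string \<Rightarrow> com" where
  "Image v q = Seq (asg v (V q (vr ''h''))) (Cond (neq (vr v) (vr ''a''))
     (Cond (neq (vr v) (vr ''z'')) Skip (asg v (vr ''a''))) (asg v (vr ''z'')))"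

definition Child :: com where
  "Child = Unless (V ''col'' (vr ''r'')) (Seq Load (Seq (asg ''s'' (vr ''a'')) (Seq Step
     (Unless (V ''col'' (vr ''r'')) (Seq (Image ''x'' ''qx'') (Seq (Image ''y'' ''qy'') Push))))))"

definition Children :: com where
  "Children = For ''a'' (vr ''n'') (When (adjE (vr ''z'') (vr ''a'')) Child)"

definition Probes_d :: com where
  "Probes_d = For ''d'' (vr ''n'') (When (V ''mark'' (vr ''d'')) (When (adjE (vr ''b'') (vr ''d'')) Probe))"

definition Probes_b :: com where
  "Probes_b = For ''b'' (vr ''n'') (When (adjE (vr ''z'') (vr ''b'')) Probes_d)"

definition Probes :: com where
  "Probes = For ''a'' (vr ''n'') (When (adjE (vr ''z'') (vr ''a'')) (Seq (asg ''x'' (vr ''a'')) (Seq Rank Probes_b)))"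

definition Far :: com where
  "Far = Seq (For ''w'' (vr ''n'') (Cond (adjE (vr ''z'') (vr ''w'')) (Assign ''al'' (vr ''w'') (N 0))
     (Assign ''al'' (vr ''w'') (N 1)))) (Assign ''al'' (vr ''z'') (N 0))"

definition Process :: com where
  "Process = Seq Load (Seq Try (Unless (V ''col'' (vr ''r''))
     (Seq (asg ''z'' (V ''qr'' (vr ''h''))) (Seq Far (Seq Probes Children)))))"

definition Main :: com where
  "Main = Seq (asg ''h'' (N 0)) (While (Minus (vr ''T'') (vr ''h''))
     (Seq (Unless (V ''col'' (vr ''r'')) Process) (asg ''h'' (Plus (vr ''h'') (N 1)))))"

definition Seed :: com where
  "Seed = When (neq (V ''col'' (vr ''u'')) (V ''col'' (vr ''v'')))
     (Seq (asg ''x'' (vr ''u'')) (Seq (asg ''y'' (vr ''v'')) Push))"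

definition Seeds :: com where
  "Seeds = Seq (asg ''T'' (N 0)) (For ''u'' (vr ''n'') (For ''v'' (vr ''n'') Seed))"

lemma mods_Child: "mods Child = {''w'', ''col'', ''r'', ''s'', ''i'', ''o'', ''e'', ''x'', ''y'', ''j'', ''fd'', ''conf'', ''qr'', ''qx'', ''qy'', ''T''}"
  by (auto simp: Child_def mods_Load mods_Step Image_def mods_Push)
lemma mods_Children: "mods Children = insert ''a'' (mods Child)"
  by (simp add: Children_def)
lemma mods_Probes_d: "mods Probes_d = insert ''d'' (mods Probe)"
  by (simp add: Probes_d_def)
lemma mods_Probes_b: "mods Probes_b = insert ''b'' (insert ''d'' (mods Probe))"
  by (simp add: Probes_b_def mods_Probes_d)
lemma mods_Probes: "mods Probes = insert ''a'' (insert ''x'' (mods Rank \<union> insert ''b'' (insert ''d'' (mods Probe))))"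
  by (auto simp: Probes_def mods_Probes_b)
lemma mods_Far: "mods Far = {''w'', ''al''}"
  by (auto simp: Far_def)
lemma mods_Process: "mods Process = mods Load \<union> mods Try \<union> {''z''} \<union> mods Far \<union> mods Probes \<union> mods Children"
  by (auto simp: Process_def)
lemma mods_Seed: "mods Seed = {''x'', ''y''} \<union> mods Push"
  by (auto simp: Seed_def)

context prog
begin

definition entry :: "(nat \<Rightarrow> nat) \<Rightarrow> state \<Rightarrow> nat \<Rightarrow> bool" where
  "entry \<phi> s k \<longleftrightarrow> (case triple s k of (r, x, y) \<Rightarrow> x < n \<and> y < n \<and> holed (stored s k) r \<and>
     reach (ugraph A) U \<phi> 0 (stored s k) r \<and> stored s k x \<noteq> stored s k y)"

text \<open>
  Since the triples are distinct, the queue has at most \<open>n * n * n\<close> entries.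
\<close>
definition queue :: "(nat \<Rightarrow> nat) \<Rightarrow> state \<Rightarrow> bool" where
  "queue \<phi> s \<longleftrightarrow> (\<forall>k < s ''T'' 0. entry \<phi> s k) \<and> inj_on (triple s) {..<s ''T'' 0}"

definition extends :: "state \<Rightarrow> state \<Rightarrow> bool" where
  "extends s s' \<longleftrightarrow> s ''T'' 0 \<le> s' ''T'' 0 \<and> (\<forall>k < s ''T'' 0. triple s' k = triple s k \<and> stored s' k = stored s k)"

lemma extends_refl: "extends s s" by (simp add: extends_def)

lemma extends_trans: "extends s s' \<Longrightarrow> extends s' s'' \<Longrightarrow> extends s s''"
  unfolding extends_def by (metis le_trans less_le_trans)

lemma same_queue:
  assumes "same X s s'" "X \<inter> {''T'', ''qr'', ''qx'', ''qy'', ''conf''} = {}"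
  shows "triple s' = triple s" "stored s' = stored s" "s' ''T'' 0 = s ''T'' 0" "extends s s'" "queue \<phi> s' = queue \<phi> s"
proof -
  have e: "s' x = s x" if "x \<in> {''T'', ''qr'', ''qx'', ''qy'', ''conf''}" for x
    using assms that unfolding same_def by blast
  have a: "triple s' = triple s" "stored s' = stored s" "s' ''T'' 0 = s ''T'' 0"
    using e by (simp_all add: triple_def[abs_def] stored_def[abs_def] cong: if_cong)
  then show "triple s' = triple s" "stored s' = stored s" "s' ''T'' 0 = s ''T'' 0" "extends s s'" "queue \<phi> s' = queue \<phi> s"
    by (simp_all add: extends_def queue_def entry_def)
qed

lemma upd_queue:
  assumes "v \<notin> {''T'', ''qr'', ''qx'', ''qy'', ''conf''}"
  shows "triple (s(v := g)) = triple s" "stored (s(v := g)) = stored s" "(s(v := g)) ''T'' = s ''T''"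
    "extends s0 (s(v := g)) = extends s0 s" "extends (s(v := g)) s0 = extends s s0" "queue \<phi> (s(v := g)) = queue \<phi> s"
proof -
  have sm: "same {v} s (s(v := g))" by (simp add: same_def)
  have d: "{v} \<inter> {''T'', ''qr'', ''qx'', ''qy'', ''conf''} = {}" using assms by blast
  note q = same_queue[OF sm d]
  show "triple (s(v := g)) = triple s" "stored (s(v := g)) = stored s" "queue \<phi> (s(v := g)) = queue \<phi> s" using q by simp_all
  show "(s(v := g)) ''T'' = s ''T''" using assms by auto
  show "extends s0 (s(v := g)) = extends s0 s" "extends (s(v := g)) s0 = extends s s0"
    unfolding extends_def using q(1,2,3) by simp_all
qed

lemma queue_le: assumes "queue \<phi> s" shows "s ''T'' 0 \<le> n * n * n"
proof -
  have "triple s ` {..<s ''T'' 0} \<subseteq> {..<n} \<times> {..<n} \<times> {..<n}"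
    using assms unfolding queue_def entry_def holed_def by (fastforce split: prod.splits)
  then have "card {..<s ''T'' 0} \<le> card ({..<n} \<times> {..<n} \<times> {..<n})"
    using assms unfolding queue_def by (intro card_inj_on_le) auto
  then show ?thesis by (simp add: card_cartesian_product)
qed

lemma Push_queue:
  assumes env: "tables_ok s" and q: "queue \<phi> s" and sup: "\<forall>v \<ge> n. s ''col'' v = 0"
    and new: "s ''x'' 0 < n" "s ''y'' 0 < n" "holed (s ''col'') (s ''r'' 0)" "reach (ugraph A) U \<phi> 0 (s ''col'') (s ''r'' 0)"
      "s ''col'' (s ''x'' 0) \<noteq> s ''col'' (s ''y'' 0)"
  shows "wp L Push (\<lambda>s'. queue \<phi> s' \<and> extends s s' \<and> (\<exists>k < s' ''T'' 0. triple s' k = current s)) s"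
proof (rule wp_weaken[OF Push_wp[OF env queue_le[OF q] sup]])
  fix s'
  let ?T = "s ''T'' 0"
  assume *: "(if \<exists>k < ?T. triple s k = current s then s' ''T'' 0 = ?T
      else s' ''T'' 0 = Suc ?T \<and> triple s' ?T = current s \<and> stored s' ?T = s ''col'') \<and>
      (\<forall>k < ?T. triple s' k = triple s k \<and> stored s' k = stored s k)"
  then have old: "\<And>k. k < ?T \<Longrightarrow> triple s' k = triple s k \<and> stored s' k = stored s k" by blast
  have oe: "entry \<phi> s' k" if "k < ?T" for k using q old[OF that] that unfolding queue_def entry_def by simp
  have oi: "inj_on (triple s') {..<?T}"
    using q old unfolding queue_def inj_on_def by simp
  show "queue \<phi> s' \<and> extends s s' \<and> (\<exists>k < s' ''T'' 0. triple s' k = current s)"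
  proof (cases "\<exists>k < ?T. triple s k = current s")
    case True
    then have T': "s' ''T'' 0 = ?T" using * by simp
    show ?thesis using True oe oi old unfolding queue_def extends_def T' by auto
  next
    case False
    then have T': "s' ''T'' 0 = Suc ?T" "triple s' ?T = current s" "stored s' ?T = s ''col''" using * by simp_all
    have ne: "entry \<phi> s' ?T" unfolding entry_def T' using new by (simp add: current_def)
    have "triple s' ?T \<notin> triple s' ` {..<?T}" using False old T'(2) by auto
    then have "inj_on (triple s') {..<Suc ?T}" using oi by (simp add: lessThan_Suc)
    then show ?thesis using oe ne old T' unfolding queue_def extends_def by (auto simp: less_Suc_eq)
  qed
qed

lemma Image_wp:
  assumes v: "v \<notin> {''a'', ''z'', ''h''}" and za: "s ''z'' 0 \<noteq> s ''a'' 0"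
  shows "wp L (Image v q) (\<lambda>s'. s' v 0 = transpose (s ''z'' 0) (s ''a'' 0) (s q (s ''h'' 0))) s"
  unfolding Image_def
proof (rule wp_SeqA)
  let ?s = "s(v := (s v)(aval (N 0) s := aval (V q (vr ''h'')) s))"
  have e: "?s v 0 = s q (s ''h'' 0)" "?s ''a'' 0 = s ''a'' 0" "?s ''z'' 0 = s ''z'' 0" using v by auto
  show "wp L (Cond (neq (vr v) (vr ''a''))
     (Cond (neq (vr v) (vr ''z'')) Skip (asg v (vr ''a''))) (asg v (vr ''z'')))
     (\<lambda>s'. s' v 0 = transpose (s ''z'' 0) (s ''a'' 0) (s q (s ''h'' 0))) ?s"
  proof (intro wp_Cond)
    assume "aval (neq (vr v) (vr ''a'')) ?s \<noteq> 0" "aval (neq (vr v) (vr ''z'')) ?s \<noteq> 0"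
    then have "aval (vr v) ?s \<noteq> aval (vr ''a'') ?s" "aval (vr v) ?s \<noteq> aval (vr ''z'') ?s" unfolding neq_val by blast+
    then show "wp L Skip (\<lambda>s'. s' v 0 = transpose (s ''z'' 0) (s ''a'' 0) (s q (s ''h'' 0))) ?s"
      using e by (intro wp_Skip) simp
  next
    assume "aval (neq (vr v) (vr ''z'')) ?s = 0"
    then have "aval (vr v) ?s = aval (vr ''z'') ?s" unfolding neq_val .
    then have "s q (s ''h'' 0) = s ''z'' 0" using e by simp
    then show "wp L (asg v (vr ''a'')) (\<lambda>s'. s' v 0 = transpose (s ''z'' 0) (s ''a'' 0) (s q (s ''h'' 0))) ?s"
      using e by (intro wp_Assign) simp
  next
    assume "aval (neq (vr v) (vr ''a'')) ?s = 0"
    then have "aval (vr v) ?s = aval (vr ''a'') ?s" unfolding neq_val .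
    then have "s q (s ''h'' 0) = s ''a'' 0" using e by simp
    then show "wp L (asg v (vr ''z'')) (\<lambda>s'. s' v 0 = transpose (s ''z'' 0) (s ''a'' 0) (s q (s ''h'' 0))) ?s"
      using e by (intro wp_Assign) simp
  qed
qed

text \<open>
  Sliding the hole from \<open>z\<close> to \<open>a\<close> turns the triple \<open>(z, x, y)\<close> into its image under the
  transposition of \<open>z\<close> and \<open>a\<close>, and its witness into a witness of the image.
\<close>
lemma Child_wp:
  assumes env: "tables_ok s" and q: "queue \<phi> s" and h: "s ''h'' 0 < s ''T'' 0" and hd: "sound (s ''col'') (s ''r'' 0)"
    and t: "triple s (s ''h'' 0) = (z, x, y)" and z: "s ''z'' 0 = z" "s ''a'' 0 = a" "(z, a) \<in> ugraph A"
  shows "wp L Child (\<lambda>s'. sound (s' ''col'') (s' ''r'' 0) \<and> queue \<phi> s' \<and> extends s s' \<and> (solved (s' ''col'') \<or>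
    (\<exists>k < s' ''T'' 0. triple s' k = (a, transpose z a x, transpose z a y)))) s" (is "wp L _ ?Q s")
  unfolding Child_def
proof (rule wp_Unless)
  assume "aval (V ''col'' (vr ''r'')) s \<noteq> 0"
  then show "?Q s" using hd sound_solved q extends_refl by simp
next
  let ?\<psi> = "stored s (s ''h'' 0)"
  have E: "x < n" "y < n" "holed ?\<psi> z" "reach (ugraph A) U \<phi> 0 ?\<psi> z" "?\<psi> x \<noteq> ?\<psi> y"
    using q h t unfolding queue_def entry_def by auto
  have qr: "s ''qr'' (s ''h'' 0) = z" "s ''qx'' (s ''h'' 0) = x" "s ''qy'' (s ''h'' 0) = y" using t by (simp_all add: triple_def)
  have sup: "\<forall>v \<ge> n. s ''col'' v = 0" using hd unfolding sound_def by blast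
  have hn: "s ''h'' 0 \<le> n * n * n" using h queue_le[OF q] by simp
  have an: "a < n" "z < n" "z \<noteq> a" using z ugraph_in ugraph_ne by blast+
  show "wp L (Seq Load (Seq (asg ''s'' (vr ''a'')) (Seq Step
     (Unless (V ''col'' (vr ''r'')) (Seq (Image ''x'' ''qx'') (Seq (Image ''y'' ''qy'') Push)))))) ?Q s"
  proof (rule wp_Seq[OF Load_wp[OF env hn sup]])
    fix s1 assume "s1 ''col'' = ?\<psi> \<and> s1 ''r'' 0 = s ''qr'' (s ''h'' 0)" and sm1: "same (mods Load) s s1"
    then have 1: "s1 ''col'' = ?\<psi>" "s1 ''r'' 0 = z" using qr by auto
    have env1: "tables_ok s1" by (rule tables_ok_same[OF env sm1]) (simp add: mods_Load)
    have hd1: "sound (s1 ''col'') (s1 ''r'' 0)" unfolding sound_def 1 using E(3) an by (auto simp: stored_def)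
    show "wp L (Seq (asg ''s'' (vr ''a'')) (Seq Step
     (Unless (V ''col'' (vr ''r'')) (Seq (Image ''x'' ''qx'') (Seq (Image ''y'' ''qy'') Push))))) ?Q s1"
    proof (rule step_to[OF env1 hd1, where q = a and P = "\<lambda>\<chi>. \<chi> = ?\<psi> \<circ> transpose z a \<and> holed \<chi> a"])
      show "aval (vr ''a'') s1 = a" using sm1 z by (simp add: same_def mods_Load)
      show "(s1 ''r'' 0, a) \<in> ugraph A" using 1 z by simp
      show "\<chi> = ?\<psi> \<circ> transpose z a \<and> holed \<chi> a" if "\<chi> = s1 ''col'' \<circ> transpose (s1 ''r'' 0) a" "holed \<chi> a" for \<chi>
        using that 1 by simp
      fix s2 assume env2: "tables_ok s2" and sm2: "same {''s'', ''i'', ''w'', ''o'', ''e'', ''col'', ''r''} s1 s2"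
        and hd2: "sound (s2 ''col'') (s2 ''r'' 0)"
        and c2: "solved (s2 ''col'') \<or> s2 ''r'' 0 = a \<and> s2 ''col'' = ?\<psi> \<circ> transpose z a \<and> holed (s2 ''col'') a"
      have sm12: "same ({''s'', ''i'', ''w'', ''o'', ''e'', ''col'', ''r''}) s s2"
        using sm1 sm2 by (auto simp: same_def mods_Load)
      have qs2: "queue \<phi> s2" "extends s s2" "triple s2 = triple s" "stored s2 = stored s"
        using same_queue[OF sm12] q by simp_all
      have v2: "s2 ''z'' 0 = z" "s2 ''a'' 0 = a" "s2 ''h'' = s ''h''" "s2 ''qx'' = s ''qx''" "s2 ''qy'' = s ''qy''"
        using sm12 z by (simp_all add: same_def)
      show "wp L (Unless (V ''col'' (vr ''r'')) (Seq (Image ''x'' ''qx'') (Seq (Image ''y'' ''qy'') Push))) ?Q s2"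
      proof (rule wp_Unless)
        assume "aval (V ''col'' (vr ''r'')) s2 \<noteq> 0"
        then show "?Q s2" using hd2 sound_solved qs2 by simp
      next
        assume "aval (V ''col'' (vr ''r'')) s2 = 0"
        then have "\<not> solved (s2 ''col'')" using sound_solved[OF hd2] by simp
        then have p2: "s2 ''r'' 0 = a" "s2 ''col'' = ?\<psi> \<circ> transpose z a" "holed (s2 ''col'') a" using c2 by blast+
        have "wp L (Image ''x'' ''qx'') (\<lambda>s3. s3 ''x'' 0 = transpose z a x) s2"
          using Image_wp[of "''x''" s2 "''qx''"] v2 an qr by simp
        then show "wp L (Seq (Image ''x'' ''qx'') (Seq (Image ''y'' ''qy'') Push)) ?Q s2"
        proof (rule wp_Seq)
          fix s3 assume x3: "s3 ''x'' 0 = transpose z a x" and sm3: "same (mods (Image ''x'' ''qx'')) s2 s3"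
          have sm3': "same {''x''} s2 s3" using sm3 by (simp add: Image_def)
          have v3: "s3 ''z'' 0 = z" "s3 ''a'' 0 = a" "s3 ''h'' = s ''h''" "s3 ''qy'' = s ''qy''"
            using sm3' v2 by (simp_all add: same_def)
          have "wp L (Image ''y'' ''qy'') (\<lambda>s4. s4 ''y'' 0 = transpose z a y) s3"
            using Image_wp[of "''y''" s3 "''qy''"] v3 an qr by simp
          then show "wp L (Seq (Image ''y'' ''qy'') Push) ?Q s3"
          proof (rule wp_Seq)
            fix s4 assume y4: "s4 ''y'' 0 = transpose z a y" and sm4: "same (mods (Image ''y'' ''qy'')) s3 s4"
            have sm4': "same {''y''} s3 s4" using sm4 by (simp add: Image_def)
            have sm24: "same {''x'', ''y''} s2 s4" using sm3' sm4' by (simp add: same_def)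
            have v4: "s4 ''x'' 0 = transpose z a x" "s4 ''r'' = s2 ''r''" "s4 ''col'' = s2 ''col''"
              using sm4' sm24 x3 by (simp_all add: same_def)
            have env4: "tables_ok s4" by (rule tables_ok_same[OF env2 sm24]) simp
            have q4: "queue \<phi> s4" "extends s s4" using same_queue[OF sm24] qs2 extends_trans by auto
            have "wp L Push (\<lambda>s'. queue \<phi> s' \<and> extends s4 s' \<and> (\<exists>k < s' ''T'' 0. triple s' k = current s4)) s4"
            proof (rule Push_queue[OF env4 q4(1)])
              show "\<forall>v \<ge> n. s4 ''col'' v = 0" using hd2 v4 unfolding sound_def by simp
              show "s4 ''x'' 0 < n" "s4 ''y'' 0 < n" using v4 y4 E an by (auto simp: transpose_def)
              show "holed (s4 ''col'') (s4 ''r'' 0)" using v4 p2 by simp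
              show "reach (ugraph A) U \<phi> 0 (s4 ''col'') (s4 ''r'' 0)"
                using reach_step[OF E(4) z(3)] an v4 p2 by simp
              show "s4 ''col'' (s4 ''x'' 0) \<noteq> s4 ''col'' (s4 ''y'' 0)" using v4 p2 y4 E(5) by simp
            qed
            then show "wp L Push ?Q s4"
            proof (rule wp_weaken)
              fix s5 assume 5: "queue \<phi> s5 \<and> extends s4 s5 \<and> (\<exists>k < s5 ''T'' 0. triple s5 k = current s4)"
                and sm5: "same (mods Push) s4 s5"
              have "s5 ''col'' = s2 ''col''" "s5 ''r'' 0 = s2 ''r'' 0" using sm5 v4 by (simp_all add: same_def mods_Push)
              moreover have "current s4 = (a, transpose z a x, transpose z a y)" using v4 y4 p2 by (simp add: current_def)
              ultimately show "?Q s5" using 5 hd2 q4(2) extends_trans by auto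
            qed
          qed
        qed
      qed
    qed
  qed
qed

lemma Child_done: "s ''col'' (s ''r'' 0) \<noteq> 0 \<Longrightarrow> Q s \<Longrightarrow> wp L Child Q s"
  unfolding Child_def by (rule wp_Unless) simp_all

lemma Probe_done: "s ''col'' (s ''r'' 0) \<noteq> 0 \<Longrightarrow> Q s \<Longrightarrow> wp L Probe Q s"
  unfolding Probe_def by (rule wp_Unless) simp_all

lemma Children_wp:
  assumes env: "tables_ok s" and q: "queue \<phi> s" and h: "s ''h'' 0 < s ''T'' 0" and hd: "sound (s ''col'') (s ''r'' 0)"
    and t: "triple s (s ''h'' 0) = (z, x, y)" and z: "s ''z'' 0 = z"
  shows "wp L Children (\<lambda>s'. sound (s' ''col'') (s' ''r'' 0) \<and> queue \<phi> s' \<and> extends s s' \<and> (solved (s' ''col'') \<or>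
    \<not> solved (s ''col'') \<and> (\<forall>a. (z, a) \<in> ugraph A \<longrightarrow> (\<exists>k < s' ''T'' 0. triple s' k = (a, transpose z a x, transpose z a y))))) s"
  unfolding Children_def
proof (rule wp_For[where m = n and I = "\<lambda>b s'. sound (s' ''col'') (s' ''r'' 0) \<and> queue \<phi> s' \<and> extends s s' \<and> (solved (s' ''col'') \<or>
    \<not> solved (s ''col'') \<and> (\<forall>a < b. (z, a) \<in> ugraph A \<longrightarrow> (\<exists>k < s' ''T'' 0. triple s' k = (a, transpose z a x, transpose z a y))))"], goal_cases)
  case 1 show ?case by (rule L_bounds)
next
  case 2 show ?case by (simp add: mods_Child)
next
  case 3 show ?case using q hd extends_refl by simp
next
  case (4 k s1 g)
  then show ?case by (simp add: upd_queue)
next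
  case (5 s1) then show ?case using tables_okD(1)[OF env] by (simp add: same_def mods_Child)
next
  case (6 b s1)
  have env1: "tables_ok s1" by (rule tables_ok_same[OF env 6(4)]) (simp add: mods_Child)
  have v: "s1 ''z'' 0 = z" "s1 ''h'' = s ''h''" using 6(4) z by (simp_all add: same_def mods_Child)
  have ex: "extends s s1" using 6(3) by blast
  have t1: "triple s1 (s1 ''h'' 0) = (z, x, y)" "s1 ''h'' 0 < s1 ''T'' 0" using ex h t v unfolding extends_def by auto
  have zn: "z < n"
  proof -
    have "entry \<phi> s (s ''h'' 0)" using q h unfolding queue_def by blast
    then show ?thesis using t unfolding entry_def holed_def by simp
  qed
  have adj: "aval (adjE (vr ''z'') (vr ''a'')) s1 = 0 \<longleftrightarrow> (z, b) \<notin> ugraph A"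
    using adj_val[OF env1, of "vr ''z''" "vr ''a''"] v 6(1,2) zn by simp
  show ?case
  proof (rule wp_When)
    assume "aval (adjE (vr ''z'') (vr ''a'')) s1 \<noteq> 0"
    then have zb: "(z, b) \<in> ugraph A" using adj by metis
    show "wp L Child (\<lambda>s'. sound (s' ''col'') (s' ''r'' 0) \<and> queue \<phi> s' \<and> extends s s' \<and> (solved (s' ''col'') \<or>
      \<not> solved (s ''col'') \<and> (\<forall>a < Suc b. (z, a) \<in> ugraph A \<longrightarrow> (\<exists>k < s' ''T'' 0. triple s' k = (a, transpose z a x, transpose z a y))))) s1"
    proof (cases "solved (s1 ''col'')")
      case True
      have "s1 ''r'' 0 < n" using 6(3) unfolding sound_def by blast
      then show ?thesis using 6(3) True by (intro Child_done) (simp_all add: solved_nonzero)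
    next
      case nw1: False
      show ?thesis
      proof (rule wp_weaken[OF Child_wp[OF env1 _ t1(2) _ t1(1) v(1) 6(2) zb]])
      show "queue \<phi> s1" "sound (s1 ''col'') (s1 ''r'' 0)" using 6(3) by blast+
      fix s2 assume 2: "sound (s2 ''col'') (s2 ''r'' 0) \<and> queue \<phi> s2 \<and> extends s1 s2 \<and> (solved (s2 ''col'') \<or>
        (\<exists>k < s2 ''T'' 0. triple s2 k = (b, transpose z b x, transpose z b y)))" and sm2: "same (mods Child) s1 s2"
      have "\<exists>k < s2 ''T'' 0. triple s2 k = (a, transpose z a x, transpose z a y)"
        if "\<not> solved (s2 ''col'')" "a < Suc b" "(z, a) \<in> ugraph A" for a
      proof (cases "a = b")
        case True then show ?thesis using 2 that by blast
      next
        case False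
        have ab: "a < b" "(z, a) \<in> ugraph A" using that False by simp_all
        obtain k where "k < s1 ''T'' 0" "triple s1 k = (a, transpose z a x, transpose z a y)"
          using 6(3) nw1 ab by blast
        then show ?thesis using 2 unfolding extends_def by (metis less_le_trans)
      qed
      then show "sound (s2 ''col'') (s2 ''r'' 0) \<and> queue \<phi> s2 \<and> extends s s2 \<and> (solved (s2 ''col'') \<or>
        \<not> solved (s ''col'') \<and> (\<forall>a < Suc b. (z, a) \<in> ugraph A \<longrightarrow> (\<exists>k < s2 ''T'' 0. triple s2 k = (a, transpose z a x, transpose z a y))))"
        using 2 ex extends_trans 6(3) nw1 by blast
      qed
    qed
  next
    assume "aval (adjE (vr ''z'') (vr ''a'')) s1 = 0"
    then have "(z, b) \<notin> ugraph A" using adj by metis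
    then show "sound (s1 ''col'') (s1 ''r'' 0) \<and> queue \<phi> s1 \<and> extends s s1 \<and> (solved (s1 ''col'') \<or>
      \<not> solved (s ''col'') \<and> (\<forall>a < Suc b. (z, a) \<in> ugraph A \<longrightarrow> (\<exists>k < s1 ''T'' 0. triple s1 k = (a, transpose z a x, transpose z a y))))"
      using 6(3) by (auto simp: less_Suc_eq)
  qed
next
  case (7 s1)
  then show ?case using ugraph_in by blast
qed

definition processing :: "state \<Rightarrow> nat \<Rightarrow> (nat \<Rightarrow> nat) \<Rightarrow> (nat \<Rightarrow> nat) \<Rightarrow> bool" where
  "processing s z \<psi> al \<longleftrightarrow> tables_ok s \<and> s ''h'' 0 \<le> n * n * n \<and> holed \<psi> z \<and> stored s (s ''h'' 0) = \<psi> \<and> s ''qr'' (s ''h'' 0) = z \<and>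
     s ''z'' 0 = z \<and> s ''al'' = al \<and> (\<forall>v < n. al v \<noteq> 0 \<longleftrightarrow> v \<noteq> z \<and> (z, v) \<notin> ugraph A)"

lemma processing_same:
  assumes "processing s z \<psi> al" "same X s s'"
    "X \<inter> {''n'', ''p'', ''arc'', ''f'', ''mn'', ''mp'', ''h'', ''conf'', ''qr'', ''z'', ''al''} = {}"
  shows "processing s' z \<psi> al"
proof -
  have e: "s' x = s x" if "x \<in> {''h'', ''conf'', ''qr'', ''z'', ''al''}" for x
    using assms(2,3) that unfolding same_def by blast
  have "tables_ok s'" by (rule tables_ok_same[OF _ assms(2)]) (use assms(1,3) in \<open>auto simp: processing_def\<close>)
  then show ?thesis using assms(1) e unfolding processing_def by (simp add: stored_def cong: if_cong)
qed

lemma full_rank_same: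
  assumes "full_rank s al a" "same X s s'" "X \<inter> {''mark'', ''par'', ''ord'', ''c''} = {}"
  shows "full_rank s' al a" "s' ''mark'' = s ''mark''"
proof -
  have e: "s' x = s x" if "x \<in> {''mark'', ''par'', ''ord'', ''c''}" for x
    using assms(2,3) that unfolding same_def by blast
  have m: "s' ''mark'' = s ''mark''" "s' ''par'' = s ''par''" "s' ''ord'' = s ''ord''" "s' ''c'' = s ''c''"
    by (simp_all add: e)
  show "full_rank s' al a" using assms(1) unfolding full_rank_def m .
  show "s' ''mark'' = s ''mark''" by (rule m)
qed

lemma processing_adj:
  assumes "processing s z \<psi> al" "s v 0 < n"
  shows "aval (adjE (vr ''z'') (vr v)) s = 0 \<longleftrightarrow> (z, s v 0) \<notin> ugraph A"
  using adj_val[of s "vr ''z''" "vr v"] assms unfolding processing_def holed_def by simp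

lemma Probes_d_wp:
  assumes c: "processing s z \<psi> al" and hd: "sound (s ''col'') (s ''r'' 0)" and R: "full_rank s al a"
    and v: "s ''a'' 0 = a" "s ''b'' 0 = b" and adj: "(z, a) \<in> ugraph A" "(z, b) \<in> ugraph A"
  shows "wp L Probes_d (\<lambda>s'. sound (s' ''col'') (s' ''r'' 0) \<and> (solved (s' ''col'') \<or>
    \<not> solved (s ''col'') \<and> (\<forall>d < n. (b, d) \<in> ugraph A \<longrightarrow> s ''mark'' d \<noteq> 0 \<longrightarrow> probe_ok \<psi> z a b d))) s"
  unfolding Probes_d_def
proof (rule wp_For[where m = n and I = "\<lambda>q s'. sound (s' ''col'') (s' ''r'' 0) \<and> (solved (s' ''col'') \<or>
    \<not> solved (s ''col'') \<and> (\<forall>d < q. (b, d) \<in> ugraph A \<longrightarrow> s ''mark'' d \<noteq> 0 \<longrightarrow> probe_ok \<psi> z a b d))"], goal_cases)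
  case 1 show ?case by (rule L_bounds)
next
  case 2 show ?case by (simp add: mods_Probe)
next
  case 3 show ?case using hd by simp
next
  case (4 k s1 g) then show ?case by simp
next
  case (5 s1) then show ?case using c tables_okD(1)[of s] by (simp add: same_def mods_Probe processing_def)
next
  case (6 q s1)
  have sm: "same ({''d''} \<union> mods Probe) s s1" using 6(4) by simp
  have c1: "processing s1 z \<psi> al" by (rule processing_same[OF c sm]) (simp add: mods_Probe)
  have R1: "full_rank s1 al a" "s1 ''mark'' = s ''mark''" using full_rank_same[OF R sm] by (simp_all add: mods_Probe)
  have v1: "s1 ''a'' 0 = a" "s1 ''b'' 0 = b" using sm v by (simp_all add: same_def mods_Probe)
  have bn: "b < n" "s1 ''r'' 0 < n" using adj ugraph_in 6(3) unfolding sound_def by blast+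
  have bd: "aval (adjE (vr ''b'') (vr ''d'')) s1 = 0 \<longleftrightarrow> (b, q) \<notin> ugraph A"
    using adj_val[of s1 "vr ''b''" "vr ''d''"] c1 v1 6(1,2) bn unfolding processing_def by simp
  let ?Q = "\<lambda>s'. sound (s' ''col'') (s' ''r'' 0) \<and> (solved (s' ''col'') \<or>
    \<not> solved (s ''col'') \<and> (\<forall>d < Suc q. (b, d) \<in> ugraph A \<longrightarrow> s ''mark'' d \<noteq> 0 \<longrightarrow> probe_ok \<psi> z a b d))"
  have skip: "?Q s1" if "(b, q) \<in> ugraph A \<Longrightarrow> s ''mark'' q \<noteq> 0 \<Longrightarrow> False" using 6(3) that by (auto simp: less_Suc_eq)
  show ?case
  proof (intro wp_When)
    assume "aval (V ''mark'' (vr ''d'')) s1 = 0"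
    then have "s ''mark'' q = 0" using R1(2) 6(2) by simp
    then show "?Q s1" using skip by blast
  next
    assume "aval (adjE (vr ''b'') (vr ''d'')) s1 = 0"
    then have "(b, q) \<notin> ugraph A" using bd by metis
    then show "?Q s1" using skip by blast
  next
    assume a: "aval (V ''mark'' (vr ''d'')) s1 \<noteq> 0" "aval (adjE (vr ''b'') (vr ''d'')) s1 \<noteq> 0"
    have m: "s1 ''mark'' q \<noteq> 0" "(b, q) \<in> ugraph A" using a(1) 6(2) by simp (use a(2) bd in metis)
    show "wp L Probe ?Q s1"
    proof (cases "solved (s1 ''col'')")
      case True
      then show ?thesis using 6(3) bn(2) by (intro Probe_done) (simp_all add: solved_nonzero)
    next
      case False
      have "wp L Probe (\<lambda>s'. sound (s' ''col'') (s' ''r'' 0) \<and> (solved (s' ''col'') \<or> probe_ok \<psi> z a b q)) s1"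
        by (rule Probe_wp[OF _ _ _ _ _ _ _ R1(1) _ v1 6(2) adj m(2) m(1)]) (use c1 6(3) in \<open>auto simp: processing_def\<close>)
      then show ?thesis
        by (rule wp_weaken) (use 6(3) False in \<open>auto simp: less_Suc_eq\<close>)
    qed
  qed
next
  case (7 s1) then show ?case by blast
qed

lemma Probes_b_wp:
  assumes c: "processing s z \<psi> al" and hd: "sound (s ''col'') (s ''r'' 0)" and R: "full_rank s al a"
    and v: "s ''a'' 0 = a" and adj: "(z, a) \<in> ugraph A"
  shows "wp L Probes_b (\<lambda>s'. sound (s' ''col'') (s' ''r'' 0) \<and> (solved (s' ''col'') \<or> \<not> solved (s ''col'') \<and>
    (\<forall>b < n. (z, b) \<in> ugraph A \<longrightarrow> (\<forall>d < n. (b, d) \<in> ugraph A \<longrightarrow> s ''mark'' d \<noteq> 0 \<longrightarrow> probe_ok \<psi> z a b d)))) s"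
  unfolding Probes_b_def
proof (rule wp_For[where m = n and I = "\<lambda>q s'. sound (s' ''col'') (s' ''r'' 0) \<and> (solved (s' ''col'') \<or> \<not> solved (s ''col'') \<and>
    (\<forall>b < q. (z, b) \<in> ugraph A \<longrightarrow> (\<forall>d < n. (b, d) \<in> ugraph A \<longrightarrow> s ''mark'' d \<noteq> 0 \<longrightarrow> probe_ok \<psi> z a b d)))"], goal_cases)
  case 1 show ?case by (rule L_bounds)
next
  case 2 show ?case by (simp add: mods_Probes_d mods_Probe)
next
  case 3 show ?case using hd by simp
next
  case (4 k s1 g) then show ?case by simp
next
  case (5 s1) then show ?case using c tables_okD(1)[of s] by (simp add: same_def mods_Probes_d mods_Probe processing_def)
next
  case (6 q s1)
  have sm: "same ({''b'', ''d''} \<union> mods Probe) s s1" using 6(4) by (simp add: mods_Probes_d)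
  have c1: "processing s1 z \<psi> al" by (rule processing_same[OF c sm]) (simp add: mods_Probe)
  have R1: "full_rank s1 al a" "s1 ''mark'' = s ''mark''" using full_rank_same[OF R sm] by (simp_all add: mods_Probe)
  have v1: "s1 ''a'' 0 = a" using sm v by (simp add: same_def mods_Probe)
  have za: "aval (adjE (vr ''z'') (vr ''b'')) s1 = 0 \<longleftrightarrow> (z, q) \<notin> ugraph A" using processing_adj[OF c1, of "''b''"] 6(1,2) by simp
  show ?case
  proof (rule wp_When)
    assume "aval (adjE (vr ''z'') (vr ''b'')) s1 = 0"
    then show "sound (s1 ''col'') (s1 ''r'' 0) \<and> (solved (s1 ''col'') \<or> \<not> solved (s ''col'') \<and>
      (\<forall>b < Suc q. (z, b) \<in> ugraph A \<longrightarrow> (\<forall>d < n. (b, d) \<in> ugraph A \<longrightarrow> s ''mark'' d \<noteq> 0 \<longrightarrow> probe_ok \<psi> z a b d)))"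
    proof -
      have "(z, q) \<notin> ugraph A" using \<open>aval (adjE (vr ''z'') (vr ''b'')) s1 = 0\<close> za by metis
      then show ?thesis using 6(3) by (auto simp: less_Suc_eq)
    qed
  next
    assume "aval (adjE (vr ''z'') (vr ''b'')) s1 \<noteq> 0"
    then have zq: "(z, q) \<in> ugraph A" using za by metis
    have hd1: "sound (s1 ''col'') (s1 ''r'' 0)" using 6(3) by blast
    show "wp L Probes_d (\<lambda>s'. sound (s' ''col'') (s' ''r'' 0) \<and> (solved (s' ''col'') \<or> \<not> solved (s ''col'') \<and>
      (\<forall>b < Suc q. (z, b) \<in> ugraph A \<longrightarrow> (\<forall>d < n. (b, d) \<in> ugraph A \<longrightarrow> s ''mark'' d \<noteq> 0 \<longrightarrow> probe_ok \<psi> z a b d)))) s1"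
      by (rule wp_weaken[OF Probes_d_wp[OF c1 hd1 R1(1) v1 6(2) adj zq]])
        (use 6(3) R1(2) in \<open>auto simp: less_Suc_eq\<close>)
  qed
next
  case (7 s1) then show ?case by blast
qed

lemma linked_marked:
  assumes R: "full_rank s al a" and al: "\<And>v. v < n \<Longrightarrow> al v \<noteq> 0 \<longleftrightarrow> v \<noteq> z \<and> (z, v) \<notin> ugraph A" and a: "a < n"
    and l: "linked (ugraph A) (insert a {y \<in> U. y \<noteq> z \<and> (z, y) \<notin> ugraph A}) d a"
  shows "s ''mark'' d \<noteq> 0"
proof -
  have "ranked (s ''mark'') (s ''par'') (s ''ord'') (s ''c'' 0) al a" using R unfolding full_rank_def by blast
  then have "1 \<le> s ''c'' 0" "s ''ord'' 0 = a" "\<forall>k < s ''c'' 0. s ''mark'' (s ''ord'' k) = Suc k" unfolding ranked_def by blast+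
  then have ma: "s ''mark'' a \<noteq> 0" by (metis less_eq_Suc_le One_nat_def nat.distinct(1))
  have cl: "s ''mark'' w \<noteq> 0" if "v < n" "w < n" "s ''mark'' v \<noteq> 0" "(v, w) \<in> ugraph A" "al w \<noteq> 0" for v w
    using R that unfolding full_rank_def by blast
  have "linked (ugraph A) (insert a {y \<in> U. y \<noteq> z \<and> (z, y) \<notin> ugraph A}) a d" using linked_sym[OF ugraph_sym l] .
  then show ?thesis
  proof (induction rule: rtrancl_induct)
    case base show ?case by (rule ma)
  next
    case (step v w)
    then have vw: "(v, w) \<in> ugraph A" "w = a \<or> (w < n \<and> w \<noteq> z \<and> (z, w) \<notin> ugraph A)" by auto
    have "v < n" "w < n" using vw ugraph_in by blast+
    then show ?case using cl[of v w] step.IH vw ma al by blast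
  qed
qed

text \<open>
  For given \<open>a\<close> the search reaches exactly the vertices that are connected to \<open>a\<close> by non-neighbours
  of \<open>z\<close>, which are the possible second vertices \<open>d\<close> of the closed walks in question.
\<close>
lemma Probes_wp:
  assumes c: "processing s z \<psi> al" and hd: "sound (s ''col'') (s ''r'' 0)"
  shows "wp L Probes (\<lambda>s'. sound (s' ''col'') (s' ''r'' 0) \<and> (solved (s' ''col'') \<or> calm A U \<psi> z)) s"
  unfolding Probes_def
proof (rule wp_For[where m = n and I = "\<lambda>q s'. sound (s' ''col'') (s' ''r'' 0) \<and> (solved (s' ''col'') \<or>
    (\<forall>a < q. (z, a) \<in> ugraph A \<longrightarrow> (\<forall>b < n. (z, b) \<in> ugraph A \<longrightarrow> (\<forall>d < n. (b, d) \<in> ugraph A \<longrightarrow>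
      linked (ugraph A) (insert a {y \<in> U. y \<noteq> z \<and> (z, y) \<notin> ugraph A}) d a \<longrightarrow> probe_ok \<psi> z a b d))))"], goal_cases)
  case 1 show ?case by (rule L_bounds)
next
  case 2 show ?case by (simp add: mods_Probes_b mods_Probe mods_Rank)
next
  case 3 show ?case using hd by simp
next
  case (4 k s1 g) then show ?case by simp
next
  case (5 s1) then show ?case using c tables_okD(1)[of s] by (simp add: same_def mods_Probes_b mods_Probe mods_Rank processing_def)
next
  case (6 q s1)
  have sm: "same ({''a'', ''x'', ''b'', ''d''} \<union> mods Rank \<union> mods Probe) s s1"
    using 6(4) by (rule same_mono) (auto simp: mods_Probes_b)
  have c1: "processing s1 z \<psi> al" by (rule processing_same[OF c sm]) (simp add: mods_Probe mods_Rank)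
  let ?K = "\<lambda>a b d. linked (ugraph A) (insert a {y \<in> U. y \<noteq> z \<and> (z, y) \<notin> ugraph A}) d a \<longrightarrow> probe_ok \<psi> z a b d"
  let ?Q = "\<lambda>s'. sound (s' ''col'') (s' ''r'' 0) \<and> (solved (s' ''col'') \<or>
    (\<forall>a < Suc q. (z, a) \<in> ugraph A \<longrightarrow> (\<forall>b < n. (z, b) \<in> ugraph A \<longrightarrow> (\<forall>d < n. (b, d) \<in> ugraph A \<longrightarrow> ?K a b d))))"
  have za: "aval (adjE (vr ''z'') (vr ''a'')) s1 = 0 \<longleftrightarrow> (z, q) \<notin> ugraph A" using processing_adj[OF c1, of "''a''"] 6(1,2) by simp
  show ?case
  proof (rule wp_When)
    assume "aval (adjE (vr ''z'') (vr ''a'')) s1 = 0"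
    then have "(z, q) \<notin> ugraph A" using za by metis
    then show "?Q s1" using 6(3) by (auto simp: less_Suc_eq)
  next
    assume "aval (adjE (vr ''z'') (vr ''a'')) s1 \<noteq> 0"
    then have zq: "(z, q) \<in> ugraph A" using za by metis
    define s2 where "s2 = s1(''x'' := (s1 ''x'')(0 := q))"
    have sm12: "same {''x''} s1 s2" by (simp add: s2_def same_def)
    have c2: "processing s2 z \<psi> al" by (rule processing_same[OF c1 sm12]) simp
    have v2: "s2 ''x'' 0 = q" "s2 ''a'' 0 = q" "s2 ''col'' = s1 ''col''" "s2 ''r'' = s1 ''r''" "s2 ''al'' = al"
      using 6(2) c2 by (simp_all add: s2_def processing_def)
    have RK: "wp L Rank (\<lambda>s'. full_rank s' al q) s2"
      using Rank_wp[of s2] c2 v2 6(1) unfolding processing_def by simp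
    have "wp L (Seq Rank Probes_b) ?Q s2"
    proof (rule wp_Seq[OF RK])
      fix s3 assume R3: "full_rank s3 al q" and sm3: "same (mods Rank) s2 s3"
      have c3: "processing s3 z \<psi> al" by (rule processing_same[OF c2 sm3]) (simp add: mods_Rank)
      have v3: "s3 ''a'' 0 = q" "s3 ''col'' = s1 ''col''" "s3 ''r'' = s1 ''r''" using sm3 v2 by (simp_all add: same_def mods_Rank)
      have hd3: "sound (s3 ''col'') (s3 ''r'' 0)" using 6(3) v3 by simp
      have mk: "s3 ''mark'' d \<noteq> 0" if "linked (ugraph A) (insert q {y \<in> U. y \<noteq> z \<and> (z, y) \<notin> ugraph A}) d q" for d
        by (rule linked_marked[OF R3 _ 6(1) that]) (use c3 in \<open>auto simp: processing_def\<close>)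
      show "wp L Probes_b ?Q s3"
      proof (rule wp_weaken[OF Probes_b_wp[OF c3 hd3 R3 v3(1) zq]])
        fix s4 assume 4: "sound (s4 ''col'') (s4 ''r'' 0) \<and> (solved (s4 ''col'') \<or> \<not> solved (s3 ''col'') \<and>
          (\<forall>b < n. (z, b) \<in> ugraph A \<longrightarrow> (\<forall>d < n. (b, d) \<in> ugraph A \<longrightarrow> s3 ''mark'' d \<noteq> 0 \<longrightarrow> probe_ok \<psi> z q b d)))"
        show "?Q s4"
        proof (cases "solved (s4 ''col'')")
          case False
          then have nw: "\<not> solved (s1 ''col'')" and N: "\<And>b d. b < n \<Longrightarrow> (z, b) \<in> ugraph A \<Longrightarrow> d < n \<Longrightarrow> (b, d) \<in> ugraph A \<Longrightarrow>
            s3 ''mark'' d \<noteq> 0 \<Longrightarrow> probe_ok \<psi> z q b d" using 4 v3 by auto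
          have "?K a b d" if "a < Suc q" "(z, a) \<in> ugraph A" "b < n" "(z, b) \<in> ugraph A" "d < n" "(b, d) \<in> ugraph A" for a b d
          proof (cases "a = q")
            case True then show ?thesis using N that mk by blast
          next
            case False
            then have "a < q" using that by simp
            then show ?thesis using 6(3) nw that by blast
          qed
          then show ?thesis using 4 by blast
        qed (use 4 in blast)
      qed
    qed
    then show "wp L (Seq (asg ''x'' (vr ''a'')) (Seq Rank Probes_b)) ?Q s1"
      by (intro wp_SeqA) (simp add: s2_def 6(2))
  qed
next
  case (7 s1)
  have "calm A U \<psi> z" if "\<not> solved (s1 ''col'')"
    unfolding calm_def
  proof (intro ballI impI)
    fix x1 x2 xm assume x: "x1 \<in> U" "x2 \<in> U" "xm \<in> U" "(z, x1) \<in> ugraph A" "(z, xm) \<in> ugraph A" "(x1, x2) \<in> ugraph A"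
      "x1 \<noteq> xm" "linked (ugraph A) (insert xm {y \<in> U. y \<noteq> z \<and> (z, y) \<notin> ugraph A}) x2 xm"
    then have "probe_ok \<psi> z xm x1 x2" using 7(1) that by blast
    then show "\<psi> x2 = \<psi> xm \<and> (arc_type A z x1 \<noteq> arc_type A z xm \<longrightarrow> \<psi> x1 = \<psi> xm)" using x(7) unfolding probe_ok_def by blast
  qed
  then show ?case using 7(1) by blast
qed

end

section \<open>The exploration\<close>

definition Search :: com where
  "Search = Unless (V ''col'' (vr ''r'')) (Seq Seeds Main)"

lemma mods_Seeds: "mods Seeds = {''T'', ''u'', ''v''} \<union> mods Seed"
  by (auto simp: Seeds_def)
lemma mods_Main: "mods Main = insert ''h'' (mods Process)"
  by (auto simp: Main_def)

lemmas mods_all = mods_Process mods_Load mods_Try mods_Far mods_Probes mods_Probe mods_Rank mods_Children mods_Child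
  mods_Seed mods_Push mods_Seeds mods_Main

context prog
begin

text \<open>
  What \<open>explored_hard\<close> demands of the triple and of the witness in an entry.
\<close>
definition processed :: "state \<Rightarrow> nat \<Rightarrow> bool" where
  "processed s k \<longleftrightarrow> (case triple s k of (z, x, y) \<Rightarrow> stuck (stored s k) z \<and> calm A U (stored s k) z \<and>
     (\<forall>a. (z, a) \<in> ugraph A \<longrightarrow> (\<exists>j < s ''T'' 0. triple s j = (a, transpose z a x, transpose z a y))))"

lemma processed_extends:
  assumes e: "extends s s'" and k: "k < s ''T'' 0" and P: "processed s k"
  shows "processed s' k"
proof -
  obtain z x y where t: "triple s k = (z, x, y)" by (metis prod_cases3)
  have o: "triple s' j = triple s j" "stored s' j = stored s j" "j < s' ''T'' 0" if "j < s ''T'' 0" for j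
    using e that unfolding extends_def by auto
  have P': "stuck (stored s k) z" "calm A U (stored s k) z"
    "\<And>a. (z, a) \<in> ugraph A \<Longrightarrow> \<exists>j < s ''T'' 0. triple s j = (a, transpose z a x, transpose z a y)"
    using P t unfolding processed_def by auto
  have "\<exists>j < s' ''T'' 0. triple s' j = (a, transpose z a x, transpose z a y)" if a: "(z, a) \<in> ugraph A" for a
  proof -
    obtain j where "j < s ''T'' 0" "triple s j = (a, transpose z a x, transpose z a y)" using P'(3)[OF a] by blast
    then show ?thesis using o by metis
  qed
  then show ?thesis unfolding processed_def o(1)[OF k] t o(2)[OF k] using P' by simp
qed

lemma Far_wp:
  assumes env: "tables_ok s" and z: "s ''z'' 0 = z" "z < n"
  shows "wp L Far (\<lambda>s'. \<forall>v < n. s' ''al'' v \<noteq> 0 \<longleftrightarrow> v \<noteq> z \<and> (z, v) \<notin> ugraph A) s"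
  unfolding Far_def
proof (rule wp_Seq[where R = "\<lambda>s'. \<forall>v < n. s' ''al'' v = 0 \<longleftrightarrow> (z, v) \<in> ugraph A"])
  show "wp L (For ''w'' (vr ''n'') (Cond (adjE (vr ''z'') (vr ''w'')) (Assign ''al'' (vr ''w'') (N 0))
     (Assign ''al'' (vr ''w'') (N 1)))) (\<lambda>s'. \<forall>v < n. s' ''al'' v = 0 \<longleftrightarrow> (z, v) \<in> ugraph A) s"
  proof (rule wp_For[where m = n and I = "\<lambda>q s'. \<forall>v < q. s' ''al'' v = 0 \<longleftrightarrow> (z, v) \<in> ugraph A"], goal_cases)
    case 1 show ?case by (rule L_bounds)
  next
    case (5 s1) then show ?case using tables_okD(1)[OF env] by (simp add: same_def)
  next
    case (6 q s1)
    have env1: "tables_ok s1" by (rule tables_ok_same[OF env 6(4)]) simp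
    have z1: "s1 ''z'' 0 = z" using 6(4) z by (simp add: same_def)
    have a: "aval (adjE (vr ''z'') (vr ''w'')) s1 = 0 \<longleftrightarrow> (z, q) \<notin> ugraph A"
      using adj_val[OF env1, of "vr ''z''" "vr ''w''"] z1 z 6(1,2) by simp
    show ?case
    proof (rule wp_Cond)
      assume "aval (adjE (vr ''z'') (vr ''w'')) s1 \<noteq> 0"
      then have "(z, q) \<in> ugraph A" using a by metis
      then show "wp L (Assign ''al'' (vr ''w'') (N 0)) (\<lambda>s'. \<forall>v < Suc q. s' ''al'' v = 0 \<longleftrightarrow> (z, v) \<in> ugraph A) s1"
        using 6(2,3) by (intro wp_Assign) (simp add: less_Suc_eq)
    next
      assume "aval (adjE (vr ''z'') (vr ''w'')) s1 = 0"
      then have "(z, q) \<notin> ugraph A" using a by metis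
      then show "wp L (Assign ''al'' (vr ''w'') (N 1)) (\<lambda>s'. \<forall>v < Suc q. s' ''al'' v = 0 \<longleftrightarrow> (z, v) \<in> ugraph A) s1"
        using 6(2,3) by (intro wp_Assign) (simp add: less_Suc_eq)
    qed
  qed simp_all
  fix s1 assume 1: "\<forall>v < n. s1 ''al'' v = 0 \<longleftrightarrow> (z, v) \<in> ugraph A"
    and sm: "same (mods (For ''w'' (vr ''n'') (Cond (adjE (vr ''z'') (vr ''w'')) (Assign ''al'' (vr ''w'') (N 0))
     (Assign ''al'' (vr ''w'') (N 1))))) s s1"
  have z1: "s1 ''z'' 0 = z" using sm z by (simp add: same_def)
  have 2: "((s1 ''al'')(z := 0)) v \<noteq> 0 \<longleftrightarrow> v \<noteq> z \<and> (z, v) \<notin> ugraph A" if "v < n" for v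
    using 1 that by auto
  show "wp L (Assign ''al'' (vr ''z'') (N 0)) (\<lambda>s'. \<forall>v < n. s' ''al'' v \<noteq> 0 \<longleftrightarrow> v \<noteq> z \<and> (z, v) \<notin> ugraph A) s1"
    by (intro wp_Assign) (use 2 z1 in simp)
qed

lemma Process_wp:
  assumes env: "tables_ok s" and q: "queue \<phi> s" and h: "s ''h'' 0 < s ''T'' 0" and hd: "sound (s ''col'') (s ''r'' 0)"
  shows "wp L Process (\<lambda>s'. sound (s' ''col'') (s' ''r'' 0) \<and> queue \<phi> s' \<and> extends s s' \<and>
    (solved (s' ''col'') \<or> processed s' (s ''h'' 0))) s" (is "wp L _ ?Q s")
  unfolding Process_def
proof -
  let ?\<psi> = "stored s (s ''h'' 0)"
  obtain z x y where t: "triple s (s ''h'' 0) = (z, x, y)" by (metis prod_cases3)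
  have E: "holed ?\<psi> z" using q h t unfolding queue_def entry_def by auto
  have zn: "z < n" using E unfolding holed_def by blast
  have qr: "s ''qr'' (s ''h'' 0) = z" using t by (simp add: triple_def)
  have sup: "\<forall>v \<ge> n. s ''col'' v = 0" using hd unfolding sound_def by blast
  have hn: "s ''h'' 0 \<le> n * n * n" using h queue_le[OF q] by simp
  show "wp L (Seq Load (Seq Try (Unless (V ''col'' (vr ''r''))
     (Seq (asg ''z'' (V ''qr'' (vr ''h''))) (Seq Far (Seq Probes Children)))))) ?Q s"
  proof (rule wp_Seq[OF Load_wp[OF env hn sup]])
    fix s1 assume "s1 ''col'' = ?\<psi> \<and> s1 ''r'' 0 = s ''qr'' (s ''h'' 0)" and sm1: "same (mods Load) s s1"
    then have 1: "s1 ''col'' = ?\<psi>" "s1 ''r'' 0 = z" using qr by auto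
    have env1: "tables_ok s1" by (rule tables_ok_same[OF env sm1]) (simp add: mods_Load)
    have c1: "holed (s1 ''col'') (s1 ''r'' 0)" unfolding 1 by (rule E)
    have sup1: "\<forall>v \<ge> n. s1 ''col'' v = 0" unfolding 1 by (simp add: stored_def)
    show "wp L (Seq Try (Unless (V ''col'' (vr ''r''))
     (Seq (asg ''z'' (V ''qr'' (vr ''h''))) (Seq Far (Seq Probes Children))))) ?Q s1"
    proof (rule wp_Seq[OF Try_sound[OF env1 c1 sup1]])
      fix s2 assume 2: "(s2 ''col'' = s1 ''col'' \<and> stuck (s1 ''col'') (s1 ''r'' 0)) \<or>
        (sound (s2 ''col'') (s1 ''r'' 0) \<and> solved (s2 ''col''))" and sm2: "same (mods Try) s1 s2"
      have sm12: "same (mods Load \<union> mods Try) s s2" using sm1 sm2 by (auto simp: same_def)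
      have env2: "tables_ok s2" by (rule tables_ok_same[OF env sm12]) (simp add: mods_Load mods_Try)
      have q2: "queue \<phi> s2" "extends s s2" "triple s2 = triple s" "stored s2 = stored s" "s2 ''T'' 0 = s ''T'' 0"
        using same_queue[OF sm12] q by (simp_all add: mods_Load mods_Try)
      have r2: "s2 ''r'' 0 = z" "s2 ''h'' = s ''h''" "s2 ''qr'' = s ''qr''"
        using sm2 sm12 1 by (simp_all add: same_def mods_Load mods_Try)
      have hd2: "sound (s2 ''col'') (s2 ''r'' 0)" using 2 c1 sup1 r2 1 zn unfolding sound_def by auto
      show "wp L (Unless (V ''col'' (vr ''r''))
        (Seq (asg ''z'' (V ''qr'' (vr ''h''))) (Seq Far (Seq Probes Children)))) ?Q s2"
      proof (rule wp_Unless)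
        assume "aval (V ''col'' (vr ''r'')) s2 \<noteq> 0"
        then show "?Q s2" using hd2 sound_solved q2 by simp
      next
        assume "aval (V ''col'' (vr ''r'')) s2 = 0"
        then have "\<not> solved (s2 ''col'')" using sound_solved[OF hd2] by simp
        then have p2: "s2 ''col'' = ?\<psi>" "stuck ?\<psi> z" using 2 1 by auto
        define s3 where "s3 = s2(''z'' := (s2 ''z'')(0 := z))"
        have sm3: "same {''z''} s2 s3" by (simp add: s3_def same_def)
        have env3: "tables_ok s3" by (rule tables_ok_same[OF env2 sm3]) simp
        have z3: "s3 ''z'' 0 = z" by (simp add: s3_def)
        have "wp L (Seq Far (Seq Probes Children)) ?Q s3"
        proof (rule wp_Seq[OF Far_wp[OF env3 z3 zn]])
          fix s4 assume 4: "\<forall>v < n. s4 ''al'' v \<noteq> 0 \<longleftrightarrow> v \<noteq> z \<and> (z, v) \<notin> ugraph A" and sm4: "same (mods Far) s3 s4"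
          have sm24: "same {''z'', ''w'', ''al''} s2 s4" using sm3 sm4 by (auto simp: same_def mods_Far)
          have env4: "tables_ok s4" by (rule tables_ok_same[OF env2 sm24]) simp
          have q4: "queue \<phi> s4" "extends s s4" "triple s4 = triple s" "stored s4 = stored s" "s4 ''T'' 0 = s ''T'' 0"
            using same_queue[OF sm24] q2 extends_trans by simp_all
          have v4: "s4 ''h'' = s ''h''" "s4 ''qr'' = s ''qr''" "s4 ''z'' 0 = z" "s4 ''col'' = s2 ''col''" "s4 ''r'' = s2 ''r''"
            using sm24 sm4 z3 r2 by (simp_all add: same_def mods_Far)
          have c4: "processing s4 z ?\<psi> (s4 ''al'')" unfolding processing_def using env4 v4 hn E q4 qr 4 by simp
          have hd4: "sound (s4 ''col'') (s4 ''r'' 0)" using hd2 v4 by simp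
          show "wp L (Seq Probes Children) ?Q s4"
          proof (rule wp_Seq[OF Probes_wp[OF c4 hd4]])
            fix s5 assume 5: "sound (s5 ''col'') (s5 ''r'' 0) \<and> (solved (s5 ''col'') \<or> calm A U ?\<psi> z)"
              and sm5: "same (mods Probes) s4 s5"
            have env5: "tables_ok s5" by (rule tables_ok_same[OF env4 sm5]) (simp add: mods_Probes mods_Probe mods_Rank)
            have q5: "queue \<phi> s5" "extends s s5" "triple s5 = triple s" "stored s5 = stored s" "s5 ''T'' 0 = s ''T'' 0"
              using same_queue[OF sm5] q4 extends_trans by (simp_all add: mods_Probes mods_Probe mods_Rank)
            have v5: "s5 ''h'' = s ''h''" "s5 ''z'' 0 = z"
              using sm5 v4 by (simp_all add: same_def mods_Probes mods_Probe mods_Rank)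
            have C: "wp L Children (\<lambda>s'. sound (s' ''col'') (s' ''r'' 0) \<and> queue \<phi> s' \<and> extends s5 s' \<and> (solved (s' ''col'') \<or>
              \<not> solved (s5 ''col'') \<and> (\<forall>a. (z, a) \<in> ugraph A \<longrightarrow> (\<exists>k < s' ''T'' 0. triple s' k = (a, transpose z a x, transpose z a y))))) s5"
              by (rule Children_wp[OF env5 q5(1)]) (use h v5 q5 5 t in simp_all)
            then show "wp L Children ?Q s5"
            proof (rule wp_weaken)
              fix s6 assume 6: "sound (s6 ''col'') (s6 ''r'' 0) \<and> queue \<phi> s6 \<and> extends s5 s6 \<and> (solved (s6 ''col'') \<or>
                \<not> solved (s5 ''col'') \<and> (\<forall>a. (z, a) \<in> ugraph A \<longrightarrow> (\<exists>k < s6 ''T'' 0. triple s6 k = (a, transpose z a x, transpose z a y))))"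
              have e6: "extends s s6" using 6 q5 extends_trans by blast
              have "processed s6 (s ''h'' 0)" if nw: "\<not> solved (s6 ''col'')"
              proof -
                have n5: "\<not> solved (s5 ''col'')" and ch: "\<And>a. (z, a) \<in> ugraph A \<Longrightarrow>
                  \<exists>k < s6 ''T'' 0. triple s6 k = (a, transpose z a x, transpose z a y)" using 6 nw by blast+
                have "calm A U ?\<psi> z" using 5 n5 by blast
                moreover have "triple s6 (s ''h'' 0) = (z, x, y)" "stored s6 (s ''h'' 0) = ?\<psi>"
                  using e6 h t unfolding extends_def by simp_all
                ultimately show ?thesis unfolding processed_def using p2(2) ch by simp
              qed
              then show "?Q s6" using 6 e6 by blast
            qed
          qed
        qed
        then show "wp L (Seq (asg ''z'' (V ''qr'' (vr ''h''))) (Seq Far (Seq Probes Children))) ?Q s2"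
          by (intro wp_SeqA) (simp add: s3_def r2 qr)
      qed
    qed
  qed
qed

text \<open>
  Entries are appended while the queue is processed, but never beyond \<open>n * n * n\<close>, which bounds the
  number of iterations.
\<close>
lemma Main_wp:
  assumes env: "tables_ok s" and q: "queue \<phi> s" and hd: "sound (s ''col'') (s ''r'' 0)"
  shows "wp L Main (\<lambda>s'. sound (s' ''col'') (s' ''r'' 0) \<and> queue \<phi> s' \<and> extends s s' \<and>
    (solved (s' ''col'') \<or> (\<forall>k < s' ''T'' 0. processed s' k))) s" (is "wp L _ ?Q s")
  unfolding Main_def
proof (rule wp_SeqA)
  define s0 where "s0 = s(''h'' := (s ''h'')(aval (N 0) s := aval (N 0) s))"
  let ?X = "insert ''h'' (mods Process)"
  let ?J = "\<lambda>s'. same ?X s0 s' \<and> sound (s' ''col'') (s' ''r'' 0) \<and> queue \<phi> s' \<and> extends s s' \<and> s' ''h'' 0 \<le> s' ''T'' 0 \<and>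
    (solved (s' ''col'') \<or> (\<forall>k < s' ''h'' 0. processed s' k))"
  have env0: "tables_ok s0" unfolding s0_def using env by (simp add: tables_ok_upd)
  have "wp L (While (Minus (vr ''T'') (vr ''h''))
     (Seq (Unless (V ''col'' (vr ''r'')) Process) (asg ''h'' (Plus (vr ''h'') (N 1))))) ?Q s0"
  proof (rule wp_While[where I = ?J and \<mu> = "\<lambda>s'. n * n * n - s' ''h'' 0"])
    show "?J s0" using q hd extends_refl by (simp add: s0_def same_refl upd_queue)
    show "n * n * n - s0 ''h'' 0 \<le> L" using L_bounds by simp
    show "?Q s1" if "?J s1" "aval (Minus (vr ''T'') (vr ''h'')) s1 = 0" for s1
      using that by auto
    fix s1 assume J: "?J s1" and b: "aval (Minus (vr ''T'') (vr ''h'')) s1 \<noteq> 0"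
    then have hT: "s1 ''h'' 0 < s1 ''T'' 0" by simp
    have env1: "tables_ok s1" by (rule tables_ok_same[OF env0, of ?X]) (use J in \<open>simp_all add: mods_all\<close>)
    have J1: "sound (s1 ''col'') (s1 ''r'' 0)" "queue \<phi> s1" "extends s s1" using J by blast+
    have Tn: "s1 ''T'' 0 \<le> n * n * n" using queue_le[OF J1(2)] .
    have r1: "s1 ''r'' 0 < n" using J1(1) unfolding sound_def by blast
    show "wp L (Seq (Unless (V ''col'' (vr ''r'')) Process) (asg ''h'' (Plus (vr ''h'') (N 1))))
      (\<lambda>s'. ?J s' \<and> n * n * n - s' ''h'' 0 < n * n * n - s1 ''h'' 0) s1"
    proof (rule wp_Seq[where R = "\<lambda>s2. sound (s2 ''col'') (s2 ''r'' 0) \<and> queue \<phi> s2 \<and> extends s1 s2 \<and>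
        (solved (s2 ''col'') \<or> \<not> solved (s1 ''col'') \<and> processed s2 (s1 ''h'' 0))"])
      show "wp L (Unless (V ''col'' (vr ''r'')) Process) (\<lambda>s2. sound (s2 ''col'') (s2 ''r'' 0) \<and> queue \<phi> s2 \<and> extends s1 s2 \<and>
        (solved (s2 ''col'') \<or> \<not> solved (s1 ''col'') \<and> processed s2 (s1 ''h'' 0))) s1"
      proof (rule wp_Unless)
        assume "aval (V ''col'' (vr ''r'')) s1 = 0"
        then have nw: "\<not> solved (s1 ''col'')" using sound_solved[OF J1(1)] by simp
        show "wp L Process (\<lambda>s2. sound (s2 ''col'') (s2 ''r'' 0) \<and> queue \<phi> s2 \<and> extends s1 s2 \<and>
          (solved (s2 ''col'') \<or> \<not> solved (s1 ''col'') \<and> processed s2 (s1 ''h'' 0))) s1"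
          by (rule wp_weaken[OF Process_wp[OF env1 J1(2) hT J1(1)]]) (use nw in blast)
      next
        assume "aval (V ''col'' (vr ''r'')) s1 \<noteq> 0"
        then have "solved (s1 ''col'')" using sound_solved[OF J1(1)] by simp
        then show "sound (s1 ''col'') (s1 ''r'' 0) \<and> queue \<phi> s1 \<and> extends s1 s1 \<and>
          (solved (s1 ''col'') \<or> \<not> solved (s1 ''col'') \<and> processed s1 (s1 ''h'' 0))" using J1 extends_refl by blast
      qed
      fix s2 assume 2: "sound (s2 ''col'') (s2 ''r'' 0) \<and> queue \<phi> s2 \<and> extends s1 s2 \<and>
        (solved (s2 ''col'') \<or> \<not> solved (s1 ''col'') \<and> processed s2 (s1 ''h'' 0))"
        and sm2: "same (mods (Unless (V ''col'' (vr ''r'')) Process)) s1 s2"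
      have h2: "s2 ''h'' 0 = s1 ''h'' 0" using sm2 by (simp add: same_def mods_all)
      let ?s3 = "s2(''h'' := (s2 ''h'')(0 := Suc (s1 ''h'' 0)))"
      have "same ?X s1 s2" by (rule same_mono[OF sm2]) auto
      then have "same ?X s0 s2" using J same_trans by blast
      then have a: "same ?X s0 ?s3" by (auto simp: same_def)
      have e: "extends s s2" using J1(3) 2 extends_trans by blast
      have T2: "Suc (s1 ''h'' 0) \<le> s2 ''T'' 0" using hT 2 unfolding extends_def by linarith
      have p: "solved (s2 ''col'') \<or> (\<forall>k < Suc (s1 ''h'' 0). processed s2 k)"
      proof (cases "solved (s2 ''col'')")
        case False
        then have "\<not> solved (s1 ''col'')" "processed s2 (s1 ''h'' 0)" using 2 by blast+
        moreover have "processed s2 k" if "k < s1 ''h'' 0" for k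
          using J that calculation(1) processed_extends[of s1 s2 k] 2 hT by auto
        ultimately show ?thesis by (auto simp: less_Suc_eq)
      qed simp
      have pr: "processed ?s3 k = processed s2 k" for k by (simp add: processed_def upd_queue)
      have d: "n * n * n - Suc (s1 ''h'' 0) < n * n * n - s1 ''h'' 0" using hT Tn by linarith
      have J3: "?J ?s3 \<and> n * n * n - ?s3 ''h'' 0 < n * n * n - s1 ''h'' 0"
        using a 2 e T2 p d by (simp add: upd_queue pr)
      show "wp L (asg ''h'' (Plus (vr ''h'') (N 1))) (\<lambda>s'. ?J s' \<and> n * n * n - s' ''h'' 0 < n * n * n - s1 ''h'' 0) s2"
      proof (rule wp_Assign)
        have "s2(''h'' := (s2 ''h'')(aval (N 0) s2 := aval (Plus (vr ''h'') (N 1)) s2)) = ?s3" using h2 by simp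
        then show "?J (s2(''h'' := (s2 ''h'')(aval (N 0) s2 := aval (Plus (vr ''h'') (N 1)) s2))) \<and>
          n * n * n - (s2(''h'' := (s2 ''h'')(aval (N 0) s2 := aval (Plus (vr ''h'') (N 1)) s2))) ''h'' 0 < n * n * n - s1 ''h'' 0"
          using J3 by metis
      qed
    qed
  qed
  then show "wp L (While (Minus (vr ''T'') (vr ''h''))
     (Seq (Unless (V ''col'' (vr ''r'')) Process) (asg ''h'' (Plus (vr ''h'') (N 1))))) ?Q
     (s(''h'' := (s ''h'')(aval (N 0) s := aval (N 0) s)))" unfolding s0_def .
qed

lemma Seed_wp:
  assumes env: "tables_ok s" and q: "queue \<phi> s" and c: "s ''col'' = \<phi>" "s ''r'' 0 = 0" "holed \<phi> 0" "\<forall>v \<ge> n. \<phi> v = 0"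
    and uv: "s ''u'' 0 = u" "s ''v'' 0 = v" "u < n" "v < n"
  shows "wp L Seed (\<lambda>s'. queue \<phi> s' \<and> extends s s' \<and> (\<phi> u \<noteq> \<phi> v \<longrightarrow> (\<exists>k < s' ''T'' 0. triple s' k = (0, u, v)))) s" (is "wp L _ ?Q s")
  unfolding Seed_def
proof (rule wp_When)
  assume "aval (neq (V ''col'' (vr ''u'')) (V ''col'' (vr ''v''))) s = 0"
  then have "\<phi> u = \<phi> v" unfolding neq_val using c uv by simp
  then show "?Q s" using q extends_refl by blast
next
  assume "aval (neq (V ''col'' (vr ''u'')) (V ''col'' (vr ''v''))) s \<noteq> 0"
  then have "aval (V ''col'' (vr ''u'')) s \<noteq> aval (V ''col'' (vr ''v'')) s" unfolding neq_val .
  then have ne: "\<phi> u \<noteq> \<phi> v" using c uv by simp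
  define s1 where "s1 = s(''x'' := (s ''x'')(0 := u))"
  define s2 where "s2 = s1(''y'' := (s1 ''y'')(0 := v))"
  have v2: "s2 ''x'' 0 = u" "s2 ''y'' 0 = v" "s2 ''col'' = \<phi>" "s2 ''r'' 0 = 0" "queue \<phi> s2" "extends s s2"
    using c q extends_refl by (simp_all add: s1_def s2_def upd_queue)
  have env2: "tables_ok s2" using env by (simp add: s1_def s2_def tables_ok_upd)
  have "wp L Push (\<lambda>s'. queue \<phi> s' \<and> extends s2 s' \<and> (\<exists>k < s' ''T'' 0. triple s' k = current s2)) s2"
    by (rule Push_queue[OF env2 v2(5)]) (use v2 c uv ne in \<open>simp_all add: reach_refl\<close>)
  then have "wp L Push ?Q s2"
    by (rule wp_weaken) (use v2 extends_trans in \<open>auto simp: current_def\<close>)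
  then show "wp L (Seq (asg ''x'' (vr ''u'')) (Seq (asg ''y'' (vr ''v'')) Push)) ?Q s"
    by (intro wp_SeqA) (simp add: s1_def s2_def uv)
qed

lemma Seeds_wp:
  assumes env: "tables_ok s" and c: "s ''col'' = \<phi>" "s ''r'' 0 = 0" "holed \<phi> 0" "\<forall>v \<ge> n. \<phi> v = 0"
  shows "wp L Seeds (\<lambda>s'. queue \<phi> s' \<and> (\<forall>u < n. \<forall>v < n. \<phi> u \<noteq> \<phi> v \<longrightarrow> (\<exists>k < s' ''T'' 0. triple s' k = (0, u, v)))) s"
  unfolding Seeds_def
proof (rule wp_SeqA)
  define s0 where "s0 = s(''T'' := (s ''T'')(aval (N 0) s := aval (N 0) s))"
  have env0: "tables_ok s0" unfolding s0_def using env by (simp add: tables_ok_upd)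
  have q0: "queue \<phi> s0" by (simp add: queue_def s0_def)
  have c0: "s0 ''col'' = \<phi>" "s0 ''r'' 0 = 0" using c by (simp_all add: s0_def)
  let ?K = "\<lambda>s' u v. \<phi> u \<noteq> \<phi> v \<longrightarrow> (\<exists>k < s' ''T'' 0. triple s' k = (0, u, v))"
  have Kext: "?K s' u v" if "?K s u v" "extends s s'" for s s' u v
    using that unfolding extends_def by (metis less_le_trans)
  have "wp L (For ''u'' (vr ''n'') (For ''v'' (vr ''n'') Seed))
    (\<lambda>s'. queue \<phi> s' \<and> (\<forall>u < n. \<forall>v < n. ?K s' u v)) s0"
  proof (rule wp_For[where m = n and I = "\<lambda>q s'. queue \<phi> s' \<and> (\<forall>u < q. \<forall>v < n. ?K s' u v)"], goal_cases)
    case 1 show ?case by (rule L_bounds)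
  next
    case 2 show ?case by (simp add: mods_all)
  next
    case 3 show ?case using q0 by simp
  next
    case (4 k s1 g) then show ?case by (simp add: upd_queue)
  next
    case (5 s1) then show ?case using tables_okD(1)[OF env0] by (simp add: same_def mods_all)
  next
    case (6 u s1)
    have env1: "tables_ok s1" by (rule tables_ok_same[OF env0 6(4)]) (simp add: mods_all)
    have c1: "s1 ''col'' = \<phi>" "s1 ''r'' 0 = 0" using 6(4) c0 by (simp_all add: same_def mods_all)
    note u = 6(1,2) and I1 = 6(3)
    show ?case
    proof (rule wp_For[where m = n and I = "\<lambda>q s'. queue \<phi> s' \<and> (\<forall>u' < u. \<forall>v < n. ?K s' u' v) \<and> (\<forall>v < q. ?K s' u v)"], goal_cases)
      case 1 show ?case by (rule L_bounds)
    next
      case 2 show ?case by (simp add: mods_all)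
    next
      case 3 show ?case using I1 by simp
    next
      case (4 k s1 g) then show ?case by (simp add: upd_queue)
    next
      case (5 s2) then show ?case using tables_okD(1)[OF env1] by (simp add: same_def mods_all)
    next
      case (6 v s2)
      have env2: "tables_ok s2" by (rule tables_ok_same[OF env1 6(4)]) (simp add: mods_all)
      have v2: "s2 ''col'' = \<phi>" "s2 ''r'' 0 = 0" "s2 ''u'' 0 = u" using 6(4) c1 u by (simp_all add: same_def mods_all)
      have q2: "queue \<phi> s2" using 6(3) by blast
      show ?case
      proof (rule wp_weaken[OF Seed_wp[OF env2 q2 v2(1,2) c(3,4) v2(3) 6(2) u(1) 6(1)]])
        fix s3 assume 3: "queue \<phi> s3 \<and> extends s2 s3 \<and> ?K s3 u v"
        have "?K s3 u' v'" if "?K s2 u' v'" for u' v' using Kext that 3 by blast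
        then show "queue \<phi> s3 \<and> (\<forall>u' < u. \<forall>v < n. ?K s3 u' v) \<and> (\<forall>v' < Suc v. ?K s3 u v')"
          using 6(3) 3 unfolding less_Suc_eq by blast
      qed
    next
      case (7 s2) then show ?case unfolding less_Suc_eq by blast
    qed
  next
    case (7 s1) then show ?case by blast
  qed
  then show "wp L (For ''u'' (vr ''n'') (For ''v'' (vr ''n'') Seed))
    (\<lambda>s'. queue \<phi> s' \<and> (\<forall>u < n. \<forall>v < n. ?K s' u v)) (s(''T'' := (s ''T'')(aval (N 0) s := aval (N 0) s)))"
    unfolding s0_def .
qed

lemma Search_wp:
  assumes env: "tables_ok s" and hd: "sound (s ''col'') (s ''r'' 0)" and r: "s ''r'' 0 = 0"
    and st: "solved (s ''col'') \<or> stuck (s ''col'') 0"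
  shows "wp L Search (\<lambda>s'. sound (s' ''col'') (s' ''r'' 0) \<and> (solved (s' ''col'') \<or> hard_pair p (induced A U) f)) s" (is "wp L _ ?Q s")
  unfolding Search_def
proof (rule wp_Unless)
  assume "aval (V ''col'' (vr ''r'')) s \<noteq> 0"
  then show "?Q s" using hd sound_solved by simp
next
  assume "aval (V ''col'' (vr ''r'')) s = 0"
  then have c: "holed (s ''col'') 0" and nw: "\<not> solved (s ''col'')" using sound_holed[OF hd] sound_solved[OF hd] r by simp_all
  have sup: "\<forall>v \<ge> n. s ''col'' v = 0" using hd unfolding sound_def by blast
  let ?\<phi> = "s ''col''"
  show "wp L (Seq Seeds Main) ?Q s"
  proof (rule wp_Seq[OF Seeds_wp[OF env refl r c sup]])
    fix s1 assume 1: "queue ?\<phi> s1 \<and> (\<forall>u < n. \<forall>v < n. ?\<phi> u \<noteq> ?\<phi> v \<longrightarrow> (\<exists>k < s1 ''T'' 0. triple s1 k = (0, u, v)))"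
      and sm1: "same (mods Seeds) s s1"
    have env1: "tables_ok s1" by (rule tables_ok_same[OF env sm1]) (simp add: mods_all)
    have "s1 ''col'' = s ''col''" "s1 ''r'' = s ''r''" using sm1 by (simp_all add: same_def mods_all)
    then have hd1: "sound (s1 ''col'') (s1 ''r'' 0)" using hd by simp
    show "wp L Main ?Q s1"
    proof (rule wp_weaken[OF Main_wp[OF env1 conjunct1[OF 1] hd1]])
      fix s2 assume 2: "sound (s2 ''col'') (s2 ''r'' 0) \<and> queue ?\<phi> s2 \<and> extends s1 s2 \<and>
        (solved (s2 ''col'') \<or> (\<forall>k < s2 ''T'' 0. processed s2 k))"
      have "hard_pair p (induced A U) f" if "\<not> solved (s2 ''col'')"
      proof -
        have P: "\<And>k. k < s2 ''T'' 0 \<Longrightarrow> processed s2 k" using 2 that by blast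
        have st0: "stuck ?\<phi> 0" using st nw by blast
        show ?thesis
        proof (rule explored_hard[OF c st0, where F = "triple s2 ` {..<s2 ''T'' 0}"])
          show "(0, u, v) \<in> triple s2 ` {..<s2 ''T'' 0}" if uv: "u < n" "v < n" "?\<phi> u \<noteq> ?\<phi> v" for u v
          proof -
            obtain k where k: "k < s1 ''T'' 0" "triple s1 k = (0, u, v)" using 1 uv by blast
            then have "k < s2 ''T'' 0" "triple s2 k = (0, u, v)" using 2 unfolding extends_def by auto
            then show ?thesis by force
          qed
          show "(a, transpose r a x, transpose r a y) \<in> triple s2 ` {..<s2 ''T'' 0}"
            if t: "(r, x, y) \<in> triple s2 ` {..<s2 ''T'' 0}" and a: "(r, a) \<in> ugraph A" for r x y a
          proof -
            obtain k where k: "k < s2 ''T'' 0" "triple s2 k = (r, x, y)" using t by auto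
            then obtain j where "j < s2 ''T'' 0" "triple s2 j = (a, transpose r a x, transpose r a y)"
              using P[OF k(1)] a unfolding processed_def by auto
            then show ?thesis by force
          qed
          show "\<exists>\<psi>. reach (ugraph A) U ?\<phi> 0 \<psi> r \<and> \<psi> x \<noteq> \<psi> y \<and> stuck \<psi> r \<and> calm A U \<psi> r"
            if t: "(r, x, y) \<in> triple s2 ` {..<s2 ''T'' 0}" for r x y
          proof -
            obtain k where k: "k < s2 ''T'' 0" "triple s2 k = (r, x, y)" using t by auto
            have "entry ?\<phi> s2 k" using 2 k unfolding queue_def by blast
            then show ?thesis using P[OF k(1)] k(2) unfolding processed_def entry_def by auto
          qed
        qed
      qed
      then show "?Q s2" using 2 by blast
    qed
  qed
qed

end

section \<open>The complete algorithm\<close>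

text \<open>
  The vertices are coloured in the reverse of a breadth-first order from 0, and 0 comes last.
\<close>
definition Init :: com where
  "Init = Seq (For ''w'' (vr ''n'') (Assign ''al'' (vr ''w'') (N 1))) (Seq (asg ''x'' (N 0)) (Seq Rank
     (Seq (For ''k'' (Minus (vr ''n'') (N 1)) (Seq
        (asg ''r'' (V ''ord'' (Minus (Minus (vr ''n'') (N 1)) (vr ''k'')))) Try))
     (Seq (asg ''r'' (N 0)) Try))))"

definition Grow :: com where
  "Grow = For ''k'' (vr ''b'') (Assign ''mn'' (Plus (vr ''k'') (N 1)) (Plus (V ''mn'' (vr ''k'')) (vr ''n'')))"

text \<open>
  Squares and cubes of \<open>n\<close> are read off from the table of multiples itself, which is therefore
  extended in three rounds.
\<close>
definition Tables :: com where
  "Tables = Seq (For ''k'' (vr ''n'') (Assign ''mp'' (Plus (vr ''k'') (N 1)) (Plus (V ''mp'' (vr ''k'')) (vr ''p''))))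
     (Seq (asg ''b'' (vr ''n'')) (Seq Grow (Seq (asg ''b'' (V ''mn'' (vr ''b''))) (Seq Grow
     (Seq (asg ''b'' (V ''mn'' (vr ''b''))) Grow)))))"

definition Output :: com where
  "Output = Seq (For ''w'' (vr ''n'') (Assign ''part'' (vr ''w'') (V ''col'' (vr ''w''))))
     (Cond (V ''col'' (vr ''r'')) (asg ''hard'' (N 0)) (asg ''hard'' (N 1)))"

definition Algorithm :: com where
  "Algorithm = Seq Tables (Seq Init (Seq Search Output))"

context prog
begin

text \<open>
  When it is the turn of a vertex other than 0, its parent is not yet coloured, so by \<open>no_avail\<close>
  some colour is available.
\<close>
lemma Init_wp:
  assumes env: "tables_ok s" and c0: "\<forall>v. s ''col'' v = 0"
  shows "wp L Init (\<lambda>s'. sound (s' ''col'') (s' ''r'' 0) \<and> s' ''r'' 0 = 0 \<and>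
    (solved (s' ''col'') \<or> stuck (s' ''col'') 0)) s" (is "wp L _ ?Q s")
  unfolding Init_def
proof (rule wp_Seq[where R = "\<lambda>s1. \<forall>v < n. s1 ''al'' v = 1"])
  have n0: "0 < n" using n1 by simp
  show "wp L (For ''w'' (vr ''n'') (Assign ''al'' (vr ''w'') (N 1))) (\<lambda>s1. \<forall>v < n. s1 ''al'' v = 1) s"
  proof (rule wp_For[where m = n and I = "\<lambda>q s1. \<forall>v < q. s1 ''al'' v = 1"], goal_cases)
    case 1 show ?case by (rule L_bounds)
  next
    case (5 s1) then show ?case using tables_okD(1)[OF env] by (simp add: same_def)
  next
    case (6 q s1) then show ?case by (intro wp_Assign) (simp add: less_Suc_eq)
  qed simp_all
  fix s1 assume al1: "\<forall>v < n. s1 ''al'' v = 1" and sm1: "same (mods (For ''w'' (vr ''n'') (Assign ''al'' (vr ''w'') (N 1)))) s s1"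
  have env1: "tables_ok s1" by (rule tables_ok_same[OF env sm1]) simp
  define s2 where "s2 = s1(''x'' := (s1 ''x'')(0 := 0))"
  have env2: "tables_ok s2" by (simp add: s2_def tables_ok_upd env1)
  have x2: "s2 ''x'' 0 = 0" "s2 ''al'' = s1 ''al''" "s2 ''col'' = s ''col''" using sm1 by (simp_all add: s2_def same_def)
  let ?al = "s1 ''al''"
  have RK: "wp L Rank (\<lambda>s'. full_rank s' ?al 0) s2" using Rank_wp[OF env2] x2 n0 by simp
  have "wp L (Seq Rank (Seq (For ''k'' (Minus (vr ''n'') (N 1)) (Seq
        (asg ''r'' (V ''ord'' (Minus (Minus (vr ''n'') (N 1)) (vr ''k'')))) Try))
     (Seq (asg ''r'' (N 0)) Try))) ?Q s2"
  proof (rule wp_Seq[OF RK])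
    fix s3 assume R: "full_rank s3 ?al 0" and sm3: "same (mods Rank) s2 s3"
    have env3: "tables_ok s3" by (rule tables_ok_same[OF env2 sm3]) (simp add: mods_Rank)
    have c3: "s3 ''col'' v = 0" for v using sm3 x2 c0 by (simp add: same_def mods_Rank)
    let ?mark = "s3 ''mark''" and ?ord = "s3 ''ord''" and ?par = "s3 ''par''" and ?c = "s3 ''c'' 0"
    have rk: "ranked ?mark ?par ?ord ?c ?al 0" and cl: "\<And>v w. v < n \<Longrightarrow> w < n \<Longrightarrow> ?mark v \<noteq> 0 \<Longrightarrow> (v, w) \<in> ugraph A \<Longrightarrow> ?mark w \<noteq> 0"
      using R al1 unfolding full_rank_def by (blast, metis zero_neq_one)
    have o0: "?ord 0 = 0" and c1: "1 \<le> ?c" and oc: "\<And>k. k < ?c \<Longrightarrow> ?ord k < n \<and> ?mark (?ord k) = Suc k"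
      and mo: "\<And>v. v < n \<Longrightarrow> ?mark v \<noteq> 0 \<Longrightarrow> ?mark v \<le> ?c \<and> ?ord (?mark v - 1) = v"
      and pa: "\<And>v. v < n \<Longrightarrow> ?mark v \<noteq> 0 \<Longrightarrow> v \<noteq> 0 \<Longrightarrow> ?mark (?par v) \<noteq> 0 \<and> ?mark (?par v) < ?mark v \<and> (?par v, v) \<in> ugraph A"
      using rk unfolding ranked_def by blast+
    have m0: "?mark 0 \<noteq> 0" using oc[of 0] o0 c1 by simp
    have all: "?mark v \<noteq> 0" if "v < n" for v
    proof -
      have "linked (ugraph A) U 0 v" using conA n0 that unfolding conn_def by blast
      then show ?thesis
      proof (induction rule: rtrancl_induct)
        case base show ?case by (rule m0)
      next
        case (step y z) then show ?case using cl[of y z] by auto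
      qed
    qed
    have cn: "?c = n"
    proof (rule antisym)
      show "?c \<le> n" using ranked_le[OF rk] .
      have "{..<n} \<subseteq> ?ord ` {..<?c}"
      proof
        fix v assume "v \<in> {..<n}"
        then have v: "v < n" by simp
        have "?mark v - 1 < ?c" "?ord (?mark v - 1) = v" using mo[OF v all[OF v]] all[OF v] by auto
        then show "v \<in> ?ord ` {..<?c}" by force
      qed
      then have "card {..<n} \<le> card {..<?c}" by (intro surj_card_le) auto
      then show "n \<le> ?c" by simp
    qed
    let ?J = "\<lambda>k col. valid col \<and> (\<forall>v \<ge> n. col v = 0) \<and> (\<forall>j < n. j < n - k \<longrightarrow> col (?ord j) = 0) \<and>
      (\<forall>j < n. n - k \<le> j \<longrightarrow> col (?ord j) \<in> {1..p})"
    have Loop: "wp L (For ''k'' (Minus (vr ''n'') (N 1)) (Seq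
        (asg ''r'' (V ''ord'' (Minus (Minus (vr ''n'') (N 1)) (vr ''k'')))) Try)) (\<lambda>s4. ?J (n - 1) (s4 ''col'')) s3"
    proof (rule wp_For[where m = "n - 1" and I = "\<lambda>k s4. ?J k (s4 ''col'')"], goal_cases)
      case 1 show ?case using L_bounds by simp
    next
      case 2 show ?case by (simp add: mods_Try)
    next
      case 3
      have "valid (s3 ''col'')" unfolding valid_def using c3 by (auto intro!: degenerate_subset[OF degenerate_empty])
      then show ?case using c3 by simp
    next
      case (4 k s4 g) then show ?case by simp
    next
      case (5 s4) then show ?case using tables_okD(1)[OF env3] by (simp add: same_def mods_Try)
    next
      case (6 k s4)
      have env4: "tables_ok s4" by (rule tables_ok_same[OF env3 6(4)]) (simp add: mods_Try)
      have o4: "s4 ''ord'' = ?ord" "s4 ''n'' 0 = n" using 6(4) tables_okD(1)[OF env4] by (simp_all add: same_def mods_Try)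
      define j where "j = n - 1 - k"
      have j: "0 < j" "j < n" "n - k = Suc j" "n - Suc k = j" using 6(1) by (auto simp: j_def)
      let ?v = "?ord j"
      have v: "?v < n" "?mark ?v = Suc j" using oc[of j] j cn by auto
      have "?mark 0 = Suc 0" using oc[of 0] o0 c1 by simp
      then have vn: "?v \<noteq> 0" using v(2) j(1) by (metis Suc_inject less_irrefl)
      define s5 where "s5 = s4(''r'' := (s4 ''r'')(0 := ?v))"
      have env5: "tables_ok s5" by (simp add: s5_def tables_ok_upd env4)
      have r5: "s5 ''r'' 0 = ?v" "s5 ''col'' = s4 ''col''" by (simp_all add: s5_def)
      let ?col = "s4 ''col''"
      have J: "valid ?col" "\<forall>v \<ge> n. ?col v = 0" "\<And>i. i < n \<Longrightarrow> i < Suc j \<Longrightarrow> ?col (?ord i) = 0"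
        "\<And>i. i < n \<Longrightarrow> Suc j \<le> i \<Longrightarrow> ?col (?ord i) \<in> {1..p}" using 6(3) j by auto
      let ?u = "?par ?v"
      have u: "?mark ?u \<noteq> 0" "?mark ?u < Suc j" "(?u, ?v) \<in> ugraph A" using pa[OF v(1) _ vn] v(2) by auto
      have un: "?u < n" using ugraph_in u by blast
      have cu: "?col ?u = 0"
      proof -
        have "?ord (?mark ?u - 1) = ?u" using mo[OF un u(1)] by blast
        moreover have "?col (?ord (?mark ?u - 1)) = 0" by (rule J(3)) (use u j in auto)
        ultimately show ?thesis by simp
      qed
      have ex: "\<exists>i. avail ?col ?v i"
      proof (rule ccontr)
        assume "\<not> (\<exists>i. avail ?col ?v i)"
        then have "?col ?u \<in> {1..p}" using no_avail(2)[OF v(1), of ?col ?u] u(3) ugraph_commute by blast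
        then show False using cu by simp
      qed
      have T: "wp L Try (\<lambda>s'. ?J (Suc k) (s' ''col'')) s5"
      proof (rule wp_weaken[OF Try_wp[OF env5, unfolded r5]])
        show "?v < n" by (rule v)
        fix s6 assume "(s6 ''col'' = ?col \<and> (\<forall>i. \<not> avail ?col ?v i)) \<or> (\<exists>i. avail ?col ?v i \<and> s6 ''col'' = ?col(?v := i))"
        then obtain i where i: "avail ?col ?v i" "s6 ''col'' = ?col(?v := i)" using ex by blast
        have ip: "i \<in> {1..p}" using i(1) unfolding avail_def by blast
        have inj: "?ord l \<noteq> ?v" if "l < n" "l \<noteq> j" for l using oc[of l] v(2) that cn by auto
        have sp: "(?col(?v := i)) w = 0" if "n \<le> w" for w using J(2) that v(1) by auto
        have lo: "(?col(?v := i)) (?ord l) = 0" if "l < n" "l < j" for l using J(3)[of l] that inj[of l] by simp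
        have hi: "(?col(?v := i)) (?ord l) \<in> {1..p}" if "l < n" "j \<le> l" for l
          using J(4)[of l] that inj[of l] ip by (cases "l = j") auto
        show "?J (Suc k) (s6 ''col'')"
          unfolding i(2) j(4) using valid_fill[OF J(1) v(1) i(1)] sp lo hi by blast
      qed
      show ?case
      proof (rule wp_SeqA)
        have "s4(''r'' := (s4 ''r'')(aval (N 0) s4 := aval (V ''ord'' (Minus (Minus (vr ''n'') (N 1)) (vr ''k''))) s4)) = s5"
          using o4 6(2) by (simp add: s5_def j_def)
        then show "wp L Try (\<lambda>s'. ?J (Suc k) (s' ''col''))
          (s4(''r'' := (s4 ''r'')(aval (N 0) s4 := aval (V ''ord'' (Minus (Minus (vr ''n'') (N 1)) (vr ''k''))) s4)))"
          using T by simp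
      qed
    next
      case (7 s4) then show ?case by blast
    qed
    show "wp L (Seq (For ''k'' (Minus (vr ''n'') (N 1)) (Seq
        (asg ''r'' (V ''ord'' (Minus (Minus (vr ''n'') (N 1)) (vr ''k'')))) Try))
     (Seq (asg ''r'' (N 0)) Try)) ?Q s3"
    proof (rule wp_Seq[OF Loop])
      fix s4 assume J: "?J (n - 1) (s4 ''col'')" and sm4: "same (mods (For ''k'' (Minus (vr ''n'') (N 1)) (Seq
        (asg ''r'' (V ''ord'' (Minus (Minus (vr ''n'') (N 1)) (vr ''k'')))) Try))) s3 s4"
      have env4: "tables_ok s4" by (rule tables_ok_same[OF env3 sm4]) (simp add: mods_Try)
      define s5 where "s5 = s4(''r'' := (s4 ''r'')(0 := 0))"
      have env5: "tables_ok s5" by (simp add: s5_def tables_ok_upd env4)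
      have r5: "s5 ''r'' 0 = 0" "s5 ''col'' = s4 ''col''" by (simp_all add: s5_def)
      have nn: "n - (n - 1) = 1" using n0 by simp
      have "s4 ''col'' (?ord 0) = 0" using J n0 nn by auto
      then have z: "s4 ''col'' 0 = 0" using o0 by simp
      have "s4 ''col'' v \<in> {1..p}" if "v \<in> U - {0}" for v
      proof -
        have v: "v < n" "v \<noteq> 0" using that by auto
        have m: "?mark v \<le> n" "?ord (?mark v - 1) = v" using mo[OF v(1) all[OF v(1)]] cn by auto
        have "?mark v - 1 \<noteq> 0" using m(2) o0 v(2) by metis
        then have "s4 ''col'' (?ord (?mark v - 1)) \<in> {1..p}" using J m(1) nn all[OF v(1)] by simp
        then show ?thesis using m(2) by simp
      qed
      then have c: "holed (s5 ''col'') (s5 ''r'' 0)" unfolding holed_def r5 using J z n0 by blast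
      have sup: "\<forall>v \<ge> n. s5 ''col'' v = 0" using J r5 by simp
      have "wp L Try ?Q s5"
      proof (rule wp_weaken[OF Try_sound[OF env5 c sup]])
        fix s6 assume 6: "(s6 ''col'' = s5 ''col'' \<and> stuck (s5 ''col'') (s5 ''r'' 0)) \<or>
          (sound (s6 ''col'') (s5 ''r'' 0) \<and> solved (s6 ''col''))" and sm6: "same (mods Try) s5 s6"
        have "s6 ''r'' 0 = 0" using sm6 r5 by (simp add: same_def mods_Try)
        then show "?Q s6" using 6 c sup r5 n0 unfolding sound_def by auto
      qed
      then show "wp L (Seq (asg ''r'' (N 0)) Try) ?Q s4" by (intro wp_SeqA) (simp add: s5_def)
    qed
  qed
  then show "wp L (Seq (asg ''x'' (N 0)) (Seq Rank (Seq (For ''k'' (Minus (vr ''n'') (N 1)) (Seq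
        (asg ''r'' (V ''ord'' (Minus (Minus (vr ''n'') (N 1)) (vr ''k'')))) Try))
     (Seq (asg ''r'' (N 0)) Try)))) ?Q s1" by (intro wp_SeqA) (simp add: s2_def)
qed

lemma Grow_wp:
  assumes "s ''n'' 0 = n" "s ''b'' 0 = b" "b \<le> n * n * n" "s ''mn'' 0 = 0"
  shows "wp L Grow (\<lambda>s'. \<forall>k \<le> b. s' ''mn'' k = k * n) s"
  unfolding Grow_def
proof (rule wp_For[where m = b and I = "\<lambda>q s1. \<forall>k \<le> q. s1 ''mn'' k = k * n"], goal_cases)
  case 1 show ?case using L_bounds assms by simp
next
  case 3 show ?case using assms by simp
next
  case (5 s1) then show ?case using assms by (simp add: same_def)
next
  case (6 q s1)
  have "s1 ''n'' 0 = n" using 6(4) assms by (simp add: same_def)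
  then show ?case using 6(2,3) by (intro wp_Assign) (auto simp: le_Suc_eq)
qed simp_all

lemma Tables_wp:
  assumes s: "s ''n'' 0 = n" "s ''p'' 0 = p" "s ''mn'' 0 = 0" "s ''mp'' 0 = 0"
  shows "wp L Tables (\<lambda>s'. (\<forall>k \<le> n * n * n. s' ''mn'' k = k * n) \<and> (\<forall>k \<le> n. s' ''mp'' k = k * p)) s" (is "wp L _ ?Q s")
  unfolding Tables_def
proof (rule wp_Seq[where R = "\<lambda>s1. \<forall>k \<le> n. s1 ''mp'' k = k * p"])
  show "wp L (For ''k'' (vr ''n'') (Assign ''mp'' (Plus (vr ''k'') (N 1)) (Plus (V ''mp'' (vr ''k'')) (vr ''p''))))
    (\<lambda>s1. \<forall>k \<le> n. s1 ''mp'' k = k * p) s"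
  proof (rule wp_For[where m = n and I = "\<lambda>q s1. \<forall>k \<le> q. s1 ''mp'' k = k * p"], goal_cases)
    case 1 show ?case by (rule L_bounds)
  next
    case 3 show ?case using s by simp
  next
    case (5 s1) then show ?case using s by (simp add: same_def)
  next
    case (6 q s1)
    have "s1 ''p'' 0 = p" using 6(4) s by (simp add: same_def)
    then show ?case using 6(2,3) by (intro wp_Assign) (auto simp: le_Suc_eq)
  qed simp_all
  fix s1 assume mp: "\<forall>k \<le> n. s1 ''mp'' k = k * p"
    and sm1: "same (mods (For ''k'' (vr ''n'') (Assign ''mp'' (Plus (vr ''k'') (N 1)) (Plus (V ''mp'' (vr ''k'')) (vr ''p''))))) s s1"
  define s2 where "s2 = s1(''b'' := (s1 ''b'')(0 := n))"
  have v1: "s1 ''n'' 0 = n" "s1 ''mn'' 0 = 0" using sm1 s by (simp_all add: same_def)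
  have v2: "s2 ''n'' 0 = n" "s2 ''b'' 0 = n" "s2 ''mn'' 0 = 0" "s2 ''mp'' = s1 ''mp''" using v1 by (simp_all add: s2_def)
  have mG: "mods Grow = {''k'', ''mn''}" by (simp add: Grow_def)
  have n2: "n \<le> n * n" "n * n \<le> n * n * n" using n1 by simp_all
  have "wp L (Seq Grow (Seq (asg ''b'' (V ''mn'' (vr ''b''))) (Seq Grow (Seq (asg ''b'' (V ''mn'' (vr ''b''))) Grow)))) ?Q s2"
  proof (rule wp_Seq[OF Grow_wp[where s = s2 and b = n, OF v2(1,2) n_cube v2(3)]])
    fix s3 assume 3: "\<forall>k \<le> n. s3 ''mn'' k = k * n" and sm3: "same (mods Grow) s2 s3"
    define s4 where "s4 = s3(''b'' := (s3 ''b'')(0 := n * n))"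
    have v3: "s3 ''n'' 0 = n" "s3 ''b'' 0 = n" "s3 ''mp'' = s1 ''mp''" using sm3 v2 mG by (simp_all add: same_def)
    have v4: "s4 ''n'' 0 = n" "s4 ''b'' 0 = n * n" "s4 ''mn'' 0 = 0" "s4 ''mp'' = s1 ''mp''" using v3 3 by (simp_all add: s4_def)
    have "wp L (Seq Grow (Seq (asg ''b'' (V ''mn'' (vr ''b''))) Grow)) ?Q s4"
    proof (rule wp_Seq[OF Grow_wp[where s = s4 and b = "n * n", OF v4(1,2) n2(2) v4(3)]])
      fix s5 assume 5: "\<forall>k \<le> n * n. s5 ''mn'' k = k * n" and sm5: "same (mods Grow) s4 s5"
      define s6 where "s6 = s5(''b'' := (s5 ''b'')(0 := n * n * n))"
      have v5: "s5 ''n'' 0 = n" "s5 ''b'' 0 = n * n" "s5 ''mp'' = s1 ''mp''" using sm5 v4 mG by (simp_all add: same_def)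
      have v6: "s6 ''n'' 0 = n" "s6 ''b'' 0 = n * n * n" "s6 ''mn'' 0 = 0" "s6 ''mp'' = s1 ''mp''" using v5 5 by (simp_all add: s6_def)
      have "wp L Grow ?Q s6"
      proof (rule wp_weaken[OF Grow_wp[where s = s6 and b = "n * n * n", OF v6(1,2) order_refl v6(3)]])
        fix s7 assume 7: "\<forall>k \<le> n * n * n. s7 ''mn'' k = k * n" and sm7: "same (mods Grow) s6 s7"
        have "s7 ''mp'' = s1 ''mp''" using sm7 v6 mG by (simp add: same_def)
        then show "?Q s7" using 7 mp by simp
      qed
      moreover have "s5(''b'' := (s5 ''b'')(aval (N 0) s5 := aval (V ''mn'' (vr ''b'')) s5)) = s6"
        using 5 v5 by (simp add: s6_def)
      ultimately show "wp L (Seq (asg ''b'' (V ''mn'' (vr ''b''))) Grow) ?Q s5" by (intro wp_SeqA) simp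
    qed
    moreover have "s3(''b'' := (s3 ''b'')(aval (N 0) s3 := aval (V ''mn'' (vr ''b'')) s3)) = s4"
      using 3 v3 by (simp add: s4_def)
    ultimately show "wp L (Seq (asg ''b'' (V ''mn'' (vr ''b''))) (Seq Grow (Seq (asg ''b'' (V ''mn'' (vr ''b''))) Grow))) ?Q s3"
      by (intro wp_SeqA) simp
  qed
  then show "wp L (Seq (asg ''b'' (vr ''n'')) (Seq Grow (Seq (asg ''b'' (V ''mn'' (vr ''b''))) (Seq Grow
     (Seq (asg ''b'' (V ''mn'' (vr ''b''))) Grow))))) ?Q s1" by (intro wp_SeqA) (simp add: s2_def v1)
qed

lemma Output_wp:
  assumes env: "tables_ok s" and hd: "sound (s ''col'') (s ''r'' 0)"
    and res: "solved (s ''col'') \<or> H"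
  shows "wp L Output (\<lambda>s'. if says_hard s' then H else solved (s' ''part'')) s" (is "wp L _ ?Q s")
  unfolding Output_def
proof (rule wp_Seq[where R = "\<lambda>s1. \<forall>v < n. s1 ''part'' v = s ''col'' v"])
  show "wp L (For ''w'' (vr ''n'') (Assign ''part'' (vr ''w'') (V ''col'' (vr ''w''))))
    (\<lambda>s1. \<forall>v < n. s1 ''part'' v = s ''col'' v) s"
  proof (rule wp_For[where m = n and I = "\<lambda>q s1. \<forall>v < q. s1 ''part'' v = s ''col'' v"], goal_cases)
    case 1 show ?case by (rule L_bounds)
  next
    case (5 s1) then show ?case using tables_okD(1)[OF env] by (simp add: same_def)
  next
    case (6 q s1)
    have "s1 ''col'' = s ''col''" using 6(4) by (simp add: same_def)
    then show ?case using 6(2,3) by (intro wp_Assign) (simp add: less_Suc_eq)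
  qed simp_all
  fix s1 assume 1: "\<forall>v < n. s1 ''part'' v = s ''col'' v"
    and sm: "same (mods (For ''w'' (vr ''n'') (Assign ''part'' (vr ''w'') (V ''col'' (vr ''w''))))) s s1"
  have v: "s1 ''col'' = s ''col''" "s1 ''r'' = s ''r''" using sm by (simp_all add: same_def)
  show "wp L (Cond (V ''col'' (vr ''r'')) (asg ''hard'' (N 0)) (asg ''hard'' (N 1))) ?Q s1"
  proof (rule wp_Cond)
    assume "aval (V ''col'' (vr ''r'')) s1 \<noteq> 0"
    then have w: "solved (s ''col'')" using sound_solved[OF hd] v by simp
    have "solved (s1 ''part'')"
      unfolding solved_def
    proof (intro conjI ballI)
      show "valid (s1 ''part'')" by (rule valid_sub[of "s ''col''"]) (use w 1 in \<open>auto simp: solved_def\<close>)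
      show "s1 ''part'' v \<in> {1..p}" if "v \<in> U" for v using w 1 that unfolding solved_def by simp
    qed
    then show "wp L (asg ''hard'' (N 0)) ?Q s1" by (intro wp_Assign) (simp add: says_hard_def)
  next
    assume "aval (V ''col'' (vr ''r'')) s1 = 0"
    then have "\<not> solved (s ''col'')" using sound_solved[OF hd] v by simp
    then show "wp L (asg ''hard'' (N 1)) ?Q s1" using res by (intro wp_Assign) (simp add: says_hard_def)
  qed
qed

lemma Algorithm_wp:
  assumes s: "s ''n'' 0 = n" "s ''p'' 0 = p" "s ''mn'' 0 = 0" "s ''mp'' 0 = 0" "\<forall>v. s ''col'' v = 0"
    and arc: "\<And>u v. u < n \<Longrightarrow> v < n \<Longrightarrow> s ''arc'' (u * n + v) = of_bool ((u, v) \<in> A)"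
    and f: "\<And>v i. v < n \<Longrightarrow> i < p \<Longrightarrow> s ''f'' (v * p + i) = f v (Suc i)"
  shows "wp L Algorithm (\<lambda>s'. if says_hard s' then hard_pair p (induced A U) f else solved (s' ''part'')) s"
  unfolding Algorithm_def
proof (rule wp_Seq[OF Tables_wp[where s = s, OF s(1-4)]])
  fix s1 assume 1: "(\<forall>k \<le> n * n * n. s1 ''mn'' k = k * n) \<and> (\<forall>k \<le> n. s1 ''mp'' k = k * p)" and sm1: "same (mods Tables) s s1"
  have mT: "mods Tables = {''k'', ''mp'', ''b'', ''mn''}" by (auto simp: Tables_def Grow_def)
  have v1: "s1 ''n'' 0 = n" "s1 ''p'' 0 = p" "s1 ''arc'' = s ''arc''" "s1 ''f'' = s ''f''" "s1 ''col'' = s ''col''"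
    using sm1 s mT by (simp_all add: same_def)
  have env1: "tables_ok s1" unfolding tables_ok_def v1 using 1 arc f by simp
  have c1: "\<forall>v. s1 ''col'' v = 0" using v1 s by simp
  show "wp L (Seq Init (Seq Search Output)) (\<lambda>s'. if says_hard s' then hard_pair p (induced A U) f else solved (s' ''part'')) s1"
  proof (rule wp_Seq[OF Init_wp[OF env1 c1]])
    fix s2 assume 2: "sound (s2 ''col'') (s2 ''r'' 0) \<and> s2 ''r'' 0 = 0 \<and> (solved (s2 ''col'') \<or> stuck (s2 ''col'') 0)"
      and sm2: "same (mods Init) s1 s2"
    have env2: "tables_ok s2" by (rule tables_ok_same[OF env1 sm2]) (simp add: Init_def mods_Rank mods_Try)
    show "wp L (Seq Search Output) (\<lambda>s'. if says_hard s' then hard_pair p (induced A U) f else solved (s' ''part'')) s2"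
    proof (rule wp_Seq[OF Search_wp[OF env2]])
      fix s3 assume 3: "sound (s3 ''col'') (s3 ''r'' 0) \<and> (solved (s3 ''col'') \<or> hard_pair p (induced A U) f)"
        and sm3: "same (mods Search) s2 s3"
      have env3: "tables_ok s3" by (rule tables_ok_same[OF env2 sm3]) (simp add: Search_def mods_all)
      show "wp L Output (\<lambda>s'. if says_hard s' then hard_pair p (induced A U) f else solved (s' ''part'')) s3"
        using Output_wp[OF env3] 3 by blast
    qed (use 2 in blast)+
  qed
qed

end

lemma poly_nat_mono: "x \<le> y \<Longrightarrow> poly (q :: nat poly) x \<le> poly q y"
  by (induction q) (auto intro: add_mono mult_mono)

theorem mainTheorem2:
  shows "\<exists>(c :: com) (q :: nat poly).
    \<forall>(n :: nat) (D :: nat pair_pre_digraph) (p :: nat) (f :: nat \<Rightarrow> nat \<Rightarrow> nat).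
      pair_digraph D \<and> pverts D = {..<n} \<and> Digraph_Component.connected (with_proj D) \<and> p \<ge> 1 \<and>
      (\<forall>v \<in> pverts D. (\<Sum>i = 1..p. f v i) \<ge> max (out_degree (with_proj D) v) (in_degree (with_proj D) v))
      \<longrightarrow> (\<exists>t s. exec c (input_state n D p f) t s \<and> t \<le> poly q (input_size n p f) \<and>
            (if says_hard s then hard_pair p D f
             else f_partition p (with_proj D) f (output_partition D s)))"
proof -
  obtain q0 :: "nat poly" where q0: "\<And>L. cost L Algorithm = poly q0 L" using cost_poly by blast
  \<comment> \<open>The bound \<open>n * n * n + n + p\<close> for all loops is at most \<open>M ^ 3 + 2 * M\<close> for input size \<open>M\<close>.\<close>
  define r :: "nat poly" where "r = [:0, 2, 0, 1:]"
  show ?thesis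
  proof (intro exI[of _ Algorithm] exI[of _ "pcompose q0 r"] allI impI, elim conjE)
    fix n :: nat and D :: "nat pair_pre_digraph" and p :: nat and f :: "nat \<Rightarrow> nat \<Rightarrow> nat"
    assume D: "pair_digraph D" and V: "pverts D = {..<n}" and con: "Digraph_Component.connected (with_proj D)"
      and p: "p \<ge> 1"
      and dem: "\<forall>v \<in> pverts D. (\<Sum>i = 1..p. f v i) \<ge> max (out_degree (with_proj D) v) (in_degree (with_proj D) v)"
    let ?A = "parcs D"
    have A: "?A \<subseteq> {..<n} \<times> {..<n}" "\<And>x. (x, x) \<notin> ?A" using D V by (auto simp: pair_digraph_iff)
    have con': "conn (ugraph ?A) {..<n}" using con V by (simp add: connected_iff_conn)
    interpret inst n p ?A f
    proof
      show "?A \<subseteq> {..<n} \<times> {..<n}" "\<And>x. (x, x) \<notin> ?A" "conn (ugraph ?A) {..<n}" "1 \<le> p" by fact+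
      fix v assume v: "v < n"
      have "{y \<in> {..<n}. (v, y) \<in> ?A} = {y. (v, y) \<in> ?A}" "{y \<in> {..<n}. (y, v) \<in> ?A} = {y. (y, v) \<in> ?A}"
        using A by auto
      then show "card {y \<in> {..<n}. (v, y) \<in> ?A} \<le> (\<Sum>i = 1..p. f v i) \<and> card {y \<in> {..<n}. (y, v) \<in> ?A} \<le> (\<Sum>i = 1..p. f v i)"
        using dem v unfolding V degree_card by simp
    qed
    define L where "L = n * n * n + n + p"
    interpret prog n p ?A f L by unfold_locales (simp add: L_def)
    let ?s = "input_state n D p f" and ?M = "input_size n p f"
    have n0: "0 < n" using n1 by simp
    have wp: "wp L Algorithm (\<lambda>s'. if says_hard s' then hard_pair p (induced ?A {..<n}) f else solved (s' ''part'')) ?s"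
    proof (rule Algorithm_wp)
      show "?s ''n'' 0 = n" "?s ''p'' 0 = p" "?s ''mn'' 0 = 0" "?s ''mp'' 0 = 0" "\<forall>v. ?s ''col'' v = 0"
        by (simp_all add: input_state_def)
      show "?s ''arc'' (u * n + v) = of_bool ((u, v) \<in> ?A)" if "u < n" "v < n" for u v
      proof -
        have "u * n + v < Suc u * n" using that by simp
        also have "\<dots> \<le> n * n" using that by (intro mult_right_mono) auto
        finally have "u * n + v < n * n" .
        moreover have "(u * n + v) div n = u" "(u * n + v) mod n = v" using that by simp_all
        ultimately show ?thesis by (simp add: input_state_def)
      qed
      show "?s ''f'' (v * p + i) = f v (Suc i)" if "v < n" "i < p" for v i
      proof -
        have "v * p + i < Suc v * p" using that by simp
        also have "\<dots> \<le> n * p" using that by (intro mult_right_mono) auto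
        finally have "v * p + i < n * p" .
        moreover have "(v * p + i) div p = v" "(v * p + i) mod p = i" using that by simp_all
        ultimately show ?thesis by (simp add: input_state_def)
      qed
    qed
    then obtain t s where ex: "exec Algorithm ?s t s" and t: "t \<le> cost L Algorithm"
      and res: "if says_hard s then hard_pair p (induced ?A {..<n}) f else solved (s ''part'')" unfolding wp_def by blast
    have nM: "n \<le> ?M"
    proof -
      have "n \<le> n * n" using n0 by simp
      then show ?thesis unfolding input_size_def by linarith
    qed
    have pM: "p \<le> ?M"
    proof -
      have "(\<Sum>v < n. \<Sum>i = 1..p. 1) \<le> (\<Sum>v < n. \<Sum>i = 1..p. bit_length (f v i))"
        by (intro sum_mono) (simp add: bit_length_def)
      moreover have "(\<Sum>v < n. \<Sum>i = 1..p. 1) = n * p" by simp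
      moreover have "p \<le> n * p" using n0 by simp
      ultimately show ?thesis unfolding input_size_def by linarith
    qed
    have "n * n * n \<le> ?M * ?M * ?M" using nM by (intro mult_mono) auto
    then have "L \<le> poly r ?M" unfolding L_def r_def using nM pM by (simp add: algebra_simps)
    then have "cost L Algorithm \<le> poly (pcompose q0 r) ?M" unfolding q0 poly_pcompose by (rule poly_nat_mono)
    then have time: "t \<le> poly (pcompose q0 r) ?M" using t by simp
    have "if says_hard s then hard_pair p D f else f_partition p (with_proj D) f (output_partition D s)"
    proof (cases "says_hard s")
      case True
      have "induced ?A {..<n} = D" using A V by (cases D) (auto simp: induced_def)
      then show ?thesis using True res by simp
    next
      case False
      then have w: "solved (s ''part'')" using res by simp
      let ?S = "\<lambda>i. {v \<in> {..<n}. s ''part'' v = i}"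
      have P: "output_partition D s i = with_proj D \<restriction> ?S i" for i unfolding output_partition_def V ..
      interpret D: pair_digraph D by (rule D)
      have "p_partition p (with_proj D) (output_partition D s)"
        unfolding p_partition_def
      proof (intro conjI ballI impI)
        fix i
        have "?S i \<subseteq> verts (with_proj D)" using V by auto
        then show "induced_subgraph (output_partition D s i) (with_proj D)"
          unfolding P using D.induced_induce by simp
        show "verts (output_partition D s i) \<inter> verts (output_partition D s j) = {}" if "i \<noteq> j" for j
          unfolding P using that by auto
      next
        show "verts (with_proj D) = (\<Union>i \<in> {1..p}. verts (output_partition D s i))"
          unfolding P using w V unfolding solved_def by auto
      qed
      moreover have "weakly_degenerate (\<lambda>v. f v i) (output_partition D s i)" if "i \<in> {1..p}" for i
        unfolding P by (rule degenerate_weakly_degenerate) (use w that in \<open>auto simp: solved_def valid_def\<close>)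
      ultimately show ?thesis using False unfolding f_partition_def by simp
    qed
    then show "\<exists>t s. exec Algorithm ?s t s \<and> t \<le> poly (pcompose q0 r) ?M \<and>
      (if says_hard s then hard_pair p D f else f_partition p (with_proj D) f (output_partition D s))"
      using ex time by blast
  qed
qed

end
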